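(* Let $X_0$ be a compact metrizable space, $\mathfrak A=C(X_0)$, and let $G$ be a unimodular, amenable, second-countable locally compact group acting on $\mathfrak A$ by $\theta:G\to\mathrm{Aut}(\mathfrak A)$ so that $(\mathfrak A,G,\theta)$ is a uniquely ergodic $C^*$-dynamical system with unique invariant state $\omega_0$. Let $\alpha\in\mathrm{Aut}(\mathfrak A)$ commute with every $\theta_g$, let $u=(u_g)_{g\in G}$ be a continuous $1$-cocycle, and let $(\mathfrak A\rtimes_\alpha\mathbb Z,G,\Phi^u)$ be the associated skew product. If this skew product is not uniquely ergodic, then the map $$\Psi:\mathcal P(\mathbb T)\to\mathcal S(\mathfrak A\rtimes_\alpha\mathbb Z)^G,\qquad \Psi(\mu):=\varphi_\mu\circ T,$$ is an affine homeomorphism between compact convex sets, where $T$ and $\varphi_\mu$ are the maps defined in the context.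
   Context: A $C^*$-dynamical system $(\mathfrak B,G,\beta)$ is a unital $C^*$-algebra $\mathfrak B$ with a group homomorphism $\beta:G\to\mathrm{Aut}(\mathfrak B)$ such that $g\mapsto\beta_g(b)$ is norm continuous for every $b\in\mathfrak B$. $\mathcal S(\mathfrak B)^G$ is the set of $G$-invariant states (states $\varphi$ with $\varphi\circ\beta_g=\varphi$ for all $g$), with the weak-$*$ topology; the system is uniquely ergodic if this set is a singleton. $\mathcal P(\mathbb T)$ is the set of Borel probability measures on $\mathbb T$ with the weak-$*$ topology. $\mu_0$ is the Borel probability measure on $X_0$ with $\omega_0(f)=\int f\,d\mu_0$; $\widetilde\omega_0$ denotes the state $f\mapsto\int f\,d\mu_0$ on $L^\infty(X_0,\mu_0)$. $\theta_g$ also denotes the homeomorphism of $X_0$ with $(\theta_g(a))(x)=a(\theta_g(x))$; $\theta_g$ and $\alpha$ also denote the induced automorphisms of $L^\infty(X_0,\mu_0)$ (note $\omega_0\circ\alpha=\omega_0$). A continuous $1$-cocycle is a continuous function $u:G\times X_0\to\mathbb T$ which, writing $u_g:=u(g,\cdot)\in C(X_0)$, satisfies $u_{gh}=\theta_g(u_h)u_g$ for all $g,h\in G$. $\mathfrak A\rtimes_\alpha\mathbb Z$ is the universal crossed product, generated by $\mathfrak A$ and a unitary $V$ with $VaV^*=\alpha(a)$ for $a\in\mathfrak A$. For $g\in G$, $\Phi^u_g$ is the automorphism of $\mathfrak A\rtimes_\alpha\mathbb Z$ with $\Phi^u_g(a)=\theta_g(a)$ for $a\in\mathfrak A$ and $\Phi^u_g(V)=u_gV$.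 For $n\in\mathbb Z$: $u_g^{(0)}=1$, $u_g^{(n)}=u_g\alpha(u_g)\cdots\alpha^{n-1}(u_g)$ for $n>0$, and $u_g^{(n)}=\alpha^{n}(u_g^* )\cdots\alpha^{-1}(u_g^* )$ for $n<0$; thus $\Phi^u_g(V^n)=u_g^{(n)}V^n$. It is a fact that the skew product fails to be uniquely ergodic exactly when, for some $n\ge1$, there is a $\mathbb T$-valued $w\in L^\infty(X_0,\mu_0)$ with $\theta_g(w)u_g^{(n)}=w$ in $L^\infty(X_0,\mu_0)$ for all $g\in G$. In that case let $n_0$ be the smallest such $n\geq 1$ and fix such a $w=:w_{n_0}$ for $n=n_0$. For $k\in\mathbb Z$ define $w_{kn_0}\in L^\infty(X_0,\mu_0)$ by $w_0=1$, $w_{kn_0}=\prod_{j=0}^{k-1}\alpha^{jn_0}(w_{n_0})$ for $k>0$, $w_{kn_0}=\prod_{j=k}^{-1}\alpha^{jn_0}(w_{n_0}^* )$ for $k<0$. $T:\mathfrak A\rtimes_\alpha\mathbb Z\to C^*(V^{n_0})$ is the (unital completely positive) bounded linear map determined by $T(aV^{kn_0})=\widetilde\omega_0(aw_{kn_0}^* )V^{kn_0}$ for $a\in\mathfrak A$, $k\in\mathbb Z$, and $T(aV^l)=0$ for $a\in\mathfrak A$ and $l\in\mathbb Z$ not a multiple of $n_0$. $C^*(V^{n_0})$ is identified with $C(\mathbb T)$ by sending $V^{n_0}$ to the function $z\mapsto z$. For $\mu\in\mathcal P(\mathbb T)$, $\varphi_\mu$ is the state on $C^*(V^{n_0})$ with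 $\varphi_\mu(V^{kn_0})=\int_{\mathbb T}z^k\,d\mu(z)$, $k\in\mathbb Z$. *)

theory Defs
  imports "HOL-Probability.Probability"
begin

section \<open>Unital C*-algebras\<close>

text \<open>
  The algebras are complex; the real scalar multiplication inherited from the library classes is
  the restriction of \<open>scaleC\<close>. Completeness comes from \<^class>\<open>banach\<close>, and
  \<open>norm 1 = 1\<close> (hence \<open>1 \<noteq> 0\<close>) from \<^class>\<open>real_normed_algebra_1\<close>.
\<close>

class cstar_algebra = real_normed_algebra_1 + banach +
  fixes scaleC :: "complex \<Rightarrow> 'a \<Rightarrow> 'a"  (infixr \<open>*\<^sub>C\<close> 75)
    and star :: "'a \<Rightarrow> 'a"
  assumes scaleC_add_right: "c *\<^sub>C (x + y) = c *\<^sub>C x + c *\<^sub>C y"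
    and scaleC_add_left: "(c + d) *\<^sub>C x = c *\<^sub>C x + d *\<^sub>C x"
    and scaleC_scaleC: "c *\<^sub>C (d *\<^sub>C x) = (c * d) *\<^sub>C x"
    and scaleC_of_real: "complex_of_real r *\<^sub>C x = r *\<^sub>R x"
    and mult_scaleC_left: "(c *\<^sub>C x) * y = c *\<^sub>C (x * y)"
    and mult_scaleC_right: "x * (c *\<^sub>C y) = c *\<^sub>C (x * y)"
    and norm_scaleC: "norm (c *\<^sub>C x) = cmod c * norm x"
    and star_star: "star (star x) = x"
    and star_add: "star (x + y) = star x + star y"
    and star_mult: "star (x * y) = star y * star x"
    and star_scaleC: "star (c *\<^sub>C x) = cnj c *\<^sub>C star x"
    and norm_star_mult_self: "norm (star x * x) = (norm x)\<^sup>2"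

instantiation complex :: cstar_algebra
begin

definition scaleC_complex :: "complex \<Rightarrow> complex \<Rightarrow> complex"
  where "scaleC_complex c x = c * x"

definition star_complex :: "complex \<Rightarrow> complex"
  where "star_complex = cnj"

instance
  by standard
    (auto simp: scaleC_complex_def star_complex_def algebra_simps norm_mult power2_eq_square
      scaleR_conv_of_real)

end

subsection \<open>The C*-algebra of (bounded) continuous functions\<close>

text \<open>
  For compact \<open>X\<close>, the type \<open>X \<Rightarrow>\<^sub>C complex\<close> with pointwise operations and supremum norm is \<open>C(X)\<close>.
  A compact metrizable space is a compact type of class \<^class>\<open>metric_space\<close>; everything below
  depends only on its topology, not on the chosen metric.
\<close>

setup_lifting type_definition_bcontfun

instantiation bcontfun :: (topological_space, real_normed_algebra_1) real_normed_algebra_1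
begin

lift_definition one_bcontfun :: "'a \<Rightarrow>\<^sub>C 'b" is "\<lambda>_. 1"
  by (rule const_bcontfun)

lift_definition times_bcontfun :: "('a \<Rightarrow>\<^sub>C 'b) \<Rightarrow> ('a \<Rightarrow>\<^sub>C 'b) \<Rightarrow> 'a \<Rightarrow>\<^sub>C 'b"
  is "\<lambda>f g x. f x * g x"
proof -
  fix f g :: "'a \<Rightarrow> 'b"
  assume f: "f \<in> bcontfun" and g: "g \<in> bcontfun"
  obtain A where A: "\<And>x. norm (f x) \<le> A"
    using f by (auto simp: bcontfun_def bounded_iff)
  obtain B where B: "\<And>x. norm (g x) \<le> B"
    using g by (auto simp: bcontfun_def bounded_iff)
  have "norm (f x * g x) \<le> A * B" for x
  proof -
    have "0 \<le> A" using A[of x] norm_ge_zero[of "f x"] by linarith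
    have "norm (f x * g x) \<le> norm (f x) * norm (g x)" by (rule norm_mult_ineq)
    also have "\<dots> \<le> A * B" using A[of x] B[of x] \<open>0 \<le> A\<close> by (intro mult_mono) auto
    finally show ?thesis .
  qed
  then show "(\<lambda>x. f x * g x) \<in> bcontfun"
    using f g by (intro bcontfun_normI[where b = "A * B"]) (auto simp: bcontfun_def intro: continuous_intros)
qed

lemmas bcontfun_rep = one_bcontfun.rep_eq times_bcontfun.rep_eq zero_bcontfun.rep_eq
  plus_bcontfun.rep_eq minus_bcontfun.rep_eq uminus_bcontfun.rep_eq scaleR_bcontfun.rep_eq

instance
proof
  fix a b c :: "'a \<Rightarrow>\<^sub>C 'b" and r :: real
  show "a * b * c = a * (b * c)" by (rule bcontfun_eqI) (simp add: bcontfun_rep mult.assoc)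
  show "(a + b) * c = a * c + b * c" by (rule bcontfun_eqI) (simp add: bcontfun_rep distrib_right)
  show "a * (b + c) = a * b + a * c" by (rule bcontfun_eqI) (simp add: bcontfun_rep distrib_left)
  show "(r *\<^sub>R a) * b = r *\<^sub>R (a * b)" by (rule bcontfun_eqI) (simp add: bcontfun_rep)
  show "a * (r *\<^sub>R b) = r *\<^sub>R (a * b)" by (rule bcontfun_eqI) (simp add: bcontfun_rep)
  show "1 * a = a" by (rule bcontfun_eqI) (simp add: bcontfun_rep)
  show "a * 1 = a" by (rule bcontfun_eqI) (simp add: bcontfun_rep)
  show "(0::'a \<Rightarrow>\<^sub>C 'b) \<noteq> 1"
    by (metis one_bcontfun.rep_eq zero_bcontfun.rep_eq zero_neq_one)
  show "norm (a * b) \<le> norm a * norm b"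
  proof (rule norm_bound)
    fix x
    have "norm (apply_bcontfun (a * b) x) = norm (apply_bcontfun a x * apply_bcontfun b x)"
      by (simp add: bcontfun_rep)
    also have "\<dots> \<le> norm (apply_bcontfun a x) * norm (apply_bcontfun b x)"
      by (rule norm_mult_ineq)
    also have "\<dots> \<le> norm a * norm b"
      by (intro mult_mono norm_bounded) auto
    finally show "norm (apply_bcontfun (a * b) x) \<le> norm a * norm b" .
  qed
  show "norm (1::'a \<Rightarrow>\<^sub>C 'b) = 1"
  proof (rule antisym)
    show "norm (1::'a \<Rightarrow>\<^sub>C 'b) \<le> 1"
      by (rule norm_bound) (simp add: one_bcontfun.rep_eq)
    show "1 \<le> norm (1::'a \<Rightarrow>\<^sub>C 'b)"
      using norm_bounded[of "1::'a \<Rightarrow>\<^sub>C 'b" undefined] by (simp add: one_bcontfun.rep_eq)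
  qed
qed

end

instance bcontfun :: (topological_space, "{real_normed_algebra_1, comm_ring_1}") comm_ring_1
proof
  fix a b c :: "'a \<Rightarrow>\<^sub>C 'b"
  show "(a + b) * c = a * c + b * c" by (rule bcontfun_eqI) (simp add: bcontfun_rep distrib_right)
  show "a * b = b * a" by (rule bcontfun_eqI) (simp add: bcontfun_rep mult.commute)
qed simp_all

lemma norm_star: "norm (star (x::'a::cstar_algebra)) = norm x"
proof -
  have le: "norm y \<le> norm (star y)" for y :: 'a
  proof (cases "norm y = 0")
    case False
    have "norm y * norm y \<le> norm (star y) * norm y"
      using norm_mult_ineq[of "star y" y] norm_star_mult_self[of y] by (simp add: power2_eq_square)
    then show ?thesis using False by simp
  qed simp
  from le[of x] le[of "star x"] show ?thesis by (simp add: star_star)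
qed

lemma star_diff: "star (x - y) = star x - star (y::'a::cstar_algebra)"
  using star_add[of "x - y" y] by simp

lemma bounded_linear_star: "bounded_linear (star :: 'a \<Rightarrow> 'a::cstar_algebra)"
proof (rule bounded_linear_intro[where K = 1])
  fix x y :: 'a and r :: real
  show "star (x + y) = star x + star y" by (rule star_add)
  show "star (r *\<^sub>R x) = r *\<^sub>R star x"
    using star_scaleC[of "complex_of_real r" x] by (simp add: scaleC_of_real)
  show "norm (star x) \<le> norm x * 1" by (simp add: norm_star)
qed

lemma bounded_linear_scaleC: "bounded_linear (\<lambda>x::'a::cstar_algebra. c *\<^sub>C x)"
proof (rule bounded_linear_intro[where K = "cmod c"])
  fix x y :: 'a and r :: real
  show "c *\<^sub>C (x + y) = c *\<^sub>C x + c *\<^sub>C y" by (rule scaleC_add_right)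
  show "c *\<^sub>C (r *\<^sub>R x) = r *\<^sub>R (c *\<^sub>C x)"
    by (simp add: scaleC_of_real[symmetric] scaleC_scaleC mult.commute)
  show "norm (c *\<^sub>C x) \<le> norm x * cmod c" by (simp add: norm_scaleC mult.commute)
qed

instantiation bcontfun :: (metric_space, cstar_algebra) cstar_algebra
begin

lift_definition scaleC_bcontfun :: "complex \<Rightarrow> ('a \<Rightarrow>\<^sub>C 'b) \<Rightarrow> 'a \<Rightarrow>\<^sub>C 'b"
  is "\<lambda>c f x. c *\<^sub>C f x"
  by (auto simp: bcontfun_def intro!: bounded_linear.continuous_on[OF bounded_linear_scaleC])
    (metis bounded_linear_image bounded_linear_scaleC image_image)

lift_definition star_bcontfun :: "('a \<Rightarrow>\<^sub>C 'b) \<Rightarrow> 'a \<Rightarrow>\<^sub>C 'b"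
  is "\<lambda>f x. star (f x)"
  by (auto simp: bcontfun_def intro!: bounded_linear.continuous_on[OF bounded_linear_star])
    (metis bounded_linear_image bounded_linear_star image_image)

lemmas bcontfun_star_rep = bcontfun_rep scaleC_bcontfun.rep_eq star_bcontfun.rep_eq

instance
proof
  fix x y :: "'a \<Rightarrow>\<^sub>C 'b" and c d :: complex and r :: real
  show "c *\<^sub>C (x + y) = c *\<^sub>C x + c *\<^sub>C y" by (rule bcontfun_eqI) (simp add: bcontfun_star_rep scaleC_add_right)
  show "(c + d) *\<^sub>C x = c *\<^sub>C x + d *\<^sub>C x" by (rule bcontfun_eqI) (simp add: bcontfun_star_rep scaleC_add_left)
  show "c *\<^sub>C (d *\<^sub>C x) = (c * d) *\<^sub>C x" by (rule bcontfun_eqI) (simp add: bcontfun_star_rep scaleC_scaleC)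
  show "complex_of_real r *\<^sub>C x = r *\<^sub>R x" by (rule bcontfun_eqI) (simp add: bcontfun_star_rep scaleC_of_real)
  show "(c *\<^sub>C x) * y = c *\<^sub>C (x * y)" by (rule bcontfun_eqI) (simp add: bcontfun_star_rep mult_scaleC_left)
  show "x * (c *\<^sub>C y) = c *\<^sub>C (x * y)" by (rule bcontfun_eqI) (simp add: bcontfun_star_rep mult_scaleC_right)
  show "star (star x) = x" by (rule bcontfun_eqI) (simp add: bcontfun_star_rep star_star)
  show "star (x + y) = star x + star y" by (rule bcontfun_eqI) (simp add: bcontfun_star_rep star_add)
  show "star (x * y) = star y * star x" by (rule bcontfun_eqI) (simp add: bcontfun_star_rep star_mult)
  show "star (c *\<^sub>C x) = cnj c *\<^sub>C star x" by (rule bcontfun_eqI) (simp add: bcontfun_star_rep star_scaleC)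
  show "norm (c *\<^sub>C x) = cmod c * norm x"
  proof (rule antisym)
    show "norm (c *\<^sub>C x) \<le> cmod c * norm x"
      by (rule norm_bound) (simp add: scaleC_bcontfun.rep_eq norm_scaleC mult_left_mono norm_bounded)
    show "cmod c * norm x \<le> norm (c *\<^sub>C x)"
    proof (cases "c = 0")
      case False
      have "norm x \<le> norm (c *\<^sub>C x) / cmod c"
      proof (rule norm_bound)
        fix t
        have "cmod c * norm (apply_bcontfun x t) \<le> norm (c *\<^sub>C x)"
          using norm_bounded[of "c *\<^sub>C x" t] by (simp add: scaleC_bcontfun.rep_eq norm_scaleC)
        then show "norm (apply_bcontfun x t) \<le> norm (c *\<^sub>C x) / cmod c"
          using False by (simp add: field_simps)
      qed
      then show ?thesis using False by (simp add: field_simps)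
    qed simp
  qed
  show "norm (star x * x) = (norm x)\<^sup>2"
  proof (rule antisym)
    show "norm (star x * x) \<le> (norm x)\<^sup>2"
      by (rule norm_bound)
        (simp add: times_bcontfun.rep_eq star_bcontfun.rep_eq norm_star_mult_self power_mono norm_bounded)
    have "norm x \<le> sqrt (norm (star x * x))"
    proof (rule norm_bound)
      fix t
      have "(norm (apply_bcontfun x t))\<^sup>2 \<le> norm (star x * x)"
        using norm_bounded[of "star x * x" t]
        by (simp add: times_bcontfun.rep_eq star_bcontfun.rep_eq norm_star_mult_self)
      then show "norm (apply_bcontfun x t) \<le> sqrt (norm (star x * x))"
        by (rule real_le_rsqrt)
    qed
    then show "(norm x)\<^sup>2 \<le> norm (star x * x)"
      by (metis norm_ge_zero power_mono real_sqrt_pow2)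
  qed
qed

end

subsection \<open>Subalgebras, morphisms, states\<close>

definition cstar_subalgebra :: "'b::cstar_algebra set \<Rightarrow> bool"
  where "cstar_subalgebra B \<longleftrightarrow> closed B \<and> 1 \<in> B \<and>
    (\<forall>x\<in>B. \<forall>y\<in>B. x + y \<in> B \<and> x * y \<in> B) \<and> (\<forall>c. \<forall>x\<in>B. c *\<^sub>C x \<in> B) \<and> (\<forall>x\<in>B. star x \<in> B)"

definition cstar_gen :: "'b::cstar_algebra set \<Rightarrow> 'b set"
  where "cstar_gen S = \<Inter> {B. cstar_subalgebra B \<and> S \<subseteq> B}"

definition clinear :: "('b::cstar_algebra \<Rightarrow> 'c::cstar_algebra) \<Rightarrow> bool"
  where "clinear f \<longleftrightarrow> (\<forall>x y. f (x + y) = f x + f y) \<and> (\<forall>c x. f (c *\<^sub>C x) = c *\<^sub>C f x)"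

definition unital_star_hom :: "('b::cstar_algebra \<Rightarrow> 'c::cstar_algebra) \<Rightarrow> bool"
  where "unital_star_hom f \<longleftrightarrow> clinear f \<and> f 1 = 1 \<and>
    (\<forall>x y. f (x * y) = f x * f y) \<and> (\<forall>x. f (star x) = star (f x))"

definition star_automorphism :: "('b::cstar_algebra \<Rightarrow> 'b) \<Rightarrow> bool"
  where "star_automorphism f \<longleftrightarrow> unital_star_hom f \<and> bij f"

definition unitary :: "'b::cstar_algebra \<Rightarrow> bool"
  where "unitary v \<longleftrightarrow> star v * v = 1 \<and> v * star v = 1"

text \<open>
  States of a unital C*-subalgebra \<open>B\<close>. A function on \<open>B\<close> is encoded as an element of
  \<open>extensional B\<close>, so that it is determined by its values on \<open>B\<close>; this is no
  condition when \<open>B = UNIV\<close>.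
\<close>

definition state_on :: "'b::cstar_algebra set \<Rightarrow> ('b \<Rightarrow> complex) \<Rightarrow> bool"
  where "state_on B \<phi> \<longleftrightarrow> \<phi> \<in> extensional B \<and>
    (\<forall>x\<in>B. \<forall>y\<in>B. \<phi> (x + y) = \<phi> x + \<phi> y) \<and> (\<forall>c. \<forall>x\<in>B. \<phi> (c *\<^sub>C x) = c * \<phi> x) \<and>
    (\<forall>x\<in>B. \<phi> (star x * x) \<in> \<real>\<^sub>\<ge>\<^sub>0) \<and> \<phi> 1 = 1"

section \<open>Groups and C*-dynamical systems\<close>

text \<open>
  The group \<open>G\<close> is a type of class \<^class>\<open>topological_group_add\<close>. The library writes the
  group law as \<open>+\<close>, but does not assume it to be commutative.

  A left Haar measure below is a nonzero left-invariant Borel measure that is finite on compact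
  sets. On a second-countable locally compact Hausdorff group regularity is automatic.
\<close>

definition left_haar_measure :: "'g::topological_group_add measure \<Rightarrow> bool"
  where "left_haar_measure \<nu> \<longleftrightarrow> sets \<nu> = sets borel \<and> emeasure \<nu> UNIV \<noteq> 0 \<and>
    (\<forall>K. compact K \<longrightarrow> emeasure \<nu> K < \<infinity>) \<and>
    (\<forall>g. \<forall>A\<in>sets borel. emeasure \<nu> ((\<lambda>h. g + h) ` A) = emeasure \<nu> A)"

definition unimodular :: "'g::topological_group_add itself \<Rightarrow> bool"
  where "unimodular _ \<longleftrightarrow> (\<exists>\<nu>::'g measure. left_haar_measure \<nu> \<and>
    (\<forall>g. \<forall>A\<in>sets borel. emeasure \<nu> ((\<lambda>h. h + g) ` A) = emeasure \<nu> A))"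

text \<open>
  Amenability: there is a left-invariant mean on (real) \<open>L\<^sup>\<infinity>(G)\<close>. The mean is given on bounded
  Borel representatives; positivity is required in the almost everywhere sense, so that by
  linearity the mean only depends on the class of a function.
\<close>

definition bounded_borel :: "('g::topological_space \<Rightarrow> real) set"
  where "bounded_borel = {f \<in> borel_measurable borel. bounded (range f)}"

definition amenable :: "'g::topological_group_add itself \<Rightarrow> bool"
  where "amenable _ \<longleftrightarrow> (\<exists>(\<nu>::'g measure) (m::('g \<Rightarrow> real) \<Rightarrow> real). left_haar_measure \<nu> \<and>
    (\<forall>f\<in>bounded_borel. \<forall>f'\<in>bounded_borel. m (\<lambda>h. f h + f' h) = m f + m f') \<and>
    (\<forall>r. \<forall>f\<in>bounded_borel. m (\<lambda>h. r * f h) = r * m f) \<and>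
    (\<forall>f\<in>bounded_borel. (AE h in \<nu>. 0 \<le> f h) \<longrightarrow> 0 \<le> m f) \<and>
    m (\<lambda>_. 1) = 1 \<and>
    (\<forall>g. \<forall>f\<in>bounded_borel. m (\<lambda>h. f (g + h)) = m f))"

definition cstar_dynamical_system ::
  "('g::topological_group_add \<Rightarrow> 'b::cstar_algebra \<Rightarrow> 'b) \<Rightarrow> bool"
  where "cstar_dynamical_system \<beta> \<longleftrightarrow> (\<forall>g. star_automorphism (\<beta> g)) \<and>
    (\<forall>g h. \<beta> (g + h) = \<beta> g \<circ> \<beta> h) \<and> (\<forall>b. continuous_on UNIV (\<lambda>g. \<beta> g b))"

definition invariant_states :: "('g \<Rightarrow> 'b::cstar_algebra \<Rightarrow> 'b) \<Rightarrow> ('b \<Rightarrow> complex) set"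
  where "invariant_states \<beta> = {\<phi>. state_on UNIV \<phi> \<and> (\<forall>g. \<phi> \<circ> \<beta> g = \<phi>)}"

definition uniquely_ergodic :: "('g \<Rightarrow> 'b::cstar_algebra \<Rightarrow> 'b) \<Rightarrow> bool"
  where "uniquely_ergodic \<beta> \<longleftrightarrow> (\<exists>\<phi>. invariant_states \<beta> = {\<phi>})"

text \<open>The weak-* topology on a set of functionals is the topology of pointwise convergence.\<close>

definition weak_star :: "('b \<Rightarrow> complex) set \<Rightarrow> ('b \<Rightarrow> complex) topology"
  where "weak_star S = subtopology (product_topology (\<lambda>_. euclidean) UNIV) S"

section \<open>Borel probability measures on a subset of a topological space\<close>

definition prob_measures :: "'z::topological_space set \<Rightarrow> 'z measure set"
  where "prob_measures Z = {\<mu>. prob_space \<mu> \<and> sets \<mu> = sets (restrict_space borel Z)}"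

text \<open>The coarsest topology making \<open>\<mu> \<mapsto> \<integral>f d\<mu>\<close> continuous for every \<open>f \<in> C(Z)\<close> (\<open>Z\<close> compact).\<close>

definition weak_star_prob :: "'z::topological_space set \<Rightarrow> 'z measure topology"
  where "weak_star_prob Z = pullback_topology (prob_measures Z)
    (\<lambda>\<mu>. \<lambda>f\<in>{f. continuous_on Z f}. (LINT z|\<mu>. f z))
    (product_topology (\<lambda>_. euclidean :: complex topology) {f. continuous_on Z f})"

definition mix_measure :: "real \<Rightarrow> 'z measure \<Rightarrow> 'z measure \<Rightarrow> 'z measure"
  where "mix_measure t \<mu> \<nu> = measure_of (space \<mu>) (sets \<mu>)
    (\<lambda>A. ennreal t * emeasure \<mu> A + ennreal (1 - t) * emeasure \<nu> A)"

lemma emeasure_mix_measure: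
  assumes "sets \<mu> = sets \<nu>" "A \<in> sets \<mu>"
  shows "emeasure (mix_measure t \<mu> \<nu>) A = ennreal t * emeasure \<mu> A + ennreal (1 - t) * emeasure \<nu> A"
proof -
  have "countably_additive (sets \<mu>) (\<lambda>A. ennreal t * emeasure \<mu> A + ennreal (1 - t) * emeasure \<nu> A)"
    using assms(1)
    by (intro countably_additiveI)
      (simp add: suminf_add[symmetric] ennreal_suminf_cmult suminf_emeasure)
  then show ?thesis
    unfolding mix_measure_def using assms(2)
    by (intro emeasure_measure_of_sigma)
      (auto simp: positive_def sets.sigma_algebra_axioms)
qed

section \<open>Crossed products by a single automorphism\<close>

definition zpow :: "('a \<Rightarrow> 'a) \<Rightarrow> int \<Rightarrow> 'a \<Rightarrow> 'a"
  where "zpow f n = (if 0 \<le> n then f ^^ nat n else inv f ^^ nat (- n))"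

text \<open>Integer powers of a unitary.\<close>

definition upow :: "'b::cstar_algebra \<Rightarrow> int \<Rightarrow> 'b"
  where "upow v n = (if 0 \<le> n then v ^ nat n else star v ^ nat (- n))"

text \<open>
  The algebraic crossed product is the *-algebra of finitely supported \<open>f :: int \<Rightarrow> A\<close>, where
  \<open>f\<close> stands for the formal sum of the \<open>f n V\<^sup>n\<close>; the operations are dictated by
  \<open>V a = \<alpha>(a) V\<close> and \<open>V\<^sup>* = V\<^sup>-\<^sup>1\<close>.
\<close>

definition alg_elem :: "(int \<Rightarrow> 'a::cstar_algebra) \<Rightarrow> bool"
  where "alg_elem f \<longleftrightarrow> finite {n. f n \<noteq> 0}"

definition alg_mult ::
  "('a::cstar_algebra \<Rightarrow> 'a) \<Rightarrow> (int \<Rightarrow> 'a) \<Rightarrow> (int \<Rightarrow> 'a) \<Rightarrow> int \<Rightarrow> 'a"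
  where "alg_mult \<alpha> f g = (\<lambda>n. \<Sum>m | f m \<noteq> 0. f m * zpow \<alpha> m (g (n - m)))"

definition alg_star :: "('a::cstar_algebra \<Rightarrow> 'a) \<Rightarrow> (int \<Rightarrow> 'a) \<Rightarrow> int \<Rightarrow> 'a"
  where "alg_star \<alpha> f = (\<lambda>n. zpow \<alpha> n (star (f (- n))))"

definition alg_cstar_seminorm ::
  "('a::cstar_algebra \<Rightarrow> 'a) \<Rightarrow> ((int \<Rightarrow> 'a) \<Rightarrow> real) \<Rightarrow> bool"
  where "alg_cstar_seminorm \<alpha> p \<longleftrightarrow>
    (\<forall>f g. alg_elem f \<longrightarrow> alg_elem g \<longrightarrow>
      0 \<le> p f \<and> p (\<lambda>n. f n + g n) \<le> p f + p g \<and> p (alg_mult \<alpha> f g) \<le> p f * p g) \<and>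
    (\<forall>c f. alg_elem f \<longrightarrow> p (\<lambda>n. c *\<^sub>C f n) = cmod c * p f) \<and>
    (\<forall>f. alg_elem f \<longrightarrow> p (alg_mult \<alpha> (alg_star \<alpha> f) f) = (p f)\<^sup>2)"

text \<open>
  \<open>'c\<close> is the universal crossed product of \<open>'a\<close> by \<open>\<alpha>\<close>, with canonical embedding \<open>\<iota>\<close> and canonical
  unitary \<open>V\<close>: it is generated by a covariant pair, and it carries the universal norm, i.e. the
  largest C*-seminorm on the algebraic crossed product. Every covariant pair in any
  C*-algebra induces such a seminorm, so the last clause is the universal property, expressed
  without quantification over all C*-algebras (which HOL does not permit).
\<close>

definition is_crossed_product ::
  "('a::cstar_algebra \<Rightarrow> 'a) \<Rightarrow> ('a \<Rightarrow> 'c::cstar_algebra) \<Rightarrow> 'c \<Rightarrow> bool"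
  where "is_crossed_product \<alpha> \<iota> V \<longleftrightarrow>
    unital_star_hom \<iota> \<and> unitary V \<and> (\<forall>a. V * \<iota> a * star V = \<iota> (\<alpha> a)) \<and>
    cstar_gen (range \<iota> \<union> {V}) = UNIV \<and>
    (\<forall>p f. alg_cstar_seminorm \<alpha> p \<longrightarrow> alg_elem f \<longrightarrow>
      p f \<le> norm (\<Sum>n | f n \<noteq> 0. \<iota> (f n) * upow V n))"

section \<open>Cocycles and skew products\<close>

text \<open>The homeomorphism \<open>h\<close> of \<open>X\<close> dual to an automorphism of \<open>C(X)\<close>; the induced automorphism of
  \<open>L\<^sup>\<infinity>(X)\<close> is \<open>f \<mapsto> f \<circ> h\<close>.\<close>

definition dual_homeo :: "(('x::metric_space \<Rightarrow>\<^sub>C complex) \<Rightarrow> ('x \<Rightarrow>\<^sub>C complex)) \<Rightarrow> 'x \<Rightarrow> 'x"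
  where "dual_homeo \<alpha> = (THE h. homeomorphic_map euclidean euclidean h \<and>
    (\<forall>a x. apply_bcontfun (\<alpha> a) x = apply_bcontfun a (h x)))"

definition cocycle_at :: "('g \<times> 'x::metric_space \<Rightarrow> complex) \<Rightarrow> 'g \<Rightarrow> 'x \<Rightarrow>\<^sub>C complex"
  where "cocycle_at u g = Bcontfun (\<lambda>x. u (g, x))"

definition continuous_cocycle ::
  "('g::topological_group_add \<Rightarrow> ('x::metric_space \<Rightarrow>\<^sub>C complex) \<Rightarrow> ('x \<Rightarrow>\<^sub>C complex)) \<Rightarrow>
    ('g \<times> 'x \<Rightarrow> complex) \<Rightarrow> bool"
  where "continuous_cocycle \<theta> u \<longleftrightarrow> continuous_on UNIV u \<and> range u \<subseteq> sphere 0 1 \<and>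
    (\<forall>g h. cocycle_at u (g + h) = \<theta> g (cocycle_at u h) * cocycle_at u g)"

definition cocycle_power ::
  "(('x::metric_space \<Rightarrow>\<^sub>C complex) \<Rightarrow> ('x \<Rightarrow>\<^sub>C complex)) \<Rightarrow> ('g \<times> 'x \<Rightarrow> complex) \<Rightarrow>
    'g \<Rightarrow> nat \<Rightarrow> 'x \<Rightarrow>\<^sub>C complex"
  where "cocycle_power \<alpha> u g n = (\<Prod>j<n. (\<alpha> ^^ j) (cocycle_at u g))"

definition skew_action ::
  "('g \<Rightarrow> ('x::metric_space \<Rightarrow>\<^sub>C complex) \<Rightarrow> ('x \<Rightarrow>\<^sub>C complex)) \<Rightarrow>
    (('x \<Rightarrow>\<^sub>C complex) \<Rightarrow> 'c::cstar_algebra) \<Rightarrow> 'c \<Rightarrow> ('g \<times> 'x \<Rightarrow> complex) \<Rightarrow> 'g \<Rightarrow> 'c \<Rightarrow> 'c"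
  where "skew_action \<theta> \<iota> V u g = (THE \<Phi>. star_automorphism \<Phi> \<and>
    (\<forall>a. \<Phi> (\<iota> a) = \<iota> (\<theta> g a)) \<and> \<Phi> V = \<iota> (cocycle_at u g) * V)"

text \<open>\<open>w\<close> represents a circle-valued element of \<open>L\<^sup>\<infinity>(X, \<mu>\<^sub>0)\<close> with
  \<open>\<theta>\<^sub>g(w) u\<^sub>g\<^sup>(\<^sup>n\<^sup>) = w\<close> for all \<open>g\<close>.\<close>

definition is_transfer ::
  "'x::metric_space measure \<Rightarrow> ('g \<Rightarrow> ('x \<Rightarrow>\<^sub>C complex) \<Rightarrow> ('x \<Rightarrow>\<^sub>C complex)) \<Rightarrow>
    (('x \<Rightarrow>\<^sub>C complex) \<Rightarrow> ('x \<Rightarrow>\<^sub>C complex)) \<Rightarrow> ('g \<times> 'x \<Rightarrow> complex) \<Rightarrow> nat \<Rightarrow> ('x \<Rightarrow> complex) \<Rightarrow> bool"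
  where "is_transfer \<mu>\<^sub>0 \<theta> \<alpha> u n w \<longleftrightarrow>
    w \<in> borel_measurable borel \<and> (AE x in \<mu>\<^sub>0. cmod (w x) = 1) \<and>
    (\<forall>g. AE x in \<mu>\<^sub>0. w (dual_homeo (\<theta> g) x) * apply_bcontfun (cocycle_power \<alpha> u g n) x = w x)"

definition transfer_period ::
  "'x::metric_space measure \<Rightarrow> ('g \<Rightarrow> ('x \<Rightarrow>\<^sub>C complex) \<Rightarrow> ('x \<Rightarrow>\<^sub>C complex)) \<Rightarrow>
    (('x \<Rightarrow>\<^sub>C complex) \<Rightarrow> ('x \<Rightarrow>\<^sub>C complex)) \<Rightarrow> ('g \<times> 'x \<Rightarrow> complex) \<Rightarrow> nat"
  where "transfer_period \<mu>\<^sub>0 \<theta> \<alpha> u = (LEAST n. 1 \<le> n \<and> (\<exists>w. is_transfer \<mu>\<^sub>0 \<theta> \<alpha> u n w))"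

text \<open>The functions \<open>w\<^bsub>k n\<^esub>\<close> obtained from \<open>w = w\<^sub>n\<close>.\<close>

definition transfer_iterate ::
  "(('x::metric_space \<Rightarrow>\<^sub>C complex) \<Rightarrow> ('x \<Rightarrow>\<^sub>C complex)) \<Rightarrow> nat \<Rightarrow> ('x \<Rightarrow> complex) \<Rightarrow>
    int \<Rightarrow> 'x \<Rightarrow> complex"
  where "transfer_iterate \<alpha> n w k x =
    (if 0 \<le> k then \<Prod>j\<in>{0..k - 1}. w (zpow (dual_homeo \<alpha>) (j * int n) x)
     else \<Prod>j\<in>{k..-1}. cnj (w (zpow (dual_homeo \<alpha>) (j * int n) x)))"

definition skew_T ::
  "'x::metric_space measure \<Rightarrow> (('x \<Rightarrow>\<^sub>C complex) \<Rightarrow> ('x \<Rightarrow>\<^sub>C complex)) \<Rightarrow>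
    (('x \<Rightarrow>\<^sub>C complex) \<Rightarrow> 'c::cstar_algebra) \<Rightarrow> 'c \<Rightarrow> nat \<Rightarrow> ('x \<Rightarrow> complex) \<Rightarrow> 'c \<Rightarrow> 'c"
  where "skew_T \<mu>\<^sub>0 \<alpha> \<iota> V n w = (THE T. bounded_linear T \<and> clinear T \<and>
    range T \<subseteq> cstar_gen {upow V (int n)} \<and>
    (\<forall>a k. T (\<iota> a * upow V (k * int n)) =
      (LINT x|\<mu>\<^sub>0. apply_bcontfun a x * cnj (transfer_iterate \<alpha> n w k x)) *\<^sub>C upow V (k * int n)) \<and>
    (\<forall>a l. \<not> int n dvd l \<longrightarrow> T (\<iota> a * upow V l) = 0))"

text \<open>The state \<open>\<phi>\<^sub>\<mu>\<close> of \<open>C\<^sup>*(V\<^sup>n)\<close>.\<close>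

definition circle_state :: "'c::cstar_algebra \<Rightarrow> nat \<Rightarrow> complex measure \<Rightarrow> 'c \<Rightarrow> complex"
  where "circle_state V n \<mu> = (THE \<phi>. state_on (cstar_gen {upow V (int n)}) \<phi> \<and>
    (\<forall>k. \<phi> (upow V (k * int n)) = (LINT z|\<mu>. z powi k)))"

definition skew_Psi ::
  "'x::metric_space measure \<Rightarrow> (('x \<Rightarrow>\<^sub>C complex) \<Rightarrow> ('x \<Rightarrow>\<^sub>C complex)) \<Rightarrow>
    (('x \<Rightarrow>\<^sub>C complex) \<Rightarrow> 'c::cstar_algebra) \<Rightarrow> 'c \<Rightarrow> nat \<Rightarrow> ('x \<Rightarrow> complex) \<Rightarrow>
    complex measure \<Rightarrow> 'c \<Rightarrow> complex"
  where "skew_Psi \<mu>\<^sub>0 \<alpha> \<iota> V n w \<mu> = circle_state V n \<mu> \<circ> skew_T \<mu>\<^sub>0 \<alpha> \<iota> V n w"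

end

theory Submission
  imports Defs
begin

text \<open>
  A functional is built on the algebraic crossed product first. If it is a vector functional of a
  representation by weighted translations of bounded measurable functions, then the operator norm of this
  representation is a C*-seminorm, so universality bounds the functional by the crossed product norm.
  Inducing from \<open>V\<^sup>n \<mapsto> z w\<^sup>*\<close> gives states \<open>\<phi>\<^sub>z\<close> with
  \<open>\<phi>\<^sub>z (a V\<^bsup>k n\<^esup>) = z\<^sup>k \<integral> a w\<^sub>k\<^sup>*\<close>. Integrating them against \<open>\<mu>\<close> yields \<open>\<Psi>(\<mu>)\<close>, and von
  Neumann's inequality for \<open>V\<^sup>n\<close> turns them into the operator \<open>T\<close>.

  Conversely, an invariant state \<open>\<phi>\<close> restricts to the unique invariant state on \<open>C(X)\<close>, so by Riesz's
  theorem \<open>\<phi>(a V\<^sup>m) = \<integral> a h\<close>. Invariance reads \<open>\<theta>\<^sub>g(h) = u\<^sub>g\<^bsup>(m)\<^esup> h\<close>. By ergodicity \<open>|h|\<close> is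
  constant; if it is not zero, then \<open>h\<^sup>* / |h|\<close> is a transfer function, so \<open>m = k n\<^sub>0\<close> and
  \<open>h = c\<^sub>k w\<^sub>k\<^sup>*\<close>. Approximating the \<open>w\<^sub>k\<close> by continuous functions shows that \<open>c\<close> is positive
  definite, and Herglotz's theorem provides the measure.
\<close>

section \<open>Selfadjoint square roots and states\<close>

text \<open>The universal norm is accessible only as the largest C*-seminorm, so each functional or
  map on the crossed product must be preceded by a seminorm that dominates it. Operators on bounded
  measurable functions with an L2 seminorm provide one without completing the space or dividing out
  null functions. A second obstacle is that the \<open>w_k\<close> are merely measurable:
  \<open>w_k V^(k n)\<close> is no element of the crossed product. Hence \<open>T\<close> is not
  built inside the algebra. The trigonometric polynomial of coefficients is bounded at every
  \<open>z\<close> of the circle, and only then \<open>V^n\<close> is substituted for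
  \<open>z\<close>. Since \<open>T\<close>, \<open>\<phi>_\<mu>\<close> and the action are definite
  descriptions, each needs existence and uniqueness, the latter from density of finite sums of
  powers with coefficients. The inverse of \<open>\<Psi>\<close> is continuous because each moment
  of the measure is the value of the state at one fixed element, divided by a nonzero constant.
  Compactness of the space of measures is then a consequence of compactness of the invariant states,
  not an ingredient.\<close>

lemma scaleC_zero_right [simp]: "c *\<^sub>C (0::'a::cstar_algebra) = 0"
  using scaleC_add_right[of c 0 "0::'a"] by simp

lemma scaleC_zero_left [simp]: "0 *\<^sub>C (x::'a::cstar_algebra) = 0"
  using scaleC_add_left[of 0 0 x] by simp

lemma scaleC_one [simp]: "1 *\<^sub>C (x::'a::cstar_algebra) = x"
  using scaleC_of_real[of 1 x] by simp

lemma scaleC_minus_one: "(-1) *\<^sub>C (x::'a::cstar_algebra) = - x"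
  using scaleC_of_real[of "-1" x] by simp

lemma scaleC_minus_left: "(- c) *\<^sub>C (x::'a::cstar_algebra) = - (c *\<^sub>C x)"
  by (metis scaleC_minus_one scaleC_scaleC mult_minus1)

lemma scaleC_diff_right: "c *\<^sub>C (x - y) = c *\<^sub>C x - c *\<^sub>C (y::'a::cstar_algebra)"
  using scaleC_add_right[of c "x - y" y] by simp

lemma scaleC_sum_right: "c *\<^sub>C (\<Sum>i\<in>I. f i) = (\<Sum>i\<in>I. c *\<^sub>C (f i :: 'a::cstar_algebra))"
  by (induction I rule: infinite_finite_induct) (auto simp: scaleC_add_right)

lemma star_zero [simp]: "star (0::'a::cstar_algebra) = 0"
  using star_add[of 0 "0::'a"] by simp

lemma star_one [simp]: "star (1::'a::cstar_algebra) = 1"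
  by (metis mult.left_neutral star_mult star_star mult.right_neutral)

lemma star_sum: "star (\<Sum>i\<in>I. f i) = (\<Sum>i\<in>I. star (f i :: 'a::cstar_algebra))"
  by (induction I rule: infinite_finite_induct) (auto simp: star_add)

lemma star_scaleR: "star (r *\<^sub>R x) = r *\<^sub>R star (x::'a::cstar_algebra)"
  by (metis bounded_linear_star bounded_linear.linear linear_scale)

lemma star_power: "star (x ^ n) = star (x::'a::cstar_algebra) ^ n"
  by (induction n) (auto simp: star_mult power_commutes)

lemma cstar_subalgebraD:
  assumes "cstar_subalgebra B"
  shows "closed B" "1 \<in> B" "\<And>x y. x \<in> B \<Longrightarrow> y \<in> B \<Longrightarrow> x + y \<in> B"
    "\<And>x y. x \<in> B \<Longrightarrow> y \<in> B \<Longrightarrow> x * y \<in> B" "\<And>c x. x \<in> B \<Longrightarrow> c *\<^sub>C x \<in> B"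
    "\<And>x. x \<in> B \<Longrightarrow> star x \<in> B" "\<And>r x. x \<in> B \<Longrightarrow> r *\<^sub>R x \<in> B" "0 \<in> B"
    "\<And>x y. x \<in> B \<Longrightarrow> y \<in> B \<Longrightarrow> x - y \<in> B"
proof -
  show *: "closed B" "1 \<in> B" "\<And>x y. x \<in> B \<Longrightarrow> y \<in> B \<Longrightarrow> x + y \<in> B"
    "\<And>x y. x \<in> B \<Longrightarrow> y \<in> B \<Longrightarrow> x * y \<in> B" "\<And>c x. x \<in> B \<Longrightarrow> c *\<^sub>C x \<in> B"
    "\<And>x. x \<in> B \<Longrightarrow> star x \<in> B"
    using assms by (auto simp: cstar_subalgebra_def)
  show "\<And>r x. x \<in> B \<Longrightarrow> r *\<^sub>R x \<in> B" by (metis *(5) scaleC_of_real)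
  show "0 \<in> B" by (metis *(2,5) scaleC_zero_left)
  show "x - y \<in> B" if "x \<in> B" "y \<in> B" for x y
    by (metis that *(3,5) scaleC_minus_one diff_conv_add_uminus)
qed

lemma cstar_subalgebra_power: "cstar_subalgebra B \<Longrightarrow> x \<in> B \<Longrightarrow> x ^ n \<in> B"
  by (induction n) (auto intro: cstar_subalgebraD)

lemma cstar_subalgebra_sum:
  "cstar_subalgebra B \<Longrightarrow> (\<And>i. i \<in> I \<Longrightarrow> f i \<in> B) \<Longrightarrow> (\<Sum>i\<in>I. f i) \<in> B"
  by (induction I rule: infinite_finite_induct) (auto intro: cstar_subalgebraD)

lemma cstar_subalgebra_UNIV [simp]: "cstar_subalgebra UNIV"
  by (auto simp: cstar_subalgebra_def)

text \<open>Consecutive coefficients differ by the factor \<open>(1/2 - k) / (k + 1)\<close>, of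
  modulus at most 1. This crude bound is all that the binomial series needs inside the open unit
  ball.\<close>

lemma abs_gbinomial_half_le: "\<bar>(1/2 :: real) gchoose k\<bar> \<le> 1"
proof (induction k)
  case (Suc k)
  have "(1/2 :: real) gchoose Suc k = ((1/2) gchoose k) * ((1/2 - real k) / (real k + 1))"
    using gbinomial_absorption'[of "Suc k" "1/2::real"] gbinomial_mult_1[of "1/2::real" k]
    by (simp add: field_simps)
  moreover have "\<bar>(1/2 - real k) / (real k + 1)\<bar> \<le> 1" by (simp add: abs_le_iff field_simps)
  ultimately show ?case using Suc by (metis abs_mult mult_le_one abs_ge_zero)
qed simp

text \<open>The binomial series of \<open>(1 - x)^(1/2)\<close>. Its partial sums are real
  polynomials in \<open>x\<close>; this explains at once why the root lies in \<open>B\<close>, is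
  selfadjoint, and commutes with whatever commutes with \<open>x\<close>.\<close>

lemma cstar_sqrt:
  fixes x :: "'a::cstar_algebra"
  assumes B: "cstar_subalgebra B" "x \<in> B" and sa: "star x = x" and nx: "norm x < 1"
  obtains y where "y \<in> B" "star y = y" "y * y = 1 - x" "\<And>z. z * x = x * z \<Longrightarrow> z * y = y * z"
proof -
  define a :: "nat \<Rightarrow> real" where "a k = (-1) ^ k * ((1/2) gchoose k)" for k
  define s where "s k = a k *\<^sub>R x ^ k" for k
  have a1: "\<bar>a k\<bar> \<le> 1" for k by (simp add: a_def abs_mult abs_gbinomial_half_le)
  have sn: "summable (\<lambda>k. norm (s k))"
  proof (rule summable_comparison_test')
    show "summable (\<lambda>k. norm x ^ k)" using nx by (simp add: summable_geometric)
    show "norm (norm (s k)) \<le> norm x ^ k" for k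
    proof -
      have "norm (s k) \<le> 1 * norm x ^ k"
        unfolding s_def norm_scaleR by (intro mult_mono a1[unfolded real_norm_def] norm_power_ineq) auto
      then show ?thesis by simp
    qed
  qed
  then have ss: "summable s" by (rule summable_norm_cancel)
  define y where "y = suminf s"
  have lim: "(\<lambda>n. \<Sum>k<n. s k) \<longlonglongrightarrow> y" using ss unfolding y_def by (rule summable_LIMSEQ)
  have inB: "(\<Sum>k<n. s k) \<in> B" for n
    unfolding s_def by (intro cstar_subalgebra_sum B cstar_subalgebraD(7) cstar_subalgebra_power)
  have "y \<in> B" using closed_sequentially[OF cstar_subalgebraD(1)[OF B(1)] inB lim] .
  moreover have "star y = y"
  proof -
    have "(\<lambda>n. star (\<Sum>k<n. s k)) \<longlonglongrightarrow> star y"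
      by (rule bounded_linear.tendsto[OF bounded_linear_star lim])
    moreover have "star (\<Sum>k<n. s k) = (\<Sum>k<n. s k)" for n
      by (simp add: star_sum s_def star_scaleR star_power sa)
    ultimately have "(\<lambda>n. \<Sum>k<n. s k) \<longlonglongrightarrow> star y" by simp
    then show ?thesis using lim by (rule LIMSEQ_unique)
  qed
  moreover have "y * y = 1 - x"
  proof -
    have "(\<lambda>k. \<Sum>i\<le>k. s i * s (k - i)) sums (y * y)"
      unfolding y_def by (rule Cauchy_product_sums[OF sn sn])
    moreover have "(\<Sum>i\<le>k. s i * s (k - i)) = (if k = 0 then 1 else if k = 1 then - x else 0)" for k
    proof -
      have "(\<Sum>i\<le>k. s i * s (k - i)) = (\<Sum>i\<le>k. (a i * a (k - i)) *\<^sub>R x ^ k)"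
        by (intro sum.cong refl) (simp add: s_def power_add[symmetric] mult.commute)
      also have "\<dots> = (\<Sum>i\<le>k. a i * a (k - i)) *\<^sub>R x ^ k" by (simp add: scaleR_left.sum)
      also have "(\<Sum>i\<le>k. a i * a (k - i)) = (\<Sum>i\<le>k. (-1)^k * (((1/2) gchoose i) * ((1/2) gchoose (k - i))))"
        by (intro sum.cong refl) (simp add: a_def power_add[symmetric])
      \<comment> \<open>Vandermonde's identity for \<open>1/2 + 1/2 = 1\<close>: the Cauchy square
        has the binomial coefficients of exponent 1, which vanish beyond degree 1.\<close>
      also have "\<dots> = (-1)^k * ((1::real) gchoose k)"
        using gbinomial_Vandermonde[where a="1/2::real" and b="1/2" and n=k]
            by (simp add: sum_distrib_left[symmetric] atLeast0AtMost)
      also have "(1::real) gchoose k = of_nat (1 choose k)" by (metis binomial_gbinomial of_nat_1)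
      finally show ?thesis by (auto simp: binomial_eq_0)
    qed
    ultimately have "(\<lambda>k. if k = 0 then 1 else if k = 1 then - x else 0) sums (y * y)" by simp
    moreover have "(\<lambda>k::nat. if k = 0 then 1 else if k = 1 then - x else 0) sums
      (\<Sum>k\<in>{0,1::nat}. if k = 0 then 1 else if k = 1 then - x else 0)"
      by (rule sums_finite) auto
    ultimately show ?thesis by (simp add: sums_unique2[of _ "y * y" "1 - x"])
  qed
  moreover have "z * y = y * z" if zx: "z * x = x * z" for z
  proof -
    have "z * x ^ k = x ^ k * z" for k
      by (induction k) (auto simp: zx mult.assoc, metis zx mult.assoc)
    then have "z * s k = s k * z" for k
      by (simp add: s_def)
    then have "z * (\<Sum>k<n. s k) = (\<Sum>k<n. s k) * z" for n
      unfolding sum_distrib_left sum_distrib_right by (intro sum.cong refl)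
    moreover have "(\<lambda>n. z * (\<Sum>k<n. s k)) \<longlonglongrightarrow> z * y" "(\<lambda>n. (\<Sum>k<n. s k) * z) \<longlonglongrightarrow> y * z"
      using lim by (auto intro: tendsto_mult tendsto_const)
    ultimately have "(\<lambda>n. z * (\<Sum>k<n. s k)) \<longlonglongrightarrow> y * z" by simp
    then show ?thesis using LIMSEQ_unique[OF \<open>(\<lambda>n. z * (\<Sum>k<n. s k)) \<longlonglongrightarrow> z * y\<close>] by simp
  qed
  ultimately show ?thesis using that by blast
qed

section \<open>Unitaries and contractivity of homomorphisms\<close>

lemma unitary_norm: "unitary (v::'a::cstar_algebra) \<Longrightarrow> norm v = 1"
  using norm_star_mult_self[of v] by (auto simp: unitary_def power2_eq_1_iff)
     (metis norm_ge_zero not_one_le_zero neg_0_le_iff_le)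

lemma unital_star_homD:
  assumes "unital_star_hom f"
  shows "f (x + y) = f x + f y" "f (c *\<^sub>C x) = c *\<^sub>C f x" "f 1 = 1" "f (x * y) = f x * f y"
    "f (star x) = star (f x)" "f 0 = 0" "f (x - y) = f x - f y" "f (r *\<^sub>R x) = r *\<^sub>R f x"
    "f (- x) = - f x"
proof -
  show *: "f (x + y) = f x + f y" "f (c *\<^sub>C x) = c *\<^sub>C f x" "f 1 = 1" "f (x * y) = f x * f y"
    "f (star x) = star (f x)" for x y c
    using assms by (auto simp: unital_star_hom_def clinear_def)
  show z: "f 0 = 0" by (metis *(2) scaleC_zero_left)
  show "f (r *\<^sub>R x) = r *\<^sub>R f x" by (metis *(2) scaleC_of_real)
  show m: "f (- x) = - f x" for x by (metis *(2) scaleC_minus_one)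
  show "f (x - y) = f x - f y" by (metis *(1) m diff_conv_add_uminus)
qed

text \<open>If \<open>c\<close> and \<open>d\<close> are commuting selfadjoint elements with \<open>c\<^sup>2 + d\<^sup>2 = 1\<close>, then \<open>c + i d\<close> is unitary, and
  \<open>c\<close> is the mean of it and its adjoint. This bounds the image of \<open>x\<close> without spectral theory.\<close>

lemma unital_star_hom_contractive:
  fixes f :: "'a::cstar_algebra \<Rightarrow> 'b::cstar_algebra"
  assumes f: "unital_star_hom f"
  shows "norm (f x) \<le> norm x"
proof -
  note F = unital_star_homD[OF f]
  have unit: "norm (f x) \<le> 1" if sa: "star x = x" and nx: "norm x < 1" for x
  proof -
    have nxx: "norm (x * x) < 1"
    proof -
      have "norm (x * x) \<le> norm x * norm x" by (rule norm_mult_ineq)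
      also have "\<dots> \<le> norm x * 1" using nx by (intro mult_left_mono) auto
      finally show ?thesis using nx by simp
    qed
    have sxx: "star (x * x) = x * x" by (simp add: star_mult sa)
    obtain y where y: "star y = y" "y * y = 1 - x * x" "\<And>z. z * (x * x) = (x * x) * z \<Longrightarrow> z * y = y * z"
      using cstar_sqrt[OF cstar_subalgebra_UNIV UNIV_I sxx nxx] by metis
    have xy: "x * y = y * x" by (rule y(3)) (simp add: mult.assoc)
    define c d where "c = f x" and "d = f y"
    have cd: "c * d = d * c" "star c = c" "star d = d"
      using F(4)[of x y] F(4)[of y x] F(5)[of x] F(5)[of y] xy
      by (simp_all add: c_def d_def sa y(1))
    have "d * d = 1 - c * c"
      unfolding c_def d_def F(4)[symmetric] y(2) F(7) F(3) ..
    then have cd1: "c * c + d * d = 1" by simp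
    define v where "v = c + \<i> *\<^sub>C d"
    have sv: "star v = c - \<i> *\<^sub>C d"
      by (simp add: v_def star_add star_scaleC cd scaleC_minus_left)
    have "unitary v"
      unfolding unitary_def sv unfolding v_def
      by (simp add: algebra_simps mult_scaleC_left mult_scaleC_right scaleC_scaleC scaleC_add_right
          scaleC_minus_one cd cd1 scaleC_diff_right scaleC_minus_left)
    then have nv: "norm v = 1" by (rule unitary_norm)
    have "2 *\<^sub>R c = v + star v" unfolding sv unfolding v_def by (simp add: scaleR_2)
    then have "2 * norm c \<le> norm v + norm (star v)" by (metis norm_scaleR norm_triangle_ineq abs_numeral)
    then show ?thesis by (simp add: nv norm_star c_def)
  qed
  have sa: "norm (f x) \<le> norm x" if "star x = x" for x
  proof (rule field_le_epsilon)
    fix e :: real assume "e > 0"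
    \<comment> \<open>The slack \<open>e\<close> makes the rescaled element have norm strictly below
      1, where the square root series converges.\<close>
    define r where "r = norm x + e"
    have r: "r > 0" "norm x < r" using \<open>e > 0\<close> norm_ge_zero[of x] unfolding r_def by linarith+
    have "norm (f ((1/r) *\<^sub>R x)) \<le> 1"
      using r by (intro unit) (simp_all add: star_scaleR that)
    then have "norm (f x) / r \<le> 1" using r(1) by (simp add: F(8))
    then show "norm (f x) \<le> norm x + e" using r(1) by (simp add: r_def[symmetric] pos_divide_le_eq)
  qed
  have "(norm (f x))\<^sup>2 = norm (f (star x * x))"
    by (simp add: norm_star_mult_self[symmetric] F(4,5))
  also have "\<dots> \<le> norm (star x * x)" by (rule sa) (simp add: star_mult star_star)
  also have "\<dots> = (norm x)\<^sup>2" by (rule norm_star_mult_self)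
  finally show ?thesis by (rule power2_le_imp_le) simp
qed

section \<open>States: hermiticity, Cauchy-Schwarz and the norm bound\<close>

lemma state_onD:
  assumes "state_on B \<phi>"
  shows "\<And>x y. x \<in> B \<Longrightarrow> y \<in> B \<Longrightarrow> \<phi> (x + y) = \<phi> x + \<phi> y" "\<And>c x. x \<in> B \<Longrightarrow> \<phi> (c *\<^sub>C x) = c * \<phi> x"
    "\<And>x. x \<in> B \<Longrightarrow> \<phi> (star x * x) \<in> \<real>\<^sub>\<ge>\<^sub>0" "\<phi> 1 = 1" "\<phi> \<in> extensional B"
  using assms by (auto simp: state_on_def)

lemma state_on_diff:
  assumes B: "cstar_subalgebra B" and s: "state_on B \<phi>" and xy: "x \<in> B" "y \<in> B"
  shows "\<phi> (x - y) = \<phi> x - \<phi> y"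
proof -
  have "\<phi> (x + (-1) *\<^sub>C y) = \<phi> x + (-1) * \<phi> y"
    by (simp only: state_onD(1,2)[OF s] xy cstar_subalgebraD(5)[OF B])
  then show ?thesis by (simp add: scaleC_minus_one)
qed

text \<open>Positivity at \<open>1 + c x\<close> makes a sum of four values real. The choices
  \<open>c = 1\<close> and \<open>c = \<i>\<close> determine the imaginary and the real part of
  \<open>\<phi> (star x)\<close>.\<close>

lemma state_on_star:
  assumes B: "cstar_subalgebra B" and s: "state_on B \<phi>" and x: "x \<in> B"
  shows "\<phi> (star x) = cnj (\<phi> x)"
proof -
  note S = state_onD[OF s] and C = cstar_subalgebraD[OF B]
  have real: "\<phi> (star y * y) \<in> \<real>" if "y \<in> B" for y
    using S(3)[OF that] by (auto simp: complex_nonneg_Reals_iff complex_is_Real_iff)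
  have e: "\<phi> (star (1 + c *\<^sub>C x) * (1 + c *\<^sub>C x)) =
      1 + c * \<phi> x + cnj c * \<phi> (star x) + (cnj c * c) * \<phi> (star x * x)" for c
  proof -
    have "star (1 + c *\<^sub>C x) * (1 + c *\<^sub>C x) = 1 + c *\<^sub>C x + cnj c *\<^sub>C star x + (cnj c * c) *\<^sub>C (star x
        * x)"
      by (simp add: star_add star_scaleC algebra_simps scaleC_add_right mult_scaleC_left
          mult_scaleC_right scaleC_scaleC)
    then show ?thesis by (simp only: S(1,2,4) C x)
  qed
  have "1 + c * \<phi> x + cnj c * \<phi> (star x) + (cnj c * c) * \<phi> (star x * x) \<in> \<real>" for c
    unfolding e[symmetric] by (intro real C x)
  from this[of 1] this[of \<i>] real[OF x] show ?thesis
    by (simp add: complex_is_Real_iff complex_eq_iff)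
qed

text \<open>Source of the Cauchy-Schwarz estimates below, for states as well as for integrals, and
  of the rate of convergence in the Riesz representation.\<close>

lemma quadratic_discriminant_le:
  fixes a b c :: real
  assumes "\<And>t. 0 \<le> a * t\<^sup>2 - 2 * b * t + c" and "0 \<le> a"
  shows "b\<^sup>2 \<le> a * c"
proof (cases "a = 0")
  case True
  have "b = 0"
  proof (rule ccontr)
    assume "b \<noteq> 0"
    \<comment> \<open>At this point the remaining linear function takes the value -1.\<close>
    then show False using assms(1)[of "(c + 1) / (2 * b)"] True by simp
  qed
  then show ?thesis using True by simp
next
  case False
  then have "0 < a" using assms(2) by simp
  have "0 \<le> a * (a * (b / a)\<^sup>2 - 2 * b * (b / a) + c)" using assms by (intro mult_nonneg_nonneg)
  also have "\<dots> = a * c - b\<^sup>2" using \<open>0 < a\<close> by (simp add: field_simps power2_eq_square)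
  finally show ?thesis by simp
qed

lemma state_on_Cauchy_Schwarz:
  assumes B: "cstar_subalgebra B" and s: "state_on B \<phi>" and x: "x \<in> B" and y: "y \<in> B"
  shows "(cmod (\<phi> (x * y)))\<^sup>2 \<le> Re (\<phi> (x * star x)) * Re (\<phi> (star y * y))"
proof -
  note S = state_onD[OF s] and C = cstar_subalgebraD[OF B]
  define p where "p = \<phi> (x * y)"
  have nn: "0 \<le> Re (\<phi> (star z * z))" "\<phi> (star z * z) = complex_of_real (Re (\<phi> (star z * z)))" if "z \<in> B"
      for z
    using S(3)[OF that] by (auto simp: complex_nonneg_Reals_iff complex_eq_iff)
  define A D where "A = Re (\<phi> (x * star x))" and "D = Re (\<phi> (star y * y))"
  have A: "\<phi> (x * star x) = complex_of_real A" "0 \<le> A" and D: "\<phi> (star y * y) = complex_of_real D" "0 \<le> D"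
    using nn[of "star x"] nn[of y] C x y by (simp_all add: A_def D_def star_star)
  have q: "\<phi> (star y * star x) = cnj p"
    using state_on_star[OF B s, of "x * y"] x y C(4) by (simp add: p_def star_mult)
  have "0 \<le> cmod c ^ 2 * A + 2 * r * Re (c * p) + r\<^sup>2 * D" for c and r :: real
  proof -
    define z where "z = cnj c *\<^sub>C star x + complex_of_real r *\<^sub>C y"
    have zB: "z \<in> B" unfolding z_def by (intro C x y)
    have "star z * z = (c * cnj c) *\<^sub>C (x * star x) + (c * r) *\<^sub>C (x * y)
        + (r * cnj c) *\<^sub>C (star y * star x) + (r * r) *\<^sub>C (star y * y)"
      by (simp add: z_def star_add star_scaleC star_star algebra_simps scaleC_add_right mult_scaleC_left
          mult_scaleC_right scaleC_scaleC)
    then have "\<phi> (star z * z) = (c * cnj c) * A + (c * r) * p + (r * cnj c) * cnj p + (r * r) * D"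
      using A D q by (simp only: S(1,2) C x y p_def of_real_mult)
    then have "Re (\<phi> (star z * z)) = cmod c ^ 2 * A + 2 * r * Re (c * p) + r\<^sup>2 * D"
      by (simp only: complex_norm_square[symmetric] of_real_power[symmetric] of_real_mult[symmetric]
        plus_complex.sel Re_complex_of_real) (simp add: power2_eq_square algebra_simps)
    with nn(1)[OF zB] show ?thesis by simp
  qed
  note * = this
  \<comment> \<open>The choice \<open>c = - cnj p\<close> aligns the phase, so a quadratic in the
    real variable \<open>r\<close> remains. The surplus factor \<open>|p|^2\<close> is cancelled at
    the end.\<close>
  have ineq: "0 \<le> (cmod p)\<^sup>2 * A - 2 * r * (cmod p)\<^sup>2 + r\<^sup>2 * D" for r
    using *[of "- cnj p" r] by (simp add: cmod_power2 algebra_simps) (simp add: power2_eq_square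
        algebra_simps)
  have "((cmod p)\<^sup>2)\<^sup>2 \<le> D * ((cmod p)\<^sup>2 * A)"
    using ineq D by (intro quadratic_discriminant_le) (simp_all add: algebra_simps)
  then have "(cmod p)\<^sup>2 * (cmod p)\<^sup>2 \<le> (cmod p)\<^sup>2 * (A * D)" by (simp add: power2_eq_square ac_simps)
  then have "(cmod p)\<^sup>2 \<le> A * D"
    using A(2) D(2) by (cases "p = 0") (simp, metis mult_le_cancel_left_pos zero_less_norm_iff
        zero_less_power)
  then show ?thesis by (simp add: p_def A_def D_def)
qed

text \<open>For a selfadjoint \<open>x\<close> of norm below 1 the element \<open>1 - x\<close> is
  the square of a selfadjoint element of \<open>B\<close>, whence
  \<open>Re (\<phi> x) \<le> 1\<close>. Cauchy-Schwarz against the unit reduces a general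
  \<open>x\<close> to \<open>star x * x\<close>.\<close>

lemma state_on_norm_le:
  assumes B: "cstar_subalgebra B" and s: "state_on B \<phi>" and x: "x \<in> B"
  shows "cmod (\<phi> x) \<le> norm x"
proof -
  note S = state_onD[OF s] and C = cstar_subalgebraD[OF B]
  have unit: "Re (\<phi> x) \<le> 1" if x': "x \<in> B" "star x = x" "norm x < 1" for x
  proof -
    obtain y where y: "y \<in> B" "star y = y" "y * y = 1 - x" using cstar_sqrt[OF B x'] by blast
    have "0 \<le> Re (\<phi> (star y * y))" using S(3)[OF y(1)] by (auto simp: complex_nonneg_Reals_iff)
    also have "\<phi> (star y * y) = 1 - \<phi> x" using state_on_diff[OF B s C(2) x'(1)] y S(4) by simp
    finally show ?thesis by simp
  qed
  have sa: "Re (\<phi> x) \<le> norm x" if xB: "x \<in> B" and "star x = x" for x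
  proof (rule field_le_epsilon)
    fix e :: real assume "e > 0"
    define r where "r = norm x + e"
    have r: "r > 0" "norm x < r" using \<open>e > 0\<close> norm_ge_zero[of x] unfolding r_def by linarith+
    have "Re (\<phi> ((1/r) *\<^sub>R x)) \<le> 1"
      using r by (intro unit C xB) (simp_all add: star_scaleR that)
    also have "\<phi> ((1/r) *\<^sub>R x) = complex_of_real (1/r) * \<phi> x"
      by (simp only: scaleC_of_real[symmetric] S(2) xB)
    finally have "Re (\<phi> x) / r \<le> 1" by (simp add: Re_divide_of_real)
    then show "Re (\<phi> x) \<le> norm x + e" using r(1) by (simp add: r_def[symmetric] pos_divide_le_eq)
  qed
  have "(cmod (\<phi> x))\<^sup>2 \<le> Re (\<phi> (star x * x))"
    using state_on_Cauchy_Schwarz[OF B s C(2) x] S(4) by simp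
  also have "\<dots> \<le> norm (star x * x)"
    by (rule sa[OF C(4)[OF C(6)[OF x] x]]) (simp add: star_mult star_star)
  also have "\<dots> = (norm x)\<^sup>2" by (rule norm_star_mult_self)
  finally show ?thesis by (rule power2_le_imp_le) simp
qed

section \<open>Covariant pairs and the algebraic crossed product\<close>

lemma zpow_0 [simp]: "zpow f 0 = id"
  by (simp add: zpow_def fun_eq_iff)

lemma zpow_of_nat: "zpow f (int k) = f ^^ k"
  by (simp add: zpow_def)

lemma zpow_Suc:
  assumes "bij f"
  shows "zpow f (n + 1) x = f (zpow f n x)"
proof (cases "0 \<le> n")
  case True
  then have "nat (n + 1) = Suc (nat n)" by simp
  then show ?thesis using True by (simp add: zpow_def)
next
  case False
  then obtain k where k: "n = - int (Suc k)" by (metis int_cases linorder_not_le of_nat_0_le_iff)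
  have "f (inv f y) = y" for y using assms by (simp add: bij_is_surj surj_f_inv_f)
  then show ?thesis by (cases k) (auto simp: zpow_def k nat_add_distrib)
qed

lemma zpow_add:
  assumes "bij f"
  shows "zpow f (m + n) x = zpow f m (zpow f n x)"
proof (induction m rule: int_induct[where k = 0])
  case (step1 i)
  then show ?case using zpow_Suc[OF assms, of "i + n" x] zpow_Suc[OF assms, of i]
      by (simp add: algebra_simps)
next
  case (step2 i)
  have "f (zpow f (i - 1 + n) x) = f (zpow f (i - 1) (zpow f n x))"
    using step2 zpow_Suc[OF assms, of "i - 1 + n" x] zpow_Suc[OF assms, of "i - 1"]
        by (simp add: algebra_simps)
  then show ?case using assms by (simp add: bij_is_inj inj_eq)
qed simp

lemma zpow_cancel: "bij f \<Longrightarrow> zpow f (- n) (zpow f n x) = x" "bij f \<Longrightarrow> zpow f n (zpow f (- n) x) = x"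
  by (simp_all add: zpow_add[symmetric])

lemma upow_0 [simp]: "upow V 0 = 1"
  by (simp add: upow_def)

lemma upow_1 [simp]: "upow V 1 = V"
  by (simp add: upow_def)

lemma upow_of_nat: "upow V (int k) = V ^ k"
  by (simp add: upow_def)

lemma upow_Suc:
  assumes "unitary V"
  shows "upow V (n + 1) = V * upow V n"
proof (cases "0 \<le> n")
  case True
  then have "nat (n + 1) = Suc (nat n)" by simp
  then show ?thesis using True by (simp add: upow_def)
next
  case False
  then obtain k where k: "n = - int (Suc k)" by (metis int_cases linorder_not_le of_nat_0_le_iff)
  have "V * (star V * y) = y" for y using assms by (simp add: unitary_def mult.assoc[symmetric])
  moreover have "V * star V = 1" using assms by (simp add: unitary_def)
  ultimately show ?thesis by (cases k) (auto simp: upow_def k nat_add_distrib)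
qed

lemma unitary_cancel: "unitary V \<Longrightarrow> V * x = V * y \<Longrightarrow> x = (y::'a::cstar_algebra)"
  unfolding unitary_def by (metis mult.assoc mult_1)

lemma upow_add:
  assumes "unitary V"
  shows "upow V (m + n) = upow V m * upow V n"
proof (induction m rule: int_induct[where k = 0])
  case (step1 i)
  then show ?case using upow_Suc[OF assms, of "i + n"] upow_Suc[OF assms, of i]
    by (simp add: algebra_simps)
next
  case (step2 i)
  have "V * upow V (i - 1 + n) = V * (upow V (i - 1) * upow V n)"
    using step2 upow_Suc[OF assms, of "i - 1 + n"] upow_Suc[OF assms, of "i - 1"]
    by (simp add: algebra_simps)
  then show ?case using assms unitary_cancel by blast
qed simp

lemma upow_star: "unitary V \<Longrightarrow> star (upow V n) = upow V (- n)"
  by (auto simp: upow_def star_power star_star)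

lemma upow_unitary: "unitary V \<Longrightarrow> unitary (upow V n)"
  unfolding unitary_def by (metis upow_0 upow_add upow_star add.right_inverse add.left_inverse unitary_def)

lemma norm_upow [simp]: "unitary V \<Longrightarrow> norm (upow V n) = 1"
  by (simp add: upow_unitary unitary_norm)

lemma upow_mult: "unitary V \<Longrightarrow> upow (upow V n) k = upow V (n * k)"
proof (induction k rule: int_induct[where k = 0])
  case (step1 i)
  then show ?case by (simp add: upow_Suc upow_unitary algebra_simps upow_add)
next
  case (step2 i)
  have "upow V n * upow (upow V n) (i - 1) = upow V n * upow V (n * (i - 1))"
    using step2 upow_Suc[OF upow_unitary, of V n "i - 1"]
    by (simp add: algebra_simps upow_add[symmetric])
  then show ?case using unitary_cancel[OF upow_unitary[OF step2(3)]] by blast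
qed simp

lemma cnj_eq_inverse: "cmod z = 1 \<Longrightarrow> cnj z = inverse z"
  by (rule inverse_unique[symmetric]) (simp add: complex_norm_square[symmetric])

lemma upow_complex: "cmod z = 1 \<Longrightarrow> upow z k = z powi k"
  by (simp add: upow_def power_int_def star_complex_def cnj_eq_inverse)

lemma unitary_complex: "cmod z = 1 \<Longrightarrow> unitary z"
  by (simp add: unitary_def star_complex_def complex_norm_square[symmetric] mult.commute[of "cnj z"])

lemma star_automorphism_bij: "star_automorphism f \<Longrightarrow> bij f"
  by (simp add: star_automorphism_def)

lemma star_automorphism_hom: "star_automorphism f \<Longrightarrow> unital_star_hom f"
  by (simp add: star_automorphism_def)

lemma star_automorphism_inv:
  assumes "star_automorphism f"
  shows "unital_star_hom (inv f)"
proof -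
  note F = unital_star_homD[OF star_automorphism_hom[OF assms]]
  have e: "inv f x = y \<longleftrightarrow> x = f y" for x y
    using star_automorphism_bij[OF assms] by (metis bij_inv_eq_iff)
  have i: "f (inv f x) = x" for x using e by metis
  show ?thesis
    unfolding unital_star_hom_def clinear_def by (auto simp: e F i)
qed

lemma unital_star_hom_id: "unital_star_hom id"
  by (simp add: unital_star_hom_def clinear_def)

lemma unital_star_hom_comp: "unital_star_hom f \<Longrightarrow> unital_star_hom g \<Longrightarrow> unital_star_hom (f \<circ> g)"
  by (simp add: unital_star_hom_def clinear_def)

lemma unital_star_hom_funpow:
  fixes f :: "'a::cstar_algebra \<Rightarrow> 'a"
  shows "unital_star_hom f \<Longrightarrow> unital_star_hom (f ^^ k)"
  by (induction k) (auto simp: unital_star_hom_id unital_star_hom_comp)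

lemma unital_star_hom_zpow: "star_automorphism f \<Longrightarrow> unital_star_hom (zpow f n)"
  by (auto simp: zpow_def unital_star_hom_funpow star_automorphism_hom star_automorphism_inv)

section \<open>The integrated form of a covariant pair\<close>

definition covariant_pair ::
  "('a::cstar_algebra \<Rightarrow> 'a) \<Rightarrow> ('a \<Rightarrow> 'd::cstar_algebra) \<Rightarrow> 'd \<Rightarrow> bool"
  where "covariant_pair \<alpha> \<iota> V \<longleftrightarrow>
    unital_star_hom \<iota> \<and> unitary V \<and> (\<forall>a. V * \<iota> a * star V = \<iota> (\<alpha> a))"

text \<open>Defined for any map and any element, so that one calculus serves the crossed product,
  other covariant pairs into it and, with \<open>\<alpha> = id\<close>, evaluation of Laurent
  polynomials at a unitary.\<close>

definition alg_rep :: "('a::cstar_algebra \<Rightarrow> 'd::cstar_algebra) \<Rightarrow> 'd \<Rightarrow> (int \<Rightarrow> 'a) \<Rightarrow> 'd"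
  where "alg_rep \<iota> V f = (\<Sum>n | f n \<noteq> 0. \<iota> (f n) * upow V n)"

lemma sum_support_superset:
  assumes "finite F" "{n. f n \<noteq> 0} \<subseteq> F" "\<And>n. f n = 0 \<Longrightarrow> h n = 0"
  shows "(\<Sum>n | f n \<noteq> 0. h n) = (\<Sum>n\<in>F. h n)"
  by (rule sum.mono_neutral_left) (use assms in auto)

text \<open>Substitution \<open>n = m + k\<close>. The outer sum runs over the sumset of the
  supports: this is finite and contains every index at which the convolution can be nonzero.\<close>

lemma sum_convolution:
  fixes h :: "int \<Rightarrow> int \<Rightarrow> 'a::comm_monoid_add"
  assumes M: "finite M" and N: "finite N" and h: "\<And>m k. k \<notin> N \<Longrightarrow> h m k = 0"
  shows "(\<Sum>n\<in>(\<lambda>(m, k). m + k) ` (M \<times> N). \<Sum>m\<in>M. h m (n - m)) = (\<Sum>m\<in>M. \<Sum>k\<in>N. h m k)"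
proof -
  let ?K = "(\<lambda>(m, k). m + k) ` (M \<times> N)"
  have "(\<Sum>n\<in>?K. h m (n - m)) = (\<Sum>k\<in>N. h m k)" if m: "m \<in> M" for m
  proof -
    have "(\<Sum>n\<in>?K. h m (n - m)) = (\<Sum>n\<in>(+) m ` N. h m (n - m))"
    proof (rule sum.mono_neutral_right)
      show "\<forall>i\<in>?K - (+) m ` N. h m (i - m) = 0"
      proof
        fix i assume "i \<in> ?K - (+) m ` N"
        then have "i - m \<notin> N" by (auto simp: image_iff)
        then show "h m (i - m) = 0" by (rule h)
      qed
    qed (use M N m in auto)
    also have "\<dots> = (\<Sum>k\<in>N. h m k)" by (subst sum.reindex) auto
    finally show ?thesis .
  qed
  then show ?thesis by (subst sum.swap) simp
qed

definition alg_single :: "int \<Rightarrow> 'a::zero \<Rightarrow> int \<Rightarrow> 'a"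
  where "alg_single m a = (\<lambda>n. if n = m then a else 0)"

lemma alg_elem_single: "alg_elem (alg_single m a)"
  unfolding alg_elem_def alg_single_def by (rule finite_subset[of _ "{m}"]) auto

lemma alg_elem_add: "alg_elem f \<Longrightarrow> alg_elem g \<Longrightarrow> alg_elem (\<lambda>n. f n + g n)"
  unfolding alg_elem_def by (rule finite_subset[of _ "{n. f n \<noteq> 0} \<union> {n. g n \<noteq> 0}"]) auto

lemma alg_elem_scaleC: "alg_elem f \<Longrightarrow> alg_elem (\<lambda>n. c *\<^sub>C f n)"
  unfolding alg_elem_def by (rule finite_subset[of _ "{n. f n \<noteq> 0}"]) auto

locale star_aut =
  fixes \<alpha> :: "'a::cstar_algebra \<Rightarrow> 'a"
  assumes aut: "star_automorphism \<alpha>"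
begin

lemmas zhom = unital_star_homD[OF unital_star_hom_zpow[OF aut]]

lemma alg_mult_supp:
  assumes "alg_elem f" "alg_elem g"
  shows "{n. alg_mult \<alpha> f g n \<noteq> 0} \<subseteq> (\<lambda>(m, k). m + k) ` ({n. f n \<noteq> 0} \<times> {n. g n \<noteq> 0})"
proof
  fix n assume "n \<in> {n. alg_mult \<alpha> f g n \<noteq> 0}"
  then have "(\<Sum>m | f m \<noteq> 0. f m * zpow \<alpha> m (g (n - m))) \<noteq> 0" by (simp add: alg_mult_def)
  then obtain m where "f m * zpow \<alpha> m (g (n - m)) \<noteq> 0"
    by (rule sum.not_neutral_contains_not_neutral)
  then have "f m \<noteq> 0" "g (n - m) \<noteq> 0" by (auto simp: zhom(6))
  then show "n \<in> (\<lambda>(m, k). m + k) ` ({n. f n \<noteq> 0} \<times> {n. g n \<noteq> 0})"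
    by (intro image_eqI[of _ _ "(m, n - m)"]) auto
qed

lemma alg_elem_mult: "alg_elem f \<Longrightarrow> alg_elem g \<Longrightarrow> alg_elem (alg_mult \<alpha> f g)"
  unfolding alg_elem_def[of "alg_mult \<alpha> f g"]
  by (rule finite_subset[OF alg_mult_supp]) (auto simp: alg_elem_def)

lemma alg_star_supp: "{n. alg_star \<alpha> f n \<noteq> 0} \<subseteq> uminus ` {n. f n \<noteq> 0}"
proof
  fix n assume "n \<in> {n. alg_star \<alpha> f n \<noteq> 0}"
  then have "f (- n) \<noteq> 0" by (auto simp: alg_star_def zhom(6))
  then show "n \<in> uminus ` {n. f n \<noteq> 0}" by (intro image_eqI[of _ _ "- n"]) auto
qed

lemma alg_elem_star: "alg_elem f \<Longrightarrow> alg_elem (alg_star \<alpha> f)"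
  unfolding alg_elem_def[of "alg_star \<alpha> f"]
  by (rule finite_subset[OF alg_star_supp]) (auto simp: alg_elem_def)

end

locale covariant = star_aut \<alpha> for \<alpha> :: "'a::cstar_algebra \<Rightarrow> 'a" +
  fixes \<iota> :: "'a \<Rightarrow> 'd::cstar_algebra" and V :: 'd
  assumes cov: "covariant_pair \<alpha> \<iota> V"
begin

lemma uV: "unitary V" and hom: "unital_star_hom \<iota>"
  using cov by (auto simp: covariant_pair_def)

lemmas I = unital_star_homD[OF hom]

lemma upow_commute: "upow V n * \<iota> a = \<iota> (zpow \<alpha> n a) * upow V n"
proof -
  have one: "V * \<iota> a = \<iota> (\<alpha> a) * V" for a
    using cov uV unfolding covariant_pair_def unitary_def by (metis mult.assoc mult.right_neutral)
  note bij = star_automorphism_bij[OF aut]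
  show ?thesis
  proof (induction n arbitrary: a rule: int_induct[where k = 0])
    case (step1 i)
    have "upow V (i + 1) * \<iota> a = V * (upow V i * \<iota> a)" by (simp add: upow_Suc[OF uV] mult.assoc)
    also have "\<dots> = \<iota> (zpow \<alpha> (i + 1) a) * upow V (i + 1)"
      by (simp add: step1 upow_Suc[OF uV] one zpow_Suc[OF bij] mult.assoc[symmetric])
    finally show ?case .
  next
    case (step2 i)
    have u: "V * upow V (i - 1) = upow V i" and z: "\<alpha> (zpow \<alpha> (i - 1) a) = zpow \<alpha> i a"
      using upow_Suc[OF uV, of "i - 1"] zpow_Suc[OF bij, of "i - 1" a] by simp_all
    have "V * (upow V (i - 1) * \<iota> a) = upow V i * \<iota> a" by (simp add: u mult.assoc[symmetric])
    also have "\<dots> = V * (\<iota> (zpow \<alpha> (i - 1) a) * upow V (i - 1))"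
      using step2 by (simp add: one z mult.assoc[symmetric]) (simp add: mult.assoc u)
    finally show ?case using unitary_cancel[OF uV] by blast
  qed simp
qed

lemma rep_superset: "finite F \<Longrightarrow> {n. f n \<noteq> 0} \<subseteq> F \<Longrightarrow> alg_rep \<iota> V f = (\<Sum>n\<in>F. \<iota> (f n) * upow V n)"
  unfolding alg_rep_def by (rule sum_support_superset) (auto simp: I(6))

lemma rep_single: "alg_rep \<iota> V (alg_single m a) = \<iota> a * upow V m"
  by (subst rep_superset[of "{m}"]) (auto simp: alg_single_def)

lemma rep_add:
  assumes "alg_elem f" "alg_elem g"
  shows "alg_rep \<iota> V (\<lambda>n. f n + g n) = alg_rep \<iota> V f + alg_rep \<iota> V g"
proof -
  define F where "F = {n. f n \<noteq> 0} \<union> {n. g n \<noteq> 0}"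
  have F: "finite F" "{n. f n \<noteq> 0} \<subseteq> F" "{n. g n \<noteq> 0} \<subseteq> F" "{n. f n + g n \<noteq> 0} \<subseteq> F"
    using assms by (auto simp: F_def alg_elem_def)
  show ?thesis
    by (simp add: rep_superset[OF F(1,2)] rep_superset[OF F(1,3)] rep_superset[OF F(1,4)] I(1)
        distrib_right sum.distrib)
qed

lemma rep_scaleC:
  assumes "alg_elem f"
  shows "alg_rep \<iota> V (\<lambda>n. c *\<^sub>C f n) = c *\<^sub>C alg_rep \<iota> V f"
proof -
  have F: "finite {n. f n \<noteq> 0}" "{n. c *\<^sub>C f n \<noteq> 0} \<subseteq> {n. f n \<noteq> 0}" using assms by (auto simp: alg_elem_def)
  show ?thesis
    by (simp add: rep_superset[OF F(1,2)] rep_superset[OF F(1) subset_refl] I(2) mult_scaleC_left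
        scaleC_sum_right)
qed

lemma rep_mult:
  assumes f: "alg_elem f" and g: "alg_elem g"
  shows "alg_rep \<iota> V (alg_mult \<alpha> f g) = alg_rep \<iota> V f * alg_rep \<iota> V g"
proof -
  define M N where "M = {n. f n \<noteq> 0}" and "N = {n. g n \<noteq> 0}"
  define K where "K = (\<lambda>(m, k). m + k) ` (M \<times> N)"
  have fin: "finite M" "finite N" "finite K" using f g by (auto simp: M_def N_def K_def alg_elem_def)
  have "alg_rep \<iota> V (alg_mult \<alpha> f g) = (\<Sum>n\<in>K. \<iota> (alg_mult \<alpha> f g n) * upow V n)"
    using alg_mult_supp[OF f g] by (intro rep_superset fin) (simp add: K_def M_def N_def)
  also have "\<dots> = (\<Sum>n\<in>K. \<Sum>m\<in>M. \<iota> (f m) * \<iota> (zpow \<alpha> m (g (n - m))) * upow V n)"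
    unfolding alg_mult_def M_def[symmetric]
    by (simp add: linear_sum[OF Real_Vector_Spaces.linearI[OF I(1) I(8)]] I(4) sum_distrib_right)
  also have "\<dots> = (\<Sum>n\<in>K. \<Sum>m\<in>M. \<iota> (f m) * \<iota> (zpow \<alpha> m (g (n - m))) * upow V (m + (n - m)))"
    by simp
  also have "\<dots> = (\<Sum>m\<in>M. \<Sum>k\<in>N. \<iota> (f m) * \<iota> (zpow \<alpha> m (g k)) * upow V (m + k))"
    unfolding K_def by (rule sum_convolution[OF fin(1,2)]) (simp add: N_def zhom(6) I(6))
  also have "\<dots> = (\<Sum>m\<in>M. \<Sum>k\<in>N. (\<iota> (f m) * upow V m) * (\<iota> (g k) * upow V k))"
  proof (intro sum.cong refl)
    fix m k
    have "(\<iota> (f m) * upow V m) * (\<iota> (g k) * upow V k) = \<iota> (f m) * (upow V m * \<iota> (g k)) * upow V k"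
      by (simp add: mult.assoc)
    also have "\<dots> = \<iota> (f m) * \<iota> (zpow \<alpha> m (g k)) * upow V (m + k)"
      unfolding upow_commute upow_add[OF uV] by (simp add: mult.assoc)
    finally show "\<iota> (f m) * \<iota> (zpow \<alpha> m (g k)) * upow V (m + k) =
        (\<iota> (f m) * upow V m) * (\<iota> (g k) * upow V k)" ..
  qed
  also have "\<dots> = alg_rep \<iota> V f * alg_rep \<iota> V g"
    by (simp add: alg_rep_def sum_product M_def N_def)
  finally show ?thesis .
qed

lemma rep_star:
  assumes f: "alg_elem f"
  shows "alg_rep \<iota> V (alg_star \<alpha> f) = star (alg_rep \<iota> V f)"
proof -
  have fin: "finite (uminus ` {n. f n \<noteq> 0})" using f by (simp add: alg_elem_def)
  have "alg_rep \<iota> V (alg_star \<alpha> f) = (\<Sum>n\<in>uminus ` {n. f n \<noteq> 0}. \<iota> (alg_star \<alpha> f n) * upow V n)"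
    by (intro rep_superset fin alg_star_supp)
  also have "\<dots> = (\<Sum>n | f n \<noteq> 0. \<iota> (zpow \<alpha> (- n) (star (f n))) * upow V (- n))"
    by (subst sum.reindex) (auto simp: alg_star_def)
  also have "\<dots> = (\<Sum>n | f n \<noteq> 0. star (\<iota> (f n) * upow V n))"
    by (intro sum.cong refl) (simp add: upow_commute[symmetric] star_mult I(5) upow_star[OF uV])
  finally show ?thesis by (simp add: alg_rep_def star_sum)
qed

text \<open>This makes the maximality of the universal norm applicable to an arbitrary covariant
  pair, and so yields homomorphisms out of the crossed product.\<close>

lemma rep_seminorm: "alg_cstar_seminorm \<alpha> (\<lambda>f. norm (alg_rep \<iota> V f))"
  unfolding alg_cstar_seminorm_def
  by (simp add: rep_add rep_mult rep_scaleC rep_star alg_elem_star norm_triangle_ineq norm_mult_ineq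
      norm_scaleC norm_star_mult_self)

end

section \<open>Extension from the algebraic crossed product by density\<close>

lemma closure_cstar_subalgebra:
  fixes D :: "'b::cstar_algebra set"
  assumes one: "1 \<in> D" and add: "\<And>x y. x \<in> D \<Longrightarrow> y \<in> D \<Longrightarrow> x + y \<in> D"
    and mult: "\<And>x y. x \<in> D \<Longrightarrow> y \<in> D \<Longrightarrow> x * y \<in> D"
    and scale: "\<And>c x. x \<in> D \<Longrightarrow> c *\<^sub>C x \<in> D" and st: "\<And>x. x \<in> D \<Longrightarrow> star x \<in> D"
  shows "cstar_subalgebra (closure D)"
proof -
  have "1 \<in> closure D" using one closure_subset by blast
  moreover have "x + y \<in> closure D" "x * y \<in> closure D" if xy: "x \<in> closure D" "y \<in> closure D" for x y
  proof -
    obtain a where a: "\<And>n. a n \<in> D" "a \<longlonglongrightarrow> x"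
      using xy(1) unfolding closure_sequential by blast
    obtain b where b: "\<And>n. b n \<in> D" "b \<longlonglongrightarrow> y"
      using xy(2) unfolding closure_sequential by blast
    show "x + y \<in> closure D" unfolding closure_sequential
      by (intro exI[of _ "\<lambda>n. a n + b n"]) (auto intro: a b tendsto_add add)
    show "x * y \<in> closure D" unfolding closure_sequential
      by (intro exI[of _ "\<lambda>n. a n * b n"]) (auto intro: a b tendsto_mult mult)
  qed
  moreover have "c *\<^sub>C x \<in> closure D" "star x \<in> closure D" if "x \<in> closure D" for x c
  proof -
    obtain a where a: "\<And>n. a n \<in> D" "a \<longlonglongrightarrow> x" using \<open>x \<in> closure D\<close> unfolding closure_sequential by blast
    show "c *\<^sub>C x \<in> closure D" unfolding closure_sequential
      by (intro exI[of _ "\<lambda>n. c *\<^sub>C a n"]) (auto intro: a bounded_linear.tendsto[OF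
          bounded_linear_scaleC] scale)
    show "star x \<in> closure D" unfolding closure_sequential
      by (intro exI[of _ "\<lambda>n. star (a n)"]) (auto intro: a bounded_linear.tendsto[OF
          bounded_linear_star] st)
  qed
  ultimately show ?thesis by (auto simp: cstar_subalgebra_def)
qed

lemma cstar_gen_subset: "S \<subseteq> B \<Longrightarrow> cstar_subalgebra B \<Longrightarrow> cstar_gen S \<subseteq> B"
  by (auto simp: cstar_gen_def)

lemma cstar_subalgebra_gen: "cstar_subalgebra (cstar_gen S)"
  unfolding cstar_gen_def by (auto simp: cstar_subalgebra_def intro!: closed_Inter)

lemma cstar_gen_superset: "S \<subseteq> cstar_gen S"
  by (auto simp: cstar_gen_def)

lemma clinearD:
  assumes "clinear f"
  shows "f (x + y) = f x + f y" "f (c *\<^sub>C x) = c *\<^sub>C f x" "f 0 = 0" "f (x - y) = f x - f y"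
proof -
  show *: "f (x + y) = f x + f y" "f (c *\<^sub>C x) = c *\<^sub>C f x" for x y c
    using assms by (auto simp: clinear_def)
  show "f 0 = 0" by (metis *(2) scaleC_zero_left)
  show "f (x - y) = f x - f y" using *(1)[of "x - y" y] by simp
qed

lemma clinear_bounded_linear:
  assumes "clinear f" "\<And>x. norm (f x) \<le> norm x"
  shows "bounded_linear f"
proof (rule bounded_linear_intro[where K = 1])
  show "f (x + y) = f x + f y" for x y using assms(1) by (rule clinearD)
  show "f (r *\<^sub>R x) = r *\<^sub>R f x" for r x using clinearD(2)[OF assms(1), of "complex_of_real r" x]
      by (simp add: scaleC_of_real)
  show "norm (f x) \<le> norm x * 1" for x using assms(2) by simp
qed

text \<open>The map is given by its graph because a dense element may come from several algebraic
  ones: the norm estimate yields single-valuedness together with the extension.\<close>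

lemma contractive_graph_extension:
  fixes R :: "('b::cstar_algebra \<times> 'y::cstar_algebra) set"
  assumes add: "\<And>x y x' y'. (x, y) \<in> R \<Longrightarrow> (x', y') \<in> R \<Longrightarrow> (x + x', y + y') \<in> R"
    and scale: "\<And>c x y. (x, y) \<in> R \<Longrightarrow> (c *\<^sub>C x, c *\<^sub>C y) \<in> R"
    and le: "\<And>x y. (x, y) \<in> R \<Longrightarrow> norm y \<le> norm x"
    and dense: "closure (fst ` R) = UNIV"
  obtains T where "clinear T" "\<And>x. norm (T x) \<le> norm x" "\<And>x y. (x, y) \<in> R \<Longrightarrow> T x = y"
proof -
  \<comment> \<open>The extension is the closed graph. Linearity and the estimate pass to limits of
    sequences, and completeness of the target makes the relation total.\<close>
  define Q where "Q = closure R"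
  have seq: "(x, y) \<in> Q \<longleftrightarrow> (\<exists>a b. (\<forall>n. (a n, b n) \<in> R) \<and> a \<longlonglongrightarrow> x \<and> b \<longlonglongrightarrow> y)" for x y
  proof
    assume "(x, y) \<in> Q"
    then obtain c where c: "\<And>n. c n \<in> R" "c \<longlonglongrightarrow> (x, y)" unfolding Q_def closure_sequential by blast
    show "\<exists>a b. (\<forall>n. (a n, b n) \<in> R) \<and> a \<longlonglongrightarrow> x \<and> b \<longlonglongrightarrow> y"
      using c tendsto_fst[OF c(2)] tendsto_snd[OF c(2)]
      by (intro exI[of _ "\<lambda>n. fst (c n)"] exI[of _ "\<lambda>n. snd (c n)"]) auto
  next
    assume "\<exists>a b. (\<forall>n. (a n, b n) \<in> R) \<and> a \<longlonglongrightarrow> x \<and> b \<longlonglongrightarrow> y"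
    then obtain a b where "\<And>n. (a n, b n) \<in> R" "a \<longlonglongrightarrow> x" "b \<longlonglongrightarrow> y" by blast
    then show "(x, y) \<in> Q" unfolding Q_def closure_sequential
      by (intro exI[of _ "\<lambda>n. (a n, b n)"]) (auto intro: tendsto_Pair)
  qed
  have Qadd: "(x + x', y + y') \<in> Q" if "(x, y) \<in> Q" "(x', y') \<in> Q" for x y x' y'
  proof -
    obtain a b a' b' where "\<And>n. (a n, b n) \<in> R" "a \<longlonglongrightarrow> x" "b \<longlonglongrightarrow> y"
      "\<And>n. (a' n, b' n) \<in> R" "a' \<longlonglongrightarrow> x'" "b' \<longlonglongrightarrow> y'"
      using \<open>(x, y) \<in> Q\<close> \<open>(x', y') \<in> Q\<close> unfolding seq by blast
    then show ?thesis unfolding seq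
      by (intro exI[of _ "\<lambda>n. a n + a' n"] exI[of _ "\<lambda>n. b n + b' n"]) (auto intro: tendsto_add add)
  qed
  have Qscale: "(c *\<^sub>C x, c *\<^sub>C y) \<in> Q" if xy: "(x, y) \<in> Q" for c x y
  proof -
    obtain a b where "\<And>n. (a n, b n) \<in> R" "a \<longlonglongrightarrow> x" "b \<longlonglongrightarrow> y"
      using xy unfolding seq by blast
    then show ?thesis unfolding seq
      by (intro exI[of _ "\<lambda>n. c *\<^sub>C a n"] exI[of _ "\<lambda>n. c *\<^sub>C b n"])
        (auto intro: bounded_linear.tendsto[OF bounded_linear_scaleC] scale)
  qed
  have Qle: "norm y \<le> norm x" if xy: "(x, y) \<in> Q" for x y
  proof -
    obtain a b where ab: "\<And>n. (a n, b n) \<in> R" "a \<longlonglongrightarrow> x" "b \<longlonglongrightarrow> y"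
      using xy unfolding seq by blast
    show ?thesis
      by (rule LIMSEQ_le[OF tendsto_norm[OF ab(3)] tendsto_norm[OF ab(2)]]) (use le ab(1) in blast)
  qed
  have Qdiff: "(x - x', y - y') \<in> Q" if "(x, y) \<in> Q" "(x', y') \<in> Q" for x y x' y'
    using Qadd[OF that(1) Qscale[OF that(2), of "-1"]] by (simp add: scaleC_minus_one)
  have ex: "\<exists>y. (x, y) \<in> Q" for x
  proof -
    have "x \<in> closure (fst ` R)" using dense by simp
    then obtain a where a: "\<And>n. a n \<in> fst ` R" "a \<longlonglongrightarrow> x" unfolding closure_sequential by blast
    have "\<exists>b. \<forall>n. (a n, b n) \<in> R" using a(1) by (intro choice) force
    then obtain b where b: "\<And>n. (a n, b n) \<in> R" by blast
    have "Cauchy b"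
    proof (rule metric_CauchyI)
      fix e :: real assume "0 < e"
      obtain M where M: "\<And>m n. m \<ge> M \<Longrightarrow> n \<ge> M \<Longrightarrow> dist (a m) (a n) < e"
        using LIMSEQ_imp_Cauchy[OF a(2)] \<open>0 < e\<close> unfolding Cauchy_def by meson
      have "dist (b m) (b n) \<le> dist (a m) (a n)" for m n
      proof -
        have "(a m + (-1) *\<^sub>C a n, b m + (-1) *\<^sub>C b n) \<in> R" by (intro add scale b)
        from le[OF this] show ?thesis by (simp add: dist_norm scaleC_minus_one)
      qed
      then show "\<exists>M. \<forall>m\<ge>M. \<forall>n\<ge>M. dist (b m) (b n) < e" using M by (meson le_less_trans)
    qed
    then obtain y where "b \<longlonglongrightarrow> y" using Cauchy_convergent convergent_def by blast
    then show ?thesis unfolding seq using a(2) b by blast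
  qed
  have uniq: "y = y'" if "(x, y) \<in> Q" "(x, y') \<in> Q" for x y y'
    using Qle[OF Qdiff[OF that]] by simp
  define T where "T x = (THE y. (x, y) \<in> Q)" for x
  have T: "T x = y \<longleftrightarrow> (x, y) \<in> Q" for x y
    unfolding T_def using ex[of x] uniq by (metis (mono_tags, lifting) the_equality)
  have TQ: "(x, T x) \<in> Q" for x using T by blast
  show ?thesis
  proof
    show "clinear T" unfolding clinear_def using T TQ Qadd Qscale by blast
    show "norm (T x) \<le> norm x" for x using Qle TQ by blast
    show "T x = y" if "(x, y) \<in> R" for x y
      unfolding T Q_def using that closure_subset by blast
  qed
qed

lemma eq_on_closure:
  fixes f g :: "'b::metric_space \<Rightarrow> 'c::metric_space"
  assumes f: "continuous_on (closure D) f" and g: "continuous_on (closure D) g"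
    and eq: "\<And>x. x \<in> D \<Longrightarrow> f x = g x" and x: "x \<in> closure D"
  shows "f x = g x"
proof -
  obtain a where a: "\<And>n. a n \<in> D" "a \<longlonglongrightarrow> x" using x unfolding closure_sequential by blast
  have cl: "\<And>n. a n \<in> closure D" using a(1) closure_subset by blast
  have "(\<lambda>n. f (a n)) \<longlonglongrightarrow> f x" "(\<lambda>n. g (a n)) \<longlonglongrightarrow> g x"
    using f g a(2) cl x unfolding continuous_on_sequentially comp_def by blast+
  then show ?thesis using eq[OF a(1)] LIMSEQ_unique by auto
qed

locale crossed_product = star_aut \<alpha> for \<alpha> :: "'a::cstar_algebra \<Rightarrow> 'a" +
  fixes \<iota> :: "'a \<Rightarrow> 'c::cstar_algebra" and V :: 'c
  assumes cp: "is_crossed_product \<alpha> \<iota> V"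
begin

sublocale covariant \<alpha> \<iota> V
  by unfold_locales (use cp in \<open>auto simp: is_crossed_product_def covariant_pair_def\<close>)

abbreviation "J \<equiv> alg_rep \<iota> V"

lemma universal_seminorm: "alg_cstar_seminorm \<alpha> p \<Longrightarrow> alg_elem f \<Longrightarrow> p f \<le> norm (J f)"
  using cp by (simp add: is_crossed_product_def alg_rep_def)

text \<open>Finite sums of \<open>a V^n\<close> form a unital algebra closed under adjoints, because
  \<open>V\<close> normalises the coefficients. Its closure is a C*-subalgebra that contains the
  generators.\<close>

lemma dense: "closure (J ` Collect alg_elem) = UNIV"
proof -
  have "cstar_subalgebra (closure (J ` Collect alg_elem))"
  proof (rule closure_cstar_subalgebra)
    show "1 \<in> J ` Collect alg_elem"
      by (rule image_eqI[of _ _ "alg_single 0 1"]) (simp_all add: rep_single alg_elem_single I(3))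
  next
    fix x y assume "x \<in> J ` Collect alg_elem" "y \<in> J ` Collect alg_elem"
    then obtain f g where "alg_elem f" "x = J f" "alg_elem g" "y = J g" by blast
    then show "x + y \<in> J ` Collect alg_elem" "x * y \<in> J ` Collect alg_elem"
      using imageI[of "\<lambda>n. f n + g n" "Collect alg_elem" J] imageI[of "alg_mult \<alpha> f g" "Collect alg_elem" J]
      by (simp_all add: rep_add alg_elem_add rep_mult alg_elem_mult)
  next
    fix x c assume "x \<in> J ` Collect alg_elem"
    then obtain f where "alg_elem f" "x = J f" by blast
    then show "c *\<^sub>C x \<in> J ` Collect alg_elem" "star x \<in> J ` Collect alg_elem"
      using imageI[of "\<lambda>n. c *\<^sub>C f n" "Collect alg_elem" J] imageI[of "alg_star \<alpha> f" "Collect alg_elem" J]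
      by (simp_all add: rep_scaleC alg_elem_scaleC rep_star alg_elem_star)
  qed
  moreover have "range \<iota> \<union> {V} \<subseteq> closure (J ` Collect alg_elem)"
  proof -
    have "\<iota> a \<in> closure (J ` Collect alg_elem)" for a
      by (rule subsetD[OF closure_subset], rule image_eqI[of _ _ "alg_single 0 a"]) (simp_all add:
          rep_single alg_elem_single)
    moreover have "V \<in> closure (J ` Collect alg_elem)"
      by (rule subsetD[OF closure_subset], rule image_eqI[of _ _ "alg_single 1 1"]) (simp_all add:
          rep_single alg_elem_single I(3))
    ultimately show ?thesis by blast
  qed
  ultimately have "cstar_gen (range \<iota> \<union> {V}) \<subseteq> closure (J ` Collect alg_elem)" by (intro cstar_gen_subset)
  then show ?thesis using cp by (auto simp: is_crossed_product_def)
qed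

lemma contractive_extension:
  fixes T0 :: "(int \<Rightarrow> 'a) \<Rightarrow> 'y::cstar_algebra"
  assumes "\<And>f g. alg_elem f \<Longrightarrow> alg_elem g \<Longrightarrow> T0 (\<lambda>n. f n + g n) = T0 f + T0 g"
    and "\<And>c f. alg_elem f \<Longrightarrow> T0 (\<lambda>n. c *\<^sub>C f n) = c *\<^sub>C T0 f"
    and "\<And>f. alg_elem f \<Longrightarrow> norm (T0 f) \<le> norm (J f)"
  shows "\<exists>T. clinear T \<and> (\<forall>x. norm (T x) \<le> norm x) \<and> (\<forall>f. alg_elem f \<longrightarrow> T (J f) = T0 f)"
proof -
  define R where "R = {(J f, T0 f) | f. alg_elem f}"
  have "fst ` R = J ` Collect alg_elem" by (force simp: R_def)
  moreover have "(x + x', y + y') \<in> R" if "(x, y) \<in> R" "(x', y') \<in> R" for x y x' y'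
  proof -
    obtain f g where "alg_elem f" "alg_elem g" "x = J f" "y = T0 f" "x' = J g" "y' = T0 g"
      using \<open>(x, y) \<in> R\<close> \<open>(x', y') \<in> R\<close> unfolding R_def by blast
    then show ?thesis
      unfolding R_def by (auto simp: rep_add assms(1) intro!: exI[of _ "\<lambda>n. f n + g n"] alg_elem_add)
  qed
  moreover have "(c *\<^sub>C x, c *\<^sub>C y) \<in> R" if "(x, y) \<in> R" for c x y
  proof -
    obtain f where "alg_elem f" "x = J f" "y = T0 f" using \<open>(x, y) \<in> R\<close> unfolding R_def by blast
    then show ?thesis
      unfolding R_def by (auto simp: rep_scaleC assms(2) intro!: exI[of _ "\<lambda>n. c *\<^sub>C f n"] alg_elem_scaleC)
  qed
  moreover have "norm y \<le> norm x" if "(x, y) \<in> R" for x y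
    using that assms(3) unfolding R_def by blast
  ultimately obtain T where "clinear T" "\<And>x. norm (T x) \<le> norm x" "\<And>x y. (x, y) \<in> R \<Longrightarrow> T x = y"
    using contractive_graph_extension[of R] dense by metis
  then show ?thesis unfolding R_def by blast
qed

lemma continuous_eq_on_generators:
  fixes f g :: "'c \<Rightarrow> 'y::metric_space"
  assumes "continuous_on UNIV f" "continuous_on UNIV g" "\<And>h. alg_elem h \<Longrightarrow> f (J h) = g (J h)"
  shows "f = g"
proof
  fix x
  show "f x = g x"
    by (rule eq_on_closure[where D = "J ` Collect alg_elem"]) (use assms dense in auto)
qed

lemma clinear_rep:
  assumes "clinear T" "alg_elem h"
  shows "T (J h) = (\<Sum>n | h n \<noteq> 0. T (\<iota> (h n) * upow V n))"
proof -
  have "T (\<Sum>n\<in>F. k n) = (\<Sum>n\<in>F. T (k n))" if "finite F" for F :: "int set" and k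
    using that by (induction F) (auto simp: clinearD[OF assms(1)])
  then show ?thesis using assms(2) by (simp add: alg_rep_def alg_elem_def)
qed

lemma bounded_clinear_eqI:
  fixes S T :: "'c \<Rightarrow> 'y::cstar_algebra"
  assumes "clinear S" "clinear T" "bounded_linear S" "bounded_linear T"
    and "\<And>a n. S (\<iota> a * upow V n) = T (\<iota> a * upow V n)"
  shows "S = T"
  by (rule continuous_eq_on_generators)
    (auto simp: clinear_rep assms intro: bounded_linear.continuous_on continuous_on_id)

lemma state_clinear: "state_on UNIV \<phi> \<Longrightarrow> clinear \<phi>"
  by (auto simp: clinear_def state_on_def scaleC_complex_def)

lemma state_bounded_linear:
  assumes "state_on UNIV (\<phi> :: 'c \<Rightarrow> complex)"
  shows "bounded_linear \<phi>"
  by (rule clinear_bounded_linear[OF state_clinear[OF assms]]) (simp add: state_on_norm_le[OF _ assms])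

text \<open>The negative powers are determined by the positive ones since a state is hermitian.\<close>

lemma state_eqI:
  assumes S: "state_on UNIV \<phi>" and T: "state_on UNIV \<psi>"
    and eq: "\<And>a k. \<phi> (\<iota> a * V ^ k) = \<psi> (\<iota> a * V ^ k)"
  shows "\<phi> = \<psi>"
proof (rule bounded_clinear_eqI)
  fix a n
  show "\<phi> (\<iota> a * upow V n) = \<psi> (\<iota> a * upow V n)"
  proof (cases "0 \<le> n")
    case True
    then show ?thesis using eq by (simp add: upow_def)
  next
    case False
    then obtain k where k: "n = - int k" by (metis int_cases2 of_nat_0_le_iff)
    have e: "\<iota> a * upow V n = star (\<iota> (zpow \<alpha> (int k) (star a)) * V ^ k)"
      by (simp add: upow_of_nat[symmetric] upow_commute[symmetric] k star_mult upow_star[OF uV] I(5)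
          star_star)
    show ?thesis
      unfolding e state_on_star[OF cstar_subalgebra_UNIV S UNIV_I] state_on_star[OF
          cstar_subalgebra_UNIV T UNIV_I] eq ..
  qed
qed (use S T in \<open>auto intro: state_clinear state_bounded_linear\<close>)

lemma hom_bounded_linear:
  fixes \<Phi> :: "'c \<Rightarrow> 'd::cstar_algebra"
  assumes "unital_star_hom \<Phi>"
  shows "bounded_linear \<Phi>"
  using assms by (intro clinear_bounded_linear unital_star_hom_contractive) (auto simp: unital_star_hom_def)

lemma hom_upow:
  fixes \<Phi> :: "'c \<Rightarrow> 'd::cstar_algebra"
  assumes "unital_star_hom \<Phi>"
  shows "\<Phi> (upow x n) = upow (\<Phi> x) n"
proof -
  note F = unital_star_homD[OF assms]
  have "\<Phi> (y ^ k) = \<Phi> y ^ k" for y k by (induction k) (auto simp: F)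
  then show ?thesis by (simp add: upow_def F)
qed

lemma hom_eqI:
  fixes \<Phi> \<Psi> :: "'c \<Rightarrow> 'd::cstar_algebra"
  assumes P: "unital_star_hom \<Phi>" and Q: "unital_star_hom \<Psi>"
    and "\<And>a. \<Phi> (\<iota> a) = \<Psi> (\<iota> a)" "\<Phi> V = \<Psi> V"
  shows "\<Phi> = \<Psi>"
  by (rule bounded_clinear_eqI)
    (use assms in \<open>auto simp: hom_bounded_linear hom_upow unital_star_homD(4)[OF P]
        unital_star_homD(4)[OF Q] unital_star_hom_def\<close>)

text \<open>Universality dominates the integrated form of the new pair by the universal norm. The
  algebraic identities then spread by density, multiplicativity in one factor at a time.\<close>

lemma hom_extension:
  fixes \<iota>' :: "'a \<Rightarrow> 'd::cstar_algebra"
  assumes c': "covariant_pair \<alpha> \<iota>' V'"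
  obtains \<Phi> where "unital_star_hom \<Phi>" "\<And>a. \<Phi> (\<iota> a) = \<iota>' a" "\<Phi> V = V'"
proof -
  interpret c: covariant \<alpha> \<iota>' V' by unfold_locales (rule c')
  obtain \<Phi> where P: "clinear \<Phi>" "\<And>x. norm (\<Phi> x) \<le> norm x" "\<And>f. alg_elem f \<Longrightarrow> \<Phi> (J f) = alg_rep \<iota>' V' f"
    using contractive_extension[OF c.rep_add c.rep_scaleC universal_seminorm[OF c.rep_seminorm]] by blast
  have bl: "bounded_linear \<Phi>" using P(1,2) by (rule clinear_bounded_linear)
  have cont: "continuous_on UNIV (\<lambda>x. \<Phi> (k x))" if "continuous_on UNIV k" for k :: "'c \<Rightarrow> 'c"
    using bounded_linear.continuous_on[OF bl that] .
  have st: "(\<lambda>x. \<Phi> (star x)) = (\<lambda>x. star (\<Phi> x))"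
    by (rule continuous_eq_on_generators)
      (auto simp: rep_star[symmetric] P(3) alg_elem_star c.rep_star
        intro!: cont bounded_linear.continuous_on[OF bounded_linear_star] continuous_on_id)
  have m1: "(\<lambda>x. \<Phi> (J f * x)) = (\<lambda>x. \<Phi> (J f) * \<Phi> x)" if f: "alg_elem f" for f
    by (rule continuous_eq_on_generators)
      (auto simp: rep_mult[symmetric] P(3) f alg_elem_mult c.rep_mult
        intro!: cont continuous_intros)
  have m2: "(\<lambda>x. \<Phi> (x * y)) = (\<lambda>x. \<Phi> x * \<Phi> y)" for y
  proof (rule continuous_eq_on_generators)
    show "\<Phi> (J h * y) = \<Phi> (J h) * \<Phi> y" if "alg_elem h" for h
      using fun_cong[OF m1[OF that]] .
  qed (auto intro!: cont continuous_intros)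
  have s: "\<Phi> (\<iota> a * upow V n) = \<iota>' a * upow V' n" for a n
    using P(3)[OF alg_elem_single[of n a]] by (simp add: rep_single c.rep_single)
  show ?thesis
  proof
    show i: "\<Phi> (\<iota> a) = \<iota>' a" for a using s[of a 0] by simp
    show "\<Phi> V = V'" using s[of 1 1] by (simp add: I c.I)
    have "\<Phi> 1 = 1" using i[of 1] by (simp add: I c.I)
    then show "unital_star_hom \<Phi>"
      unfolding unital_star_hom_def using P(1) fun_cong[OF st] fun_cong[OF m2] by auto
  qed
qed

end

section \<open>Representations by weighted translations\<close>

lemma apply_bcontfun_sum: "apply_bcontfun (\<Sum>i\<in>I. f i) x = (\<Sum>i\<in>I. apply_bcontfun (f i) x)"
  for f :: "'i \<Rightarrow> ('x::metric_space \<Rightarrow>\<^sub>C complex)"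
  by (induction I rule: infinite_finite_induct) (auto simp: zero_bcontfun.rep_eq plus_bcontfun.rep_eq)

text \<open>Data of a unitary representation on square integrable functions: \<open>V^m\<close> acts
  by \<open>K m * (\<xi> o \<tau> m)\<close> and \<open>a\<close> by multiplication with
  \<open>a o pr\<close>. The conditions \<open>\<tau>_distr\<close> and \<open>K_norm\<close> make
  it isometric, the cocycle identity \<open>K_add\<close> makes it multiplicative, and
  \<open>equivariant\<close> is covariance. A separate space \<open>M\<close> over \<open>X\<close>
  is allowed because induced representations live on several copies of \<open>X\<close>.\<close>

locale koopman = star_aut \<alpha> for \<alpha> :: "('x::metric_space \<Rightarrow>\<^sub>C complex) \<Rightarrow> ('x \<Rightarrow>\<^sub>C complex)" +
  fixes M :: "'m measure" and pr :: "'m \<Rightarrow> 'x" and \<tau> :: "int \<Rightarrow> 'm \<Rightarrow> 'm" and K :: "int \<Rightarrow> 'm \<Rightarrow> complex"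
  assumes fin: "finite_measure M"
    and pr [measurable]: "pr \<in> M \<rightarrow>\<^sub>M borel"
    and \<tau>_meas [measurable]: "\<And>m. \<tau> m \<in> M \<rightarrow>\<^sub>M M" and \<tau>_distr: "\<And>m. distr M M (\<tau> m) = M"
    and K_meas [measurable]: "\<And>m. K m \<in> borel_measurable M"
    and K_norm: "\<And>m y. y \<in> space M \<Longrightarrow> cmod (K m y) = 1"
    and \<tau>_0: "\<And>y. y \<in> space M \<Longrightarrow> \<tau> 0 y = y"
    and \<tau>_add: "\<And>m k y. y \<in> space M \<Longrightarrow> \<tau> (m + k) y = \<tau> k (\<tau> m y)"
    and K_0: "\<And>y. y \<in> space M \<Longrightarrow> K 0 y = 1"
    and K_add: "\<And>m k y. y \<in> space M \<Longrightarrow> K (m + k) y = K m y * K k (\<tau> m y)"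
    and equivariant: "\<And>m a y. y \<in> space M \<Longrightarrow>
      apply_bcontfun (zpow \<alpha> m a) (pr y) = apply_bcontfun a (pr (\<tau> m y))"
begin

interpretation finite_measure M by (rule fin)

text \<open>Bounded functions instead of square integrable ones: they are stable under all
  operations used and always integrable. Null functions are kept, so \<open>N\<close> below is only
  a seminorm.\<close>

definition H :: "('m \<Rightarrow> complex) set"
  where "H = {\<xi> \<in> borel_measurable M. \<exists>C. \<forall>y\<in>space M. cmod (\<xi> y) \<le> C}"

definition ip :: "('m \<Rightarrow> complex) \<Rightarrow> ('m \<Rightarrow> complex) \<Rightarrow> complex"
  where "ip \<xi> \<eta> = (LINT y|M. cnj (\<xi> y) * \<eta> y)"

definition N :: "('m \<Rightarrow> complex) \<Rightarrow> real"
  where "N \<xi> = sqrt (LINT y|M. (cmod (\<xi> y))\<^sup>2)"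

definition act :: "(int \<Rightarrow> ('x \<Rightarrow>\<^sub>C complex)) \<Rightarrow> ('m \<Rightarrow> complex) \<Rightarrow> 'm \<Rightarrow> complex"
  where "act f \<xi> y = (\<Sum>m | f m \<noteq> 0. apply_bcontfun (f m) (pr y) * (K m y * \<xi> (\<tau> m y)))"

lemma \<tau>_space: "y \<in> space M \<Longrightarrow> \<tau> m y \<in> space M"
  by (rule measurable_space[OF \<tau>_meas])

lemma bcontfun_measurable [measurable]: "apply_bcontfun (a :: 'x \<Rightarrow>\<^sub>C complex) \<in> borel_measurable borel"
  by (intro borel_measurable_continuous_onI continuous_on_apply_bcontfun)

lemma H_measurable: "\<xi> \<in> H \<Longrightarrow> \<xi> \<in> borel_measurable M"
  by (simp add: H_def)

lemma H_add: "\<xi> \<in> H \<Longrightarrow> \<eta> \<in> H \<Longrightarrow> (\<lambda>y. \<xi> y + \<eta> y) \<in> H"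
proof -
  assume a: "\<xi> \<in> H" "\<eta> \<in> H"
  obtain A B where "\<And>y. y \<in> space M \<Longrightarrow> cmod (\<xi> y) \<le> A" "\<And>y. y \<in> space M \<Longrightarrow> cmod (\<eta> y) \<le> B"
    using a unfolding H_def by blast
  then have "cmod (\<xi> y + \<eta> y) \<le> A + B" if "y \<in> space M" for y
    using that by (meson add_mono norm_triangle_le)
  then show ?thesis using a unfolding H_def by auto
qed

lemma H_mult: "\<xi> \<in> H \<Longrightarrow> \<eta> \<in> H \<Longrightarrow> (\<lambda>y. \<xi> y * \<eta> y) \<in> H"
proof -
  assume a: "\<xi> \<in> H" "\<eta> \<in> H"
  obtain A B where "\<And>y. y \<in> space M \<Longrightarrow> cmod (\<xi> y) \<le> A" "\<And>y. y \<in> space M \<Longrightarrow> cmod (\<eta> y) \<le> B"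
    using a unfolding H_def by blast
  then have "cmod (\<xi> y * \<eta> y) \<le> \<bar>A\<bar> * \<bar>B\<bar>" if "y \<in> space M" for y
    unfolding norm_mult using that by (intro mult_mono) force+
  then show ?thesis using a unfolding H_def by auto
qed

lemma H_const: "(\<lambda>y. c) \<in> H"
  by (auto simp: H_def)

lemma H_sum: "(\<And>i. i \<in> I \<Longrightarrow> f i \<in> H) \<Longrightarrow> (\<lambda>y. \<Sum>i\<in>I. f i y) \<in> H"
  by (induction I rule: infinite_finite_induct) (auto intro: H_const H_add)

lemma H_fun: "(\<lambda>y. apply_bcontfun a (pr y)) \<in> H"
  unfolding H_def by (auto intro!: exI[of _ "norm a"] norm_bounded)

lemma H_K: "K m \<in> H"
  unfolding H_def using K_norm by (auto intro!: exI[of _ 1])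

lemma H_\<tau>: "\<xi> \<in> H \<Longrightarrow> (\<lambda>y. \<xi> (\<tau> m y)) \<in> H"
  unfolding H_def using \<tau>_space by auto

lemma H_cnj: "\<xi> \<in> H \<Longrightarrow> (\<lambda>y. cnj (\<xi> y)) \<in> H"
  unfolding H_def by (auto intro!: borel_measurable_continuous_on[of cnj] continuous_intros)

lemma H_act: "\<xi> \<in> H \<Longrightarrow> act f \<xi> \<in> H"
  unfolding act_def by (intro H_sum H_mult H_fun H_K H_\<tau>)

lemma H_integrable: "\<xi> \<in> H \<Longrightarrow> integrable M \<xi>"
  unfolding H_def by (auto intro!: integrable_const_bound)

lemma H_square_integrable: "\<xi> \<in> H \<Longrightarrow> integrable M (\<lambda>y. (cmod (\<xi> y))\<^sup>2)"
  using integrable_norm[OF H_integrable[OF H_mult[of \<xi> \<xi>]]] by (simp add: norm_mult power2_eq_square)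

lemma ip_integrable: "\<xi> \<in> H \<Longrightarrow> \<eta> \<in> H \<Longrightarrow> integrable M (\<lambda>y. cnj (\<xi> y) * \<eta> y)"
  by (intro H_integrable H_mult H_cnj)

lemma N_nonneg: "0 \<le> N \<xi>"
  by (simp add: N_def)

lemma N_cong: "(\<And>y. y \<in> space M \<Longrightarrow> \<xi> y = \<eta> y) \<Longrightarrow> N \<xi> = N \<eta>"
  unfolding N_def by (metis (mono_tags, lifting) Bochner_Integration.integral_cong)

lemma ip_cong: "(\<And>y. y \<in> space M \<Longrightarrow> \<xi> y = \<eta> y) \<Longrightarrow> ip \<zeta> \<xi> = ip \<zeta> \<eta>"
  unfolding ip_def by (intro Bochner_Integration.integral_cong) auto

lemma N_square: "(N \<xi>)\<^sup>2 = (LINT y|M. (cmod (\<xi> y))\<^sup>2)"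
  unfolding N_def by (rule real_sqrt_pow2) simp

lemma ip_self: "ip \<xi> \<xi> = complex_of_real ((N \<xi>)\<^sup>2)"
proof -
  have "cnj (\<xi> y) * \<xi> y = complex_of_real ((cmod (\<xi> y))\<^sup>2)" for y
    by (subst mult.commute) (rule complex_norm_square[symmetric])
  then show ?thesis unfolding ip_def N_square by (simp only: integral_complex_of_real)
qed

lemma N_scale: "N (\<lambda>y. c * \<xi> y) = cmod c * N \<xi>"
  by (simp add: N_def norm_mult power_mult_distrib real_sqrt_mult)

lemma N_zero: "N (\<lambda>y. 0) = 0"
  by (simp add: N_def)

lemma ip_le: 
  assumes x: "\<xi> \<in> H" and e: "\<eta> \<in> H"
  shows "cmod (ip \<xi> \<eta>) \<le> N \<xi> * N \<eta>"
proof -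
  define B where "B = (LINT y|M. cmod (\<xi> y) * cmod (\<eta> y))"
  have iB: "integrable M (\<lambda>y. cmod (\<xi> y) * cmod (\<eta> y))"
    using integrable_norm[OF H_integrable[OF H_mult[OF x e]]] by (simp add: norm_mult)
  have "0 \<le> (N \<xi>)\<^sup>2 * t\<^sup>2 - 2 * B * t + (N \<eta>)\<^sup>2" for t
  proof -
    have "0 \<le> (LINT y|M. (t * cmod (\<xi> y) - cmod (\<eta> y))\<^sup>2)" by simp
    also have "\<dots> = (LINT y|M. t\<^sup>2 * (cmod (\<xi> y))\<^sup>2 - (2 * t) * (cmod (\<xi> y) * cmod (\<eta> y)) + (cmod (\<eta> y))\<^sup>2)"
      by (intro Bochner_Integration.integral_cong) (auto simp: power2_eq_square algebra_simps)
    also have "\<dots> = t\<^sup>2 * (N \<xi>)\<^sup>2 - 2 * t * B + (N \<eta>)\<^sup>2"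
      unfolding N_square B_def using iB H_square_integrable[OF x] H_square_integrable[OF e] by simp
    finally show ?thesis by (simp add: algebra_simps)
  qed
  then have "B\<^sup>2 \<le> (N \<xi>)\<^sup>2 * (N \<eta>)\<^sup>2" by (rule quadratic_discriminant_le) simp
  then have "B \<le> N \<xi> * N \<eta>"
    by (metis N_nonneg mult_nonneg_nonneg power2_le_imp_le power_mult_distrib)
  moreover have "cmod (ip \<xi> \<eta>) \<le> B"
    unfolding ip_def B_def by (rule order_trans[OF integral_norm_bound]) (simp add: norm_mult)
  ultimately show ?thesis by simp
qed

lemma N_triangle:
  assumes x: "\<xi> \<in> H" and e: "\<eta> \<in> H"
  shows "N (\<lambda>y. \<xi> y + \<eta> y) \<le> N \<xi> + N \<eta>"
proof -
  have "complex_of_real ((N (\<lambda>y. \<xi> y + \<eta> y))\<^sup>2) = ip \<xi> \<xi> + ip \<xi> \<eta> + (ip \<eta> \<xi> + ip \<eta> \<eta>)"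
    unfolding ip_self[symmetric] unfolding ip_def
    using x e by (simp add: distrib_left distrib_right ip_integrable)
  then have "(N (\<lambda>y. \<xi> y + \<eta> y))\<^sup>2 = Re (ip \<xi> \<xi> + ip \<xi> \<eta> + (ip \<eta> \<xi> + ip \<eta> \<eta>))"
    by (metis Re_complex_of_real)
  also have "\<dots> = (N \<xi>)\<^sup>2 + Re (ip \<xi> \<eta>) + (Re (ip \<eta> \<xi>) + (N \<eta>)\<^sup>2)" by (simp add: ip_self)
  also have "\<dots> \<le> (N \<xi>)\<^sup>2 + N \<xi> * N \<eta> + (N \<eta> * N \<xi> + (N \<eta>)\<^sup>2)"
    using ip_le[OF x e] ip_le[OF e x] complex_Re_le_cmod[of "ip \<xi> \<eta>"] complex_Re_le_cmod[of "ip \<eta> \<xi>"]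
    by linarith
  also have "\<dots> = (N \<xi> + N \<eta>)\<^sup>2" by (simp add: power2_eq_square algebra_simps)
  finally show ?thesis by (rule power2_le_imp_le) (simp add: N_nonneg)
qed

lemma N_sum: "(\<And>i. i \<in> I \<Longrightarrow> f i \<in> H) \<Longrightarrow> N (\<lambda>y. \<Sum>i\<in>I. f i y) \<le> (\<Sum>i\<in>I. N (f i))"
proof (induction I rule: infinite_finite_induct)
  case (insert i I)
  have "N (\<lambda>y. f i y + (\<Sum>i\<in>I. f i y)) \<le> N (f i) + N (\<lambda>y. \<Sum>i\<in>I. f i y)"
    by (intro N_triangle H_sum insert.prems) auto
  then show ?case using insert by fastforce
qed (simp_all add: N_zero)

lemma integral_\<tau>: 
  fixes g :: "'m \<Rightarrow> 'b::{banach, second_countable_topology}"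
  shows "g \<in> borel_measurable M \<Longrightarrow> (LINT y|M. g (\<tau> m y)) = (LINT y|M. g y)"
  using integral_distr[OF \<tau>_meas[of m], of g] by (simp add: \<tau>_distr)

text \<open>The trivial bound by the sum of the coefficient norms. It makes the supremum in
  \<open>op_norm\<close> finite and takes care of vectors with \<open>N \<xi> = 0\<close>, which
  cannot be normalised.\<close>

lemma act_bounded:
  assumes x: "\<xi> \<in> H"
  shows "N (act f \<xi>) \<le> (\<Sum>m | f m \<noteq> 0. norm (f m)) * N \<xi>"
proof -
  have "N (\<lambda>y. apply_bcontfun a (pr y) * (K m y * \<xi> (\<tau> m y))) \<le> norm a * N \<xi>" for a m
  proof -
    have "(N (\<lambda>y. apply_bcontfun a (pr y) * (K m y * \<xi> (\<tau> m y))))\<^sup>2 \<le>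
        (LINT y|M. (norm a)\<^sup>2 * (cmod (\<xi> (\<tau> m y)))\<^sup>2)"
      unfolding N_square
    proof (rule integral_mono)
      show "integrable M (\<lambda>y. (cmod (apply_bcontfun a (pr y) * (K m y * \<xi> (\<tau> m y))))\<^sup>2)"
        by (intro H_square_integrable H_mult H_fun H_K H_\<tau> x)
      show "integrable M (\<lambda>y. (norm a)\<^sup>2 * (cmod (\<xi> (\<tau> m y)))\<^sup>2)"
        by (intro integrable_mult_right H_square_integrable H_\<tau> x)
      show "(cmod (apply_bcontfun a (pr y) * (K m y * \<xi> (\<tau> m y))))\<^sup>2 \<le> (norm a)\<^sup>2 * (cmod (\<xi> (\<tau> m y)))\<^sup>2"
        if "y \<in> space M" for y
        by (auto simp: norm_mult K_norm that power_mult_distrib intro!: mult_right_mono power_mono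
            norm_bounded)
    qed
    also have "\<dots> = (norm a * N \<xi>)\<^sup>2"
      using integral_\<tau>[of "\<lambda>y. (cmod (\<xi> y))\<^sup>2" m] H_measurable[OF x]
          by (simp add: N_square power_mult_distrib)
    finally show ?thesis by (rule power2_le_imp_le) (simp add: N_nonneg)
  qed
  then have "(\<Sum>m | f m \<noteq> 0. N (\<lambda>y. apply_bcontfun (f m) (pr y) * (K m y * \<xi> (\<tau> m y)))) \<le>
      (\<Sum>m | f m \<noteq> 0. norm (f m)) * N \<xi>"
    unfolding sum_distrib_right by (rule sum_mono)
  moreover have "N (act f \<xi>) \<le> (\<Sum>m | f m \<noteq> 0. N (\<lambda>y. apply_bcontfun (f m) (pr y) * (K m y * \<xi> (\<tau> m y))))"
    unfolding act_def by (intro N_sum H_mult H_fun H_K H_\<tau> x)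
  ultimately show ?thesis by simp
qed

lemma act_superset:
  "finite F \<Longrightarrow> {n. f n \<noteq> 0} \<subseteq> F \<Longrightarrow>
    act f \<xi> y = (\<Sum>m\<in>F. apply_bcontfun (f m) (pr y) * (K m y * \<xi> (\<tau> m y)))"
  unfolding act_def by (rule sum_support_superset) (auto simp: zero_bcontfun.rep_eq)

lemma act_add:
  assumes "alg_elem f" "alg_elem g"
  shows "act (\<lambda>n. f n + g n) \<xi> y = act f \<xi> y + act g \<xi> y"
proof -
  define F where "F = {n. f n \<noteq> 0} \<union> {n. g n \<noteq> 0}"
  have F: "finite F" "{n. f n \<noteq> 0} \<subseteq> F" "{n. g n \<noteq> 0} \<subseteq> F" "{n. f n + g n \<noteq> 0} \<subseteq> F"
    using assms by (auto simp: F_def alg_elem_def)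
  show ?thesis
    by (simp add: act_superset[OF F(1,2)] act_superset[OF F(1,3)] act_superset[OF F(1,4)]
        plus_bcontfun.rep_eq distrib_right sum.distrib)
qed

lemma act_scaleC:
  assumes "alg_elem f"
  shows "act (\<lambda>n. c *\<^sub>C f n) \<xi> y = c * act f \<xi> y"
proof -
  have F: "finite {n. f n \<noteq> 0}" "{n. c *\<^sub>C f n \<noteq> 0} \<subseteq> {n. f n \<noteq> 0}" using assms by (auto simp: alg_elem_def)
  show ?thesis
    by (simp add: act_superset[OF F(1,2)] act_superset[OF F(1) subset_refl] scaleC_bcontfun.rep_eq
        scaleC_complex_def mult.assoc sum_distrib_left)
qed

lemma act_scale: "act f (\<lambda>y. c * \<xi> y) y = c * act f \<xi> y"
  by (simp add: act_def sum_distrib_left ac_simps)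

lemma act_mult:
  assumes f: "alg_elem f" and g: "alg_elem g" and y: "y \<in> space M"
  shows "act (alg_mult \<alpha> f g) \<xi> y = act f (act g \<xi>) y"
proof -
  define A B where "A = {n. f n \<noteq> 0}" and "B = {n. g n \<noteq> 0}"
  define S where "S = (\<lambda>(m, k). m + k) ` (A \<times> B)"
  have finS: "finite A" "finite B" "finite S" using f g by (auto simp: A_def B_def S_def alg_elem_def)
  define h where "h m k = apply_bcontfun (f m) (pr y) * apply_bcontfun (g k) (pr (\<tau> m y)) * (K (m + k) y
      * \<xi> (\<tau> (m + k) y))" for m k
  have "act (alg_mult \<alpha> f g) \<xi> y = (\<Sum>n\<in>S. apply_bcontfun (alg_mult \<alpha> f g n) (pr y) * (K n y * \<xi> (\<tau> n y)))"
    using alg_mult_supp[OF f g] by (intro act_superset finS) (simp add: S_def A_def B_def)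
  also have "\<dots> = (\<Sum>n\<in>S. \<Sum>m\<in>A. h m (n - m))"
    unfolding alg_mult_def A_def[symmetric] h_def
    by (simp add: apply_bcontfun_sum times_bcontfun.rep_eq equivariant[OF y] sum_distrib_right)
  also have "\<dots> = (\<Sum>m\<in>A. \<Sum>k\<in>B. h m k)"
    unfolding S_def by (rule sum_convolution[OF finS(1,2)]) (simp add: B_def h_def zero_bcontfun.rep_eq)
  also have "\<dots> = act f (act g \<xi>) y"
    unfolding act_def A_def[symmetric] B_def[symmetric] h_def
    by (simp add: K_add[OF y] \<tau>_add[OF y] sum_distrib_left mult.assoc) (simp add: ac_simps)
  finally show ?thesis .
qed

lemma ip_sum_right:
  "\<xi> \<in> H \<Longrightarrow> (\<And>i. i \<in> I \<Longrightarrow> f i \<in> H) \<Longrightarrow> ip \<xi> (\<lambda>y. \<Sum>i\<in>I. f i y) = (\<Sum>i\<in>I. ip \<xi> (f i))"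
  unfolding ip_def sum_distrib_left by (rule Bochner_Integration.integral_sum) (rule ip_integrable)

lemma ip_sum_left:
  "\<xi> \<in> H \<Longrightarrow> (\<And>i. i \<in> I \<Longrightarrow> f i \<in> H) \<Longrightarrow> ip (\<lambda>y. \<Sum>i\<in>I. f i y) \<xi> = (\<Sum>i\<in>I. ip (f i) \<xi>)"
  unfolding ip_def cnj_sum sum_distrib_right by (rule Bochner_Integration.integral_sum) (rule ip_integrable)

text \<open>Translating the integral by \<open>\<tau> (- m)\<close> turns the term of degree
  \<open>m\<close> into one of degree \<open>- m\<close>. The weights match because the cocycle
  identity makes \<open>K m\<close> at the translated point inverse, hence conjugate, to
  \<open>K (- m)\<close>.\<close>

lemma act_adjoint:
  assumes f: "alg_elem f" and x: "\<xi> \<in> H" and e: "\<eta> \<in> H"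
  shows "ip (act f \<xi>) \<eta> = ip \<xi> (act (alg_star \<alpha> f) \<eta>)"
proof -
  have fin: "finite (uminus ` {n. f n \<noteq> 0})" using f by (simp add: alg_elem_def)
  let ?L = "\<lambda>m y. apply_bcontfun (f m) (pr y) * (K m y * \<xi> (\<tau> m y))"
  let ?R = "\<lambda>m y. apply_bcontfun (alg_star \<alpha> f m) (pr y) * (K m y * \<eta> (\<tau> m y))"
  have L: "?L m \<in> H" and R: "?R m \<in> H" for m
    by (intro H_mult H_fun H_K H_\<tau> x e)+
  have one: "ip (?L m) \<eta> = ip \<xi> (?R (- m))" for m
  proof -
    have "ip (?L m) \<eta> = (LINT y|M. cnj (?L m (\<tau> (- m) y)) * \<eta> (\<tau> (- m) y))"
      unfolding ip_def using H_measurable[OF H_mult[OF H_cnj[OF L] e]]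
      by (rule integral_\<tau>[symmetric])
    also have "\<dots> = ip \<xi> (?R (- m))"
      unfolding ip_def
    proof (rule Bochner_Integration.integral_cong[OF refl])
      fix y assume y: "y \<in> space M"
      have bk: "\<tau> m (\<tau> (- m) y) = y" using \<tau>_add[OF y, of "- m" m] \<tau>_0[OF y] by simp
      have "K (- m) y * K m (\<tau> (- m) y) = 1" using K_add[OF y, of "- m" m] K_0[OF y] by simp
      then have K: "cnj (K m (\<tau> (- m) y)) = K (- m) y"
        using K_norm[OF \<tau>_space[OF y], of m "- m"] by (metis cnj_eq_inverse inverse_unique mult.commute)
      have F: "apply_bcontfun (alg_star \<alpha> f (- m)) (pr y) = cnj (apply_bcontfun (f m) (pr (\<tau> (- m) y)))"
        by (simp add: alg_star_def equivariant[OF y] star_bcontfun.rep_eq star_complex_def)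
      show "cnj (?L m (\<tau> (- m) y)) * \<eta> (\<tau> (- m) y) = cnj (\<xi> y) * ?R (- m) y"
        by (simp add: bk K F ac_simps)
    qed
    finally show ?thesis .
  qed
  have "ip (act f \<xi>) \<eta> = (\<Sum>m | f m \<noteq> 0. ip (?L m) \<eta>)"
    unfolding act_def by (rule ip_sum_left[OF e L])
  also have "\<dots> = (\<Sum>m\<in>uminus ` {n. f n \<noteq> 0}. ip \<xi> (?R m))"
    by (subst sum.reindex) (auto simp: one)
  also have "\<dots> = ip \<xi> (\<lambda>y. \<Sum>m\<in>uminus ` {n. f n \<noteq> 0}. ?R m y)"
    by (rule ip_sum_right[OF x R, symmetric])
  also have "\<dots> = ip \<xi> (act (alg_star \<alpha> f) \<eta>)"
    by (rule ip_cong) (simp add: act_superset[OF fin alg_star_supp])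
  finally show ?thesis .
qed

section \<open>The operator norm as a C*-seminorm, and its vector functionals\<close>

definition op_norm :: "(int \<Rightarrow> ('x \<Rightarrow>\<^sub>C complex)) \<Rightarrow> real"
  where "op_norm f = (SUP \<xi>\<in>{\<xi>\<in>H. N \<xi> \<le> 1}. N (act f \<xi>))"

lemma op_norm_bdd: "bdd_above ((\<lambda>\<xi>. N (act f \<xi>)) ` {\<xi>\<in>H. N \<xi> \<le> 1})"
proof (rule bdd_aboveI2)
  fix \<xi> assume x: "\<xi> \<in> {\<xi>\<in>H. N \<xi> \<le> 1}"
  have "N (act f \<xi>) \<le> (\<Sum>m | f m \<noteq> 0. norm (f m)) * N \<xi>" using x by (intro act_bounded) auto
  also have "\<dots> \<le> (\<Sum>m | f m \<noteq> 0. norm (f m)) * 1" using x by (intro mult_left_mono) (auto intro: sum_nonneg)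
  finally show "N (act f \<xi>) \<le> (\<Sum>m | f m \<noteq> 0. norm (f m)) * 1" .
qed

lemma op_norm_upper: "\<xi> \<in> H \<Longrightarrow> N \<xi> \<le> 1 \<Longrightarrow> N (act f \<xi>) \<le> op_norm f"
  unfolding op_norm_def by (rule cSUP_upper2[OF _ _ order_refl]) (auto intro: op_norm_bdd)

lemma op_norm_least: "(\<And>\<xi>. \<xi> \<in> H \<Longrightarrow> N \<xi> \<le> 1 \<Longrightarrow> N (act f \<xi>) \<le> c) \<Longrightarrow> op_norm f \<le> c"
  unfolding op_norm_def
proof (rule cSUP_least)
  show "{\<xi>\<in>H. N \<xi> \<le> 1} \<noteq> {}" using H_const[of 0] N_zero by auto
qed auto

lemma op_norm_nonneg: "0 \<le> op_norm f"
  using op_norm_upper[OF H_const[of 0], of f] N_zero N_nonneg[of "act f (\<lambda>y. 0)"] by linarith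

lemma act_le_op_norm:
  assumes x: "\<xi> \<in> H"
  shows "N (act f \<xi>) \<le> op_norm f * N \<xi>"
proof (cases "N \<xi> = 0")
  case True
  then show ?thesis using act_bounded[OF x, of f] by simp
next
  case False
  then have pos: "N \<xi> > 0" using N_nonneg[of \<xi>] by simp
  let ?c = "complex_of_real (1 / N \<xi>)"
  have "N (act f (\<lambda>y. ?c * \<xi> y)) \<le> op_norm f"
    by (intro op_norm_upper H_mult H_const x, subst N_scale)
      (use pos in \<open>auto simp: norm_divide\<close>)
  also have "act f (\<lambda>y. ?c * \<xi> y) = (\<lambda>y. ?c * act f \<xi> y)" by (rule ext) (rule act_scale)
  also have "N (\<lambda>y. ?c * act f \<xi> y) = N (act f \<xi>) / N \<xi>"
      by (subst N_scale) (use pos in \<open>auto simp: norm_divide\<close>)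
  finally show ?thesis using pos by (simp add: pos_divide_le_eq)
qed

text \<open>The adjoint relation and Cauchy-Schwarz bound the square of \<open>op_norm f\<close> by
  the value at the product of \<open>f\<close> with its adjoint. With submultiplicativity this
  forces the involution to be isometric, and only then does the reverse inequality follow.\<close>

lemma op_norm_seminorm: "alg_cstar_seminorm \<alpha> op_norm"
proof -
  have add: "op_norm (\<lambda>n. f n + g n) \<le> op_norm f + op_norm g" if "alg_elem f" "alg_elem g" for f g
  proof (rule op_norm_least)
    fix \<xi> assume x: "\<xi> \<in> H" "N \<xi> \<le> 1"
    have "N (act (\<lambda>n. f n + g n) \<xi>) \<le> N (act f \<xi>) + N (act g \<xi>)"
      using N_triangle[OF H_act[OF x(1)] H_act[OF x(1)], of f g] N_cong[OF act_add[OF that]] by simp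
    then show "N (act (\<lambda>n. f n + g n) \<xi>) \<le> op_norm f + op_norm g"
      using op_norm_upper[OF x, of f] op_norm_upper[OF x, of g] by linarith
  qed
  have mult: "op_norm (alg_mult \<alpha> f g) \<le> op_norm f * op_norm g" if "alg_elem f" "alg_elem g" for f g
  proof (rule op_norm_least)
    fix \<xi> assume x: "\<xi> \<in> H" "N \<xi> \<le> 1"
    have "N (act (alg_mult \<alpha> f g) \<xi>) = N (act f (act g \<xi>))" by (intro N_cong act_mult that)
    also have "\<dots> \<le> op_norm f * N (act g \<xi>)" by (intro act_le_op_norm H_act x)
    also have "\<dots> \<le> op_norm f * op_norm g" by (intro mult_left_mono op_norm_upper x op_norm_nonneg)
    finally show "N (act (alg_mult \<alpha> f g) \<xi>) \<le> op_norm f * op_norm g" .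
  qed
  have scale_le: "op_norm (\<lambda>n. c *\<^sub>C f n) \<le> cmod c * op_norm f" if "alg_elem f" for c f
  proof (rule op_norm_least)
    fix \<xi> assume x: "\<xi> \<in> H" "N \<xi> \<le> 1"
    have "act (\<lambda>n. c *\<^sub>C f n) \<xi> = (\<lambda>y. c * act f \<xi> y)" by (rule ext) (rule act_scaleC[OF that])
    then show "N (act (\<lambda>n. c *\<^sub>C f n) \<xi>) \<le> cmod c * op_norm f"
      by (simp add: N_scale mult_left_mono op_norm_upper x)
  qed
  have scale: "op_norm (\<lambda>n. c *\<^sub>C f n) = cmod c * op_norm f" if f: "alg_elem f" for c f
  proof (cases "c = 0")
    case True
    then show ?thesis using scale_le[OF f, of c] op_norm_nonneg[of "\<lambda>n. c *\<^sub>C f n"] by simp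
  next
    case False
    have "op_norm f = op_norm (\<lambda>n. (1 / c) *\<^sub>C (c *\<^sub>C f n))" using False by (simp add: scaleC_scaleC)
    also have "\<dots> \<le> cmod (1 / c) * op_norm (\<lambda>n. c *\<^sub>C f n)" by (intro scale_le alg_elem_scaleC f)
    finally have "cmod c * op_norm f \<le> op_norm (\<lambda>n. c *\<^sub>C f n)"
      using False by (simp add: norm_divide field_simps)
    then show ?thesis using scale_le[OF f, of c] by simp
  qed
  have sq: "(op_norm f)\<^sup>2 \<le> op_norm (alg_mult \<alpha> (alg_star \<alpha> f) f)" if f: "alg_elem f" for f
  proof -
    let ?g = "alg_mult \<alpha> (alg_star \<alpha> f) f"
    have "op_norm f \<le> sqrt (op_norm ?g)"
    proof (rule op_norm_least)
      fix \<xi> assume x: "\<xi> \<in> H" "N \<xi> \<le> 1"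
      have "complex_of_real ((N (act f \<xi>))\<^sup>2) = ip \<xi> (act (alg_star \<alpha> f) (act f \<xi>))"
        unfolding ip_self[symmetric] by (intro act_adjoint f x H_act)
      also have "\<dots> = ip \<xi> (act ?g \<xi>)" by (intro ip_cong act_mult[symmetric] alg_elem_star f)
      finally have "(N (act f \<xi>))\<^sup>2 = cmod (ip \<xi> (act ?g \<xi>))"
        by (metis norm_of_real abs_of_nonneg zero_le_power2)
      also have "\<dots> \<le> N \<xi> * N (act ?g \<xi>)" by (intro ip_le x H_act)
      also have "\<dots> \<le> 1 * op_norm ?g" by (intro mult_mono op_norm_upper x N_nonneg) auto
      finally show "N (act f \<xi>) \<le> sqrt (op_norm ?g)" by (intro real_le_rsqrt) simp
    qed
    then show ?thesis
      by (metis op_norm_nonneg power_mono real_sqrt_pow2)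
  qed
  have star_star: "alg_star \<alpha> (alg_star \<alpha> f) = f" for f
    by (rule ext) (simp add: alg_star_def zhom(5)[symmetric] star_star zpow_cancel[OF
        star_automorphism_bij[OF aut]])
  have le: "op_norm f \<le> op_norm (alg_star \<alpha> f)" if f: "alg_elem f" for f
  proof (cases "op_norm f = 0")
    case False
    have "op_norm f * op_norm f \<le> op_norm (alg_star \<alpha> f) * op_norm f"
      using sq[OF f] mult[OF alg_elem_star[OF f] f] by (simp add: power2_eq_square)
    then show ?thesis using False op_norm_nonneg[of f] by (simp add: mult_le_cancel_right)
  qed (simp add: op_norm_nonneg)
  have st: "op_norm (alg_star \<alpha> f) = op_norm f" if "alg_elem f" for f
    using le[OF that] le[OF alg_elem_star[OF that]] by (simp add: star_star)
  have "op_norm (alg_mult \<alpha> (alg_star \<alpha> f) f) = (op_norm f)\<^sup>2" if f: "alg_elem f" for f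
    using sq[OF f] mult[OF alg_elem_star[OF f] f] st[OF f] by (simp add: power2_eq_square)
  then show ?thesis
    unfolding alg_cstar_seminorm_def using add mult scale op_norm_nonneg by blast
qed

lemma vector_functional_le:
  assumes "\<xi> \<in> H" "N \<xi> \<le> 1"
  shows "cmod (ip \<xi> (act f \<xi>)) \<le> op_norm f"
proof -
  have "cmod (ip \<xi> (act f \<xi>)) \<le> N \<xi> * N (act f \<xi>)" by (intro ip_le assms H_act)
  also have "\<dots> \<le> 1 * op_norm f" by (intro mult_mono op_norm_upper assms N_nonneg) auto
  finally show ?thesis by simp
qed

lemma vector_functional_positive:
  assumes "\<xi> \<in> H" "alg_elem f"
  shows "ip \<xi> (act (alg_mult \<alpha> (alg_star \<alpha> f) f) \<xi>) \<in> \<real>\<^sub>\<ge>\<^sub>0"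
proof -
  have "ip \<xi> (act (alg_mult \<alpha> (alg_star \<alpha> f) f) \<xi>) = ip \<xi> (act (alg_star \<alpha> f) (act f \<xi>))"
    by (intro ip_cong act_mult alg_elem_star assms)
  also have "\<dots> = complex_of_real ((N (act f \<xi>))\<^sup>2)"
    unfolding ip_self[symmetric] by (intro act_adjoint[symmetric] assms H_act)
  finally show ?thesis by (simp only: complex_nonneg_Reals_iff Re_complex_of_real Im_complex_of_real) simp
qed

end

section \<open>Homeomorphisms and measures on a compact metric space\<close>

lemma bcontfun_of_compact:
  fixes f :: "'x::metric_space \<Rightarrow> complex"
  assumes "compact (UNIV :: 'x set)" "continuous_on UNIV f"
  shows "apply_bcontfun (Bcontfun f) = f"
proof -
  have "compact (range f)" using assms by (intro compact_continuous_image)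
  then have "f \<in> bcontfun" using assms(2) by (auto simp: bcontfun_def compact_imp_bounded)
  then show ?thesis by (rule Bcontfun_inverse)
qed

text \<open>The distance to \<open>y\<close> vanishes at no other point.\<close>

lemma bcontfun_separates:
  fixes x y :: "'x::metric_space"
  assumes "compact (UNIV :: 'x set)" "\<And>a :: 'x \<Rightarrow>\<^sub>C complex. apply_bcontfun a x = apply_bcontfun a y"
  shows "x = y"
proof -
  have "continuous_on UNIV (\<lambda>z. complex_of_real (dist z y))" by (intro continuous_intros)
  from bcontfun_of_compact[OF assms(1) this] assms(2)[of "Bcontfun (\<lambda>z. complex_of_real (dist z y))"]
  show ?thesis by simp
qed

lemma unital_star_hom_eval: "unital_star_hom (\<lambda>a :: 'x::metric_space \<Rightarrow>\<^sub>C complex. apply_bcontfun a x)"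
  by (simp add: unital_star_hom_def clinear_def bcontfun_star_rep)

text \<open>A character that is no point evaluation would vanish on a function without zeros.\<close>

lemma character_is_evaluation:
  fixes \<psi> :: "('x::metric_space \<Rightarrow>\<^sub>C complex) \<Rightarrow> complex"
  assumes comp: "compact (UNIV :: 'x set)" and hom: "unital_star_hom \<psi>"
  shows "\<exists>y. \<forall>a. \<psi> a = apply_bcontfun a y"
proof (rule ccontr)
  note C = unital_star_homD[OF hom]
  assume "\<not> ?thesis"
  then obtain a where a: "\<And>y. \<psi> (a y) \<noteq> apply_bcontfun (a y) y" by metis
  define b where "b y = a y - \<psi> (a y) *\<^sub>C 1" for y
  define c where "c y = star (b y) * b y" for y
  have \<psi>c: "\<psi> (c y) = 0" for y by (simp add: c_def b_def C scaleC_complex_def)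
  have cv: "apply_bcontfun (c y) x = complex_of_real ((cmod (apply_bcontfun (b y) x))\<^sup>2)" for x y
    unfolding c_def times_bcontfun.rep_eq star_bcontfun.rep_eq star_complex_def
    by (subst mult.commute) (rule complex_norm_square[symmetric])
  have b0: "apply_bcontfun (b y) y \<noteq> 0" for y
    using a[of y] by (simp add: b_def bcontfun_star_rep scaleC_complex_def)
  define U where "U y = {x. 0 < Re (apply_bcontfun (c y) x)}" for y
  have "open (U y)" for y
    unfolding U_def by (intro open_Collect_less continuous_intros continuous_on_apply_bcontfun)
  moreover have "y \<in> U y" for y using b0 by (simp add: U_def cv)
  then have "UNIV \<subseteq> (\<Union>y. U y)" by blast
  ultimately obtain D where D: "finite D" "UNIV \<subseteq> (\<Union>y\<in>D. U y)"
    by (rule compactE_image[OF comp, of UNIV U])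
  \<comment> \<open>Every point lies in one of finitely many sets where a summand is positive, so
    \<open>s\<close> is invertible, although \<open>\<psi>\<close> kills each summand.\<close>
  define s where "s = (\<Sum>y\<in>D. c y)"
  have "\<psi> s = (\<Sum>y\<in>D. \<psi> (c y))" unfolding s_def
    by (induction D rule: infinite_finite_induct) (auto simp: C)
  then have \<psi>s: "\<psi> s = 0" by (simp add: \<psi>c)
  have s0: "apply_bcontfun s x \<noteq> 0" for x
  proof -
    obtain y where y: "y \<in> D" "x \<in> U y" using D(2) by blast
    have "0 < (\<Sum>y\<in>D. Re (apply_bcontfun (c y) x))"
      using D(1) y by (intro sum_pos2[OF D(1) y(1)]) (auto simp: U_def cv)
    then show ?thesis unfolding s_def apply_bcontfun_sum by (metis Re_sum less_irrefl zero_complex.sel(1))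
  qed
  have "continuous_on UNIV (\<lambda>x. 1 / apply_bcontfun s x)"
    by (intro continuous_intros continuous_on_apply_bcontfun) (use s0 in auto)
  note inv = bcontfun_of_compact[OF comp this]
  have "s * Bcontfun (\<lambda>x. 1 / apply_bcontfun s x) = 1"
    by (rule bcontfun_eqI) (simp add: bcontfun_rep inv s0)
  then have "\<psi> s * \<psi> (Bcontfun (\<lambda>x. 1 / apply_bcontfun s x)) = 1" using C(3,4) by metis
  then show False using \<psi>s by simp
qed

text \<open>Evaluation at \<open>x\<close> after \<open>\<alpha>\<close> is a character, hence
  evaluation at some \<open>h x\<close>. Continuity of \<open>h\<close> at \<open>x\<close> is
  tested on the single function \<open>dist _ (h x)\<close>.\<close>

lemma dual_point_map:
  fixes \<alpha> :: "('x::metric_space \<Rightarrow>\<^sub>C complex) \<Rightarrow> ('x \<Rightarrow>\<^sub>C complex)"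
  assumes comp: "compact (UNIV :: 'x set)" and hom: "unital_star_hom \<alpha>"
  shows "\<exists>h. continuous_on UNIV h \<and> (\<forall>a x. apply_bcontfun (\<alpha> a) x = apply_bcontfun a (h x))"
proof -
  have "\<exists>y. \<forall>a. apply_bcontfun (\<alpha> a) x = apply_bcontfun a y" for x
    using character_is_evaluation[OF comp unital_star_hom_comp[OF unital_star_hom_eval[of x] hom]]
        by (simp add: comp_def)
  then obtain h where h: "\<And>x a. apply_bcontfun (\<alpha> a) x = apply_bcontfun a (h x)" by metis
  have "continuous (at x) h" for x
  proof -
    have "continuous_on UNIV (\<lambda>z. complex_of_real (dist z (h x)))" by (intro continuous_intros)
    note d = bcontfun_of_compact[OF comp this]
    have "continuous_on UNIV (apply_bcontfun (\<alpha> (Bcontfun (\<lambda>z. complex_of_real (dist z (h x))))))"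
      by (rule continuous_on_apply_bcontfun)
    then have "continuous_on UNIV (\<lambda>z. complex_of_real (dist (h z) (h x)))"
      by (simp add: h d cong: continuous_on_cong)
    then have "continuous_on UNIV (\<lambda>z. Re (complex_of_real (dist (h z) (h x))))" by (rule continuous_on_Re)
    then have "continuous_on UNIV (\<lambda>z. dist (h z) (h x))" by simp
    then have "((\<lambda>z. dist (h z) (h x)) \<longlongrightarrow> dist (h x) (h x)) (at x)"
      unfolding continuous_on_def by blast
    then show ?thesis unfolding continuous_at using tendsto_dist_iff[of h "h x" "at x"] by simp
  qed
  then have "continuous_on UNIV h" by (simp add: continuous_on_eq_continuous_at)
  then show ?thesis using h by blast
qed

text \<open>The point map of the inverse automorphism is the continuous inverse of the point map.
  Since functions separate points, the definite description has no other candidate.\<close>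

lemma dual_homeo_properties:
  fixes \<alpha> :: "('x::metric_space \<Rightarrow>\<^sub>C complex) \<Rightarrow> ('x \<Rightarrow>\<^sub>C complex)"
  assumes comp: "compact (UNIV :: 'x set)" and aut: "star_automorphism \<alpha>"
  shows "apply_bcontfun (\<alpha> a) x = apply_bcontfun a (dual_homeo \<alpha> x)"
    and "continuous_on UNIV (dual_homeo \<alpha>)" and "bij (dual_homeo \<alpha>)"
    and "apply_bcontfun (inv \<alpha> a) x = apply_bcontfun a (inv (dual_homeo \<alpha>) x)"
    and "continuous_on UNIV (inv (dual_homeo \<alpha>))"
proof -
  obtain h where h: "continuous_on UNIV h" "\<And>a x. apply_bcontfun (\<alpha> a) x = apply_bcontfun a (h x)"
    using dual_point_map[OF comp star_automorphism_hom[OF aut]] by blast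
  obtain k where k: "continuous_on UNIV k" "\<And>a x. apply_bcontfun (inv \<alpha> a) x = apply_bcontfun a (k x)"
    using dual_point_map[OF comp star_automorphism_inv[OF aut]] by blast
  note bij = star_automorphism_bij[OF aut]
  have hk: "h (k x) = x" for x
    by (rule bcontfun_separates[OF comp]) (simp add: h(2)[symmetric] k(2)[symmetric] inv_f_f[OF
        bij_is_inj[OF bij]])
  have kh: "k (h x) = x" for x
    by (rule bcontfun_separates[OF comp]) (simp add: h(2)[symmetric] k(2)[symmetric] surj_f_inv_f[OF
        bij_is_surj[OF bij]])
  have bijh: "bij h" by (rule o_bij[of k]) (auto simp: hk kh)
  have invh: "inv h = k" using hk kh by (intro inv_equality) auto
  have "homeomorphic_maps euclidean euclidean h k"
    using h(1) k(1) hk kh by (simp add: homeomorphic_maps_def)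
  then have hm: "homeomorphic_map euclidean euclidean h" using homeomorphic_maps_map by blast
  have "dual_homeo \<alpha> = h"
    unfolding dual_homeo_def
  proof (rule the_equality)
    fix h' assume "homeomorphic_map euclidean euclidean h' \<and> (\<forall>a x. apply_bcontfun (\<alpha> a) x =
        apply_bcontfun a (h' x))"
    then have "apply_bcontfun a (h' x) = apply_bcontfun a (h x)" 
      for a :: "'x \<Rightarrow>\<^sub>C complex" and x
      using h(2)[of a x] by simp
    then show "h' = h" by (intro ext bcontfun_separates[OF comp])
  qed (use hm h in blast)
  then show "apply_bcontfun (\<alpha> a) x = apply_bcontfun a (dual_homeo \<alpha> x)"
    "continuous_on UNIV (dual_homeo \<alpha>)" "bij (dual_homeo \<alpha>)"
    "apply_bcontfun (inv \<alpha> a) x = apply_bcontfun a (inv (dual_homeo \<alpha>) x)"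
    "continuous_on UNIV (inv (dual_homeo \<alpha>))"
    using h k bijh invh by simp_all
qed

lemma funpow_dual:
  fixes \<alpha> :: "('x::metric_space \<Rightarrow>\<^sub>C complex) \<Rightarrow> ('x \<Rightarrow>\<^sub>C complex)"
  assumes "\<And>a x. apply_bcontfun (\<alpha> a) x = apply_bcontfun a (h x)"
  shows "apply_bcontfun ((\<alpha> ^^ k) a) x = apply_bcontfun a ((h ^^ k) x)"
  by (induction k arbitrary: a x) (auto simp: assms funpow_swap1)

lemma zpow_dual_homeo:
  fixes \<alpha> :: "('x::metric_space \<Rightarrow>\<^sub>C complex) \<Rightarrow> ('x \<Rightarrow>\<^sub>C complex)"
  assumes comp: "compact (UNIV :: 'x set)" and aut: "star_automorphism \<alpha>"
  shows "apply_bcontfun (zpow \<alpha> m a) x = apply_bcontfun a (zpow (dual_homeo \<alpha>) m x)"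
  using funpow_dual[OF dual_homeo_properties(1)[OF assms]] funpow_dual[OF dual_homeo_properties(4)[OF
      assms]]
  by (simp add: zpow_def)

lemma continuous_on_funpow:
  fixes h :: "'x::topological_space \<Rightarrow> 'x"
  shows "continuous_on UNIV h \<Longrightarrow> continuous_on UNIV (h ^^ k)"
proof (induction k)
  case (Suc k)
  then have "continuous_on UNIV (h ^^ k)" by simp
  then have "continuous_on UNIV (h \<circ> (h ^^ k))"
    by (rule continuous_on_compose) (rule continuous_on_subset[OF Suc.prems subset_UNIV])
  then show ?case by simp
qed (simp add: id_def)

lemma continuous_on_zpow_dual_homeo:
  fixes \<alpha> :: "('x::metric_space \<Rightarrow>\<^sub>C complex) \<Rightarrow> ('x \<Rightarrow>\<^sub>C complex)"
  assumes comp: "compact (UNIV :: 'x set)" and aut: "star_automorphism \<alpha>"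
  shows "continuous_on UNIV (zpow (dual_homeo \<alpha>) m)"
  using dual_homeo_properties(2,5)[OF assms] by (simp add: zpow_def continuous_on_funpow)

text \<open>The functions \<open>max 0 (1 - n * infdist x F)\<close> decrease to the indicator of a
  closed set \<open>F\<close>, and closed sets generate the Borel sets. The carrier \<open>Z\<close>
  covers two cases: \<open>UNIV\<close> for measures on \<open>X\<close>, and the circle inside the
  plane. Test functions live on the whole space in both.\<close>

lemma measure_eqI_continuous:
  fixes M N :: "'a::metric_space measure"
  assumes M: "finite_measure M" "sets M = sets (restrict_space borel Z)"
    and N: "finite_measure N" "sets N = sets (restrict_space borel Z)"
    and eq: "\<And>f :: 'a \<Rightarrow> real. continuous_on UNIV f \<Longrightarrow> (\<And>x. 0 \<le> f x \<and> f x \<le> 1) \<Longrightarrow> (LINT x|M. f x) =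
        (LINT x|N. f x)"
  shows "M = N"
proof -
  have borelI: "f \<in> borel_measurable L" if "f \<in> borel_measurable borel" "sets L =
      sets (restrict_space borel Z)"
    for f :: "'a \<Rightarrow> real" and L :: "'a measure"
    using measurable_restrict_space1[OF that(1), of Z] measurable_cong_sets[OF that(2) refl] by blast
  have sp: "space L = Z" if "sets L = sets (restrict_space borel Z)" for L :: "'a measure"
    using sets_eq_imp_space_eq[OF that] by (simp add: space_restrict_space)
  have bnd: "0 \<le> max 0 (1 - real n * infdist x F) \<and> max 0 (1 - real n * infdist x F) \<le> 1"
      for n x and F :: "'a set"
    using mult_nonneg_nonneg[of "real n" "infdist x F"] infdist_nonneg[of x F] by simp
  have lim: "(\<lambda>n. LINT x|L. max 0 (1 - real n * infdist x F)) \<longlonglongrightarrow> measure L (F \<inter> Z)"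
    if F: "closed F" "F \<noteq> {}" and L: "finite_measure L" "sets L = sets (restrict_space borel Z)"
        for F and L :: "'a measure"
  proof -
    interpret finite_measure L by (rule L)
    have Fm: "F \<inter> Z \<in> sets L" using F(1) L(2) by (auto simp: sets_restrict_space)
    have "(\<lambda>n. LINT x|L. max 0 (1 - real n * infdist x F)) \<longlonglongrightarrow> (LINT x|L. indicator F x)"
    proof (rule integral_dominated_convergence[where w = "\<lambda>_. 1"])
      show "(indicator F :: 'a \<Rightarrow> real) \<in> borel_measurable L"
        by (rule borelI[OF borel_measurable_indicator L(2)]) (use F(1) in simp)
      show "(\<lambda>x. max 0 (1 - real n * infdist x F)) \<in> borel_measurable L" for n
        by (rule borelI[OF borel_measurable_continuous_onI L(2)]) (intro continuous_intros)
      show "AE x in L. norm (max 0 (1 - real n * infdist x F)) \<le> 1" for n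
        using bnd by simp
      show "AE x in L. (\<lambda>n. max 0 (1 - real n * infdist x F)) \<longlonglongrightarrow> indicator F x"
      proof (rule AE_I2)
        fix x
        show "(\<lambda>n. max 0 (1 - real n * infdist x F)) \<longlonglongrightarrow> indicator F x"
        proof (cases "x \<in> F")
          case False
          then have pos: "infdist x F > 0"
            using in_closed_iff_infdist_zero[OF F] infdist_nonneg[of x F] by (metis le_less)
          obtain n0 where n0: "1 / infdist x F < real n0" using reals_Archimedean2 by blast
          have "max 0 (1 - real n * infdist x F) = 0" if "n \<ge> n0" for n
          proof -
            have "1 / infdist x F < real n" using n0 that by linarith
            then show ?thesis using pos by (simp add: divide_less_eq)
          qed
          then show ?thesis using False
            by (intro tendsto_eventually) (auto simp: eventually_sequentially)
        qed simp
      qed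
    qed simp
    moreover have "(LINT x|L. indicator F x) = measure L (F \<inter> Z)" by (simp add: sp[OF L(2)])
    ultimately show ?thesis by simp
  qed
  have closed_eq: "measure M (F \<inter> Z) = measure N (F \<inter> Z)" if "closed F" for F
  proof (cases "F = {}")
    case False
    have "(LINT x|M. max 0 (1 - real n * infdist x F)) = (LINT x|N. max 0 (1 - real n * infdist x F))" for n
      by (rule eq) (intro continuous_intros bnd)+
    then show ?thesis using lim[OF that False M] lim[OF that False N] LIMSEQ_unique by auto
  qed simp
  have id: "(\<lambda>x. x) \<in> measurable L borel" if "sets L = sets (restrict_space borel Z)" for L :: "'a measure"
    using measurable_restrict_space1[OF measurable_ident, of borel Z] measurable_cong_sets[OF that refl]
    by (auto simp: id_def)
  have ed: "emeasure (distr L borel (\<lambda>x. x)) B = emeasure L (B \<inter> Z)"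
    if "sets L = sets (restrict_space borel Z)" "B \<in> sets borel" for L :: "'a measure" and B
    using that by (simp add: emeasure_distr[OF id] sp)
  \<comment> \<open>Passing to the ambient Borel algebra makes the closed sets an
    intersection-stable generator; the restriction to \<open>Z\<close> is undone afterwards.\<close>
  have "distr M borel (\<lambda>x. x) = distr N borel (\<lambda>x. x)"
  proof (rule measure_eqI_generator_eq[where \<Omega> = UNIV and E = "Collect closed" and A = "\<lambda>_. UNIV"])
    show "Int_stable (Collect closed)" by (auto simp: Int_stable_def)
    show "emeasure (distr M borel (\<lambda>x. x)) X = emeasure (distr N borel (\<lambda>x. x)) X"
        if "X \<in> Collect closed" for X
      using that closed_eq[of X] M N
      by (subst (1 2) ed) (auto simp: finite_measure.emeasure_eq_measure)
    show "emeasure (distr M borel (\<lambda>x. x)) UNIV \<noteq> \<infinity>"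
      using M by (subst ed) (auto simp: finite_measure.emeasure_eq_measure)
  qed (auto simp: borel_eq_closed)
  then show ?thesis
    using M(2) N(2) ed
    by (intro measure_eqI) (auto simp: sets_restrict_space, metis inf_commute)
qed

section \<open>Integration of continuous functions: null functions, Riesz representation, density in
  L1\<close>

locale compact_prob = prob_space \<mu> for \<mu> :: "'x::metric_space measure" +
  assumes comp: "compact (UNIV :: 'x set)" and sets_borel: "sets \<mu> = sets borel"
begin

lemma space_UNIV [simp]: "space \<mu> = UNIV"
  using sets_eq_imp_space_eq[OF sets_borel] by simp

lemma borel_measurableI: "f \<in> borel_measurable borel \<Longrightarrow> f \<in> borel_measurable \<mu>"
  using measurable_cong_sets[OF sets_borel refl] by blast

lemma continuous_measurable:
  "continuous_on UNIV f \<Longrightarrow> f \<in> borel_measurable \<mu>" for f :: "'x \<Rightarrow> 'b::topological_space"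
  by (intro borel_measurableI borel_measurable_continuous_onI)

lemma bcontfun_measurable: "apply_bcontfun a \<in> borel_measurable \<mu>" for a :: "'x \<Rightarrow>\<^sub>C complex"
  by (intro continuous_measurable continuous_on_apply_bcontfun)

lemma integrable_mult_bcontfun:
  fixes a :: "'x \<Rightarrow>\<^sub>C complex" and h :: "'x \<Rightarrow> complex"
  assumes "integrable \<mu> h"
  shows "integrable \<mu> (\<lambda>x. apply_bcontfun a x * h x)"
proof (rule Bochner_Integration.integrable_bound)
  show "integrable \<mu> (\<lambda>x. norm a * norm (h x))" using assms by simp
  show "(\<lambda>x. apply_bcontfun a x * h x) \<in> borel_measurable \<mu>"
    using assms by (intro borel_measurable_times bcontfun_measurable borel_measurable_integrable)
  show "AE x in \<mu>. norm (apply_bcontfun a x * h x) \<le> norm (norm a * norm (h x))"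
    by (simp add: norm_mult mult_right_mono norm_bounded)
qed

lemma integrable_bcontfun: "integrable \<mu> (apply_bcontfun a)" for a :: "'x \<Rightarrow>\<^sub>C complex"
  using integrable_mult_bcontfun[of "\<lambda>_. 1" a] by simp

lemma distr_invariant:
  assumes T: "continuous_on UNIV T"
    and inv: "\<And>a :: 'x \<Rightarrow>\<^sub>C complex. (LINT x|\<mu>. apply_bcontfun a (T x)) = (LINT x|\<mu>. apply_bcontfun a x)"
  shows "distr \<mu> borel T = \<mu>"
proof (rule measure_eqI_continuous[where Z = UNIV])
  have Tm: "T \<in> measurable \<mu> borel" using T by (rule continuous_measurable)
  show "finite_measure (distr \<mu> borel T)" using prob_space_distr[OF Tm] by (rule prob_space.axioms)
  show "finite_measure \<mu>" by (rule finite_measure_axioms)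
  fix f :: "'x \<Rightarrow> real" assume f: "continuous_on UNIV f"
  have c: "continuous_on UNIV (\<lambda>x. complex_of_real (f x))" using f by (intro continuous_intros)
  have "complex_of_real (LINT x|distr \<mu> borel T. f x) = complex_of_real (LINT x|\<mu>. f (T x))"
    using f by (simp add: integral_distr[OF Tm] borel_measurable_continuous_onI)
  also have "\<dots> = complex_of_real (LINT x|\<mu>. f x)"
    using inv[of "Bcontfun (\<lambda>x. complex_of_real (f x))"]
        by (simp add: bcontfun_of_compact[OF comp c] del: of_real_eq_iff)
  finally show "(LINT x|distr \<mu> borel T. f x) = (LINT x|\<mu>. f x)" by (simp only: of_real_eq_iff)
qed (simp_all add: sets_borel)

text \<open>The positive and the negative part of \<open>k\<close> are densities of two finite
  measures that agree on continuous functions, hence everywhere.\<close>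

lemma AE_zero_real:
  fixes k :: "'x \<Rightarrow> real"
  assumes k: "integrable \<mu> k" and zero: "\<And>f. continuous_on UNIV f \<Longrightarrow> (LINT x|\<mu>. f x * k x) = 0"
  shows "AE x in \<mu>. k x = 0"
proof -
  note km [measurable] = borel_measurable_integrable[OF k]
  define p q where "p x = max 0 (k x)" and "q x = max 0 (- k x)" for x
  have int: "integrable \<mu> p" "integrable \<mu> q" using k unfolding p_def q_def by auto
  have meas [measurable]: "p \<in> borel_measurable \<mu>" "q \<in> borel_measurable \<mu>"
    using int by (auto intro: borel_measurable_integrable)
  have fin: "finite_measure (density \<mu> (\<lambda>x. ennreal (r x)))" if "integrable \<mu> r" "\<And>x. 0 \<le> r x" for r
  proof (rule finite_measureI)
    have "(\<integral>\<^sup>+ x. ennreal (r x) \<partial>\<mu>) = ennreal (LINT x|\<mu>. r x)"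
      using that by (intro nn_integral_eq_integral) auto
    then show "emeasure (density \<mu> (\<lambda>x. ennreal (r x))) (space (density \<mu> (\<lambda>x. ennreal (r x)))) \<noteq> \<infinity>"
      using that borel_measurable_integrable[OF that(1)] by (subst emeasure_density) (auto simp: sets_borel)
  qed
  have "density \<mu> (\<lambda>x. ennreal (p x)) = density \<mu> (\<lambda>x. ennreal (q x))"
  proof (rule measure_eqI_continuous[where Z = UNIV])
    show "finite_measure (density \<mu> (\<lambda>x. ennreal (p x)))" by (rule fin[OF int(1)]) (simp add: p_def)
    show "finite_measure (density \<mu> (\<lambda>x. ennreal (q x)))" by (rule fin[OF int(2)]) (simp add: q_def)
    fix f :: "'x \<Rightarrow> real" assume f: "continuous_on UNIV f" and b: "\<And>x. 0 \<le> f x \<and> f x \<le> 1"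
    have fm [measurable]: "f \<in> borel_measurable \<mu>" using f by (rule continuous_measurable)
    have fi: "integrable \<mu> (\<lambda>x. f x * r x)" if r: "integrable \<mu> r" for r :: "'x \<Rightarrow> real"
    proof (rule Bochner_Integration.integrable_bound[OF r])
      show "AE x in \<mu>. norm (f x * r x) \<le> norm (r x)"
        using b by (auto simp: abs_mult intro!: mult_left_le_one_le)
    qed (use r in simp)
    have "(LINT x|\<mu>. f x * p x) - (LINT x|\<mu>. f x * q x) = (LINT x|\<mu>. f x * p x - f x * q x)"
      by (rule Bochner_Integration.integral_diff[symmetric]) (intro fi int)+
    also have "\<dots> = (LINT x|\<mu>. f x * k x)"
      by (intro Bochner_Integration.integral_cong) (auto simp: p_def q_def max_def)
    finally have "(LINT x|\<mu>. f x * p x) = (LINT x|\<mu>. f x * q x)" using zero[OF f] by simp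
    then show "(LINT x|density \<mu> (\<lambda>x. ennreal (p x)). f x) = (LINT x|density \<mu> (\<lambda>x. ennreal (q x)). f x)"
      by (subst (1 2) integral_density) (auto simp: p_def q_def mult.commute)
  qed (simp_all add: sets_borel)
  then have "AE x in \<mu>. ennreal (p x) = ennreal (q x)" by (rule density_unique[rotated 2]) auto
  then show ?thesis by eventually_elim (auto simp: p_def q_def max_def split: if_splits)
qed

lemma AE_zero:
  fixes h :: "'x \<Rightarrow> complex"
  assumes h: "integrable \<mu> h" and zero: "\<And>a :: 'x \<Rightarrow>\<^sub>C complex. (LINT x|\<mu>. apply_bcontfun a x * h x) = 0"
  shows "AE x in \<mu>. h x = 0"
proof -
  have "(LINT x|\<mu>. f x * Re (h x)) = 0" "(LINT x|\<mu>. f x * Im (h x)) = 0" if f: "continuous_on UNIV f" for f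
  proof -
    have c: "continuous_on UNIV (\<lambda>x. complex_of_real (f x))" using f by (intro continuous_intros)
    let ?a = "Bcontfun (\<lambda>x. complex_of_real (f x))"
    note i = integrable_mult_bcontfun[OF h, of ?a]
    show "(LINT x|\<mu>. f x * Re (h x)) = 0" "(LINT x|\<mu>. f x * Im (h x)) = 0"
      using integral_Re[OF i] integral_Im[OF i] zero[of ?a]
          by (simp_all add: bcontfun_of_compact[OF comp c])
  qed
  then have "AE x in \<mu>. Re (h x) = 0" "AE x in \<mu>. Im (h x) = 0"
    using h by (auto intro!: AE_zero_real)
  then show ?thesis by eventually_elim (simp add: complex_eq_iff)
qed

text \<open>Beppo Levi: the sum of the moduli has a finite integral, so it is finite almost
  everywhere.\<close>

lemma AE_summable_of_integrals:
  fixes f :: "nat \<Rightarrow> 'x \<Rightarrow> complex"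
  assumes int: "\<And>n. integrable \<mu> (f n)" and sum: "summable (\<lambda>n. LINT x|\<mu>. cmod (f n x))"
  shows "AE x in \<mu>. summable (\<lambda>n. cmod (f n x))"
proof -
  have [measurable]: "f n \<in> borel_measurable \<mu>" for n using int by (rule borel_measurable_integrable)
  have "(\<integral>\<^sup>+ x. (\<Sum>n. ennreal (cmod (f n x))) \<partial>\<mu>) = (\<Sum>n. \<integral>\<^sup>+ x. ennreal (cmod (f n x)) \<partial>\<mu>)"
    by (rule nn_integral_suminf) simp
  also have "\<dots> = (\<Sum>n. ennreal (LINT x|\<mu>. cmod (f n x)))"
    by (intro arg_cong[where f = suminf] ext nn_integral_eq_integral integrable_norm int) auto
  also have "\<dots> \<noteq> \<infinity>"
    using sum by (simp add: ennreal_suminf_neq_top integral_nonneg_AE)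
  finally have "AE x in \<mu>. (\<Sum>n. ennreal (cmod (f n x))) \<noteq> \<infinity>"
    by (intro nn_integral_PInf_AE) auto
  then show ?thesis
    by eventually_elim (auto intro!: summable_suminf_not_top)
qed

lemma integrable_square_bcontfun: "integrable \<mu> (\<lambda>x. (cmod (apply_bcontfun a x))\<^sup>2)"
  for a :: "'x \<Rightarrow>\<^sub>C complex"
  using integrable_norm[OF integrable_bcontfun[of "a * a"]]
  by (simp add: times_bcontfun.rep_eq norm_mult power2_eq_square)

lemma L1_le_L2:
  fixes f :: "'x \<Rightarrow> complex"
  assumes "integrable \<mu> f" "integrable \<mu> (\<lambda>x. (cmod (f x))\<^sup>2)"
  shows "(LINT x|\<mu>. cmod (f x))\<^sup>2 \<le> (LINT x|\<mu>. (cmod (f x))\<^sup>2)"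
proof -
  have "0 \<le> 1 * t\<^sup>2 - 2 * (LINT x|\<mu>. cmod (f x)) * t + (LINT x|\<mu>. (cmod (f x))\<^sup>2)" for t
  proof -
    have "0 \<le> (LINT x|\<mu>. (t - cmod (f x))\<^sup>2)" by simp
    also have "\<dots> = (LINT x|\<mu>. t\<^sup>2 - (2 * t) * cmod (f x) + (cmod (f x))\<^sup>2)"
      by (intro Bochner_Integration.integral_cong) (auto simp: power2_eq_square algebra_simps)
    also have "\<dots> = t\<^sup>2 - 2 * t * (LINT x|\<mu>. cmod (f x)) + (LINT x|\<mu>. (cmod (f x))\<^sup>2)"
      using assms prob_space by simp
    finally show ?thesis by (simp add: algebra_simps)
  qed
  then have "(LINT x|\<mu>. cmod (f x))\<^sup>2 \<le> 1 * (LINT x|\<mu>. (cmod (f x))\<^sup>2)"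
    by (rule quadratic_discriminant_le) simp
  then show ?thesis by simp
qed

text \<open>Riesz representation by minimising \<open>\<parallel>a\<parallel>\<^sup>2 - 2 Re (L a)\<close> over the continuous functions: a fast minimising
  sequence converges in mean.\<close>

lemma L2_functional_representation:
  fixes L :: "('x \<Rightarrow>\<^sub>C complex) \<Rightarrow> complex"
  assumes lin: "clinear L" and bound: "\<And>a. (cmod (L a))\<^sup>2 \<le> (LINT x|\<mu>. (cmod (apply_bcontfun a x))\<^sup>2)"
  shows "\<exists>h s. integrable \<mu> h \<and> (\<forall>a. L a = (LINT x|\<mu>. apply_bcontfun a x * h x)) \<and>
    (\<lambda>n. LINT x|\<mu>. cmod (h x - apply_bcontfun (s n :: 'x \<Rightarrow>\<^sub>C complex) x)) \<longlonglongrightarrow> 0"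
proof -
  define n2 where "n2 a = (LINT x|\<mu>. (cmod (apply_bcontfun a x))\<^sup>2)" for a :: "'x \<Rightarrow>\<^sub>C complex"
  define ip where "ip a b = (LINT x|\<mu>. apply_bcontfun (star a * b) x)" for a b :: "'x \<Rightarrow>\<^sub>C complex"
  define J where "J a = n2 a - 2 * Re (L a)" for a
  have n2_nonneg: "0 \<le> n2 a" for a by (simp add: n2_def)
  have bound': "\<bar>Re (L a)\<bar> \<le> sqrt (n2 a)" for a
    using bound[of a] abs_Re_le_cmod[of "L a"] by (metis n2_def real_le_rsqrt order_trans)
  have n2_ip: "complex_of_real (n2 a) = ip a a" for a
  proof -
    have "apply_bcontfun (star a * a) x = complex_of_real ((cmod (apply_bcontfun a x))\<^sup>2)" for x
      unfolding times_bcontfun.rep_eq star_bcontfun.rep_eq star_complex_def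
      by (subst mult.commute) (rule complex_norm_square[symmetric])
    then have "apply_bcontfun (star a * a) = (\<lambda>x. complex_of_real ((cmod (apply_bcontfun a x))\<^sup>2))"
        by (rule ext)
    then show ?thesis unfolding n2_def ip_def by (simp only: integral_complex_of_real)
  qed
  have ip_lin: "ip a (b + c) = ip a b + ip a c" "ip (a + b) c = ip a c + ip b c"
    "ip a (r *\<^sub>C b) = r * ip a b" "ip (r *\<^sub>C a) b = cnj r * ip a b"
    "ip a (b - c) = ip a b - ip a c" "ip (a - b) c = ip a c - ip b c" for a b c r
    by (simp_all add: ip_def bcontfun_star_rep distrib_left distrib_right star_add star_scaleC star_diff
        star_complex_def scaleC_complex_def left_diff_distrib right_diff_distrib
        Bochner_Integration.integral_add Bochner_Integration.integral_diff mult.assoc mult.left_commute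
        integrable_bcontfun[of "star _ * _", unfolded bcontfun_star_rep star_complex_def])
  have ip_cnj: "ip b a = cnj (ip a b)" for a b
    unfolding ip_def
    by (subst Bochner_Integration.integral_cnj[symmetric])
      (simp add: bcontfun_star_rep star_complex_def mult.commute del: Bochner_Integration.integral_cnj)
  \<comment> \<open>Restricting the functional to a line gives a quadratic whose linear coefficient
    is the defect \<open>Re (L b) - Re (ip a b)\<close>.\<close>
  have J_expand: "J (a + complex_of_real t *\<^sub>C b) = n2 b * t\<^sup>2 - 2 * (Re (L b) - Re (ip a b)) * t + J a"
      for a b t
  proof -
    have "complex_of_real (n2 (a + complex_of_real t *\<^sub>C b)) =
      complex_of_real (n2 a) + t * (ip a b + cnj (ip a b)) + complex_of_real (t\<^sup>2 * n2 b)"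
      unfolding n2_ip of_real_mult by (simp add: ip_lin ip_cnj[of b a] algebra_simps power2_eq_square)
    also have "\<dots> = complex_of_real (n2 a + t * (2 * Re (ip a b)) + t\<^sup>2 * n2 b)"
      by (simp add: complex_add_cnj)
    finally have "n2 (a + complex_of_real t *\<^sub>C b) = n2 a + t * (2 * Re (ip a b)) + t\<^sup>2 * n2 b"
      by (simp only: of_real_eq_iff)
    then show ?thesis
      by (simp add: J_def clinearD[OF lin] scaleC_complex_def algebra_simps)
  qed
  define m where "m = Inf (range J)"
  have "-1 \<le> J a" for a
  proof -
    have "0 \<le> (sqrt (n2 a) - 1)\<^sup>2" by simp
    also have "\<dots> = n2 a - 2 * sqrt (n2 a) + 1" using n2_nonneg[of a]
        by (simp add: power2_eq_square algebra_simps)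
    finally show ?thesis using bound'[of a] unfolding J_def by linarith
  qed
  then have bdd: "bdd_below (range J)" by (intro bdd_belowI2[where m = "-1"])
  have mJ: "m \<le> J a" for a unfolding m_def using bdd by (intro cInf_lower) auto
  have "\<exists>a. J a < m + (1/4) ^ n" for n :: nat
    using cInf_lessD[of "range J" "m + (1/4) ^ n"] unfolding m_def by auto
  \<comment> \<open>Through the discriminant the rate \<open>(1/4)^n\<close> becomes
    \<open>(1/2)^n\<close> for the defect, and hence for the distance of consecutive terms, which
    must be summable.\<close>
  then obtain a where a: "\<And>n. J (a n) < m + (1/4) ^ n" by metis
  have D: "\<bar>Re (L b) - Re (ip (a n) b)\<bar> \<le> sqrt (n2 b) * (1/2) ^ n" for b n
  proof -
    have "(Re (L b) - Re (ip (a n) b))\<^sup>2 \<le> n2 b * (1/4) ^ n"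
    proof (rule quadratic_discriminant_le)
      show "0 \<le> n2 b * t\<^sup>2 - 2 * (Re (L b) - Re (ip (a n) b)) * t + (1/4) ^ n" for t
        using J_expand[of "a n" t b] mJ[of "a n + complex_of_real t *\<^sub>C b"] a[of n] by linarith
    qed (rule n2_nonneg)
    also have "(1/4 :: real) ^ n = ((1/2) ^ n)\<^sup>2" by (simp add: power_mult_distrib[symmetric]
        power2_eq_square)
    finally have "\<bar>Re (L b) - Re (ip (a n) b)\<bar> \<le> sqrt (n2 b * ((1/2) ^ n)\<^sup>2)" 
      by (intro real_le_rsqrt) (simp only: power2_abs)
    then show ?thesis by (simp add: real_sqrt_mult)
  qed
  have lim: "(\<lambda>n. ip (a n) b) \<longlonglongrightarrow> L b" for b
  proof -
    have z: "(\<lambda>n. sqrt (n2 b) * (1/2) ^ n) \<longlonglongrightarrow> 0" for b by (intro tendsto_mult_right_zero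
        LIMSEQ_power_zero) simp
    have re: "(\<lambda>n. Re (ip (a n) b)) \<longlonglongrightarrow> Re (L b)" for b
      by (rule LIM_zero_cancel, rule Lim_null_comparison[OF _ z[of b]]) (use D in \<open>auto simp:
          abs_minus_commute\<close>)
    \<comment> \<open>Replacing \<open>b\<close> by \<open>\<i> b\<close> turns the real part into
      the imaginary part up to sign.\<close>
    have "(\<lambda>n. Im (ip (a n) b)) \<longlonglongrightarrow> Im (L b)"
      using tendsto_minus[OF re[of "\<i> *\<^sub>C b"]] by (simp add: ip_lin clinearD[OF lin] scaleC_complex_def)
    with re[of b] show ?thesis by (simp add: tendsto_complex_iff)
  qed
  define d where "d n = a (Suc n) - a n" for n
  have d2: "sqrt (n2 (d n)) \<le> 2 * (1/2) ^ n" for n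
  proof -
    have "n2 (d n) = Re (ip (d n) (d n))" by (metis n2_ip Re_complex_of_real)
    also have "\<dots> = Re (ip (a (Suc n)) (d n)) - Re (ip (a n) (d n))" by (simp add: d_def ip_lin)
    also have "\<dots> \<le> sqrt (n2 (d n)) * (1/2) ^ n + sqrt (n2 (d n)) * (1/2) ^ Suc n"
      using D[of "d n" n] D[of "d n" "Suc n"] by linarith
    also have "\<dots> \<le> sqrt (n2 (d n)) * (2 * (1/2) ^ n)" using n2_nonneg[of "d n"] by simp
    finally have "sqrt (n2 (d n)) * sqrt (n2 (d n)) \<le> sqrt (n2 (d n)) * (2 * (1/2) ^ n)"
      using n2_nonneg[of "d n"] by simp
    moreover have "0 < sqrt (n2 (d n)) \<or> n2 (d n) = 0" using n2_nonneg[of "d n"] by auto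
    ultimately show ?thesis by (auto simp only: mult_le_cancel_left_pos real_sqrt_zero) simp
  qed
  \<comment> \<open>\<open>ip\<close> conjugates its first argument, whereas the representing
    integral is bilinear. So the density is the limit of \<open>star (a n)\<close>, and
    \<open>v\<close> collects its increments.\<close>
  define v where "v n = star (d n)" for n
  have v1: "(LINT x|\<mu>. cmod (apply_bcontfun (v n) x)) \<le> 2 * (1/2) ^ n" for n
  proof -
    have "(LINT x|\<mu>. cmod (apply_bcontfun (v n) x)) = (LINT x|\<mu>. cmod (apply_bcontfun (d n) x))"
      by (simp add: v_def star_bcontfun.rep_eq star_complex_def)
    also have "\<dots> \<le> sqrt (n2 (d n))"
      unfolding n2_def by (intro real_le_rsqrt L1_le_L2 integrable_bcontfun integrable_square_bcontfun)
    finally show ?thesis using d2[of n] by simp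
  qed
  have geo: "summable (\<lambda>n. 2 * (1/2 :: real) ^ n)" by (intro summable_mult summable_geometric) simp
  have sv: "summable (\<lambda>n. LINT x|\<mu>. cmod (apply_bcontfun (v n) x))"
    by (rule summable_comparison_test'[OF geo]) (use v1 in auto)
  note ae = AE_summable_of_integrals[OF integrable_bcontfun sv]
  define h where "h x = apply_bcontfun (star (a 0)) x + (\<Sum>n. apply_bcontfun (v n) x)" for x
  have part: "star (a 0) + (\<Sum>n<k. v n) = star (a k)" for k
    by (induction k) (simp_all add: v_def d_def star_diff add.assoc[symmetric] del: add_diff_eq)
  have int_h: "integrable \<mu> h"
    unfolding h_def by (intro Bochner_Integration.integrable_add integrable_bcontfun integrable_suminf
        ae sv)
  have "L b = (LINT x|\<mu>. apply_bcontfun b x * h x)" for b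
  proof -
    have norm_le: "(LINT x|\<mu>. cmod (apply_bcontfun (b * v n) x)) \<le>
        norm b * (LINT x|\<mu>. cmod (apply_bcontfun (v n) x))" for n
    proof -
      have "(LINT x|\<mu>. cmod (apply_bcontfun (b * v n) x)) \<le>
          (LINT x|\<mu>. norm b * cmod (apply_bcontfun (v n) x))"
        by (intro integral_mono integrable_norm integrable_mult_right integrable_bcontfun)
          (simp add: times_bcontfun.rep_eq norm_mult mult_right_mono norm_bounded)
      then show ?thesis by simp
    qed
    have "(\<lambda>n. LINT x|\<mu>. apply_bcontfun (b * v n) x) sums (LINT x|\<mu>. (\<Sum>n. apply_bcontfun (b * v n) x))"
    proof (rule sums_integral)
      show "AE x in \<mu>. summable (\<lambda>n. norm (apply_bcontfun (b * v n) x))"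
        using ae by eventually_elim (simp add: times_bcontfun.rep_eq norm_mult summable_mult)
      show "summable (\<lambda>n. LINT x|\<mu>. norm (apply_bcontfun (b * v n) x))"
        by (rule summable_comparison_test'[OF summable_mult[OF sv, of "norm b"]]) (use norm_le in auto)
    qed (rule integrable_bcontfun)
    also have "(LINT x|\<mu>. (\<Sum>n. apply_bcontfun (b * v n) x)) =
        (LINT x|\<mu>. apply_bcontfun b x * h x - apply_bcontfun (b * star (a 0)) x)"
    proof (rule integral_cong_AE)
      show "AE x in \<mu>. (\<Sum>n. apply_bcontfun (b * v n) x) =
          apply_bcontfun b x * h x - apply_bcontfun (b * star (a 0)) x"
        using ae
      proof eventually_elim
        fix x assume "summable (\<lambda>n. cmod (apply_bcontfun (v n) x))"
        then have "summable (\<lambda>n. apply_bcontfun (v n) x)" by (rule summable_norm_cancel)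
        from suminf_mult[OF this, of "apply_bcontfun b x"]
        show "(\<Sum>n. apply_bcontfun (b * v n) x) = apply_bcontfun b x * h x - apply_bcontfun (b * star (a
            0)) x"
          by (simp add: times_bcontfun.rep_eq h_def distrib_left)
      qed
    qed (intro borel_measurable_suminf bcontfun_measurable borel_measurable_diff borel_measurable_times
        borel_measurable_integrable[OF int_h])+
    also have "\<dots> = (LINT x|\<mu>. apply_bcontfun b x * h x) - ip (a 0) b"
      using integrable_mult_bcontfun[OF int_h] integrable_bcontfun
      by (simp add: ip_def mult.commute)
    finally have "(\<lambda>k. \<Sum>n<k. LINT x|\<mu>. apply_bcontfun (b * v n) x) \<longlonglongrightarrow>
        (LINT x|\<mu>. apply_bcontfun b x * h x) - ip (a 0) b"
      by (simp add: sums_def)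
    then have l: "(\<lambda>k. ip (a 0) b + (\<Sum>n<k. LINT x|\<mu>. apply_bcontfun (b * v n) x)) \<longlonglongrightarrow>
        ip (a 0) b + ((LINT x|\<mu>. apply_bcontfun b x * h x) - ip (a 0) b)"
      by (intro tendsto_add tendsto_const)
    have "ip (a 0) b + (\<Sum>n<k. LINT x|\<mu>. apply_bcontfun (b * v n) x) = ip (a k) b" for k
    proof (induction k)
      case (Suc k)
      have e: "(LINT x|\<mu>. apply_bcontfun (b * v k) x) = ip (a (Suc k)) b - ip (a k) b"
        unfolding ip_lin(6)[symmetric] by (simp add: ip_def v_def d_def mult.commute)
      show ?case by (simp add: e Suc[symmetric] del: Suc)
    qed simp
    then have "(\<lambda>k. ip (a k) b) \<longlonglongrightarrow> (LINT x|\<mu>. apply_bcontfun b x * h x)" using l by simp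
    then show ?thesis using lim LIMSEQ_unique by blast
  qed
  moreover have "(\<lambda>n. LINT x|\<mu>. cmod (h x - apply_bcontfun (star (a n)) x)) \<longlonglongrightarrow> 0"
  proof (rule Lim_null_comparison)
    \<comment> \<open>The constant 4 is the sum of the tail \<open>2 * (1/2)^(n + k)\<close> over
      \<open>n\<close>, in units of \<open>(1/2)^k\<close>.\<close>
    show "(\<lambda>k. 4 * (1/2 :: real) ^ k) \<longlonglongrightarrow> 0" by (intro tendsto_mult_right_zero LIMSEQ_power_zero) simp
    have "(LINT x|\<mu>. cmod (h x - apply_bcontfun (star (a k)) x)) \<le> 4 * (1/2) ^ k" for k
    proof -
      have svk: "summable (\<lambda>n. LINT x|\<mu>. cmod (apply_bcontfun (v (n + k)) x))"
        using sv by (rule summable_ignore_initial_segment)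
      have svk': "summable (\<lambda>n. LINT x|\<mu>. norm (cmod (apply_bcontfun (v (n + k)) x)))" using svk by simp
      have aek: "AE x in \<mu>. summable (\<lambda>n. norm (cmod (apply_bcontfun (v (n + k)) x)))"
        using ae by eventually_elim (auto intro: summable_ignore_initial_segment)
      have intk: "integrable \<mu> (\<lambda>x. cmod (apply_bcontfun (v (n + k)) x))" for n
        by (intro integrable_norm integrable_bcontfun)
      have "(LINT x|\<mu>. cmod (h x - apply_bcontfun (star (a k)) x)) \<le>
          (LINT x|\<mu>. (\<Sum>n. cmod (apply_bcontfun (v (n + k)) x)))"
      proof (rule integral_mono_AE)
        show "integrable \<mu> (\<lambda>x. cmod (h x - apply_bcontfun (star (a k)) x))"
          by (intro integrable_norm Bochner_Integration.integrable_diff int_h integrable_bcontfun)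
        show "integrable \<mu> (\<lambda>x. \<Sum>n. cmod (apply_bcontfun (v (n + k)) x))"
          by (rule integrable_suminf[OF intk aek svk'])
        show "AE x in \<mu>. cmod (h x - apply_bcontfun (star (a k)) x) \<le>
            (\<Sum>n. cmod (apply_bcontfun (v (n + k)) x))"
          using ae
        proof eventually_elim
          fix x assume s: "summable (\<lambda>n. cmod (apply_bcontfun (v n) x))"
          have "apply_bcontfun (star (a k)) x = apply_bcontfun (star (a 0)) x + (\<Sum>n<k. apply_bcontfun (v
              n) x)"
            by (simp add: part[of k, symmetric] plus_bcontfun.rep_eq apply_bcontfun_sum)
          moreover have "(\<Sum>n. apply_bcontfun (v n) x) =
              (\<Sum>n. apply_bcontfun (v (n + k)) x) + (\<Sum>n<k. apply_bcontfun (v n) x)"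
            by (rule suminf_split_initial_segment[OF summable_norm_cancel[OF s]])
          ultimately have "h x - apply_bcontfun (star (a k)) x = (\<Sum>n. apply_bcontfun (v (n + k)) x)"
            unfolding h_def by (simp only:) simp
          then show "cmod (h x - apply_bcontfun (star (a k)) x) \<le> (\<Sum>n. cmod (apply_bcontfun (v (n + k)) x))"
            by (simp only: summable_norm[OF summable_ignore_initial_segment[OF s, of k]])
        qed
      qed
      also have "\<dots> = (\<Sum>n. LINT x|\<mu>. cmod (apply_bcontfun (v (n + k)) x))"
        by (rule integral_suminf[OF intk aek svk'])
      also have "\<dots> \<le> (\<Sum>n. 2 * (1/2) ^ (n + k))"
        by (intro suminf_le v1 svk summable_ignore_initial_segment[OF geo])
      also have "\<dots> = 4 * (1/2) ^ k"
      proof -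
        have "(\<lambda>n. 2 * (1/2) ^ k * (1/2) ^ n) sums (2 * (1/2) ^ k * (1 / (1 - 1/2 :: real)))"
          by (intro sums_mult geometric_sums) simp
        then show ?thesis by (simp add: power_add sums_iff mult.commute mult.left_commute)
      qed
      finally show ?thesis .
    qed
    then show "\<forall>\<^sub>F n in sequentially. norm (LINT x|\<mu>. cmod (h x - apply_bcontfun (star (a n)) x)) \<le>
        4 * (1/2) ^ n"
      by (intro always_eventually allI) simp
  qed
  ultimately show ?thesis using int_h by (intro exI[of _ h] exI[of _ "\<lambda>n. star (a n)"]) blast
qed

text \<open>A by-product of the Riesz construction: the functional
  \<open>a \<mapsto> \<integral> a f\<close> is represented by some \<open>h\<close> that is a limit
  in mean of continuous functions, and \<open>h = f\<close> almost everywhere since both represent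
  it.\<close>

lemma bcontfun_dense_L1:
  fixes f :: "'x \<Rightarrow> complex"
  assumes f: "f \<in> borel_measurable \<mu>" "AE x in \<mu>. cmod (f x) \<le> 1"
  obtains s :: "nat \<Rightarrow> ('x \<Rightarrow>\<^sub>C complex)"
    where "(\<lambda>n. LINT x|\<mu>. cmod (f x - apply_bcontfun (s n) x)) \<longlonglongrightarrow> 0"
proof -
  have int: "integrable \<mu> f" using f by (intro integrable_const_bound[where B = 1])
  note inta = integrable_mult_bcontfun[OF int]
  have sq: "(cmod (LINT x|\<mu>. apply_bcontfun a x * f x))\<^sup>2 \<le> (LINT x|\<mu>. (cmod (apply_bcontfun a x))\<^sup>2)" for a
  proof -
    have "cmod (LINT x|\<mu>. apply_bcontfun a x * f x) \<le> (LINT x|\<mu>. cmod (apply_bcontfun a x * f x))"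
      by (rule integral_norm_bound)
    also have "\<dots> \<le> (LINT x|\<mu>. cmod (apply_bcontfun a x))"
    proof (rule integral_mono_AE)
      show "AE x in \<mu>. cmod (apply_bcontfun a x * f x) \<le> cmod (apply_bcontfun a x)"
        using f(2) by eventually_elim (simp add: norm_mult mult_right_le_one_le)
    qed (intro integrable_norm inta integrable_bcontfun)+
    finally have "(cmod (LINT x|\<mu>. apply_bcontfun a x * f x))\<^sup>2 \<le> (LINT x|\<mu>. cmod (apply_bcontfun a x))\<^sup>2"
      by (rule power_mono) simp
    also have "\<dots> \<le> (LINT x|\<mu>. (cmod (apply_bcontfun a x))\<^sup>2)"
      by (intro L1_le_L2 integrable_bcontfun integrable_square_bcontfun)
    finally show ?thesis .
  qed
  have lin: "clinear (\<lambda>a. LINT x|\<mu>. apply_bcontfun a x * f x)"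
    unfolding clinear_def using inta
    by (simp add: plus_bcontfun.rep_eq scaleC_bcontfun.rep_eq scaleC_complex_def distrib_right mult.assoc)
  obtain h s where hs: "integrable \<mu> h" "\<And>a. (LINT x|\<mu>. apply_bcontfun a x * f x) =
      (LINT x|\<mu>. apply_bcontfun a x * h x)"
    "(\<lambda>n. LINT x|\<mu>. cmod (h x - apply_bcontfun (s n) x)) \<longlonglongrightarrow> 0"
    using L2_functional_representation[OF lin sq] by blast
  have "AE x in \<mu>. f x - h x = 0"
    by (rule AE_zero) (use int hs inta integrable_mult_bcontfun[OF hs(1)] in \<open>auto simp:
        right_diff_distrib\<close>)
  then have "AE x in \<mu>. f x = h x" by simp
  then have "(LINT x|\<mu>. cmod (f x - apply_bcontfun (s n) x)) =
      (LINT x|\<mu>. cmod (h x - apply_bcontfun (s n) x))" for n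
    using borel_measurable_integrable[OF hs(1)] f(1) bcontfun_measurable[of "s n"]
    by (intro integral_cong_AE) auto
  then show ?thesis using hs(3) that[of s] by simp
qed

end

section \<open>Trigonometric polynomials in a unitary\<close>

lemma sum_roots_of_unity:
  assumes "0 < n"
  shows "(\<Sum>m<n. cis (2 * pi * real m / real n) powi k) = (if int n dvd k then of_nat n else 0)"
proof -
  define w where "w = cis (2 * pi * (of_int k / real n))"
  have pw: "cis (2 * pi * real m / real n) powi k = w ^ m" for m
    unfolding w_def cis_power_int Complex.DeMoivre by (simp add: algebra_simps)
  show ?thesis
  proof (cases "int n dvd k")
    case True
    then obtain j where "k = int n * j" by (elim dvdE)
    then have "w = 1" using assms by (simp add: w_def)
    then show ?thesis using True by (simp add: pw)
  next
    case False
    have "w \<noteq> 1"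
    proof
      assume "w = 1"
      then have "cos (2 * pi * (of_int k / real n)) = 1" by (metis w_def cis.sel(1) one_complex.sel(1))
      then obtain j :: int where "2 * pi * (of_int k / real n) = of_int j * 2 * pi"
          using cos_one_2pi_int by blast
      then have "(2 * pi) * (of_int k / real n) = (2 * pi) * of_int j" by (simp only: mult_ac)
      then have "of_int k / real n = (of_int j :: real)" by (simp only: mult_cancel_left) simp
      then have "of_int k = (of_int (j * int n) :: real)" using assms by (simp add: field_simps)
      then have "k = j * int n" by (simp only: of_int_eq_iff)
      then show False using False by simp
    qed
    moreover have "w ^ n = 1"
    proof -
      have "w ^ n = cis (2 * pi * of_int k)" using assms by (simp add: w_def Complex.DeMoivre algebra_simps)
      also have "\<dots> = 1" by (rule cis_multiple_2pi) simp
      finally show ?thesis .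
    qed
    ultimately show ?thesis using False by (simp add: pw sum_gp_strict)
  qed
qed

text \<open>Trigonometric polynomials are treated as the algebraic crossed product of the complex
  numbers by the identity, so the rules for products and adjoints are those of covariant
  pairs.\<close>

abbreviation trig_poly :: "(int \<Rightarrow> complex) \<Rightarrow> complex \<Rightarrow> complex"
  where "trig_poly c z \<equiv> alg_rep (\<lambda>a. a) z c"

abbreviation poly_unitary :: "(int \<Rightarrow> complex) \<Rightarrow> 'b::cstar_algebra \<Rightarrow> 'b"
  where "poly_unitary c U \<equiv> alg_rep (\<lambda>r. r *\<^sub>C 1) U c"

lemma star_aut_id: "star_aut (id :: 'a::cstar_algebra \<Rightarrow> 'a)"
  by unfold_locales (simp add: star_automorphism_def unital_star_hom_id)

lemma covariant_circle: "cmod z = 1 \<Longrightarrow> covariant id (\<lambda>a. a) z"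
  by (intro covariant.intro star_aut_id, unfold_locales)
    (simp add: covariant_pair_def unital_star_hom_id[unfolded id_def] unitary_complex,
      simp add: star_complex_def complex_norm_square[symmetric] mult.commute mult.left_commute)

lemma covariant_scalars: "unitary U \<Longrightarrow> covariant id (\<lambda>r. r *\<^sub>C (1 :: 'b::cstar_algebra)) U"
  by (intro covariant.intro star_aut_id, unfold_locales)
    (auto simp: covariant_pair_def unital_star_hom_def clinear_def scaleC_add_left scaleC_scaleC
        scaleC_complex_def
      mult_scaleC_left mult_scaleC_right star_scaleC star_complex_def unitary_def mult.commute)

text \<open>Discrete Fourier inversion over the \<open>n\<close>-th roots of unity. Here
  \<open>n\<close> exceeds every \<open>|j - k|\<close> with \<open>j\<close> in the support, so no
  other index is congruent to \<open>k\<close> and the average isolates \<open>c k\<close>.\<close>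

lemma trig_poly_coeff_le:
  assumes c: "alg_elem c" and M: "\<And>z. cmod z = 1 \<Longrightarrow> cmod (trig_poly c z) \<le> M"
  shows "cmod (c k) \<le> M"
proof -
  let ?F = "{n. c n \<noteq> 0}"
  have fin: "finite ?F" using c by (simp add: alg_elem_def)
  define B where "B = Max (insert 0 ((\<lambda>n. \<bar>n - k\<bar>) ` ?F))"
  define n where "n = nat B + 1"
  have n: "0 < n" by (simp add: n_def)
  have B: "\<bar>j - k\<bar> < int n" if "j \<in> ?F" for j
  proof -
    have "\<bar>j - k\<bar> \<le> B" unfolding B_def using fin that by (intro Max_ge) auto
    moreover have "0 \<le> B" unfolding B_def using fin by (intro Max_ge) auto
    ultimately show ?thesis by (simp add: n_def)
  qed
  define \<zeta> where "\<zeta> m = cis (2 * pi * real m / real n)" for m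
  have z: "\<zeta> m \<noteq> 0" "cmod (\<zeta> m) = 1" for m by (simp_all add: \<zeta>_def)
  have "(\<Sum>m<n. trig_poly c (\<zeta> m) * \<zeta> m powi (- k)) = (\<Sum>m<n. \<Sum>j\<in>?F. c j * \<zeta> m powi (j - k))"
    unfolding alg_rep_def id_def sum_distrib_right
    by (intro sum.cong refl) (simp add: upow_complex z power_int_diff power_int_minus field_simps)
  also have "\<dots> = (\<Sum>j\<in>?F. c j * (\<Sum>m<n. \<zeta> m powi (j - k)))"
    by (subst sum.swap) (simp add: sum_distrib_left)
  also have "\<dots> = (\<Sum>j\<in>?F. if j = k then c k * of_nat n else 0)"
  proof (intro sum.cong refl)
    fix j assume j: "j \<in> ?F"
    have "int n dvd j - k \<longleftrightarrow> j = k" using B[OF j] zdvd_imp_le[of "int n" "\<bar>j - k\<bar>"] by auto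
    then show "c j * (\<Sum>m<n. \<zeta> m powi (j - k)) = (if j = k then c k * of_nat n else 0)"
      unfolding \<zeta>_def sum_roots_of_unity[OF n] by simp
  qed
  also have "\<dots> = c k * of_nat n" using fin by (simp add: sum.delta)
  finally have "cmod (c k) * real n = cmod (\<Sum>m<n. trig_poly c (\<zeta> m) * \<zeta> m powi (- k))"
    by (simp add: norm_mult)
  also have "\<dots> \<le> (\<Sum>m<n. M)"
    by (rule order_trans[OF norm_sum], rule sum_mono) (simp add: norm_mult norm_power_int z M)
  finally show ?thesis using n by (simp add: mult.commute)
qed

text \<open>If \<open>s < r\<close>, then \<open>(s / r)^N\<close> decays exponentially and beats
  the linear factor \<open>N\<close>, here taken along powers of two.\<close>

lemma le_of_power_growth:
  fixes r s C :: real
  assumes r: "0 \<le> r" and s: "0 \<le> s" and le: "\<And>m. r ^ (2 ^ m) \<le> C * 2 ^ m * s ^ (2 ^ m)"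
  shows "r \<le> s"
proof (rule ccontr)
  assume "\<not> r \<le> s"
  then have rs: "s < r" by simp
  define x where "x = s / r"
  have x: "0 \<le> x" "x < 1" using rs s by (simp_all add: x_def)
  have one: "1 \<le> C * (real (2 ^ m) * x ^ (2 ^ m))" for m
  proof -
    have "0 < r ^ (2 ^ m)" using rs s by simp
    then have "1 \<le> C * 2 ^ m * s ^ (2 ^ m) / r ^ (2 ^ m)" using le[of m] by (simp add: pos_le_divide_eq)
    then show ?thesis by (simp add: x_def power_divide)
  qed
  have "(\<lambda>n. real n * x ^ n) \<longlonglongrightarrow> 0" using x by (intro powser_times_n_limit_0) simp
  moreover have "strict_mono (\<lambda>m. 2 ^ m :: nat)" by (rule strict_monoI) simp
  ultimately have "((\<lambda>n. real n * x ^ n) \<circ> (\<lambda>m. 2 ^ m)) \<longlonglongrightarrow> 0" by (rule LIMSEQ_subseq_LIMSEQ)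
  then have "(\<lambda>m. C * (real (2 ^ m) * x ^ (2 ^ m))) \<longlonglongrightarrow> C * 0"
    by (intro tendsto_mult tendsto_const) (simp add: comp_def)
  then have "1 \<le> C * 0" by (rule LIMSEQ_le_const) (use one in blast)
  then show False by simp
qed

text \<open>Von Neumann's inequality without functional calculus: the coefficients of the
  powers of \<open>q\<^sup>* q\<close> are bounded by powers of the supremum of \<open>q\<^sup>* q\<close>, while their number grows linearly.\<close>

lemma norm_poly_unitary_le:
  fixes U :: "'b::cstar_algebra"
  assumes U: "unitary U" and q: "alg_elem q" and M: "\<And>z. cmod z = 1 \<Longrightarrow> cmod (trig_poly q z) \<le> M"
  shows "norm (poly_unitary q U) \<le> M"
proof -
  interpret u: covariant id "\<lambda>r. r *\<^sub>C (1 :: 'b)" U by (rule covariant_scalars[OF U])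
  have M0: "0 \<le> M" using order_trans[OF norm_ge_zero M[of 1]] by simp
  define h0 where "h0 = alg_mult id (alg_star id q) q"
  \<comment> \<open>Repeated squaring: \<open>hs m\<close> stands for the power \<open>2^m\<close>
    of the positive element. These are the exponents at which the C*-identity computes the norm of a
    power of a selfadjoint element.\<close>
  define hs where "hs = rec_nat h0 (\<lambda>_ f. alg_mult id f f)"
  have hs: "hs 0 = h0" "hs (Suc m) = alg_mult id (hs m) (hs m)" for m by (simp_all add: hs_def)
  have e0: "alg_elem h0" unfolding h0_def by (intro u.alg_elem_mult u.alg_elem_star q)
  have e: "alg_elem (hs m)" for m by (induction m) (simp_all add: hs e0 u.alg_elem_mult)
  define y where "y = star (poly_unitary q U) * poly_unitary q U"
  have rep: "poly_unitary (hs m) U = y ^ (2 ^ m)" for m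
    by (induction m) (simp_all add: hs h0_def u.rep_mult u.rep_star u.alg_elem_star q e y_def mult_2
        power_add)
  have sy: "star (y ^ k) = y ^ k" for k
    by (simp add: star_power) (simp add: y_def star_mult star_star)
  have ny: "norm (y ^ (2 ^ m)) = norm y ^ (2 ^ m)" for m
  proof (induction m)
    case (Suc m)
    have "norm (y ^ (2 ^ Suc m)) = norm (star (y ^ (2 ^ m)) * y ^ (2 ^ m))"
        by (simp add: sy mult_2 power_add)
    also have "\<dots> = (norm y ^ (2 ^ m))\<^sup>2" by (simp add: norm_star_mult_self Suc)
    finally show ?case by (simp add: power_mult[symmetric] mult.commute)
  qed simp
  have bound: "cmod (trig_poly (hs m) z) \<le> (M\<^sup>2) ^ (2 ^ m)" if z: "cmod z = 1" for m z
  proof -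
    interpret c: covariant id "\<lambda>a. a" z by (rule covariant_circle[OF z])
    have "trig_poly (hs m) z = (star (trig_poly q z) * trig_poly q z) ^ (2 ^ m)"
      by (induction m) (simp_all add: hs h0_def c.rep_mult c.rep_star u.alg_elem_star q e mult_2 power_add)
    then have "cmod (trig_poly (hs m) z) = ((cmod (trig_poly q z))\<^sup>2) ^ (2 ^ m)"
      by (simp add: norm_power norm_star_mult_self)
    also have "\<dots> \<le> (M\<^sup>2) ^ (2 ^ m)" by (intro power_mono M z) auto
    finally show ?thesis .
  qed
  obtain D :: nat where D: "{n. h0 n \<noteq> 0} \<subseteq> {- int D..int D}"
  proof -
    have "finite ((\<lambda>n. nat \<bar>n\<bar>) ` {n. h0 n \<noteq> 0})" using e0 by (simp add: alg_elem_def)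
    then obtain D where "\<forall>x\<in>(\<lambda>n. nat \<bar>n\<bar>) ` {n. h0 n \<noteq> 0}. x \<le> D" using finite_nat_set_iff_bounded_le
        by blast
    then have "{n. h0 n \<noteq> 0} \<subseteq> {- int D..int D}" by force
    then show ?thesis by (rule that)
  qed
  \<comment> \<open>Squaring doubles the width of the support. With the uniform bound on the
    coefficients this gives the growth \<open>C * 2^m\<close> that \<open>le_of_power_growth\<close>
    tolerates.\<close>
  have supp: "{n. hs m n \<noteq> 0} \<subseteq> {- int (D * 2 ^ m)..int (D * 2 ^ m)}" for m
  proof (induction m)
    case (Suc m)
    show ?case
    proof
      fix n assume "n \<in> {n. hs (Suc m) n \<noteq> 0}"
      then have "n \<in> (\<lambda>(i, j). i + j) ` ({n. hs m n \<noteq> 0} \<times> {n. hs m n \<noteq> 0})"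
        using u.alg_mult_supp[OF e[of m] e[of m]] by (auto simp: hs)
      then obtain i j where "n = i + j" "i \<in> {n. hs m n \<noteq> 0}" "j \<in> {n. hs m n \<noteq> 0}" by auto
      moreover from this Suc have "i \<in> {- int (D * 2 ^ m)..int (D * 2 ^ m)}" "j \<in> {- int (D * 2 ^
          m)..int (D * 2 ^ m)}"
        by blast+
      ultimately show "n \<in> {- int (D * 2 ^ Suc m)..int (D * 2 ^ Suc m)}" by simp
    qed
  qed (simp add: hs D)
  have "norm y ^ (2 ^ m) \<le> real (2 * D + 1) * 2 ^ m * (M\<^sup>2) ^ (2 ^ m)" for m
  proof -
    let ?S = "{- int (D * 2 ^ m)..int (D * 2 ^ m)}"
    have "norm y ^ (2 ^ m) = norm (poly_unitary (hs m) U)" by (simp add: rep ny)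
    also have "\<dots> = norm (\<Sum>n\<in>?S. (hs m n *\<^sub>C 1) * upow U n)" by (subst u.rep_superset[OF _ supp[of m]]) auto
    also have "\<dots> \<le> (\<Sum>n\<in>?S. (M\<^sup>2) ^ (2 ^ m))"
    proof (rule order_trans[OF norm_sum], rule sum_mono)
      fix n
      show "norm ((hs m n *\<^sub>C 1) * upow U n) \<le> (M\<^sup>2) ^ (2 ^ m)"
        using trig_poly_coeff_le[OF e bound, of m n] by (simp add: mult_scaleC_left norm_scaleC U)
    qed
    also have "\<dots> = (2 * real D * 2 ^ m + 1) * (M\<^sup>2) ^ (2 ^ m)" by (simp add: of_nat_diff algebra_simps)
    also have "\<dots> \<le> (2 * real D * 2 ^ m + 2 ^ m) * (M\<^sup>2) ^ (2 ^ m)" by (intro mult_right_mono) auto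
    finally show ?thesis by (simp add: algebra_simps)
  qed
  then have "norm y \<le> M\<^sup>2" by (rule le_of_power_growth[rotated 2]) simp_all
  then have "(norm (poly_unitary q U))\<^sup>2 \<le> M\<^sup>2" by (simp add: y_def norm_star_mult_self)
  then show ?thesis using M0 by (rule power2_le_imp_le)
qed

lemma trig_poly_single: "cmod z = 1 \<Longrightarrow> trig_poly (alg_single k a) z = a * z powi k"
  using covariant.rep_single[OF covariant_circle] by (simp add: upow_complex)

section \<open>Uniform density of trigonometric polynomials on the circle\<close>

definition is_trig :: "(complex \<Rightarrow> complex) \<Rightarrow> bool"
  where "is_trig g \<longleftrightarrow> (\<exists>c. alg_elem c \<and> (\<forall>z. cmod z = 1 \<longrightarrow> g z = trig_poly c z))"

lemma is_trig_power: "is_trig (\<lambda>z. a * z powi k)"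
  unfolding is_trig_def by (intro exI[of _ "alg_single k a"]) (simp add: alg_elem_single trig_poly_single)

lemma is_trig_add:
  assumes "is_trig f" "is_trig g" shows "is_trig (\<lambda>z. f z + g z)"
proof -
  obtain c d where "alg_elem c" "\<forall>z. cmod z = 1 \<longrightarrow> f z = trig_poly c z" "alg_elem d" "\<forall>z. cmod z =
      1 \<longrightarrow> g z = trig_poly d z"
    using assms unfolding is_trig_def by blast
  then show ?thesis unfolding is_trig_def
    by (intro exI[of _ "\<lambda>n. c n + d n"]) (simp add: alg_elem_add covariant.rep_add[OF covariant_circle])
qed

lemma is_trig_mult:
  assumes "is_trig f" "is_trig g" shows "is_trig (\<lambda>z. f z * g z)"
proof -
  obtain c d where "alg_elem c" "\<forall>z. cmod z = 1 \<longrightarrow> f z = trig_poly c z" "alg_elem d" "\<forall>z. cmod z =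
      1 \<longrightarrow> g z = trig_poly d z"
    using assms unfolding is_trig_def by blast
  then show ?thesis unfolding is_trig_def
    by (intro exI[of _ "alg_mult id c d"])
      (simp add: star_aut.alg_elem_mult[OF star_aut_id] covariant.rep_mult[OF covariant_circle])
qed

lemma is_trig_const: "is_trig (\<lambda>z. a)"
  using is_trig_power[of a 0] by simp

lemma is_trig_cong: "is_trig f \<Longrightarrow> (\<And>z. cmod z = 1 \<Longrightarrow> f z = g z) \<Longrightarrow> is_trig g"
  unfolding is_trig_def by metis

text \<open>On the circle \<open>cnj z\<close> is \<open>z powi (-1)\<close>, so a real-linear
  functional is a combination of these two powers with coefficients read off from its values at
  \<open>1\<close> and \<open>\<i>\<close>. Sums and products follow by induction.\<close>

lemma is_trig_real_polynomial:
  "real_polynomial_function p \<Longrightarrow> is_trig (\<lambda>z. complex_of_real (p z))"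
proof (induction p rule: real_polynomial_function.induct)
  case (linear f)
  have eq: "complex_of_real (f z) = (complex_of_real (f 1) - \<i> * complex_of_real (f \<i>)) / 2 * z powi 1 +
    (complex_of_real (f 1) + \<i> * complex_of_real (f \<i>)) / 2 * z powi (-1)" if z: "cmod z = 1" for z
  proof -
    have "f z = f (Re z *\<^sub>R 1 + Im z *\<^sub>R \<i>)" by (rule arg_cong[of _ _ f]) (simp add: complex_eq_iff)
    also have "\<dots> = Re z * f 1 + Im z * f \<i>"
      using linear by (simp add: bounded_linear.linear linear_add linear_scale del: complex_scaleR)
    finally have "complex_of_real (f z) = complex_of_real (Re z) * complex_of_real (f 1) +
        complex_of_real (Im z) * complex_of_real (f \<i>)" by simp
    moreover have "z powi (-1) = cnj z" using z by (simp add: cnj_eq_inverse power_int_minus)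
    ultimately show ?thesis by (simp only: power_int_1_right) (simp add: complex_eq_iff field_simps)
  qed
  show ?case
    by (rule is_trig_cong[OF is_trig_add[OF is_trig_power is_trig_power]]) (rule eq[symmetric])
qed (simp_all add: is_trig_const is_trig_add is_trig_mult)

lemma trig_poly_dense:
  fixes f :: "complex \<Rightarrow> complex"
  assumes f: "continuous_on (sphere 0 1) f" and e: "0 < e"
  shows "\<exists>c. alg_elem c \<and> (\<forall>z. cmod z = 1 \<longrightarrow> cmod (f z - trig_poly c z) < e)"
proof -
  obtain p where p: "real_polynomial_function p" "\<And>z. z \<in> sphere 0 1 \<Longrightarrow> \<bar>Re (f z) - p z\<bar> < e / 2"
    using Stone_Weierstrass_real_polynomial_function[of "sphere (0::complex) 1" "\<lambda>z. Re (f z)" "e / 2"] f e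
    by (auto intro: continuous_intros)
  obtain q where q: "real_polynomial_function q" "\<And>z. z \<in> sphere 0 1 \<Longrightarrow> \<bar>Im (f z) - q z\<bar> < e / 2"
    using Stone_Weierstrass_real_polynomial_function[of "sphere (0::complex) 1" "\<lambda>z. Im (f z)" "e / 2"] f e
    by (auto intro: continuous_intros)
  have "is_trig (\<lambda>z. complex_of_real (p z) + \<i> * complex_of_real (q z))"
    by (intro is_trig_add is_trig_mult is_trig_const is_trig_real_polynomial p q)
  then obtain c where c: "alg_elem c" "\<And>z. cmod z = 1 \<Longrightarrow>
      complex_of_real (p z) + \<i> * complex_of_real (q z) = trig_poly c z"
    unfolding is_trig_def by blast
  have "cmod (f z - trig_poly c z) < e" if z: "cmod z = 1" for z
  proof -
    have "cmod (f z - trig_poly c z) \<le> \<bar>Re (f z - trig_poly c z)\<bar> + \<bar>Im (f z - trig_poly c z)\<bar>"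
        by (rule cmod_le)
    also have "\<dots> = \<bar>Re (f z) - p z\<bar> + \<bar>Im (f z) - q z\<bar>" by (simp add: c(2)[OF z, symmetric])
    also have "\<dots> < e" using p(2)[of z] q(2)[of z] z by simp
    finally show ?thesis .
  qed
  then show ?thesis using c(1) by blast
qed

section \<open>Measures on the circle\<close>

abbreviation "circle \<equiv> sphere (0::complex) 1"

locale circle_measure =
  fixes \<mu> :: "complex measure"
  assumes P: "\<mu> \<in> prob_measures circle"
begin

sublocale prob_space \<mu>
  using P by (simp add: prob_measures_def)

lemma sets_circle: "sets \<mu> = sets (restrict_space borel circle)"
  using P by (simp add: prob_measures_def)

lemma space_circle: "space \<mu> = circle"
  using sets_eq_imp_space_eq[OF sets_circle] by (simp add: space_restrict_space)

lemma continuous_measurable: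
  fixes f :: "complex \<Rightarrow> 'b::topological_space"
  assumes "continuous_on circle f"
  shows "f \<in> borel_measurable \<mu>"
  using borel_measurable_continuous_on_restrict[OF assms] measurable_cong_sets[OF sets_circle refl] by blast

lemma continuous_integrable:
  fixes f :: "complex \<Rightarrow> 'b::{banach, second_countable_topology}"
  assumes f: "continuous_on circle f"
  shows "integrable \<mu> f"
proof -
  have "compact (f ` circle)" using f by (intro compact_continuous_image) auto
  then obtain B where "\<And>z. z \<in> circle \<Longrightarrow> norm (f z) \<le> B" by (meson compact_imp_bounded bounded_iff imageI)
  then show ?thesis using continuous_measurable[OF f] space_circle
    by (intro integrable_const_bound[where B = B]) auto
qed

lemma continuous_powi: "continuous_on circle (\<lambda>z. z powi k)"
  by (intro continuous_intros) auto

lemma integral_powi_minus: "(LINT z|\<mu>. z powi (- k)) = cnj (LINT z|\<mu>. z powi k)"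
proof -
  have "(LINT z|\<mu>. z powi (- k)) = (LINT z|\<mu>. cnj (z powi k))"
  proof (rule Bochner_Integration.integral_cong[OF refl])
    fix z assume "z \<in> space \<mu>"
    then have z: "cmod z = 1" by (simp add: space_circle)
    have "cmod (z powi k) = 1" by (simp add: norm_power_int z)
    then show "z powi (- k) = cnj (z powi k)" by (simp only: power_int_minus cnj_eq_inverse)
  qed
  then show ?thesis by (simp only: Bochner_Integration.integral_cnj)
qed

lemma integral_trig_poly:
  "(LINT z|\<mu>. trig_poly c z) = (\<Sum>n | c n \<noteq> 0. c n * (LINT z|\<mu>. z powi n))"
proof -
  have "(LINT z|\<mu>. trig_poly c z) = (LINT z|\<mu>. (\<Sum>n | c n \<noteq> 0. c n * z powi n))"
    by (intro Bochner_Integration.integral_cong refl) (simp add: alg_rep_def space_circle upow_complex)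
  also have "\<dots> = (\<Sum>n | c n \<noteq> 0. c n * (LINT z|\<mu>. z powi n))"
    by (subst Bochner_Integration.integral_sum) (auto intro!: continuous_integrable continuous_on_mult
        continuous_on_const continuous_powi)
  finally show ?thesis .
qed

lemma continuous_trig_poly: "continuous_on circle (trig_poly c)"
proof -
  have "continuous_on circle (\<lambda>z. \<Sum>n | c n \<noteq> 0. c n * z powi n)"
    by (intro continuous_on_sum continuous_on_mult continuous_on_const continuous_powi)
  then show ?thesis by (rule continuous_on_eq) (simp add: alg_rep_def upow_complex)
qed

lemma integral_trig_poly_approx:
  assumes f: "continuous_on circle f" and c: "\<And>z. cmod z = 1 \<Longrightarrow> cmod (f z - trig_poly c z) \<le> e"
  shows "cmod ((LINT z|\<mu>. f z) - (LINT z|\<mu>. trig_poly c z)) \<le> e"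
proof -
  have d: "continuous_on circle (\<lambda>z. f z - trig_poly c z)"
    by (intro continuous_on_diff f continuous_trig_poly)
  have "(LINT z|\<mu>. f z) - (LINT z|\<mu>. trig_poly c z) = (LINT z|\<mu>. f z - trig_poly c z)"
    by (intro Bochner_Integration.integral_diff[symmetric] continuous_integrable f continuous_trig_poly)
  also have "cmod \<dots> \<le> (LINT z|\<mu>. cmod (f z - trig_poly c z))" by (rule integral_norm_bound)
  also have "\<dots> \<le> (LINT z|\<mu>. e)"
    by (intro integral_mono integrable_norm continuous_integrable d integrable_const) (simp add: c
        space_circle)
  finally show ?thesis using prob_space by simp
qed

end

text \<open>Conjugation supplies the moments of negative order, and trigonometric polynomials are
  uniformly dense. Only natural exponents are required, matching the conclusion of Herglotz's
  theorem.\<close>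

lemma circle_measure_eqI:
  assumes "\<mu> \<in> prob_measures circle" "\<nu> \<in> prob_measures circle"
    and mom: "\<And>k. (LINT z|\<mu>. z ^ k) = (LINT z|\<nu>. z ^ k)"
  shows "\<mu> = \<nu>"
proof -
  interpret m: circle_measure \<mu> by unfold_locales fact
  interpret n: circle_measure \<nu> by unfold_locales fact
  have "(LINT z|\<mu>. z powi k) = (LINT z|\<nu>. z powi k)" for k
  proof (cases "0 \<le> k")
    case True
    then show ?thesis using mom[of "nat k"] by (simp add: power_int_def)
  next
    case False
    then have "(LINT z|\<mu>. z powi (- k)) = (LINT z|\<nu>. z powi (- k))" using mom[of "nat (- k)"]
        by (simp add: power_int_def)
    then have "cnj (LINT z|\<mu>. z powi k) = cnj (LINT z|\<nu>. z powi k)"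
      by (simp only: m.integral_powi_minus n.integral_powi_minus)
    then show ?thesis by simp
  qed
  then have trig: "(LINT z|\<mu>. trig_poly c z) = (LINT z|\<nu>. trig_poly c z)" for c
    by (simp add: m.integral_trig_poly n.integral_trig_poly)
  have eq: "(LINT z|\<mu>. f z) = (LINT z|\<nu>. f z)" if f: "continuous_on circle f" for f :: "complex \<Rightarrow> complex"
  proof -
    have "dist (LINT z|\<mu>. f z) (LINT z|\<nu>. f z) \<le> 0"
    proof (rule field_le_epsilon)
      fix e :: real assume "0 < e"
      then obtain c where c: "\<And>z. cmod z = 1 \<Longrightarrow> cmod (f z - trig_poly c z) < e / 2"
        using trig_poly_dense[OF f, of "e / 2"] by auto
      then have c': "cmod (f z - trig_poly c z) \<le> e / 2" if "cmod z = 1" for z using that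
          by (simp add: less_imp_le)
      have "dist (LINT z|\<mu>. f z) (LINT z|\<mu>. trig_poly c z) \<le>
          e / 2" "dist (LINT z|\<nu>. f z) (LINT z|\<nu>. trig_poly c z) \<le> e / 2"
        unfolding dist_norm using m.integral_trig_poly_approx[OF f c'] n.integral_trig_poly_approx[OF f
            c'] by auto
      then show "dist (LINT z|\<mu>. f z) (LINT z|\<nu>. f z) \<le> 0 + e"
        unfolding trig using dist_triangle2[of "LINT z|\<mu>. f z" "LINT z|\<nu>. f z" "LINT z|\<nu>. trig_poly c
            z"] by linarith
    qed
    then show ?thesis by simp
  qed
  show ?thesis
  proof (rule measure_eqI_continuous[where Z = circle])
    fix f :: "complex \<Rightarrow> real" assume "continuous_on UNIV f"
    then have "continuous_on circle (\<lambda>z. complex_of_real (f z))"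
      by (intro continuous_intros) (rule continuous_on_subset, auto)
    from eq[OF this] show "(LINT z|\<mu>. f z) = (LINT z|\<nu>. f z)"
        by (simp only: integral_complex_of_real of_real_eq_iff)
  qed (use m.sets_circle n.sets_circle m.finite_measure_axioms n.finite_measure_axioms in auto)
qed

section \<open>Convex combinations of probability measures\<close>

lemma sets_mix_measure [simp]: "sets (mix_measure t \<mu> \<nu>) = sets \<mu>"
  by (simp add: mix_measure_def sets.sets_measure_of_eq)

lemma space_mix_measure [simp]: "space (mix_measure t \<mu> \<nu>) = space \<mu>"
  by (simp add: mix_measure_def)

lemma prob_space_mix_measure:
  assumes "prob_space \<mu>" "prob_space \<nu>" "sets \<mu> = sets \<nu>" "t \<in> {0..1}"
  shows "prob_space (mix_measure t \<mu> \<nu>)"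
proof (rule prob_spaceI)
  have "emeasure (mix_measure t \<mu> \<nu>) (space \<mu>) = ennreal t * 1 + ennreal (1 - t) * 1"
    using prob_space.emeasure_space_1[OF assms(1)] prob_space.emeasure_space_1[OF assms(2)]
        sets_eq_imp_space_eq[OF assms(3)]
      sets.top[of \<mu>]
    by (subst emeasure_mix_measure[OF assms(3)]) auto
  also have "\<dots> = 1" using assms(4) by (simp add: ennreal_plus[symmetric] del: ennreal_plus)
  finally show "emeasure (mix_measure t \<mu> \<nu>) (space (mix_measure t \<mu> \<nu>)) = 1" by simp
qed

lemma nn_integral_mix_measure:
  assumes s: "sets \<mu> = sets \<nu>" and f: "f \<in> borel_measurable \<mu>"
  shows "(\<integral>\<^sup>+ x. f x \<partial>mix_measure t \<mu> \<nu>) = ennreal t * (\<integral>\<^sup>+ x. f x \<partial>\<mu>) + ennreal (1 - t) * (\<integral>\<^sup>+ x. f x \<partial>\<nu>)"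
  using f
proof (induction rule: borel_measurable_induct)
  case (cong f g)
  have "space \<nu> = space \<mu>" using sets_eq_imp_space_eq[OF s] by simp
  then show ?case using cong(3,4) by (simp cong: nn_integral_cong_simp)
next
  case (set A)
  then show ?case using s emeasure_mix_measure[OF s set] by simp
next
  case (mult u c)
  have m: "u \<in> borel_measurable (mix_measure t \<mu> \<nu>)" "u \<in> borel_measurable \<nu>"
    using mult(2) s by (auto cong: measurable_cong_sets)
  show ?case
    using mult m by (simp add: nn_integral_cmult distrib_left mult.left_commute)
next
  case (add u v)
  have m: "u \<in> borel_measurable (mix_measure t \<mu> \<nu>)" "u \<in> borel_measurable \<nu>"
    "v \<in> borel_measurable (mix_measure t \<mu> \<nu>)" "v \<in> borel_measurable \<nu>"
    using add s by (auto cong: measurable_cong_sets)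
  show ?case
    using add m by (simp add: nn_integral_add distrib_left ac_simps)
next
  case (seq U)
  have m: "U i \<in> borel_measurable (mix_measure t \<mu> \<nu>)" "U i \<in> borel_measurable \<nu>" for i
    using seq s by (auto cong: measurable_cong_sets)
  have inc: "incseq (\<lambda>i. \<integral>\<^sup>+ x. U i x \<partial>L)" for L
    using seq(3) by (intro incseq_SucI nn_integral_mono) (auto simp: incseq_def le_fun_def)
  have sup: "(\<integral>\<^sup>+ x. (SUP i. U i x) \<partial>L) = (SUP i. \<integral>\<^sup>+ x. U i x \<partial>L)" if "\<And>i. U i \<in> borel_measurable L" for L
    using seq(3) that by (intro nn_integral_monotone_convergence_SUP)
  have "(SUP i. U i) x = (SUP i. U i x)" for x by (rule SUP_apply)
  then show ?case
    using seq m inc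
    by (simp add: sup SUP_mult_left_ennreal[symmetric] ennreal_SUP_add incseq_def mult_left_mono)
qed

lemma mix_measure_circle:
  assumes "\<mu> \<in> prob_measures circle" "\<nu> \<in> prob_measures circle" "t \<in> {0..1}"
  shows "mix_measure t \<mu> \<nu> \<in> prob_measures circle"
  using assms by (auto simp: prob_measures_def intro!: prob_space_mix_measure)

text \<open>For nonnegative functions the formula is that of the unsigned integral. A bounded real
  function becomes nonnegative after adding a constant, which contributes equally on both sides as
  all masses are 1.\<close>

lemma integral_mix_measure:
  fixes f :: "complex \<Rightarrow> complex"
  assumes m: "\<mu> \<in> prob_measures circle" and n: "\<nu> \<in> prob_measures circle" and t: "t \<in> {0..1}"
    and f: "continuous_on circle f"
  shows "(LINT z|mix_measure t \<mu> \<nu>. f z) = t * (LINT z|\<mu>. f z) + (1 - t) * (LINT z|\<nu>. f z)"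
proof -
  interpret m: circle_measure \<mu> by unfold_locales fact
  interpret n: circle_measure \<nu> by unfold_locales fact
  interpret x: circle_measure "mix_measure t \<mu> \<nu>" by unfold_locales (rule mix_measure_circle[OF m n t])
  have s: "sets \<mu> = sets \<nu>" using m.sets_circle n.sets_circle by simp
  have nonneg: "(LINT z|mix_measure t \<mu> \<nu>. g z) = t * (LINT z|\<mu>. g z) + (1 - t) * (LINT z|\<nu>. g z)"
    if g: "continuous_on circle g" and pos: "\<And>z. z \<in> circle \<Longrightarrow> 0 \<le> g z" for g :: "complex \<Rightarrow> real"
  proof -
    have nn: "(\<integral>\<^sup>+ z. ennreal (g z) \<partial>L) = ennreal (LINT z|L. g z)" "0 \<le> (LINT z|L. g z)"
        if "L \<in> prob_measures circle" for L
    proof -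
      interpret l: circle_measure L by unfold_locales fact
      show "(\<integral>\<^sup>+ z. ennreal (g z) \<partial>L) = ennreal (LINT z|L. g z)" "0 \<le> (LINT z|L. g z)"
        using pos by (auto intro!: nn_integral_eq_integral l.continuous_integrable g integral_nonneg_AE
            simp: l.space_circle)
    qed
    have "ennreal (LINT z|mix_measure t \<mu> \<nu>. g z) =
        ennreal t * ennreal (LINT z|\<mu>. g z) + ennreal (1 - t) * ennreal (LINT z|\<nu>. g z)"
      using nn_integral_mix_measure[OF s, of "\<lambda>z. ennreal (g z)" t] m.continuous_measurable[OF g]
      by (simp add: nn[OF x.P] nn[OF m] nn[OF n])
    also have "\<dots> = ennreal (t * (LINT z|\<mu>. g z) + (1 - t) * (LINT z|\<nu>. g z))"
      using t nn(2)[OF m] nn(2)[OF n] by (simp add: ennreal_plus[symmetric] ennreal_mult' [symmetric]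
          del: ennreal_plus)
    finally show ?thesis
      using t nn(2)[OF m] nn(2)[OF n] nn(2)[OF x.P] by (subst (asm) ennreal_inj) auto
  qed
  have real: "(LINT z|mix_measure t \<mu> \<nu>. g z) = t * (LINT z|\<mu>. g z) + (1 - t) * (LINT z|\<nu>. g z)"
    if g: "continuous_on circle g" for g :: "complex \<Rightarrow> real"
  proof -
    have "compact (g ` circle)" using g by (intro compact_continuous_image) auto
    then obtain B where B: "\<And>z. z \<in> circle \<Longrightarrow> \<bar>g z\<bar> \<le>
        B" by (metis compact_imp_bounded bounded_iff imageI real_norm_def)
    have "continuous_on circle (\<lambda>z. g z + B)" by (intro continuous_intros g)
    moreover have "0 \<le> g z + B" if "z \<in> circle" for z using B[OF that] by linarith
    ultimately have "(LINT z|mix_measure t \<mu> \<nu>. g z + B) =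
        t * (LINT z|\<mu>. g z + B) + (1 - t) * (LINT z|\<nu>. g z + B)"
      by (rule nonneg)
    then show ?thesis
      using m.continuous_integrable[OF g] n.continuous_integrable[OF g] x.continuous_integrable[OF g]
        m.prob_space n.prob_space x.prob_space
      by (simp add: algebra_simps)
  qed
  have fR: "continuous_on circle (\<lambda>z. Re (f z))" "continuous_on circle (\<lambda>z. Im (f z))"
      by (intro continuous_intros f)+
  show ?thesis
    using real[OF fR(1)] real[OF fR(2)] m.continuous_integrable[OF f] n.continuous_integrable[OF f]
        x.continuous_integrable[OF f]
    by (simp add: complex_eq_iff)
qed

text \<open>For each \<open>j\<close> exactly one \<open>k\<close> in range solves the congruence,
  and then \<open>k - j\<close> is \<open>l\<close> or, after wrapping around, \<open>l - n\<close>.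
  The two cases occur for \<open>n - l\<close> and for \<open>l\<close> values of
  \<open>j\<close>.\<close>

lemma shifted_diagonal_sum:
  fixes c :: "int \<Rightarrow> complex"
  assumes l: "l < n"
  shows "(\<Sum>j<n. \<Sum>k<n. if int n dvd int l - (int k - int j) then c (int k - int j) else 0) =
    of_nat (n - l) * c (int l) + of_nat l * c (int l - int n)"
proof -
  have inner: "(\<Sum>k<n. if int n dvd int l - (int k - int j) then c (int k - int j) else 0) =
    (if j < n - l then c (int l) else c (int l - int n))" if j: "j < n" for j
  proof -
    define k0 where "k0 = (if j < n - l then j + l else j + l - n)"
    have k0: "k0 < n" "int k0 - int j = (if j < n - l then int l else int l - int n)"
      using j l by (auto simp: k0_def of_nat_diff)
    have "int n dvd int l - (int k - int j) \<longleftrightarrow> k = k0" if k: "k < n" for k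
    proof
      assume "int n dvd int l - (int k - int j)"
      moreover have "int n dvd int l - (int k0 - int j)" using k0(2) by simp
      ultimately have "int n dvd (int l - (int k0 - int j)) - (int l - (int k - int j))"
        by (rule dvd_diff[rotated])
      then have "int n dvd int k - int k0" by simp
      moreover have "\<bar>int k - int k0\<bar> < int n" using k k0(1) by linarith
      ultimately have "int k - int k0 = 0"
        using dvd_imp_le_int[of "int k - int k0" "int n"] by (meson abs_ge_self not_le order_trans)
      then show "k = k0" by simp
    qed (use k0(2) in simp)
    then have "(\<Sum>k<n. if int n dvd int l - (int k - int j) then c (int k - int j) else 0) =
      (\<Sum>k<n. if k = k0 then c (int k0 - int j) else 0)" by (intro sum.cong) auto
    also have "\<dots> = c (int k0 - int j)" using k0(1) by (simp add: sum.delta)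
    finally show ?thesis unfolding k0(2) by simp
  qed
  have "(\<Sum>j<n. \<Sum>k<n. if int n dvd int l - (int k - int j) then c (int k - int j) else 0) =
    (\<Sum>j<n. if j < n - l then c (int l) else c (int l - int n))"
    by (intro sum.cong refl inner) simp
  also have "\<dots> = (\<Sum>j\<in>{..<n} \<inter> {j. j < n - l}. c (int l)) + (\<Sum>j\<in>{..<n} \<inter> - {j. j < n - l}. c (int l - int
      n))"
    by (rule sum.If_cases) simp
  also have "{..<n} \<inter> {j. j < n - l} = {..<n - l}" by auto
  also have "{..<n} \<inter> - {j. j < n - l} = {n - l..<n}" by auto
  finally show ?thesis using l by simp
qed

text \<open>The approximating measures are carried by the \<open>n\<close>-th roots of unity, with the Fejer means of \<open>c\<close> as
  weights. Lifted to \<open>[0, 2 pi]\<close> they are tight, so Helly's theorem applies.\<close>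

theorem Herglotz:
  fixes c :: "int \<Rightarrow> complex"
  assumes pd: "\<And>n a. (\<Sum>j<n. \<Sum>k<n. a k * cnj (a j) * c (int k - int j)) \<in> \<real>\<^sub>\<ge>\<^sub>0"
    and c0: "c 0 = 1" and bounded: "\<And>k. cmod (c k) \<le> 1"
  shows "\<exists>\<mu>\<in>prob_measures circle. \<forall>k. (LINT z|\<mu>. z ^ k) = c (int k)"
proof -
  define \<theta> where "\<theta> n m = 2 * pi * real m / real n" for n m :: nat
  define P where "P n m = (\<Sum>j<n. \<Sum>k<n. c (int k - int j) * cis (\<theta> n m) powi (int j - int k))" for n m :: nat
  define p where "p n m = Re (P n m) / (real n)\<^sup>2" for n m :: nat
  \<comment> \<open>Positive definiteness, evaluated at the vector of powers
    \<open>\<zeta>^(-k)\<close> of a root of unity \<open>\<zeta>\<close>.\<close>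
  have P_pos: "P n m \<in> \<real>\<^sub>\<ge>\<^sub>0" for n m
  proof -
    have "P n m = (\<Sum>j<n. \<Sum>k<n. cis (\<theta> n m) powi (- int k) * cnj (cis (\<theta> n m) powi (- int j)) * c (int k
        - int j))"
      unfolding P_def by (intro sum.cong refl) (simp add: cis_power_int cis_cnj cis_mult algebra_simps)
    then show ?thesis using pd[where a = "\<lambda>k. cis (\<theta> n m) powi (- int k)"] by simp
  qed
  have p0: "0 \<le> p n m" for n m
    using P_pos[of n m] by (simp add: p_def complex_nonneg_Reals_iff)
  have pP: "complex_of_real (p n m) = P n m / (of_nat n)\<^sup>2" for n m
    using P_pos[of n m] by (simp add: p_def complex_nonneg_Reals_iff complex_eq_iff power2_eq_square)
  \<comment> \<open>Summation over the roots sees \<open>l\<close> only modulo \<open>n\<close>: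
    besides \<open>c l\<close> it retains the alias \<open>c (l - n)\<close>, whose weight
    \<open>l / n\<close> disappears in the limit.\<close>
  have mom: "(\<Sum>m<n. complex_of_real (p n m) * cis (\<theta> n m) powi int l) =
    (of_nat (n - l) * c (int l) + of_nat l * c (int l - int n)) / of_nat n" if l: "l < n" for n l
  proof -
    have n: "0 < n" using l by simp
    have "(\<Sum>m<n. P n m * cis (\<theta> n m) powi int l) =
      (\<Sum>m<n. \<Sum>j<n. \<Sum>k<n. c (int k - int j) * cis (\<theta> n m) powi (int l - (int k - int j)))"
      unfolding P_def sum_distrib_right
      by (intro sum.cong refl) (simp only: cis_power_int cis_mult mult.assoc, simp add: algebra_simps)
    also have "\<dots> = (\<Sum>j<n. \<Sum>m<n. \<Sum>k<n. c (int k - int j) * cis (\<theta> n m) powi (int l - (int k - int j)))"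
      by (rule sum.swap)
    also have "\<dots> = (\<Sum>j<n. \<Sum>k<n. \<Sum>m<n. c (int k - int j) * cis (\<theta> n m) powi (int l - (int k - int j)))"
      by (rule sum.cong[OF refl], rule sum.swap)
    also have "\<dots> = (\<Sum>j<n. \<Sum>k<n. of_nat n * (if int n dvd int l - (int k - int j) then c (int k - int j)
        else 0))"
      unfolding sum_distrib_left[symmetric] \<theta>_def sum_roots_of_unity[OF n]
      unfolding sum_distrib_left by (intro sum.cong refl) simp
    also have "\<dots> = of_nat n * (of_nat (n - l) * c (int l) + of_nat l * c (int l - int n))"
      unfolding sum_distrib_left[symmetric] shifted_diagonal_sum[OF l] ..
    finally show ?thesis using n
      by (simp add: pP sum_divide_distrib[symmetric] power2_eq_square)
  qed
  \<comment> \<open>Indexed by \<open>Suc n\<close>, so that the number of roots is never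
    zero.\<close>
  define Q where "Q n = point_measure {..<Suc n} (\<lambda>m. ennreal (p (Suc n) m))" for n
  define \<nu> where "\<nu> n = distr (Q n) borel (\<theta> (Suc n))" for n
  have int_Q: "integral\<^sup>L (Q n) g = (\<Sum>m<Suc n. p (Suc n) m *\<^sub>R g m)" for g :: "nat \<Rightarrow> complex" and n
    unfolding Q_def using p0 by (intro lebesgue_integral_point_measure_finite) auto
  have meas: "\<theta> (Suc n) \<in> borel_measurable (Q n)" for n
    by (simp add: Q_def measurable_point_measure_eq1)
  have sum1: "(\<Sum>m<Suc n. p (Suc n) m) = 1" for n
  proof -
    have "complex_of_real (\<Sum>m<Suc n. p (Suc n) m) = 1" using mom[of 0 "Suc n"] c0 of_nat_neq_0[of n,
        where 'a = complex]
      by (simp del: sum.lessThan_Suc of_nat_Suc)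
    then show ?thesis by (simp only: of_real_eq_1_iff)
  qed
  have pQ: "prob_space (Q n)" for n
  proof (rule prob_spaceI)
    have "emeasure (Q n) {..<Suc n} = (\<Sum>m<Suc n. ennreal (p (Suc n) m))"
      unfolding Q_def by (rule emeasure_point_measure_finite) auto
    also have "\<dots> = ennreal (\<Sum>m<Suc n. p (Suc n) m)" using p0 by (intro sum_ennreal) auto
    finally show "emeasure (Q n) (space (Q n)) = 1" unfolding sum1 by (simp add: Q_def space_point_measure)
  qed
  have rd: "real_distribution (\<nu> n)" for n
    unfolding \<nu>_def by (intro real_distribution.intro prob_space.prob_space_distr[OF pQ meas])
      (simp add: real_distribution_axioms_def)
  have "tight \<nu>"
    unfolding tight_def
  proof (intro conjI allI impI)
    fix e :: real assume e: "0 < e"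
    \<comment> \<open>All angles lie in \<open>[0, 2 pi)\<close>; the left endpoint -1 keeps the
      angle 0 inside an interval that is open on the left.\<close>
    show "\<exists>a b. a < b \<and> (\<forall>n. 1 - e < measure (\<nu> n) {a<..b})"
    proof (rule exI[of _ "-1"], rule exI[of _ "2 * pi"], intro conjI allI)
      show "- 1 < 2 * pi" using pi_gt_zero by linarith
      fix n
      have "\<theta> (Suc n) m \<in> {-1<..2 * pi}" if "m < Suc n" for m
      proof -
        have "0 \<le> \<theta> (Suc n) m" by (simp add: \<theta>_def)
        moreover have "\<theta> (Suc n) m \<le> 2 * pi"
          using mult_left_mono[of "real m" "real (Suc n)" "2 * pi"] that
              by (simp add: \<theta>_def pos_divide_le_eq)
        ultimately show ?thesis by simp
      qed
      then have "\<theta> (Suc n) -` {-1<..2 * pi} \<inter> space (Q n) = space (Q n)"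
          by (auto simp: Q_def space_point_measure)
      then have "measure (\<nu> n) {-1<..2 * pi} = 1"
        unfolding \<nu>_def by (subst measure_distr[OF meas]) (auto simp: prob_space.prob_space[OF pQ])
      then show "1 - e < measure (\<nu> n) {- 1<..2 * pi}" using e by simp
    qed
  qed (rule rd)
  from tight_imp_convergent_subsubsequence[OF this strict_mono_id]
  obtain r M where r: "strict_mono r" and M: "real_distribution M" and wc: "weak_conv_m (\<nu> \<circ> r) M"
    by (auto simp: comp_def)
  interpret M: real_distribution M by (rule M)
  have lim: "(\<lambda>n. char (\<nu> (r n)) (real l)) \<longlonglongrightarrow> char M (real l)" for l :: nat
    using levy_continuity1[OF _ M wc, of "real l"] rd by (simp add: comp_def)
  have char: "char (\<nu> n) (real l) = (of_nat (Suc n - l) * c (int l) + of_nat l * c (int l - int (Suc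
      n))) / of_nat (Suc n)"
    if "l < Suc n" for n l
  proof -
    have "char (\<nu> n) (real l) = integral\<^sup>L (Q n) (\<lambda>m. cis (real l * \<theta> (Suc n) m))"
      unfolding char_def \<nu>_def by (subst integral_distr[OF meas]) (simp_all add: cis_conv_exp)
    also have "\<dots> = (\<Sum>m<Suc n. complex_of_real (p (Suc n) m) * cis (\<theta> (Suc n) m) powi int l)"
      unfolding int_Q by (intro sum.cong refl) (simp add: Complex.DeMoivre scaleR_conv_of_real)
    also note mom[OF that]
    finally show ?thesis .
  qed
  have char_lim: "(\<lambda>n. char (\<nu> n) (real l)) \<longlonglongrightarrow> c (int l)" for l
  proof (rule LIM_zero_cancel, rule Lim_null_comparison)
    show "(\<lambda>n. 2 * real l / real (Suc n)) \<longlonglongrightarrow> 0"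
      using tendsto_mult_right_zero[OF LIMSEQ_inverse_real_of_nat, of "2 * real l"]
          by (simp add: field_simps)
    \<comment> \<open>Only the aliased coefficient deviates from \<open>c l\<close>. It has weight
      \<open>l / (n + 1)\<close>, and two numbers of modulus at most 1 differ by at most 2.\<close>
    have "cmod (char (\<nu> n) (real l) - c (int l)) \<le> 2 * real l / real (Suc n)" if n: "l < Suc n" for n
    proof -
      have "char (\<nu> n) (real l) - c (int l) = of_nat l * (c (int l - int (Suc n)) - c (int l)) / of_nat
          (Suc n)"
        unfolding char[OF n] using n by (simp add: of_nat_diff field_simps del: of_nat_Suc)
      also have "cmod \<dots> = real l * cmod (c (int l - int (Suc n)) - c (int l)) / real (Suc n)"
        by (simp add: norm_mult norm_divide del: of_nat_Suc)
      also have "\<dots> \<le> real l * 2 / real (Suc n)"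
        using norm_triangle_ineq4[of "c (int l - int (Suc n))" "c (int l)"] bounded[of "int l - int (Suc
            n)"] bounded[of "int l"]
        by (intro divide_right_mono mult_left_mono) linarith+
      finally show ?thesis by (simp add: mult.commute)
    qed
    then show "\<forall>\<^sub>F n in sequentially. norm (char (\<nu> n) (real l) - c (int l)) \<le> 2 * real l / real (Suc n)"
      by (intro eventually_sequentiallyI[of l]) auto
  qed
  have cM: "char M (real l) = c (int l)" for l
    using LIMSEQ_unique[OF lim LIMSEQ_subseq_LIMSEQ[OF char_lim r, unfolded comp_def]] by simp
  \<comment> \<open>Wrapping the limit around the circle: its characteristic function at integers
    consists of the moments of the image.\<close>
  define \<mu> where "\<mu> = distr M (restrict_space borel circle) cis"
  have cis: "cis \<in> measurable M (restrict_space borel circle)"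
    by (intro measurable_restrict_space2) (auto intro!: borel_measurable_continuous_onI
        continuous_intros simp: measurable_cong_sets[OF M.events_eq_borel refl])
  have "\<mu> \<in> prob_measures circle"
    unfolding prob_measures_def \<mu>_def using M.prob_space_distr[OF cis] by simp
  moreover have "(LINT z|\<mu>. z ^ k) = c (int k)" for k
  proof -
    have "(LINT z|\<mu>. z ^ k) = (LINT x|M. cis x ^ k)"
      unfolding \<mu>_def
      by (rule integral_distr[OF cis]) (intro borel_measurable_continuous_on_restrict continuous_intros)
    also have "\<dots> = char M (real k)"
      unfolding char_def by (intro Bochner_Integration.integral_cong refl) (simp only: Complex.DeMoivre
          cis_conv_exp[symmetric])
    finally show ?thesis by (simp add: cM)
  qed
  ultimately show ?thesis by blast
qed

section \<open>States induced from powers of the canonical unitary\<close>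

locale cp_system = crossed_product \<alpha> \<iota> V + compact_prob \<mu>
  for \<alpha> :: "('x::metric_space \<Rightarrow>\<^sub>C complex) \<Rightarrow> ('x \<Rightarrow>\<^sub>C complex)"
    and \<iota> :: "('x \<Rightarrow>\<^sub>C complex) \<Rightarrow> 'c::cstar_algebra" and V :: 'c and \<mu> :: "'x measure" +
  assumes integral_\<alpha>: "\<And>a. (LINT x|\<mu>. apply_bcontfun (\<alpha> a) x) = (LINT x|\<mu>. apply_bcontfun a x)"
begin

abbreviation hz :: "int \<Rightarrow> 'x \<Rightarrow> 'x"
  where "hz \<equiv> zpow (dual_homeo \<alpha>)"

lemmas bij\<alpha> = star_automorphism_bij[OF aut]
lemmas zpow_eval = zpow_dual_homeo[OF comp aut]
lemmas hz_add = zpow_add[OF dual_homeo_properties(3)[OF comp aut]]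

lemma integral_zpow: "(LINT x|\<mu>. apply_bcontfun (zpow \<alpha> m a) x) = (LINT x|\<mu>. apply_bcontfun a x)"
proof (induction m rule: int_induct[where k = 0])
  case (step1 i)
  then show ?case by (simp add: zpow_Suc[OF bij\<alpha>] integral_\<alpha>)
next
  case (step2 i)
  have "zpow \<alpha> i a = \<alpha> (zpow \<alpha> (i - 1) a)" using zpow_Suc[OF bij\<alpha>, of "i - 1" a] by simp
  then show ?case using step2 integral_\<alpha>[of "zpow \<alpha> (i - 1) a"] by simp
qed simp

lemma hz_continuous: "continuous_on UNIV (hz m)"
  by (rule continuous_on_zpow_dual_homeo[OF comp aut])

lemma hz_measurable_borel: "hz m \<in> measurable \<mu> borel"
  by (intro continuous_measurable hz_continuous)

lemma hz_measurable [measurable]: "hz m \<in> measurable \<mu> \<mu>"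
  using hz_measurable_borel measurable_cong_sets[OF refl sets_borel] by blast

lemma hz_distr: "distr \<mu> \<mu> (hz m) = \<mu>"
proof -
  have "distr \<mu> borel (hz m) = \<mu>"
    by (rule distr_invariant[OF hz_continuous]) (simp add: zpow_eval[symmetric] integral_zpow)
  moreover have "distr \<mu> \<mu> (hz m) = distr \<mu> borel (hz m)" by (rule distr_cong) (simp_all add: sets_borel)
  ultimately show ?thesis by simp
qed

lemma integral_hz:
  fixes g :: "'x \<Rightarrow> 'b::{banach, second_countable_topology}"
  assumes "g \<in> borel_measurable \<mu>"
  shows "(LINT x|\<mu>. g (hz m x)) = (LINT x|\<mu>. g x)"
  using integral_distr[OF hz_measurable[of m] assms] by (simp add: hz_distr)

lemma AE_hz:
  assumes "AE x in \<mu>. P x"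
  shows "AE x in \<mu>. P (hz m x)"
proof -
  have "AE x in distr \<mu> \<mu> (hz m). P x" using assms by (simp only: hz_distr)
  then obtain N where N: "N \<in> sets \<mu>" "emeasure (distr \<mu> \<mu> (hz m)) N = 0" "{x. \<not> P x} \<subseteq> N"
    by (auto elim!: AE_E)
  show ?thesis
  proof (rule AE_I)
    show "{x \<in> space \<mu>. \<not> P (hz m x)} \<subseteq> hz m -` N \<inter> space \<mu>" using N(3) by auto
    show "emeasure \<mu> (hz m -` N \<inter> space \<mu>) = 0" using N(2) by (simp add: emeasure_distr N(1))
    show "hz m -` N \<inter> space \<mu> \<in> sets \<mu>" by (rule measurable_sets[OF hz_measurable N(1)])
  qed
qed

section \<open>The multiplicative cocycle of a unimodular function\<close>

abbreviation "trf \<equiv> transfer_iterate \<alpha>"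

lemma trf_0 [simp]: "trf n w 0 x = 1"
  by (simp add: transfer_iterate_def)

lemma trf_measurable:
  assumes w: "w \<in> borel_measurable \<mu>"
  shows "trf n w k \<in> borel_measurable \<mu>"
proof -
  have [measurable]: "(\<lambda>x. w (hz m x)) \<in> borel_measurable \<mu>" for m
    by (rule measurable_compose[OF hz_measurable w])
  have [measurable]: "(\<lambda>x. cnj (w (hz m x))) \<in> borel_measurable \<mu>" for m
    by (rule borel_measurable_continuous_on[of cnj]) (auto intro: continuous_intros)
  show ?thesis unfolding transfer_iterate_def[abs_def] by (cases "0 \<le> k") simp_all
qed

text \<open>The maps \<open>hz m\<close> preserve null sets and there are countably many of them, so
  one null set serves for all factors.\<close>

lemma trf_AE_cong:
  assumes "AE x in \<mu>. w x = w' x"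
  shows "AE x in \<mu>. trf n w k x = trf n w' k x"
proof -
  have "AE x in \<mu>. \<forall>m. w (hz m x) = w' (hz m x)"
    using AE_hz[OF assms] by (simp add: AE_all_countable)
  then show ?thesis by eventually_elim (simp add: transfer_iterate_def)
qed

context
  fixes n :: nat and w :: "'x \<Rightarrow> complex"
  assumes w: "w \<in> borel_measurable \<mu>" and unim: "\<And>x. cmod (w x) = 1"
begin

text \<open>In this context \<open>w\<close> is unimodular at every point, so the cocycle identities
  hold pointwise. For negative \<open>k\<close> the new factor cancels the first conjugated
  one.\<close>

lemma trf_Suc: "trf n w (k + 1) x = trf n w k x * w (hz (k * int n) x)"
proof (cases "0 \<le> k")
  case True
  then have "{0..k + 1 - 1} = insert k {0..k - 1}" by auto
  then show ?thesis using True by (simp add: transfer_iterate_def mult.commute)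
next
  case False
  then have i: "{k..-1} = insert k {k + 1..-1}" by auto
  have c: "cnj (w y) * w y = 1" for y
    using complex_norm_square[of "w y"] by (simp add: unim mult.commute)
  have "trf n w k x * w (hz (k * int n) x) =
    (\<Prod>j\<in>{k + 1..-1}. cnj (w (hz (j * int n) x))) * (cnj (w (hz (k * int n) x)) * w (hz (k * int n) x))"
    using False by (simp add: transfer_iterate_def i ac_simps)
  also have "\<dots> = trf n w (k + 1) x" using False c by (cases "k = -1") (auto simp: transfer_iterate_def)
  finally show ?thesis ..
qed

lemma w_nonzero: "w x \<noteq> 0"
  using unim[of x] by auto

text \<open>The cocycle identity over the powers of \<open>hz n\<close>. It is the commutative
  shadow of multiplying elements \<open>w V^n\<close> and is what makes \<open>z w\<close> a
  representation of the subgroup of multiples of \<open>n\<close>.\<close>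

lemma trf_add: "trf n w (j + k) x = trf n w j x * trf n w k (hz (j * int n) x)"
proof (induction k rule: int_induct[where k = 0])
  case (step1 k)
  have "trf n w (j + k + 1) x = trf n w (j + k) x * w (hz ((j + k) * int n) x)" by (rule trf_Suc)
  also have "\<dots> = trf n w j x * (trf n w k (hz (j * int n) x) * w (hz (k * int n) (hz (j * int n) x)))"
    by (simp add: step1 hz_add[symmetric] algebra_simps)
  finally show ?case by (simp add: trf_Suc add.assoc)
next
  case (step2 k)
  have e: "hz (k * int n - int n) (hz (j * int n) x) = hz ((j + (k - 1)) * int n) x"
    by (simp add: hz_add[symmetric] algebra_simps)
  have "trf n w (j + (k - 1)) x * w (hz ((j + (k - 1)) * int n) x) = trf n w (j + k) x"
    using trf_Suc[of "j + (k - 1)" x] by simp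
  also have "\<dots> = trf n w j x * (trf n w (k - 1) (hz (j * int n) x) * w (hz ((k - 1) * int n) (hz (j *
      int n) x)))"
    using step2 trf_Suc[of "k - 1" "hz (j * int n) x"] by simp
  finally show ?case using w_nonzero by (simp add: e left_diff_distrib mult.assoc[symmetric])
qed simp

lemma trf_norm: "cmod (trf n w k x) = 1"
  by (simp add: transfer_iterate_def prod_norm[symmetric] unim)

lemma trf_inverse: "trf n w (- k) (hz (k * int n) x) = cnj (trf n w k x)"
proof -
  have "trf n w k x * trf n w (- k) (hz (k * int n) x) = 1"
    using trf_add[of k "- k" x] by simp
  then have "trf n w (- k) (hz (k * int n) x) = inverse (trf n w k x)" by (rule inverse_unique[symmetric])
  then show ?thesis by (simp add: cnj_eq_inverse trf_norm)
qed

text \<open>The Fourier coefficients that \<open>T\<close> is going to have: \<open>coef f k\<close>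
  belongs to \<open>V^(k n)\<close>. Substituting a number \<open>z\<close> for \<open>V^n\<close>
  gives a functional, substituting \<open>V^n\<close> itself gives \<open>T\<close>.\<close>

definition coef :: "(int \<Rightarrow> ('x \<Rightarrow>\<^sub>C complex)) \<Rightarrow> int \<Rightarrow> complex"
  where "coef f k = (LINT x|\<mu>. apply_bcontfun (f (k * int n)) x * cnj (trf n w k x))"

lemma integrable_cnj_trf: "integrable \<mu> (\<lambda>x. cnj (trf n w k x))"
  using trf_measurable[OF w] trf_norm
  by (intro integrable_const_bound[where B = 1]) (auto intro!: borel_measurable_continuous_on[of cnj]
      continuous_intros)

lemmas integrable_mult_trf = integrable_mult_bcontfun[OF integrable_cnj_trf]

lemma coef_add: "coef (\<lambda>n. f n + g n) k = coef f k + coef g k"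
  by (simp add: coef_def plus_bcontfun.rep_eq distrib_right integrable_mult_trf)

lemma coef_scaleC: "coef (\<lambda>n. c *\<^sub>C f n) k = c * coef f k"
  by (simp add: coef_def scaleC_bcontfun.rep_eq scaleC_complex_def mult.assoc)

context
  assumes n: "0 < n"
begin

lemma alg_elem_coef:
  assumes "alg_elem f" shows "alg_elem (coef f)"
proof -
  have "{k. coef f k \<noteq> 0} \<subseteq> (\<lambda>k. k * int n) -` {m. f m \<noteq> 0}"
    by (auto simp: coef_def zero_bcontfun.rep_eq)
  moreover have "finite ((\<lambda>k. k * int n) -` {m. f m \<noteq> 0})"
    using assms n by (intro finite_vimageI) (auto simp: alg_elem_def inj_on_def)
  ultimately show ?thesis unfolding alg_elem_def by (rule finite_subset)
qed

lemma coef_single_multiple: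
  "coef (alg_single (k * int n) a) = alg_single k (LINT x|\<mu>. apply_bcontfun a x * cnj (trf n w k x))"
  using n by (auto simp: coef_def alg_single_def zero_bcontfun.rep_eq fun_eq_iff)

lemma coef_single_other: "\<not> int n dvd m \<Longrightarrow> coef (alg_single m a) = (\<lambda>_. 0)"
  by (auto simp: coef_def alg_single_def zero_bcontfun.rep_eq fun_eq_iff)

text \<open>The functional \<open>f \<mapsto> \<Sum>\<^sub>k z\<^sup>k \<integral> f(k n) w\<^sub>k\<^sup>*\<close> is a vector functional of the representation on
  \<open>L\<^sup>2({0..<n} \<times> X)\<close> induced from \<open>V\<^sup>n \<mapsto> z w\<^sup>*\<close>.\<close>

context
  fixes z :: complex
  assumes z: "cmod z = 1"
begin

definition "induced_measure = count_space {0..<int n} \<Otimes>\<^sub>M \<mu>"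
definition "induced_map m = (\<lambda>(r, x). ((r - m) mod int n, hz m x))"
text \<open>Writing \<open>r - m = j n + s\<close>, the coset moves from \<open>r\<close> to
  \<open>s\<close> and the subgroup element \<open>j\<close> contributes \<open>z powi (- j)\<close>
  and a transfer factor. The latter sits at \<open>hz (s + m) x\<close>, which is
  \<open>hz (r - j n) x\<close>. At \<open>r = 0\<close> and \<open>m = k n\<close> the result is
  \<open>z powi k * cnj (trf n w k x)\<close>.\<close>

definition "induced_factor m = (\<lambda>(r, x). z powi (- ((r - m) div int n)) * trf n w ((r - m) div int n)
    (hz ((r - m) mod int n + m) x))"

lemma induced_map_measurable: "induced_map m \<in> measurable induced_measure induced_measure"
proof -
  have "(\<lambda>r. (r - m) mod int n) \<in> measurable (count_space {0..<int n}) (count_space {0..<int n})"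
    using n by (simp add: measurable_count_space_eq1)
  then show ?thesis
    unfolding induced_map_def induced_measure_def case_prod_beta
    by (intro measurable_Pair measurable_compose[OF measurable_fst] measurable_compose[OF measurable_snd
        hz_measurable])
qed

lemma induced_map_distr: "distr induced_measure induced_measure (induced_map m) = induced_measure"
proof -
  let ?C = "count_space {0..<int n}"
  have inj: "inj_on (\<lambda>r. (r - m) mod int n) {0..<int n}"
  proof (rule inj_onI)
    fix r s assume "r \<in> {0..<int n}" "s \<in> {0..<int n}" and eq: "(r - m) mod int n = (s - m) mod int n"
    then have "((r - m) + m) mod int n = ((s - m) + m) mod int n" by (metis mod_add_cong)
    then show "r = s" using \<open>r \<in> _\<close> \<open>s \<in> _\<close> by simp
  qed
  moreover have "(\<lambda>r. (r - m) mod int n) ` {0..<int n} = {0..<int n}"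
    using n by (intro endo_inj_surj inj) auto
  ultimately have bij: "bij_betw (\<lambda>r. (r - m) mod int n) {0..<int n} {0..<int n}"
      by (simp add: bij_betw_def)
  have d: "distr ?C ?C (\<lambda>r. (r - m) mod int n) = ?C" by (rule distr_bij_count_space[OF bij])
  have sf: "sigma_finite_measure (distr \<mu> \<mu> (hz m))" unfolding hz_distr
      by (rule sigma_finite_measure_axioms)
  have "distr ?C ?C (\<lambda>r. (r - m) mod int n) \<Otimes>\<^sub>M distr \<mu> \<mu> (hz m) =
      distr induced_measure induced_measure (induced_map m)"
    unfolding induced_measure_def induced_map_def
    by (rule pair_measure_distr[OF _ hz_measurable sf]) (use n in \<open>simp add: measurable_count_space_eq1\<close>)
  then show ?thesis by (simp add: d hz_distr induced_measure_def)
qed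

text \<open>The quotients of two successive divisions with remainder add up, and both transfer
  factors refer to points on the orbit of \<open>hz (s' + (m + k)) x\<close>, so the cocycle
  identity of \<open>trf\<close> combines them.\<close>

lemma induced_factor_cocycle: "induced_factor (m + k) y =
    induced_factor m y * induced_factor k (induced_map m y)"
proof (cases y)
  case (Pair r x)
  define s j where "s = (r - m) mod int n" and "j = (r - m) div int n"
  define s' j' where "s' = (s - k) mod int n" and "j' = (s - k) div int n"
  have rm: "r - m = j * int n + s" and sk: "s - k = j' * int n + s'"
      by (simp_all add: s_def j_def s'_def j'_def)
  have rmk: "r - (m + k) = (j + j') * int n + s'" using rm sk by (simp add: algebra_simps)
  have s': "0 \<le> s'" "s' < int n" using n by (simp_all add: s'_def)
  have dm: "(r - (m + k)) div int n = j + j'" "(r - (m + k)) mod int n = s'"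
    unfolding rmk using s' by simp_all
  let ?y = "hz (s' + (m + k)) x"
  have "j' * int n + (s' + (m + k)) = s + m" using sk by simp
  then have "hz (j' * int n) ?y = hz (s + m) x" by (simp only: hz_add[symmetric])
  moreover have "hz (s' + k) (hz m x) = ?y" by (simp add: hz_add[symmetric] ac_simps)
  moreover have "trf n w (j + j') ?y = trf n w j' ?y * trf n w j (hz (j' * int n) ?y)"
    using trf_add[of j' j ?y] by (simp add: add.commute)
  moreover have "z powi (- (j + j')) = z powi (- j) * z powi (- j')"
    using z by (subst power_int_add[symmetric]) auto
  ultimately show ?thesis
    by (simp add: Pair induced_factor_def induced_map_def dm s_def[symmetric] j_def[symmetric]
        s'_def[symmetric] j'_def[symmetric])
qed

lemma induced_measure_finite: "finite_measure induced_measure"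
  unfolding induced_measure_def by (intro finite_measure_pair_measure finite_measure_axioms
      finite_measure_count_space) simp

lemma induced_measure_space: "space induced_measure = {0..<int n} \<times> UNIV"
  by (simp add: induced_measure_def space_pair_measure)

lemma induced_factor_measurable: "induced_factor m \<in> borel_measurable induced_measure"
  unfolding induced_measure_def induced_factor_def
  by (intro measurable_pair_measure_countable1)
    (auto intro!: borel_measurable_times measurable_compose[OF hz_measurable trf_measurable[OF w]])

lemma koopman_twisted: "koopman \<alpha> induced_measure snd induced_map induced_factor"
proof (intro koopman.intro star_aut.intro aut koopman_axioms.intro)
  show "finite_measure induced_measure" by (rule induced_measure_finite)
  have "snd \<in> measurable induced_measure \<mu>" unfolding induced_measure_def by (rule measurable_snd)
  then show "snd \<in> borel_measurable induced_measure" using measurable_cong_sets[OF refl sets_borel] by blast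
  show "induced_map m \<in> measurable induced_measure induced_measure" for m by (rule induced_map_measurable)
  show "distr induced_measure induced_measure (induced_map m) = induced_measure" for m
      by (rule induced_map_distr)
  show "induced_factor m \<in> borel_measurable induced_measure" for m by (rule induced_factor_measurable)
  show "cmod (induced_factor m y) = 1" for m y
    by (simp add: induced_factor_def norm_mult norm_power_int z trf_norm split: prod.split)
  show "induced_map 0 y = y" if "y \<in> space induced_measure" for y using that
      by (auto simp: induced_map_def induced_measure_space)
  show "induced_map (m + k) y = induced_map k (induced_map m y)" for m k y
    by (simp add: induced_map_def hz_add[symmetric] mod_diff_left_eq add.commute algebra_simps split:
        prod.split)
  show "induced_factor 0 y = 1" if "y \<in> space induced_measure" for y
    using that by (auto simp: induced_factor_def induced_measure_space)
  show "induced_factor (m + k) y = induced_factor m y * induced_factor k (induced_map m y)" for m k y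
      by (rule induced_factor_cocycle)
  show "apply_bcontfun (zpow \<alpha> m a) (snd y) = apply_bcontfun a (snd (induced_map m y))" for m a y
    by (simp add: induced_map_def zpow_eval split: prod.split)
qed

interpretation kp: koopman \<alpha> induced_measure snd induced_map induced_factor by (rule koopman_twisted)

text \<open>The indicator of the coset 0. Only translations by multiples of \<open>n\<close> lead
  from it back to itself, so its vector functional annihilates the other powers of
  \<open>V\<close>.\<close>

definition "induced_vector = (\<lambda>(r::int, x::'x). if r = 0 then 1 else 0 :: complex)"

lemma induced_vector_H: "induced_vector \<in> kp.H"
proof -
  have "induced_vector \<in> borel_measurable induced_measure"
    unfolding induced_measure_def induced_vector_def by (intro measurable_pair_measure_countable1) auto
  then show ?thesis by (auto simp: kp.H_def induced_vector_def intro!: exI[of _ 1])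
qed

lemma integral_MM:
  fixes g :: "int \<times> 'x \<Rightarrow> 'b::{banach, second_countable_topology}"
  assumes "integrable induced_measure g" and "\<And>r x. r \<noteq> 0 \<Longrightarrow> g (r, x) = 0"
  shows "integral\<^sup>L induced_measure g = (LINT x|\<mu>. g (0, x))"
proof -
  interpret c: finite_measure "count_space {0..<int n}" by (rule finite_measure_count_space) simp
  interpret p: pair_sigma_finite "count_space {0..<int n}" \<mu> ..
  have "integral\<^sup>L induced_measure g = (LINT r|count_space {0..<int n}. (LINT x|\<mu>. g (r, x)))"
    using p.integral_fst'[of g] assms(1) by (simp add: induced_measure_def)
  also have "\<dots> = (\<Sum>r\<in>{0..<int n}. LINT x|\<mu>. g (r, x))"
    by (rule lebesgue_integral_count_space_finite) simp
  also have "\<dots> = (\<Sum>r\<in>{0..<int n}. if r = 0 then (LINT x|\<mu>. g (0, x)) else 0)"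
    by (intro sum.cong refl) (auto simp: assms(2))
  also have "\<dots> = (LINT x|\<mu>. g (0, x))" using n by (simp add: sum.delta)
  finally show ?thesis .
qed

lemma induced_vector_norm: "kp.N induced_vector \<le> 1"
proof -
  have "(kp.N induced_vector)\<^sup>2 = (LINT x|\<mu>. (cmod (induced_vector (0, x)))\<^sup>2)"
    unfolding kp.N_square
    by (intro integral_MM kp.H_square_integrable induced_vector_H) (simp add: induced_vector_def)
  also have "\<dots> = 1" using prob_space by (simp add: induced_vector_def)
  finally have "(kp.N induced_vector)\<^sup>2 \<le> 1\<^sup>2" by simp
  then show ?thesis by (rule power2_le_imp_le) simp
qed

lemma induced_vector_functional:
  assumes f: "alg_elem f"
  shows "kp.ip induced_vector (kp.act f induced_vector) = trig_poly (coef f) z"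
proof -
  let ?S = "{k. f (k * int n) \<noteq> 0}"
  have finS: "finite ?S"
  proof -
    have "finite ((\<lambda>k. k * int n) -` {m. f m \<noteq> 0})"
      using f n by (intro finite_vimageI) (auto simp: alg_elem_def inj_on_def)
    then show ?thesis by (simp add: vimage_def)
  qed
  have "kp.ip induced_vector (kp.act f induced_vector) =
      (LINT x|\<mu>. cnj (induced_vector (0, x)) * kp.act f induced_vector (0, x))"
    unfolding kp.ip_def
    by (intro integral_MM kp.ip_integrable kp.H_act induced_vector_H) (simp add: induced_vector_def)
  also have "\<dots> = (LINT x|\<mu>. (\<Sum>k\<in>?S. z powi k * (apply_bcontfun (f (k * int n)) x * cnj (trf n w k x))))"
  proof (rule Bochner_Integration.integral_cong[OF refl])
    fix x
    \<comment> \<open>From the coset 0 the translation by \<open>m\<close> leads to the coset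
      \<open>(- m) mod n\<close>, where the vector vanishes unless \<open>n\<close> divides
      \<open>m\<close>.\<close>
    have t: "apply_bcontfun (f m) (snd (0::int, x)) * (induced_factor m (0, x) * induced_vector
        (induced_map m (0, x))) =
      (if int n dvd m then apply_bcontfun (f m) x * (z powi (m div int n) * cnj (trf n w (m div int n)
          x)) else 0)" for m
    proof (cases "int n dvd m")
      case True
      then obtain k where k: "m = k * int n" by (metis dvdE mult.commute)
      have "(- m) div int n = - k" "(- m) mod int n = 0"
        using n by (simp_all add: k) (metis mult_minus_left nonzero_mult_div_cancel_right of_nat_0
            of_nat_eq_iff less_not_refl)
      then show ?thesis using n by (simp add: k induced_factor_def induced_map_def induced_vector_def
          trf_inverse)
    next
      case False
      then have "(- m) mod int n \<noteq> 0" by (simp add: mod_eq_0_iff_dvd)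
      then show ?thesis using False by (simp add: induced_map_def induced_vector_def)
    qed
    have "cnj (induced_vector (0, x)) * kp.act f induced_vector (0, x) = (\<Sum>m | f m \<noteq> 0.
      if int n dvd m then apply_bcontfun (f m) x * (z powi (m div int n) * cnj (trf n w (m div int n)
          x)) else 0)"
      unfolding kp.act_def t by (simp add: induced_vector_def)
    also have "\<dots> = (\<Sum>m\<in>(\<lambda>k. k * int n) ` ?S. apply_bcontfun (f m) x * (z powi (m div int n) * cnj (trf n
        w (m div int n) x)))"
    proof (rule sum.mono_neutral_cong_right)
      show "finite {m. f m \<noteq> 0}" using f by (simp add: alg_elem_def)
    qed (auto elim!: dvdE simp: mult.commute)
    also have "\<dots> = (\<Sum>k\<in>?S. z powi k * (apply_bcontfun (f (k * int n)) x * cnj (trf n w k x)))"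
      using n by (subst sum.reindex) (auto simp: inj_on_def intro!: sum.cong)
    finally show "cnj (induced_vector (0, x)) * kp.act f induced_vector (0, x) = \<dots>" .
  qed
  also have "\<dots> = (\<Sum>k\<in>?S. coef f k * z powi k)"
    using integrable_mult_trf by (subst Bochner_Integration.integral_sum) (auto simp: coef_def mult.commute)
  also have "\<dots> = (\<Sum>k | coef f k \<noteq> 0. coef f k * z powi k)"
    by (rule sum.mono_neutral_right[OF finS]) (auto simp: coef_def zero_bcontfun.rep_eq)
  also have "\<dots> = trig_poly (coef f) z" by (simp add: alg_rep_def upow_complex z)
  finally show ?thesis .
qed

text \<open>Universality enters here. The bound is uniform in \<open>z\<close>: it makes the limits
  over the circle uniform, and it is the hypothesis of von Neumann's inequality for
  \<open>T\<close>.\<close>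

lemma trig_coef_le: "alg_elem f \<Longrightarrow> cmod (trig_poly (coef f) z) \<le> norm (J f)"
  using kp.vector_functional_le[OF induced_vector_H induced_vector_norm, of f] universal_seminorm[OF
      kp.op_norm_seminorm, of f]
  by (simp add: induced_vector_functional)

lemma trig_coef_positive: "alg_elem f \<Longrightarrow> trig_poly (coef (alg_mult \<alpha> (alg_star \<alpha> f) f)) z \<in> \<real>\<^sub>\<ge>\<^sub>0"
  using kp.vector_functional_positive[OF induced_vector_H, of f] alg_elem_mult[OF alg_elem_star, of f f]
  by (simp add: induced_vector_functional)

end

end

end

end

section \<open>States obtained by mixing over the circle, and the operator \<open>T\<close>\<close>

context cp_system
begin

text \<open>A choice, yet for \<open>z\<close> on the circle there is one candidate only, since a
  contraction is determined by its values on the dense algebraic elements.\<close>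

definition twisted_state :: "nat \<Rightarrow> ('x \<Rightarrow> complex) \<Rightarrow> complex \<Rightarrow> 'c \<Rightarrow> complex"
  where "twisted_state n w z = (SOME \<phi>. clinear \<phi> \<and> (\<forall>x. norm (\<phi> x) \<le> norm x) \<and>
    (\<forall>f. alg_elem f \<longrightarrow> \<phi> (J f) = trig_poly (coef n w f) z))"

definition mixture :: "nat \<Rightarrow> ('x \<Rightarrow> complex) \<Rightarrow> complex measure \<Rightarrow> 'c \<Rightarrow> complex"
  where "mixture n w \<nu> x = (LINT z|\<nu>. twisted_state n w z x)"

context
  fixes n :: nat and w :: "'x \<Rightarrow> complex"
  assumes w: "w \<in> borel_measurable \<mu>" and unim: "\<And>x. cmod (w x) = 1" and n: "0 < n"
begin

lemma twisted_state_properties: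
  assumes z: "cmod z = 1"
  shows "clinear (twisted_state n w z)" "\<And>x. cmod (twisted_state n w z x) \<le> norm x"
    "\<And>f. alg_elem f \<Longrightarrow> twisted_state n w z (J f) = trig_poly (coef n w f) z"
proof -
  interpret c: covariant id "\<lambda>a. a" z by (rule covariant_circle[OF z])
  have "\<exists>\<phi>. clinear \<phi> \<and> (\<forall>x. norm (\<phi> x) \<le> norm x) \<and>
    (\<forall>f. alg_elem f \<longrightarrow> \<phi> (J f) = trig_poly (coef n w f) z)"
  proof (rule contractive_extension)
    fix f g :: "int \<Rightarrow> ('x \<Rightarrow>\<^sub>C complex)" assume fg: "alg_elem f" "alg_elem g"
    have "coef n w (\<lambda>n. f n + g n) = (\<lambda>k. coef n w f k + coef n w g k)"
      by (rule ext) (rule coef_add[OF w unim])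
    then show "trig_poly (coef n w (\<lambda>n. f n + g n)) z = trig_poly (coef n w f) z + trig_poly (coef n w g) z"
      by (simp add: c.rep_add alg_elem_coef[OF w unim n] fg)
  next
    fix r and f :: "int \<Rightarrow> ('x \<Rightarrow>\<^sub>C complex)" assume f: "alg_elem f"
    have "coef n w (\<lambda>n. r *\<^sub>C f n) = (\<lambda>k. r *\<^sub>C coef n w f k)"
      by (rule ext) (simp add: coef_scaleC[OF w unim] scaleC_complex_def)
    then show "trig_poly (coef n w (\<lambda>n. r *\<^sub>C f n)) z = r *\<^sub>C trig_poly (coef n w f) z"
      by (simp add: c.rep_scaleC alg_elem_coef[OF w unim n] f)
  qed (rule trig_coef_le[OF w unim n z])
  from someI_ex[OF this, folded twisted_state_def]
  show "clinear (twisted_state n w z)" "\<And>x. cmod (twisted_state n w z x) \<le> norm x"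
    "\<And>f. alg_elem f \<Longrightarrow> twisted_state n w z (J f) = trig_poly (coef n w f) z"
    by blast+
qed

text \<open>On algebraic elements the dependence on \<open>z\<close> is a trigonometric polynomial.
  Contractivity is uniform in \<open>z\<close>, so a general \<open>x\<close> gives a uniform limit
  of such polynomials.\<close>

lemma twisted_state_continuous: "continuous_on circle (\<lambda>z. twisted_state n w z x)"
proof -
  have "x \<in> closure (J ` Collect alg_elem)" using dense by simp
  then obtain b where b: "\<And>i. b i \<in> J ` Collect alg_elem" "b \<longlonglongrightarrow> x" unfolding closure_sequential by blast
  show ?thesis
  proof (rule uniform_limit_theorem[where F = sequentially and f = "\<lambda>i z. twisted_state n w z (b i)"])
    show "\<forall>\<^sub>F i in sequentially. continuous_on circle (\<lambda>z. twisted_state n w z (b i))"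
    proof (intro always_eventually allI)
      fix i
      obtain f where f: "alg_elem f" "b i = J f" using b(1)[of i] by blast
      have "continuous_on circle (trig_poly (coef n w f))"
      proof -
        have "continuous_on circle (\<lambda>z. \<Sum>k | coef n w f k \<noteq> 0. coef n w f k * z powi k)"
          by (intro continuous_intros) auto
        then show ?thesis by (rule continuous_on_eq) (simp add: alg_rep_def upow_complex)
      qed
      then show "continuous_on circle (\<lambda>z. twisted_state n w z (b i))"
        by (rule continuous_on_eq) (simp add: f twisted_state_properties(3))
    qed
    show "uniform_limit circle (\<lambda>i z. twisted_state n w z (b i)) (\<lambda>z. twisted_state n w z x) sequentially"
    proof (rule uniform_limitI)
      fix e :: real assume "0 < e"
      then have "\<forall>\<^sub>F i in sequentially. dist (b i) x < e" by (rule tendstoD[OF b(2)])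
      then show "\<forall>\<^sub>F i in sequentially. \<forall>z\<in>circle. dist (twisted_state n w z (b i)) (twisted_state n w z
          x) < e"
      proof eventually_elim
        case (elim i)
        show ?case
        proof
          fix z assume "z \<in> circle"
          then have z: "cmod z = 1" by simp
          have "dist (twisted_state n w z (b i)) (twisted_state n w z x) =
              cmod (twisted_state n w z (b i - x))"
            by (simp add: dist_norm clinearD[OF twisted_state_properties(1)[OF z]])
          also have "\<dots> \<le> norm (b i - x)" by (rule twisted_state_properties(2)[OF z])
          finally show "dist (twisted_state n w z (b i)) (twisted_state n w z x) < e" using elim
              by (simp add: dist_norm)
        qed
      qed
    qed
  qed simp
qed

lemma twisted_state_positive:
  assumes z: "cmod z = 1"
  shows "twisted_state n w z (star x * x) \<in> \<real>\<^sub>\<ge>\<^sub>0"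
proof -
  have "x \<in> closure (J ` Collect alg_elem)" using dense by simp
  then obtain b where b: "\<And>i. b i \<in> J ` Collect alg_elem" "b \<longlonglongrightarrow> x" unfolding closure_sequential by blast
  have "twisted_state n w z (star (b i) * b i) \<in> \<real>\<^sub>\<ge>\<^sub>0" for i
  proof -
    obtain f where f: "alg_elem f" "b i = J f" using b(1)[of i] by blast
    have "star (b i) * b i = J (alg_mult \<alpha> (alg_star \<alpha> f) f)"
      by (simp add: f rep_mult alg_elem_star rep_star)
    then show ?thesis
      using trig_coef_positive[OF w unim n z f(1)]
      by (simp add: twisted_state_properties(3)[OF z] alg_elem_mult alg_elem_star f)
  qed
  moreover have "(\<lambda>i. twisted_state n w z (star (b i) * b i)) \<longlonglongrightarrow> twisted_state n w z (star x * x)"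
    using clinear_bounded_linear[OF twisted_state_properties(1,2)[OF z]] b(2)
    by (intro bounded_linear.tendsto[of "twisted_state n w z"] tendsto_mult bounded_linear.tendsto[OF
        bounded_linear_star])
  ultimately show ?thesis by (rule closed_sequentially[OF closed_nonneg_Reals_complex])
qed

context
  fixes \<nu> assumes \<nu>: "\<nu> \<in> prob_measures circle"
begin

interpretation nu: circle_measure \<nu> by unfold_locales (rule \<nu>)

lemma mixture_clinear: "clinear (mixture n w \<nu>)"
proof -
  have i: "integrable \<nu> (\<lambda>z. twisted_state n w z x)" for x
    by (rule nu.continuous_integrable[OF twisted_state_continuous])
  have "mixture n w \<nu> (x + y) = mixture n w \<nu> x + mixture n w \<nu> y" for x y
  proof -
    have "mixture n w \<nu> (x + y) = (LINT z|\<nu>. twisted_state n w z x + twisted_state n w z y)"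
      unfolding mixture_def
      by (intro Bochner_Integration.integral_cong refl) (simp add: nu.space_circle clinearD[OF
          twisted_state_properties(1)])
    then show ?thesis using i by (simp add: mixture_def)
  qed
  moreover have "mixture n w \<nu> (c *\<^sub>C x) = c *\<^sub>C mixture n w \<nu> x" for c x
  proof -
    have "mixture n w \<nu> (c *\<^sub>C x) = (LINT z|\<nu>. c * twisted_state n w z x)"
      unfolding mixture_def
      by (intro Bochner_Integration.integral_cong refl)
        (simp add: nu.space_circle clinearD[OF twisted_state_properties(1)] scaleC_complex_def)
    then show ?thesis by (simp add: mixture_def scaleC_complex_def)
  qed
  ultimately show ?thesis by (simp add: clinear_def)
qed

lemma mixture_rep: "alg_elem f \<Longrightarrow> mixture n w \<nu> (J f) =
    (\<Sum>k | coef n w f k \<noteq> 0. coef n w f k * (LINT z|\<nu>. z powi k))"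
  unfolding mixture_def nu.integral_trig_poly[symmetric]
  by (intro Bochner_Integration.integral_cong refl) (simp add: nu.space_circle twisted_state_properties(3))

lemma mixture_multiple:
  "mixture n w \<nu> (\<iota> a * upow V (k * int n)) =
    (LINT x|\<mu>. apply_bcontfun a x * cnj (trf n w k x)) * (LINT z|\<nu>. z powi k)"
proof -
  let ?c = "LINT x|\<mu>. apply_bcontfun a x * cnj (trf n w k x)"
  have "mixture n w \<nu> (\<iota> a * upow V (k * int n)) =
    (\<Sum>l | alg_single k ?c l \<noteq> 0. alg_single k ?c l * (LINT z|\<nu>. z powi l))"
    using mixture_rep[OF alg_elem_single[of "k * int n" a]]
    unfolding coef_single_multiple[OF w unim n] rep_single .
  also have "\<dots> = (\<Sum>l\<in>{k}. alg_single k ?c l * (LINT z|\<nu>. z powi l))"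
    by (rule sum.mono_neutral_left) (auto simp: alg_single_def)
  finally show ?thesis by (simp add: alg_single_def)
qed

lemma mixture_other: "\<not> int n dvd m \<Longrightarrow> mixture n w \<nu> (\<iota> a * upow V m) = 0"
  using mixture_rep[OF alg_elem_single[of m a]] unfolding rep_single
  by (simp add: coef_single_other[OF w unim n])

lemma state_mixture: "state_on UNIV (mixture n w \<nu>)"
proof -
  note L = clinearD[OF mixture_clinear]
  have "mixture n w \<nu> (star x * x) \<in> \<real>\<^sub>\<ge>\<^sub>0" for x
  proof -
    have i: "integrable \<nu> (\<lambda>z. twisted_state n w z (star x * x))"
      by (rule nu.continuous_integrable[OF twisted_state_continuous])
    have p: "0 \<le> Re (twisted_state n w z (star x * x))" "Im (twisted_state n w z (star x * x)) = 0"
        if "z \<in> space \<nu>" for z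
      using twisted_state_positive[of z x] that by (auto simp: complex_nonneg_Reals_iff nu.space_circle)
    have "0 \<le> (LINT z|\<nu>. Re (twisted_state n w z (star x * x)))"
      by (rule Bochner_Integration.integral_nonneg) (rule p)
    moreover have "(LINT z|\<nu>. Im (twisted_state n w z (star x * x))) = (LINT z|\<nu>. 0)"
      by (intro Bochner_Integration.integral_cong refl p)
    ultimately show ?thesis using i by (simp add: mixture_def complex_nonneg_Reals_iff)
  qed
  moreover have "mixture n w \<nu> 1 = 1"
    using mixture_multiple[of 1 0] prob_space nu.prob_space
    by (simp add: I(3) one_bcontfun.rep_eq)
  ultimately show ?thesis
    using L by (simp add: state_on_def scaleC_complex_def)
qed

end

text \<open>The values of \<open>T\<close> on algebraic elements: the coefficient polynomial
  evaluated at the unitary \<open>V^n\<close> in place of a number.\<close>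

definition transfer_alg :: "(int \<Rightarrow> ('x \<Rightarrow>\<^sub>C complex)) \<Rightarrow> 'c"
  where "transfer_alg f = poly_unitary (coef n w f) (upow V (int n))"

text \<open>Von Neumann's inequality reduces the norm at \<open>V^n\<close> to the supremum over the
  circle, and at each point of the circle the induced representation gives the bound.\<close>

lemma transfer_alg_le: "alg_elem f \<Longrightarrow> norm (transfer_alg f) \<le> norm (J f)"
  unfolding transfer_alg_def
  by (rule norm_poly_unitary_le[OF upow_unitary[OF uV] alg_elem_coef[OF w unim n]])
    (auto intro: trig_coef_le[OF w unim n])

lemma transfer_operator_exists:
  "\<exists>T. clinear T \<and> (\<forall>x. norm (T x) \<le> norm x) \<and> range T \<subseteq> cstar_gen {upow V (int n)} \<and>
    (\<forall>a k. T (\<iota> a * upow V (k * int n)) =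
      (LINT x|\<mu>. apply_bcontfun a x * cnj (trf n w k x)) *\<^sub>C upow V (k * int n)) \<and>
    (\<forall>a l. \<not> int n dvd l \<longrightarrow> T (\<iota> a * upow V l) = (0 :: 'c))"
proof -
  have U: "unitary (upow V (int n))" by (rule upow_unitary[OF uV])
  interpret u: covariant id "\<lambda>r. r *\<^sub>C (1 :: 'c)" "upow V (int n)" by (rule covariant_scalars[OF U])
  have "\<exists>T. clinear T \<and> (\<forall>x. norm (T x) \<le> norm x) \<and> (\<forall>f. alg_elem f \<longrightarrow> T (J f) = transfer_alg f)"
  proof (rule contractive_extension)
    fix f g :: "int \<Rightarrow> ('x \<Rightarrow>\<^sub>C complex)" assume fg: "alg_elem f" "alg_elem g"
    have "coef n w (\<lambda>n. f n + g n) = (\<lambda>k. coef n w f k + coef n w g k)"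
      by (rule ext) (rule coef_add[OF w unim])
    then show "transfer_alg (\<lambda>n. f n + g n) = transfer_alg f + transfer_alg g"
      by (simp add: transfer_alg_def u.rep_add alg_elem_coef[OF w unim n] fg)
  next
    fix r and f :: "int \<Rightarrow> ('x \<Rightarrow>\<^sub>C complex)" assume f: "alg_elem f"
    have "coef n w (\<lambda>n. r *\<^sub>C f n) = (\<lambda>k. r *\<^sub>C coef n w f k)"
      by (rule ext) (simp add: coef_scaleC[OF w unim] scaleC_complex_def)
    then show "transfer_alg (\<lambda>n. r *\<^sub>C f n) = r *\<^sub>C transfer_alg f"
      by (simp add: transfer_alg_def u.rep_scaleC alg_elem_coef[OF w unim n] f)
  qed (rule transfer_alg_le)
  then obtain T where T: "clinear T" "\<And>x. norm (T x) \<le> norm x" "\<And>f. alg_elem f \<Longrightarrow> T (J f) =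
      transfer_alg f" by blast
  have "T x \<in> cstar_gen {upow V (int n)}" for x
  proof -
    note C = cstar_subalgebraD[OF cstar_subalgebra_gen[of "{upow V (int n)}"]]
    have gen: "upow V (int n) \<in> cstar_gen {upow V (int n)}" using cstar_gen_superset by blast
    have pw: "upow (upow V (int n)) k \<in> cstar_gen {upow V (int n)}" for k
      unfolding upow_def[of "upow V (int n)"]
      by (auto intro: cstar_subalgebra_power[OF cstar_subalgebra_gen] gen C(6))
    have transfer_alg: "transfer_alg f \<in> cstar_gen {upow V (int n)}" for f
      unfolding transfer_alg_def alg_rep_def
      by (intro cstar_subalgebra_sum[OF cstar_subalgebra_gen]) (simp add: mult_scaleC_left C(5) pw)
    have "x \<in> closure (J ` Collect alg_elem)" using dense by simp
    then obtain b where b: "\<And>i. b i \<in> J ` Collect alg_elem" "b \<longlonglongrightarrow> x" unfolding closure_sequential by blast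
    have "T (b i) \<in> cstar_gen {upow V (int n)}" for i using b(1)[of i] T(3) transfer_alg by auto
    moreover have "(\<lambda>i. T (b i)) \<longlonglongrightarrow> T x"
      by (rule bounded_linear.tendsto[OF clinear_bounded_linear[OF T(1,2)] b(2)])
    ultimately show ?thesis by (rule closed_sequentially[OF C(1)])
  qed
  moreover have "T (\<iota> a * upow V (k * int n)) =
      (LINT x|\<mu>. apply_bcontfun a x * cnj (trf n w k x)) *\<^sub>C upow V (k * int n)" for a k
    using T(3)[OF alg_elem_single[of "k * int n" a]]
    by (simp add: rep_single transfer_alg_def coef_single_multiple[OF w unim n] u.rep_single
        mult_scaleC_left upow_mult[OF uV] mult.commute)
  moreover have "T (\<iota> a * upow V l) = 0" if "\<not> int n dvd l" for a l
    using T(3)[OF alg_elem_single[of l a]] 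
    unfolding rep_single transfer_alg_def coef_single_other[OF w unim n that] by (simp add: alg_rep_def)
  ultimately show ?thesis using T(1,2) by blast
qed

end

text \<open>Existence comes from the extension of \<open>transfer_alg\<close>, uniqueness from the
  values on the generators. The range condition must be verified but plays a part in existence
  only.\<close>

lemma skew_T_properties:
  assumes w: "w \<in> borel_measurable \<mu>" and unim: "AE x in \<mu>. cmod (w x) = 1" and n: "0 < n"
  defines "T \<equiv> skew_T \<mu> \<alpha> \<iota> V n w"
  shows "clinear T" "\<And>x. norm (T x) \<le> norm x" "range T \<subseteq> cstar_gen {upow V (int n)}"
    "\<And>a k. T (\<iota> a * upow V (k * int n)) =
      (LINT x|\<mu>. apply_bcontfun a x * cnj (trf n w k x)) *\<^sub>C upow V (k * int n)"
    "\<And>a l. \<not> int n dvd l \<Longrightarrow> T (\<iota> a * upow V l) = 0"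
proof -
  \<comment> \<open>A correction on a null set makes \<open>w\<close> unimodular everywhere; none of
    the defining integrals changes.\<close>
  define w' where "w' x = (if cmod (w x) = 1 then w x else 1)" for x
  have w': "w' \<in> borel_measurable \<mu>" "\<And>x. cmod (w' x) = 1" using w by (auto simp: w'_def[abs_def])
  have ae: "AE x in \<mu>. trf n w k x = trf n w' k x" for k
    using unim by (intro trf_AE_cong) (auto simp: w'_def elim: AE_mp)
  have int: "(LINT x|\<mu>. apply_bcontfun a x * cnj (trf n w k x)) =
      (LINT x|\<mu>. apply_bcontfun a x * cnj (trf n w' k x))" for a k
  proof (rule integral_cong_AE)
    have m: "(\<lambda>x. cnj (trf n v k x)) \<in> borel_measurable \<mu>" if "v \<in> borel_measurable \<mu>" for v
      by (rule borel_measurable_continuous_on[OF _ trf_measurable[OF that], of cnj]) (auto intro: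
          continuous_intros)
    show "(\<lambda>x. apply_bcontfun a x * cnj (trf n w k x)) \<in> borel_measurable \<mu>"
      "(\<lambda>x. apply_bcontfun a x * cnj (trf n w' k x)) \<in> borel_measurable \<mu>"
      by (intro borel_measurable_times bcontfun_measurable m w w')+
    show "AE x in \<mu>. apply_bcontfun a x * cnj (trf n w k x) = apply_bcontfun a x * cnj (trf n w' k x)"
      using ae[of k] by eventually_elim simp
  qed
  obtain S where S: "clinear S" "\<And>x. norm (S x) \<le> norm x" "range S \<subseteq> cstar_gen {upow V (int n)}"
    "\<And>a k. S (\<iota> a * upow V (k * int n)) =
      (LINT x|\<mu>. apply_bcontfun a x * cnj (trf n w k x)) *\<^sub>C upow V (k * int n)"
    "\<And>a l. \<not> int n dvd l \<Longrightarrow> S (\<iota> a * upow V l) = 0"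
    using transfer_operator_exists[OF w' n] unfolding int by blast
  have "T = S"
    unfolding T_def skew_T_def
  proof (rule the_equality)
    show "bounded_linear S \<and> clinear S \<and> range S \<subseteq> cstar_gen {upow V (int n)} \<and>
      (\<forall>a k. S (\<iota> a * upow V (k * int n)) =
        (LINT x|\<mu>. apply_bcontfun a x * cnj (trf n w k x)) *\<^sub>C upow V (k * int n)) \<and>
      (\<forall>a l. \<not> int n dvd l \<longrightarrow> S (\<iota> a * upow V l) = 0)"
      using S clinear_bounded_linear[OF S(1,2)] by blast
    fix R assume R: "bounded_linear R \<and> clinear R \<and> range R \<subseteq> cstar_gen {upow V (int n)} \<and>
      (\<forall>a k. R (\<iota> a * upow V (k * int n)) =
        (LINT x|\<mu>. apply_bcontfun a x * cnj (trf n w k x)) *\<^sub>C upow V (k * int n)) \<and>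
      (\<forall>a l. \<not> int n dvd l \<longrightarrow> R (\<iota> a * upow V l) = 0)"
    show "R = S"
    proof (rule bounded_clinear_eqI)
      fix a m
      show "R (\<iota> a * upow V m) = S (\<iota> a * upow V m)"
      proof (cases "int n dvd m")
        case True
        then obtain k where "m = k * int n" by (metis dvdE mult.commute)
        then show ?thesis using R S(4) by simp
      qed (use R S(5) in simp)
    qed (use R S clinear_bounded_linear[OF S(1,2)] in auto)
  qed
  then show "clinear T" "\<And>x. norm (T x) \<le> norm x" "range T \<subseteq> cstar_gen {upow V (int n)}"
    "\<And>a k. T (\<iota> a * upow V (k * int n)) =
      (LINT x|\<mu>. apply_bcontfun a x * cnj (trf n w k x)) *\<^sub>C upow V (k * int n)"
    "\<And>a l. \<not> int n dvd l \<Longrightarrow> T (\<iota> a * upow V l) = 0"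
    using S by simp_all
qed

end

section \<open>States on the C*-algebra generated by one unitary\<close>

lemma state_on_continuous:
  assumes B: "cstar_subalgebra B" and s: "state_on B \<phi>"
  shows "continuous_on B \<phi>"
proof (rule continuous_onI)
  fix x and e :: real assume x: "x \<in> B" and e: "0 < e"
  have "dist (\<phi> y) (\<phi> x) \<le> e" if y: "y \<in> B" and d: "dist y x < e" for y
  proof -
    have "dist (\<phi> y) (\<phi> x) = cmod (\<phi> (y - x))" by (simp add: dist_norm state_on_diff[OF B s y x])
    also have "\<dots> \<le> norm (y - x)" by (rule state_on_norm_le[OF B s cstar_subalgebraD(9)[OF B y x]])
    finally show ?thesis using d by (simp add: dist_norm)
  qed
  then show "\<exists>d>0. \<forall>y\<in>B. dist y x < d \<longrightarrow> dist (\<phi> y) (\<phi> x) \<le> e" using e by blast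
qed

lemma state_on_sum:
  assumes B: "cstar_subalgebra B" and s: "state_on B \<phi>" and f: "\<And>i. i \<in> F \<Longrightarrow> f i \<in> B"
  shows "\<phi> (\<Sum>i\<in>F. f i) = (\<Sum>i\<in>F. \<phi> (f i))"
  using f
proof (induction F rule: infinite_finite_induct)
  case (insert i F)
  then show ?case
    by (simp add: state_onD(1)[OF s] cstar_subalgebra_sum[OF B])
qed (use state_onD(2)[OF s cstar_subalgebraD(8)[OF B], of 0] in simp_all)

text \<open>Laurent polynomials in \<open>U\<close> are dense in the generated algebra and states
  are continuous on it. Outside the algebra both functions are fixed by extensionality.\<close>

lemma circle_algebra_state_eqI:
  fixes U :: "'b::cstar_algebra"
  assumes U: "unitary U" and s: "state_on (cstar_gen {U}) \<phi>" and t: "state_on (cstar_gen {U}) \<psi>"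
    and eq: "\<And>k. \<phi> (upow U k) = \<psi> (upow U k)"
  shows "\<phi> = \<psi>"
proof -
  interpret u: covariant id "\<lambda>r. r *\<^sub>C (1 :: 'b)" U by (rule covariant_scalars[OF U])
  note B = cstar_subalgebra_gen[of "{U}"]
  note C = cstar_subalgebraD[OF B]
  let ?D = "(\<lambda>c. poly_unitary c U) ` Collect alg_elem"
  have gen: "U \<in> cstar_gen {U}" using cstar_gen_superset by blast
  have pw: "upow U k \<in> cstar_gen {U}" for k
    unfolding upow_def by (auto intro: cstar_subalgebra_power[OF B] gen C(6))
  have D: "?D \<subseteq> cstar_gen {U}"
    unfolding alg_rep_def by (auto intro!: cstar_subalgebra_sum[OF B] C(4,5) C(2) pw)
  have "cstar_gen {U} \<subseteq> closure ?D"
  proof (rule cstar_gen_subset)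
    have single: "poly_unitary (alg_single k 1) U = upow U k" for k by (simp add: u.rep_single)
    show "cstar_subalgebra (closure ?D)"
    proof (rule closure_cstar_subalgebra)
      show "1 \<in> ?D" using single[of 0] by (intro image_eqI[of _ _ "alg_single 0 1"]) (auto simp:
          alg_elem_single)
    next
      fix x y assume "x \<in> ?D" "y \<in> ?D"
      then obtain f g where "alg_elem f" "x = poly_unitary f U" "alg_elem g" "y = poly_unitary g U" by blast
      then show "x + y \<in> ?D" "x * y \<in> ?D"
        using imageI[of "\<lambda>n. f n + g n" "Collect alg_elem" "\<lambda>c. poly_unitary c U"]
          imageI[of "alg_mult id f g" "Collect alg_elem" "\<lambda>c. poly_unitary c U"]
        by (simp_all add: u.rep_add alg_elem_add u.rep_mult u.alg_elem_mult)
    next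
      fix x c assume "x \<in> ?D"
      then obtain f where "alg_elem f" "x = poly_unitary f U" by blast
      then show "c *\<^sub>C x \<in> ?D" "star x \<in> ?D"
        using imageI[of "\<lambda>n. c *\<^sub>C f n" "Collect alg_elem" "\<lambda>c. poly_unitary c U"]
          imageI[of "alg_star id f" "Collect alg_elem" "\<lambda>c. poly_unitary c U"]
        by (simp_all add: u.rep_scaleC alg_elem_scaleC u.rep_star u.alg_elem_star)
    qed
    show "{U} \<subseteq> closure ?D"
    proof -
      have "U \<in> ?D" using single[of 1] by (intro image_eqI[of _ _ "alg_single 1 1"]) (auto simp:
          alg_elem_single)
      then show ?thesis using closure_subset[of ?D] by blast
    qed
  qed
  moreover have "closure ?D \<subseteq> cstar_gen {U}" using D C(1) by (rule closure_minimal)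
  ultimately have cl: "closure ?D = cstar_gen {U}" by blast
  have poly: "\<rho> (poly_unitary c U) = (\<Sum>k | c k \<noteq> 0. c k * \<rho> (upow U k))"
      if r: "state_on (cstar_gen {U}) \<rho>" for \<rho> c
    unfolding alg_rep_def
    by (subst state_on_sum[OF B r]) (auto simp: mult_scaleC_left state_onD(2)[OF r] pw C(5))
  have "\<phi> x = \<psi> x" if "x \<in> cstar_gen {U}" for x
  proof (rule eq_on_closure[where D = ?D])
    show "continuous_on (closure ?D) \<phi>" "continuous_on (closure ?D) \<psi>"
      unfolding cl by (rule state_on_continuous[OF B s], rule state_on_continuous[OF B t])
    show "x \<in> closure ?D" unfolding cl by (rule that)
  qed (auto simp: poly[OF s] poly[OF t] eq)
  then show ?thesis using state_onD(5)[OF s] state_onD(5)[OF t] by (intro extensionalityI) auto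
qed

section \<open>The map \<open>\<Psi>\<close> as a mixture of induced states\<close>

context cp_system
begin

lemma cnj_trf_measurable: "v \<in> borel_measurable \<mu> \<Longrightarrow> (\<lambda>x. cnj (trf n v k x)) \<in> borel_measurable \<mu>"
  by (rule borel_measurable_continuous_on[OF _ trf_measurable, of cnj]) (auto intro: continuous_intros)

text \<open>The mixture for the constant function 1 takes the moments of \<open>\<nu>\<close> as its
  values at the powers \<open>V^(k n)\<close>, because \<open>\<mu>\<close> has mass 1. Its
  restriction proves existence without identifying the generated algebra with functions on the
  circle.\<close>

lemma circle_state_properties:
  assumes n: "0 < n" and \<nu>: "\<nu> \<in> prob_measures circle"
  shows "state_on (cstar_gen {upow V (int n)}) (circle_state V n \<nu>)"
    "circle_state V n \<nu> (upow V (k * int n)) = (LINT z|\<nu>. z powi k)"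
proof -
  let ?B = "cstar_gen {upow V (int n)}"
  let ?m = "mixture n (\<lambda>_. 1) \<nu>"
  note B = cstar_subalgebra_gen[of "{upow V (int n)}"]
  note C = cstar_subalgebraD[OF B]
  note U = upow_unitary[OF uV, of "int n"]
  have m: "state_on UNIV ?m" by (rule state_mixture[OF _ _ n \<nu>]) auto
  have val: "?m (upow V (k * int n)) = (LINT z|\<nu>. z powi k)" for k
    using mixture_multiple[of "\<lambda>_. 1" n \<nu> 1 k] n \<nu> prob_space
    by (simp add: I(3) one_bcontfun.rep_eq transfer_iterate_def)
  have "upow V (int n) \<in> ?B" using cstar_gen_superset by blast
  then have pw: "upow (upow V (int n)) k \<in> ?B" for k
    unfolding upow_def[of "upow V (int n)"] by (auto intro: cstar_subalgebra_power[OF B] C(6))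
  then have pw': "upow V (k * int n) \<in> ?B" for k
    using pw[of k] upow_mult[OF uV, of "int n" k] by (simp add: mult.commute)
  have r: "state_on ?B (restrict ?m ?B) \<and> (\<forall>k. restrict ?m ?B (upow V (k * int n)) = (LINT z|\<nu>. z powi k))"
    using state_onD[OF m] pw' val by (auto simp: state_on_def C)
  have "circle_state V n \<nu> = restrict ?m ?B"
    unfolding circle_state_def
  proof (rule the_equality)
    show "state_on ?B (restrict ?m ?B) \<and> (\<forall>k. restrict ?m ?B (upow V (k * int n)) =
        (LINT z|\<nu>. z powi k))" by (rule r)
    fix \<phi> assume p: "state_on ?B \<phi> \<and> (\<forall>k. \<phi> (upow V (k * int n)) = (LINT z|\<nu>. z powi k))"
    show "\<phi> = restrict ?m ?B"
    proof (rule circle_algebra_state_eqI[OF U])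
      show "\<phi> (upow (upow V (int n)) k) = restrict ?m ?B (upow (upow V (int n)) k)" for k
        using p r upow_mult[OF uV, of "int n" k] by (simp add: mult.commute)
    qed (use p r in auto)
  qed
  then show "state_on (cstar_gen {upow V (int n)}) (circle_state V n \<nu>)"
    "circle_state V n \<nu> (upow V (k * int n)) = (LINT z|\<nu>. z powi k)"
    using r by simp_all
qed

context
  fixes n :: nat and w :: "'x \<Rightarrow> complex"
  assumes w: "w \<in> borel_measurable \<mu>" and unim: "AE x in \<mu>. cmod (w x) = 1" and n: "0 < n"
begin

abbreviation "\<Psi> \<equiv> skew_Psi \<mu> \<alpha> \<iota> V n w"

text \<open>Transfer functions are unimodular almost everywhere; \<open>w1\<close> is unimodular
  everywhere and has the same integrals.\<close>

definition "w1 x = (if cmod (w x) = 1 then w x else 1)"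

lemma w1: "w1 \<in> borel_measurable \<mu>" "\<And>x. cmod (w1 x) = 1" "AE x in \<mu>. w x = w1 x"
  using w unim by (auto simp: w1_def[abs_def] elim: AE_mp)

lemma trf_w1: "AE x in \<mu>. trf n w k x = trf n w1 k x"
  by (rule trf_AE_cong[OF w1(3)])

lemma integral_trf_w1: "(LINT x|\<mu>. apply_bcontfun a x * cnj (trf n w k x)) =
    (LINT x|\<mu>. apply_bcontfun a x * cnj (trf n w1 k x))"
proof (rule integral_cong_AE)
  show "AE x in \<mu>. apply_bcontfun a x * cnj (trf n w k x) = apply_bcontfun a x * cnj (trf n w1 k x)"
    using trf_w1[of k] by eventually_elim simp
qed (intro borel_measurable_times bcontfun_measurable cnj_trf_measurable w w1)+

text \<open>Both sides are bounded and linear, so the generators decide. The right side is an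
  integral over the circle, which makes positivity of \<open>\<Psi>\<close> and its dependence on
  the measure visible.\<close>

lemma skew_Psi_eq_mixture:
  assumes \<nu>: "\<nu> \<in> prob_measures circle"
  shows "\<Psi> \<nu> = mixture n w1 \<nu>"
proof (rule bounded_clinear_eqI)
  note T = skew_T_properties[OF w unim n]
  note S = circle_state_properties[OF n \<nu>]
  let ?B = "cstar_gen {upow V (int n)}"
  have TB: "skew_T \<mu> \<alpha> \<iota> V n w x \<in> ?B" for x using T(3) by blast
  note B = cstar_subalgebra_gen[of "{upow V (int n)}"]
  show cl: "clinear (\<Psi> \<nu>)"
    unfolding skew_Psi_def clinear_def comp_def
    by (simp add: clinearD[OF T(1)] state_onD(1,2)[OF S(1)] TB scaleC_complex_def)
  have "cmod (\<Psi> \<nu> x) \<le> norm x" for x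
    unfolding skew_Psi_def comp_def
    by (rule order_trans[OF state_on_norm_le[OF B S(1) TB] T(2)])
  then show "bounded_linear (\<Psi> \<nu>)" by (rule clinear_bounded_linear[OF cl])
  have m: "state_on UNIV (mixture n w1 \<nu>)" by (rule state_mixture[OF w1(1,2) n \<nu>])
  show "clinear (mixture n w1 \<nu>)" "bounded_linear (mixture n w1 \<nu>)"
    by (rule state_clinear[OF m], rule state_bounded_linear[OF m])
  fix a m
  show "\<Psi> \<nu> (\<iota> a * upow V m) = mixture n w1 \<nu> (\<iota> a * upow V m)"
  proof (cases "int n dvd m")
    case True
    then obtain k where m: "m = k * int n" by (metis dvdE mult.commute)
    have "upow V (int n) \<in> ?B" using cstar_gen_superset by blast
    then have "upow (upow V (int n)) k \<in> ?B"
      unfolding upow_def[of "upow V (int n)"] by (auto intro: cstar_subalgebra_power[OF B]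
          cstar_subalgebraD(6)[OF B])
    then have pw: "upow V (k * int n) \<in> ?B" using upow_mult[OF uV, of "int n" k] by (simp add: mult.commute)
    show ?thesis
      unfolding m mixture_multiple[OF w1(1,2) n \<nu>]
      by (simp add: skew_Psi_def T(4) state_onD(2)[OF S(1) pw] S(2) integral_trf_w1)
  next
    case False
    have "circle_state V n \<nu> 0 = 0"
      using state_onD(2)[OF S(1) cstar_subalgebraD(8)[OF B], of 0] by simp
    then show ?thesis
      by (simp add: mixture_other[OF w1(1,2) n \<nu> False] skew_Psi_def T(5)[OF False])
  qed
qed

lemma skew_Psi_properties:
  assumes \<nu>: "\<nu> \<in> prob_measures circle"
  shows "state_on UNIV (\<Psi> \<nu>)"
    "\<Psi> \<nu> (\<iota> a * upow V (k * int n)) = (LINT x|\<mu>. apply_bcontfun a x * cnj (trf n w k x)) * (LINT z|\<nu>. z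
        powi k)"
    "\<not> int n dvd m \<Longrightarrow> \<Psi> \<nu> (\<iota> a * upow V m) = 0"
  unfolding skew_Psi_eq_mixture[OF \<nu>] integral_trf_w1
  by (rule state_mixture[OF w1(1,2) n \<nu>], rule mixture_multiple[OF w1(1,2) n \<nu>], rule mixture_other[OF
      w1(1,2) n \<nu>])

text \<open>In this form weak-* continuity and affinity of \<open>\<Psi>\<close> are
  immediate.\<close>

lemma skew_Psi_integral: "\<exists>f. continuous_on circle f \<and> (\<forall>\<nu>\<in>prob_measures circle. \<Psi> \<nu> x = (LINT z|\<nu>. f z))"
  using twisted_state_continuous[OF w1(1,2) n] skew_Psi_eq_mixture
  by (intro exI[of _ "\<lambda>z. twisted_state n w1 z x"]) (simp add: mixture_def)

end

end

section \<open>Invariant states of the skew product\<close>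

lemma state_on_comp_hom:
  assumes s: "state_on UNIV \<phi>" and h: "unital_star_hom f"
  shows "state_on UNIV (\<phi> \<circ> f)"
  using state_onD[OF s] unital_star_homD[OF h] by (auto simp: state_on_def)

text \<open>\<open>\<omega> \<circ> \<alpha>\<close> is again an invariant state, and there is only
  one.\<close>

lemma uniquely_ergodic_commuting_invariant:
  assumes inv: "invariant_states \<theta> = {\<omega>}" and aut: "star_automorphism \<alpha>"
    and comm: "\<And>g. \<alpha> \<circ> \<theta> g = \<theta> g \<circ> \<alpha>"
  shows "\<omega> (\<alpha> a) = \<omega> a"
proof -
  have w: "state_on UNIV \<omega>" "\<And>g. \<omega> \<circ> \<theta> g = \<omega>" using inv by (auto simp: invariant_states_def)
  have "\<omega> \<circ> \<alpha> \<circ> \<theta> g = \<omega> \<circ> \<alpha>" for g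
    using comm[of g] w(2)[of g] by (metis comp_assoc)
  then have "\<omega> \<circ> \<alpha> \<in> invariant_states \<theta>"
    using state_on_comp_hom[OF w(1) star_automorphism_hom[OF aut]] by (simp add: invariant_states_def)
  then have "\<omega> \<circ> \<alpha> = \<omega>" using inv by simp
  then show ?thesis by (metis comp_apply)
qed

text \<open>Later the approximants are multiplied with each other, and convergence in mean survives
  products only under a uniform bound. Hence they are truncated to the unit disc.\<close>

lemma (in compact_prob) bcontfun_dense_L1_bounded:
  fixes f :: "'x \<Rightarrow> complex"
  assumes f: "f \<in> borel_measurable \<mu>" "\<And>x. cmod (f x) = 1"
  obtains s :: "nat \<Rightarrow> ('x \<Rightarrow>\<^sub>C complex)"
    where "(\<lambda>i. LINT x|\<mu>. cmod (f x - apply_bcontfun (s i) x)) \<longlonglongrightarrow> 0" "\<And>i. norm (s i) \<le> 1"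
proof -
  obtain s :: "nat \<Rightarrow> ('x \<Rightarrow>\<^sub>C complex)" where s: "(\<lambda>i. LINT x|\<mu>. cmod (f x - apply_bcontfun (s i) x)) \<longlonglongrightarrow> 0"
    using bcontfun_dense_L1[OF f(1)] f(2) by auto
  define t where "t i = Bcontfun (\<lambda>x. apply_bcontfun (s i) x / complex_of_real (max 1 (cmod
      (apply_bcontfun (s i) x))))" for i
  have m: "complex_of_real (max 1 r) \<noteq> 0" for r by (simp add: max_def)
  have "continuous_on UNIV (\<lambda>x. apply_bcontfun (s i) x / complex_of_real (max 1 (cmod (apply_bcontfun (s
      i) x))))" for i
    by (intro continuous_intros continuous_on_apply_bcontfun) (use m in auto)
  then have t: "apply_bcontfun (t i) x = apply_bcontfun (s i) x / complex_of_real (max 1 (cmod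
      (apply_bcontfun (s i) x)))" for i x
    unfolding t_def by (simp add: bcontfun_of_compact[OF comp])
  have int_f: "integrable \<mu> f" using f by (intro integrable_const_bound[where B = 1]) auto
  \<comment> \<open>The radial retraction moves a value \<open>a\<close> outside the disc by
    \<open>|a| - 1\<close>, which is at most \<open>|f - a|\<close> as \<open>|f| = 1\<close>; hence
    the factor 2.\<close>
  have close: "cmod (f x - apply_bcontfun (t i) x) \<le> 2 * cmod (f x - apply_bcontfun (s i) x)" for i x
  proof (cases "cmod (apply_bcontfun (s i) x) \<le> 1")
    case True
    then show ?thesis by (simp add: t max_absorb1)
  next
    case False
    define a r where "a = apply_bcontfun (s i) x" and "r = cmod a"
    have r: "1 < r" using False by (simp add: a_def r_def)
    have "a - apply_bcontfun (t i) x = a * complex_of_real ((r - 1) / r)"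
      using r by (simp add: t a_def[symmetric] r_def[symmetric] max_def field_simps)
    then have "cmod (a - apply_bcontfun (t i) x) = r * ((r - 1) / r)"
      using r by (simp only: norm_mult norm_of_real r_def[symmetric]) simp
    also have "\<dots> = r - 1" using r by simp
    also have "\<dots> \<le> cmod (f x - a)" using norm_triangle_ineq2[of a "f x"] f(2)[of x]
        by (simp add: r_def norm_minus_commute)
    finally show ?thesis
      using norm_triangle_ineq[of "f x - a" "a - apply_bcontfun (t i) x"] by (simp add: a_def)
  qed
  have "(\<lambda>i. LINT x|\<mu>. cmod (f x - apply_bcontfun (t i) x)) \<longlonglongrightarrow> 0"
  proof (rule Lim_null_comparison)
    show "(\<lambda>i. 2 * (LINT x|\<mu>. cmod (f x - apply_bcontfun (s i) x))) \<longlonglongrightarrow> 0"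
        by (intro tendsto_mult_right_zero s)
    have "(LINT x|\<mu>. cmod (f x - apply_bcontfun (t i) x)) \<le>
        (LINT x|\<mu>. 2 * cmod (f x - apply_bcontfun (s i) x))" for i
      by (intro integral_mono close integrable_mult_right integrable_norm
          Bochner_Integration.integrable_diff int_f integrable_bcontfun)
    then show "\<forall>\<^sub>F i in sequentially. norm (LINT x|\<mu>. cmod (f x - apply_bcontfun (t i) x)) \<le>
        2 * (LINT x|\<mu>. cmod (f x - apply_bcontfun (s i) x))"
      by (intro always_eventually allI) simp
  qed
  moreover have "norm (t i) \<le> 1" for i
    by (rule norm_bound) (auto simp: t norm_divide max_def)
  ultimately show ?thesis by (rule that)
qed

section \<open>The skew product action and its invariant states\<close>

locale skew_system = cp_system \<alpha> \<iota> V \<mu>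
  for \<alpha> :: "('x::metric_space \<Rightarrow>\<^sub>C complex) \<Rightarrow> ('x \<Rightarrow>\<^sub>C complex)"
    and \<iota> :: "('x \<Rightarrow>\<^sub>C complex) \<Rightarrow> 'c::cstar_algebra" and V :: 'c and \<mu> :: "'x measure" +
  fixes \<theta> :: "'g::topological_group_add \<Rightarrow> ('x \<Rightarrow>\<^sub>C complex) \<Rightarrow> ('x \<Rightarrow>\<^sub>C complex)"
    and u :: "'g \<times> 'x \<Rightarrow> complex"
  assumes system: "cstar_dynamical_system \<theta>"
    and unique: "invariant_states \<theta> = {\<lambda>f. LINT x|\<mu>. apply_bcontfun f x}"
    and comm: "\<And>g. \<alpha> \<circ> \<theta> g = \<theta> g \<circ> \<alpha>"
    and cocycle: "continuous_cocycle \<theta> u"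
begin

lemma \<theta>_aut: "star_automorphism (\<theta> g)" and \<theta>_add: "\<theta> (g + h) a = \<theta> g (\<theta> h a)"
  using system by (auto simp: cstar_dynamical_system_def)

lemma \<theta>_zero: "\<theta> 0 a = a"
proof -
  have "\<theta> 0 (\<theta> 0 a) = \<theta> 0 a" using \<theta>_add[of 0 0 a] by simp
  then show ?thesis by (rule injD[OF bij_is_inj[OF star_automorphism_bij[OF \<theta>_aut]]])
qed

abbreviation cu :: "'g \<Rightarrow> 'x \<Rightarrow>\<^sub>C complex"
  where "cu \<equiv> cocycle_at u"

lemma cu_norm: "cmod (apply_bcontfun (cu g) x) = 1"
proof -
  have "continuous_on UNIV (\<lambda>x. u (g, x))"
  proof (rule continuous_on_compose2[of UNIV u])
    show "continuous_on UNIV u" using cocycle by (simp add: continuous_cocycle_def)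
  qed (auto intro: continuous_on_Pair continuous_on_const continuous_on_id)
  then have "apply_bcontfun (cu g) x = u (g, x)"
    unfolding cocycle_at_def by (simp add: bcontfun_of_compact[OF comp])
  moreover have "u (g, x) \<in> sphere 0 1" using cocycle unfolding continuous_cocycle_def by blast
  ultimately show ?thesis by simp
qed

lemma cu_add: "cu (g + h) = \<theta> g (cu h) * cu g"
  using cocycle by (simp add: continuous_cocycle_def)

lemma cu_unitary: "star (cu g) * cu g = 1"
proof (rule bcontfun_eqI)
  fix x
  show "apply_bcontfun (star (cu g) * cu g) x = apply_bcontfun 1 x"
    using complex_norm_square[of "apply_bcontfun (cu g) x"]
    by (simp add: bcontfun_star_rep star_complex_def cu_norm mult.commute)
qed

lemma cu_zero: "cu 0 = 1"
proof -
  have "cu 0 = cu 0 * cu 0" using cu_add[of 0 0] by (simp add: \<theta>_zero)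
  then have "star (cu 0) * cu 0 = (star (cu 0) * cu 0) * cu 0" by (simp add: mult.assoc)
  then show ?thesis by (simp add: cu_unitary)
qed

text \<open>Since \<open>C(X)\<close> is commutative, \<open>u_g\<close> cancels against its adjoint
  in the conjugation; what is left is that \<open>\<alpha>\<close> and \<open>\<theta> g\<close>
  commute.\<close>

lemma covariant_skew: "covariant_pair \<alpha> (\<iota> \<circ> \<theta> g) (\<iota> (cu g) * V)"
proof -
  have cu': "\<iota> (star (cu g)) * \<iota> (cu g) = 1" "\<iota> (cu g) * \<iota> (star (cu g)) = 1"
    by (simp_all only: I(4)[symmetric] cu_unitary mult.commute[of "cu g" "star (cu g)"] I(3))
  have V: "star V * V = 1" "V * star V = 1" using uV by (auto simp: unitary_def)
  have e: "star (\<iota> (cu g) * V) = star V * \<iota> (star (cu g))" by (simp add: star_mult I(5))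
  have "star V * \<iota> (star (cu g)) * (\<iota> (cu g) * V) = star V * (\<iota> (star (cu g)) * \<iota> (cu g)) * V"
      by (simp only: mult.assoc)
  then have un1: "star (\<iota> (cu g) * V) * (\<iota> (cu g) * V) = 1" unfolding e by (simp only: cu' V mult_1_right)
  have "\<iota> (cu g) * V * (star V * \<iota> (star (cu g))) = \<iota> (cu g) * (V * star V) * \<iota> (star (cu g))"
      by (simp only: mult.assoc)
  then have un2: "(\<iota> (cu g) * V) * star (\<iota> (cu g) * V) = 1" unfolding e by (simp only: cu' V mult_1_right)
  have "(\<iota> (cu g) * V) * \<iota> (\<theta> g a) * star (\<iota> (cu g) * V) = \<iota> (\<theta> g (\<alpha> a))" for a
  proof -
    have "(\<iota> (cu g) * V) * \<iota> (\<theta> g a) * star (\<iota> (cu g) * V) =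
        \<iota> (cu g) * (V * \<iota> (\<theta> g a) * star V) * \<iota> (star (cu g))"
      unfolding e by (simp only: mult.assoc)
    also have "V * \<iota> (\<theta> g a) * star V = \<iota> (\<alpha> (\<theta> g a))" using cov by (simp add: covariant_pair_def)
    also have "\<iota> (cu g) * \<iota> (\<alpha> (\<theta> g a)) * \<iota> (star (cu g)) = \<iota> (\<alpha> (\<theta> g a) * (star (cu g) * cu g))"
      by (simp add: I(4)[symmetric] ac_simps)
    also have "\<dots> = \<iota> (\<theta> g (\<alpha> a))" using comm[of g] by (simp add: cu_unitary fun_eq_iff)
    finally show ?thesis .
  qed
  then show ?thesis
    unfolding covariant_pair_def unitary_def using un1 un2 unital_star_hom_comp[OF hom
        star_automorphism_hom[OF \<theta>_aut]]
    by simp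
qed

abbreviation \<Phi> :: "'g \<Rightarrow> 'c \<Rightarrow> 'c"
  where "\<Phi> \<equiv> skew_action \<theta> \<iota> V u"

text \<open>Universality gives the endomorphism. The cocycle identity for \<open>- g\<close> and
  \<open>g\<close>, together with \<open>u_0 = 1\<close>, shows that the endomorphisms for
  \<open>- g\<close> and \<open>g\<close> are inverse to each other.\<close>

lemma skew_action_properties:
  shows "star_automorphism (\<Phi> g)" "\<Phi> g (\<iota> a) = \<iota> (\<theta> g a)" "\<Phi> g V = \<iota> (cu g) * V"
proof -
  have "\<exists>F. \<forall>g. unital_star_hom (F g) \<and> (\<forall>a. F g (\<iota> a) = \<iota> (\<theta> g a)) \<and> F g V = \<iota> (cu g) * V"
  proof (intro choice allI)
    fix g
    show "\<exists>F. unital_star_hom F \<and> (\<forall>a. F (\<iota> a) = \<iota> (\<theta> g a)) \<and> F V = \<iota> (cu g) * V"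
      by (rule hom_extension[OF covariant_skew[of g]]) (metis comp_apply)
  qed
  then obtain F where F: "\<And>g. unital_star_hom (F g)" "\<And>g a. F g (\<iota> a) = \<iota> (\<theta> g a)" "\<And>g. F g V =
      \<iota> (cu g) * V" by blast
  have comp: "F (- g) \<circ> F g = id" for g
  proof (rule hom_eqI[OF unital_star_hom_comp[OF F(1) F(1)] unital_star_hom_id])
    show "(F (- g) \<circ> F g) (\<iota> a) = id (\<iota> a)" for a
      by (simp add: F(2) \<theta>_add[symmetric] \<theta>_zero)
    have "(F (- g) \<circ> F g) V = \<iota> (\<theta> (- g) (cu g) * cu (- g)) * V"
      by (simp add: F unital_star_homD(4)[OF F(1)] I(4) mult.assoc)
    then show "(F (- g) \<circ> F g) V = id V" by (simp add: cu_add[symmetric] cu_zero I(3))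
  qed
  have aut: "star_automorphism (F g)" for g
    unfolding star_automorphism_def using F(1) o_bij[OF comp[of g]] comp[of "- g"] by simp
  have "\<Phi> g = F g"
    unfolding skew_action_def
  proof (rule the_equality)
    show "star_automorphism (F g) \<and> (\<forall>a. F g (\<iota> a) = \<iota> (\<theta> g a)) \<and> F g V = \<iota> (cu g) * V" using aut F by blast
  next
    fix G assume "star_automorphism G \<and> (\<forall>a. G (\<iota> a) = \<iota> (\<theta> g a)) \<and> G V = \<iota> (cu g) * V"
    then show "G = F g" by (intro hom_eqI) (auto simp: F star_automorphism_hom)
  qed
  then show "star_automorphism (\<Phi> g)" "\<Phi> g (\<iota> a) = \<iota> (\<theta> g a)" "\<Phi> g V = \<iota> (cu g) * V"
    using aut F by simp_all
qed

abbreviation cp :: "'g \<Rightarrow> nat \<Rightarrow> 'x \<Rightarrow>\<^sub>C complex"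
  where "cp \<equiv> cocycle_power \<alpha> u"

lemma skew_action_power: "\<Phi> g (\<iota> a * V ^ k) = \<iota> (\<theta> g a * cp g k) * V ^ k"
proof -
  note F = unital_star_homD[OF star_automorphism_hom[OF skew_action_properties(1)[of g]]]
  have "\<Phi> g (V ^ k) = \<iota> (cp g k) * V ^ k"
  proof (induction k)
    case 0
    then show ?case by (simp add: F cocycle_power_def I(3))
  next
    case (Suc k)
    have "\<Phi> g (V ^ Suc k) = \<iota> (cp g k) * V ^ k * (\<iota> (cu g) * V)"
      by (simp add: power_Suc2 F skew_action_properties(3) Suc del: power_Suc)
    also have "\<dots> = \<iota> (cp g k) * (upow V (int k) * \<iota> (cu g)) * V" by (simp add: upow_of_nat mult.assoc)
    also have "\<dots> = \<iota> (cp g k * (\<alpha> ^^ k) (cu g)) * V ^ Suc k"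
      unfolding upow_commute by (simp add: zpow_of_nat upow_of_nat I(4) mult.assoc power_commutes)
    finally show ?case by (simp add: cocycle_power_def)
  qed
  then show ?thesis by (simp add: F skew_action_properties(2) I(4) mult.assoc)
qed

abbreviation "S \<equiv> invariant_states \<Phi>"

lemma invariant_stateI:
  assumes s: "state_on UNIV \<phi>" and inv: "\<And>g a k. \<phi> (\<iota> (\<theta> g a * cp g k) * V ^ k) = \<phi> (\<iota> a * V ^ k)"
  shows "\<phi> \<in> S"
proof -
  have "\<phi> \<circ> \<Phi> g = \<phi>" for g
    by (rule state_eqI[OF state_on_comp_hom[OF s star_automorphism_hom[OF skew_action_properties(1)]] s])
      (simp add: skew_action_power inv)
  then show ?thesis using s by (simp add: invariant_states_def)
qed

lemma invariant_stateD:
  assumes "\<phi> \<in> S"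
  shows "state_on UNIV \<phi>" "\<phi> (\<iota> (\<theta> g a * cp g k) * V ^ k) = \<phi> (\<iota> a * V ^ k)"
proof -
  show "state_on UNIV \<phi>" using assms by (simp add: invariant_states_def)
  have "\<phi> \<circ> \<Phi> g = \<phi>" using assms by (simp add: invariant_states_def)
  then have "\<phi> (\<Phi> g (\<iota> a * V ^ k)) = \<phi> (\<iota> a * V ^ k)" by (metis comp_apply)
  then show "\<phi> (\<iota> (\<theta> g a * cp g k) * V ^ k) = \<phi> (\<iota> a * V ^ k)" by (simp add: skew_action_power)
qed

lemma invariant_state_base:
  assumes "\<phi> \<in> S" shows "\<phi> (\<iota> a) = (LINT x|\<mu>. apply_bcontfun a x)"
proof -
  have s: "state_on UNIV (\<phi> \<circ> \<iota>)" by (rule state_on_comp_hom[OF invariant_stateD(1)[OF assms] hom])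
  have "\<phi> \<circ> \<iota> \<circ> \<theta> g = \<phi> \<circ> \<iota>" for g
    using invariant_stateD(2)[OF assms, of g _ 0] by (simp add: fun_eq_iff cocycle_power_def)
  then have "\<phi> \<circ> \<iota> \<in> invariant_states \<theta>" using s by (simp add: invariant_states_def)
  then show ?thesis using unique by (metis comp_apply singletonD)
qed

section \<open>The measure-preserving action on \<open>X\<close> and its ergodicity\<close>

abbreviation hg :: "'g \<Rightarrow> 'x \<Rightarrow> 'x"
  where "hg g \<equiv> dual_homeo (\<theta> g)"

lemmas hg_eval = dual_homeo_properties(1)[OF comp \<theta>_aut]

lemma integral_\<theta>: "(LINT x|\<mu>. apply_bcontfun (\<theta> g a) x) = (LINT x|\<mu>. apply_bcontfun a x)"
proof -
  have "(\<lambda>f. LINT x|\<mu>. apply_bcontfun f x) \<in> invariant_states \<theta>" using unique by simp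
  then have "(\<lambda>f. LINT x|\<mu>. apply_bcontfun f x) \<circ> \<theta> g = (\<lambda>f. LINT x|\<mu>. apply_bcontfun f x)"
    by (simp add: invariant_states_def)
  then show ?thesis by (metis (no_types, lifting) comp_apply)
qed

lemma hg_continuous: "continuous_on UNIV (hg g)"
  by (rule dual_homeo_properties(2)[OF comp \<theta>_aut])

lemma hg_measurable [measurable]: "hg g \<in> measurable \<mu> \<mu>"
  using continuous_measurable[OF hg_continuous] measurable_cong_sets[OF refl sets_borel] by blast

lemma hg_distr: "distr \<mu> \<mu> (hg g) = \<mu>"
proof -
  have "distr \<mu> borel (hg g) = \<mu>"
    by (rule distr_invariant[OF hg_continuous]) (simp add: hg_eval[symmetric] integral_\<theta>)
  moreover have "distr \<mu> \<mu> (hg g) = distr \<mu> borel (hg g)" by (rule distr_cong) (simp_all add: sets_borel)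
  ultimately show ?thesis by simp
qed

lemma integral_hg:
  fixes f :: "'x \<Rightarrow> 'b::{banach, second_countable_topology}"
  assumes "f \<in> borel_measurable \<mu>"
  shows "(LINT x|\<mu>. f (hg g x)) = (LINT x|\<mu>. f x)"
  using integral_distr[OF hg_measurable[of g] assms] by (simp add: hg_distr)

lemma integrable_hg:
  fixes f :: "'x \<Rightarrow> complex"
  assumes "integrable \<mu> f"
  shows "integrable \<mu> (\<lambda>x. f (hg g x))"
  using integrable_distr_eq[OF hg_measurable borel_measurable_integrable[OF assms], of g] assms
      by (simp add: hg_distr)

lemma hz_hg: "hz m (hg g x) = hg g (hz m x)"
proof -
  let ?h = "dual_homeo \<alpha>"
  note bij = dual_homeo_properties(3)[OF comp aut]
  note ev = dual_homeo_properties(1)[OF comp aut]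
  have one: "?h (hg g x) = hg g (?h x)" for x
  proof (rule bcontfun_separates[OF comp])
    fix a :: "'x \<Rightarrow>\<^sub>C complex"
    have "apply_bcontfun (\<theta> g (\<alpha> a)) x = apply_bcontfun (\<alpha> (\<theta> g a)) x" using comm[of g]
        by (simp add: fun_eq_iff)
    then show "apply_bcontfun a (?h (hg g x)) = apply_bcontfun a (hg g (?h x))" by (simp add: hg_eval ev)
  qed
  show ?thesis
  proof (induction m rule: int_induct[where k = 0])
    case (step1 i)
    then show ?case by (simp add: zpow_Suc[OF bij] one)
  next
    case (step2 i)
    have "?h (hz (i - 1) (hg g x)) = ?h (hg g (hz (i - 1) x))"
      using step2 zpow_Suc[OF bij, of "i - 1"] by (simp add: one)
    then show ?case using bij by (simp add: bij_is_inj inj_eq)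
  qed simp
qed

text \<open>Ergodicity: an invariant density would produce a second invariant state.\<close>

lemma invariant_density_constant:
  fixes f :: "'x \<Rightarrow> real"
  assumes f: "integrable \<mu> f" and pos: "AE x in \<mu>. 0 \<le> f x" and inv: "\<And>g. AE x in \<mu>. f (hg g x) = f x"
  shows "\<exists>c. AE x in \<mu>. f x = c"
proof (cases "(LINT x|\<mu>. f x) = 0")
  case True
  then have "AE x in \<mu>. f x = 0" using integral_nonneg_eq_0_iff_AE[OF f pos] by simp
  then show ?thesis by blast
next
  case False
  define c where "c = (LINT x|\<mu>. f x)"
  have c: "0 < c" using False integral_nonneg_AE[OF pos] by (simp add: c_def)
  define k where "k x = complex_of_real (f x / c)" for x
  have k: "integrable \<mu> k" unfolding k_def using f by simp
  note ik = integrable_mult_bcontfun[OF k]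
  define \<psi> where "\<psi> a = (LINT x|\<mu>. apply_bcontfun a x * k x)" for a :: "'x \<Rightarrow>\<^sub>C complex"
  have "\<psi> (star a * a) \<in> \<real>\<^sub>\<ge>\<^sub>0" for a
  proof -
    have e: "apply_bcontfun (star a * a) x * k x = complex_of_real ((cmod (apply_bcontfun a x))\<^sup>2 * (f x
        / c))" for x
      unfolding k_def of_real_mult complex_norm_square
      by (simp add: times_bcontfun.rep_eq star_bcontfun.rep_eq star_complex_def mult.commute)
    have "0 \<le> (LINT x|\<mu>. (cmod (apply_bcontfun a x))\<^sup>2 * (f x / c))"
      using pos c by (intro integral_nonneg_AE) (auto elim: AE_mp)
    then show ?thesis
      unfolding \<psi>_def e integral_complex_of_real by (simp only: complex_nonneg_Reals_iff
          Re_complex_of_real Im_complex_of_real)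
  qed
  moreover have "\<psi> 1 = 1" using c by (simp add: \<psi>_def one_bcontfun.rep_eq k_def c_def[symmetric])
  ultimately have st: "state_on UNIV \<psi>"
    using ik by (simp add: state_on_def \<psi>_def plus_bcontfun.rep_eq scaleC_bcontfun.rep_eq
        scaleC_complex_def distrib_right mult.assoc)
  have "\<psi> (\<theta> g a) = \<psi> a" for g a
  proof -
    have km: "k \<in> borel_measurable \<mu>" using k by (rule borel_measurable_integrable)
    have "\<psi> (\<theta> g a) = (LINT x|\<mu>. apply_bcontfun a (hg g x) * k (hg g x))"
      unfolding \<psi>_def hg_eval
    proof (rule integral_cong_AE)
      show "AE x in \<mu>. apply_bcontfun a (hg g x) * k x = apply_bcontfun a (hg g x) * k (hg g x)"
        using inv[of g] by eventually_elim (simp add: k_def)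
    qed (intro borel_measurable_times measurable_compose[OF hg_measurable] bcontfun_measurable km)+
    also have "\<dots> = \<psi> a" unfolding \<psi>_def
      by (rule integral_hg[where f = "\<lambda>x. apply_bcontfun a x * k x"]) (intro borel_measurable_times
          bcontfun_measurable km)
    finally show ?thesis .
  qed
  then have "\<psi> \<in> invariant_states \<theta>" using st by (simp add: invariant_states_def fun_eq_iff)
  then have eq: "\<psi> a = (LINT x|\<mu>. apply_bcontfun a x)" for a using unique by auto
  have "AE x in \<mu>. k x - 1 = 0"
  proof (rule AE_zero)
    show "integrable \<mu> (\<lambda>x. k x - 1)" using k by simp
    fix a
    show "(LINT x|\<mu>. apply_bcontfun a x * (k x - 1)) = 0"
      using eq[of a] ik[of a] integrable_bcontfun[of a] by (simp add: \<psi>_def right_diff_distrib)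
  qed
  then have "AE x in \<mu>. f x = c"
  proof eventually_elim
    case (elim x)
    then have "complex_of_real (f x / c) = complex_of_real 1" by (simp add: k_def)
    then have "f x / c = 1" by (simp only: of_real_eq_iff)
    then show ?case using c by simp
  qed
  then show ?thesis by blast
qed

text \<open>Adding the bound \<open>B\<close> makes the real and the imaginary part nonnegative, so
  the statement on densities applies to each.\<close>

lemma invariant_function_constant:
  fixes f :: "'x \<Rightarrow> complex"
  assumes f: "integrable \<mu> f" and bound: "AE x in \<mu>. cmod (f x) \<le>
      B" and inv: "\<And>g. AE x in \<mu>. f (hg g x) = f x"
  shows "\<exists>c. AE x in \<mu>. f x = c"
proof -
  have "\<exists>c. AE x in \<mu>. Re (f x) + B = c"
  proof (rule invariant_density_constant)
    show "AE x in \<mu>. 0 \<le> Re (f x) + B"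
      using bound by eventually_elim (use abs_Re_le_cmod in \<open>smt (verit)\<close>)
    show "AE x in \<mu>. Re (f (hg g x)) + B = Re (f x) + B" for g
      using inv[of g] by eventually_elim simp
  qed (use f in simp)
  moreover have "\<exists>c. AE x in \<mu>. Im (f x) + B = c"
  proof (rule invariant_density_constant)
    show "AE x in \<mu>. 0 \<le> Im (f x) + B"
      using bound by eventually_elim (use abs_Im_le_cmod in \<open>smt (verit)\<close>)
    show "AE x in \<mu>. Im (f (hg g x)) + B = Im (f x) + B" for g
      using inv[of g] by eventually_elim simp
  qed (use f in simp)
  ultimately obtain c d where "AE x in \<mu>. Re (f x) + B = c" "AE x in \<mu>. Im (f x) + B = d" by blast
  then have "AE x in \<mu>. f x = Complex (c - B) (d - B)" by eventually_elim (auto simp: complex_eq_iff)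
  then show ?thesis by blast
qed

end

section \<open>Compactness and convexity of sets of states\<close>

lemma weak_star_eq: "weak_star A = top_of_set A"
  by (simp add: weak_star_def euclidean_product_topology)

text \<open>Banach-Alaoglu: states are bounded by the norm, so the set is a closed part of a product
  of discs, compact by Tychonoff's theorem.\<close>

lemma compact_states:
  fixes F :: "('b::cstar_algebra \<Rightarrow> complex) set"
  assumes "closed F" "\<And>\<phi>. \<phi> \<in> F \<Longrightarrow> state_on UNIV \<phi>"
  shows "compact F"
proof -
  let ?B = "PiE UNIV (\<lambda>x::'b. cball (0::complex) (norm x))"
  have "compactin (product_topology (\<lambda>_. euclidean) UNIV) ?B"
    by (subst compactin_PiE) (auto simp: compactin_euclidean_iff)
  then have "compact ?B" by (simp add: euclidean_product_topology)
  moreover have "F \<subseteq> ?B"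
    using state_on_norm_le[OF cstar_subalgebra_UNIV assms(2)] by auto
  ultimately show ?thesis using assms(1) by (metis compact_Int_closed inf.absorb_iff2)
qed

lemma closed_invariant_states:
  fixes \<beta> :: "'g \<Rightarrow> 'b::cstar_algebra \<Rightarrow> 'b"
  shows "closed (invariant_states \<beta>)"
proof -
  have ev: "continuous_on UNIV (\<lambda>\<phi>::'b \<Rightarrow> complex. \<phi> x)" for x by (rule continuous_on_product_coordinates)
  have "invariant_states \<beta> = {\<phi>. (\<forall>x y. \<phi> (x + y) = \<phi> x + \<phi> y) \<and> (\<forall>c x. \<phi> (c *\<^sub>C x) = c * \<phi> x) \<and>
    (\<forall>x. \<phi> (star x * x) \<in> \<real>\<^sub>\<ge>\<^sub>0) \<and> \<phi> 1 = 1 \<and> (\<forall>g x. \<phi> (\<beta> g x) = \<phi> x)}"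
    by (auto simp: invariant_states_def state_on_def fun_eq_iff)
  also have "closed \<dots>"
    by (intro closed_Collect_conj closed_Collect_all closed_Collect_eq continuous_on_add
        continuous_on_mult continuous_on_const ev)
      (metis closed_nonneg_Reals_complex closed_vimage ev vimage_def)
  finally show ?thesis .
qed

lemma convex_invariant_states:
  assumes "\<phi> \<in> invariant_states \<beta>" "\<psi> \<in> invariant_states \<beta>" "t \<in> {0..1}"
  shows "(\<lambda>x. complex_of_real t * \<phi> x + complex_of_real (1 - t) * \<psi> x) \<in> invariant_states \<beta>"
proof -
  have s: "state_on UNIV \<phi>" "state_on UNIV \<psi>" "\<And>g. \<phi> \<circ> \<beta> g = \<phi>" "\<And>g. \<psi> \<circ> \<beta> g = \<psi>"
    using assms by (auto simp: invariant_states_def)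
  have "complex_of_real t * a + complex_of_real (1 - t) * b \<in> \<real>\<^sub>\<ge>\<^sub>0" if "a \<in> \<real>\<^sub>\<ge>\<^sub>0" "b \<in> \<real>\<^sub>\<ge>\<^sub>0" for a b
    using that assms(3) by (auto simp: complex_nonneg_Reals_iff)
  then have "state_on UNIV (\<lambda>x. complex_of_real t * \<phi> x + complex_of_real (1 - t) * \<psi> x)"
    unfolding state_on_def
    using state_onD[OF s(1)] state_onD[OF s(2)]
    by (intro conjI ballI allI) (simp_all add: distrib_left mult.left_commute del: of_real_diff, simp)
  moreover have "(\<lambda>x. complex_of_real t * \<phi> x + complex_of_real (1 - t) * \<psi> x) \<circ> \<beta> g =
    (\<lambda>x. complex_of_real t * \<phi> x + complex_of_real (1 - t) * \<psi> x)" for g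
    using s(3)[of g] s(4)[of g] by (simp add: fun_eq_iff)
  ultimately show ?thesis by (simp add: invariant_states_def)
qed

lemma topspace_weak_star_prob: "topspace (weak_star_prob Z) = prob_measures Z"
  unfolding weak_star_prob_def topspace_pullback_topology by (auto simp: topspace_product_topology)


section \<open>Densities of invariant states and transfer functions\<close>

context skew_system
begin

lemma cp_norm: "cmod (apply_bcontfun (cp g k) x) = 1"
proof -
  have "apply_bcontfun (cp g k) x = (\<Prod>j<k. apply_bcontfun ((\<alpha> ^^ j) (cu g)) x)"
    unfolding cocycle_power_def
    by (induction k) (simp_all add: one_bcontfun.rep_eq times_bcontfun.rep_eq)
  then show ?thesis
    using zpow_eval[of "int _" "cu g" x]
    by (simp add: prod_norm[symmetric] zpow_of_nat cu_norm)
qed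

lemma cp_add: "apply_bcontfun (cp g (j + k)) x = apply_bcontfun (cp g j) x * apply_bcontfun (cp g k) (hz
    (int j) x)"
proof (induction k)
  case 0
  then show ?case by (simp add: cocycle_power_def one_bcontfun.rep_eq)
next
  case (Suc k)
  have s: "cp g (Suc m) = cp g m * (\<alpha> ^^ m) (cu g)" for m by (simp add: cocycle_power_def)
  have "apply_bcontfun ((\<alpha> ^^ (j + k)) (cu g)) x = apply_bcontfun ((\<alpha> ^^ k) (cu g)) (hz (int j) x)"
    unfolding zpow_of_nat[symmetric] zpow_eval by (simp add: hz_add[symmetric] add.commute)
  then show ?case using Suc by (simp add: s times_bcontfun.rep_eq mult.assoc)
qed

text \<open>Riesz applies because Cauchy-Schwarz with the unitary \<open>V^k\<close> bounds
  \<open>\<phi> (a V^k)\<close> by the L2 norm of \<open>a\<close>: on \<open>C(X)\<close> the state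
  is integration against \<open>\<mu>\<close>. Taking moduli removes the unimodular cocycle, so
  \<open>|h|\<close> is an invariant density and therefore constant.\<close>

lemma invariant_state_density:
  assumes \<phi>: "\<phi> \<in> S"
  shows "\<exists>h c. integrable \<mu> h \<and> (\<forall>a. \<phi> (\<iota> a * V ^ k) = (LINT x|\<mu>. apply_bcontfun a x * h x)) \<and>
    (\<forall>g. AE x in \<mu>. h (hg g x) = apply_bcontfun (cp g k) x * h x) \<and> (AE x in \<mu>. cmod (h x) = c)"
proof -
  note s = invariant_stateD(1)[OF \<phi>]
  note L = clinearD[OF state_clinear[OF s]]
  have lin: "clinear (\<lambda>a. \<phi> (\<iota> a * V ^ k))"
    by (simp add: clinear_def I distrib_right mult_scaleC_left L)
  have "(cmod (\<phi> (\<iota> a * V ^ k)))\<^sup>2 \<le> (LINT x|\<mu>. (cmod (apply_bcontfun a x))\<^sup>2)" for a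
  proof -
    have u: "star (V ^ k) * V ^ k = 1" using upow_unitary[OF uV, of "int k"]
        by (simp add: unitary_def upow_of_nat)
    have p: "apply_bcontfun (a * star a) = (\<lambda>x. complex_of_real ((cmod (apply_bcontfun a x))\<^sup>2))"
    proof
      fix x show "apply_bcontfun (a * star a) x = complex_of_real ((cmod (apply_bcontfun a x))\<^sup>2)"
        unfolding times_bcontfun.rep_eq star_bcontfun.rep_eq star_complex_def
            by (rule complex_norm_square[symmetric])
    qed
    have "(cmod (\<phi> (\<iota> a * V ^ k)))\<^sup>2 \<le> Re (\<phi> (\<iota> a * star (\<iota> a))) * Re (\<phi> (star (V ^ k) * V ^ k))"
      by (rule state_on_Cauchy_Schwarz[OF cstar_subalgebra_UNIV s]) auto
    also have "\<dots> = Re (\<phi> (\<iota> (a * star a)))" by (simp add: u state_onD(4)[OF s] I)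
    also have "\<dots> = (LINT x|\<mu>. (cmod (apply_bcontfun a x))\<^sup>2)"
      unfolding invariant_state_base[OF \<phi>] p integral_complex_of_real by simp
    finally show ?thesis .
  qed
  from L2_functional_representation[OF lin this]
  obtain h where h: "integrable \<mu> h" and rep: "\<And>a. \<phi> (\<iota> a * V ^ k) =
      (LINT x|\<mu>. apply_bcontfun a x * h x)" by blast
  note hm = borel_measurable_integrable[OF h]
  have eq: "AE x in \<mu>. h (hg g x) = apply_bcontfun (cp g k) x * h x" for g
  proof -
    have i: "integrable \<mu> (\<lambda>x. apply_bcontfun (cp g k) x * h x)" by (rule integrable_mult_bcontfun[OF h])
    have "AE x in \<mu>. apply_bcontfun (cp g k) x * h x - h (hg g x) = 0"
    proof (rule AE_zero)
      show "integrable \<mu> (\<lambda>x. apply_bcontfun (cp g k) x * h x - h (hg g x))"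
        by (intro Bochner_Integration.integrable_diff i integrable_hg h)
      fix b :: "'x \<Rightarrow>\<^sub>C complex"
      \<comment> \<open>As \<open>\<theta> g\<close> is onto, every test function has this form, and
        invariance of the state becomes a change of variables.\<close>
      obtain a where b: "b = \<theta> g a" using star_automorphism_bij[OF \<theta>_aut[of g]] by (metis bij_pointE)
      have "(LINT x|\<mu>. apply_bcontfun b x * (apply_bcontfun (cp g k) x * h x)) =
          \<phi> (\<iota> (\<theta> g a * cp g k) * V ^ k)"
        by (simp add: rep b times_bcontfun.rep_eq mult.assoc)
      also have "\<dots> = (LINT x|\<mu>. apply_bcontfun a x * h x)" 
        unfolding invariant_stateD(2)[OF \<phi>] by (rule rep)
      also have "\<dots> = (LINT x|\<mu>. apply_bcontfun b x * h (hg g x))"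
        using integral_hg[of "\<lambda>x. apply_bcontfun a x * h x" g] hm bcontfun_measurable[of a]
        by (simp add: b hg_eval)
      finally show "(LINT x|\<mu>. apply_bcontfun b x * (apply_bcontfun (cp g k) x * h x - h (hg g x))) = 0"
        using integrable_mult_bcontfun[OF i, of b] integrable_mult_bcontfun[OF integrable_hg[OF h], of b g]
        by (simp add: right_diff_distrib)
    qed
    then show ?thesis by eventually_elim simp
  qed
  have "\<exists>c. AE x in \<mu>. cmod (h x) = c"
  proof (rule invariant_density_constant)
    show "AE x in \<mu>. cmod (h (hg g x)) = cmod (h x)" for g
      using eq[of g] by eventually_elim (simp add: norm_mult cp_norm)
  qed (use h in auto)
  then show ?thesis using h rep eq by blast
qed

lemma AE_not_False: "\<not> (AE x in \<mu>. False)"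
  using prob_space by (simp add: AE_False)

abbreviation "transfer \<equiv> is_transfer \<mu> \<theta> \<alpha> u"

lemma transferI:
  assumes "w \<in> borel_measurable \<mu>" "AE x in \<mu>. cmod (w x) = 1"
    "\<And>g. AE x in \<mu>. w (hg g x) * apply_bcontfun (cp g n) x = w x"
  shows "transfer n w"
  using assms measurable_cong_sets[OF sets_borel refl] unfolding is_transfer_def by blast

lemma transferD:
  assumes "transfer n w"
  shows "w \<in> borel_measurable \<mu>" "AE x in \<mu>. cmod (w x) = 1"
    "\<And>g. AE x in \<mu>. w (hg g x) * apply_bcontfun (cp g n) x = w x"
  using assms measurable_cong_sets[OF sets_borel refl] unfolding is_transfer_def by blast+

text \<open>Conjugation is needed because the cocycle multiplies \<open>h\<close> at the original
  point, while in the transfer equation it multiplies \<open>w\<close> at the translated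
  one.\<close>

lemma density_transfer:
  assumes h: "h \<in> borel_measurable \<mu>" and eq: "\<And>g. AE x in \<mu>. h (hg g x) = apply_bcontfun (cp g k) x * h x"
    and c: "AE x in \<mu>. cmod (h x) = c" "c \<noteq> 0"
  shows "transfer k (\<lambda>x. cnj (h x) / complex_of_real c)"
proof (rule transferI)
  have "(\<lambda>x. cnj (h x)) \<in> borel_measurable \<mu>"
    by (rule borel_measurable_continuous_on[OF _ h, of cnj]) (auto intro: continuous_intros)
  then show "(\<lambda>x. cnj (h x) / complex_of_real c) \<in> borel_measurable \<mu>" by simp
  show "AE x in \<mu>. cmod (cnj (h x) / complex_of_real c) = 1"
    using c(1) by eventually_elim (use c(2) in \<open>auto simp: norm_divide\<close>)
  show "AE x in \<mu>. cnj (h (hg g x)) / complex_of_real c * apply_bcontfun (cp g k) x =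
      cnj (h x) / complex_of_real c" for g
    using eq[of g]
  proof eventually_elim
    case (elim x)
    have "cnj (apply_bcontfun (cp g k) x) * apply_bcontfun (cp g k) x = 1"
      using complex_norm_square[of "apply_bcontfun (cp g k) x"] by (simp add: cp_norm mult.commute)
    then show ?case by (simp add: elim mult.assoc[symmetric] mult.commute[of _ "cnj (h x)"])
  qed
qed

text \<open>The sequence of moments is the unit mass at 0; its Toeplitz matrices are identities, so
  Herglotz's theorem applies.\<close>

lemma Haar_exists: "\<exists>\<nu>\<in>prob_measures circle. \<forall>k. (LINT z|\<nu>. z ^ k) = (if k = 0 then 1 else 0)"
proof -
  have "\<exists>\<nu>\<in>prob_measures circle. \<forall>k. (LINT z|\<nu>. z ^ k) = (if int k = 0 then 1 else 0)"
  proof (rule Herglotz)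
    fix n and a :: "nat \<Rightarrow> complex"
    have "(\<Sum>j<n. \<Sum>k<n. a k * cnj (a j) * (if int k - int j = 0 then 1 else 0)) = (\<Sum>j<n. \<Sum>k<n. if k =
        j then a j * cnj (a j) else 0)"
      by (intro sum.cong refl) auto
    also have "\<dots> = complex_of_real (\<Sum>j<n. (cmod (a j))\<^sup>2)"
      unfolding of_real_sum complex_norm_square by simp
    finally show "(\<Sum>j<n. \<Sum>k<n. a k * cnj (a j) * (if int k - int j = 0 then 1 else 0)) \<in> \<real>\<^sub>\<ge>\<^sub>0"
      by (simp only: complex_nonneg_Reals_iff Re_complex_of_real Im_complex_of_real) (simp add: sum_nonneg)
  qed auto
  then show ?thesis by simp
qed

text \<open>\<open>G\<close> annihilates all nonzero powers of \<open>V\<close>; it is the mixture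
  for \<open>n = 1\<close>, trivial \<open>w\<close> and Haar measure. It is always invariant, so a
  second invariant state must be nonzero at some \<open>a V^k\<close> with \<open>k > 0\<close>, and
  its density there yields a transfer function.\<close>

lemma transfer_exists:
  assumes "\<not> uniquely_ergodic \<Phi>"
  shows "\<exists>n\<ge>1. \<exists>w. transfer n w"
proof -
  obtain \<nu> where \<nu>: "\<nu> \<in> prob_measures circle" "\<And>k. (LINT z|\<nu>. z ^ k) = (if k = 0 then 1 else 0)"
    using Haar_exists by blast
  define G where "G = mixture 1 (\<lambda>_. 1) \<nu>"
  have st: "state_on UNIV G" unfolding G_def by (rule state_mixture[OF _ _ _ \<nu>(1)]) auto
  have G: "G (\<iota> a * V ^ k) = (if k = 0 then (LINT x|\<mu>. apply_bcontfun a x) else 0)" for a k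
    using mixture_multiple[of "\<lambda>_. 1" 1 \<nu> a "int k"] \<nu>
    by (simp add: G_def upow_of_nat transfer_iterate_def split: if_splits)
  have "G \<in> S"
    by (rule invariant_stateI[OF st]) (simp add: G cocycle_power_def integral_\<theta>)
  moreover have "S \<noteq> {G}" using assms unfolding uniquely_ergodic_def by blast
  ultimately obtain \<phi> where \<phi>: "\<phi> \<in> S" "\<phi> \<noteq> G" by blast
  obtain a k where neq: "\<phi> (\<iota> a * V ^ k) \<noteq> G (\<iota> a * V ^ k)"
    using state_eqI[OF invariant_stateD(1)[OF \<phi>(1)] st] \<phi>(2) by blast
  have k: "k \<noteq> 0"
  proof
    assume "k = 0"
    then show False using neq invariant_state_base[OF \<phi>(1), of a] G[of a 0] by simp
  qed
  obtain h c where h: "integrable \<mu> h" "\<And>a. \<phi> (\<iota> a * V ^ k) = (LINT x|\<mu>. apply_bcontfun a x * h x)"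
    "\<And>g. AE x in \<mu>. h (hg g x) = apply_bcontfun (cp g k) x * h x" "AE x in \<mu>. cmod (h x) = c"
    using invariant_state_density[OF \<phi>(1), of k] by blast
  have "c \<noteq> 0"
  proof
    assume "c = 0"
    then have z: "AE x in \<mu>. h x = 0" using h(4) by simp
    have "(LINT x|\<mu>. apply_bcontfun a x * h x) = 0"
      by (rule integral_eq_zero_AE) (use z in \<open>eventually_elim, simp\<close>)
    then show False using neq k by (simp add: G h(2))
  qed
  from density_transfer[OF borel_measurable_integrable[OF h(1)] h(3,4) this]
  have "transfer k (\<lambda>x. cnj (h x) / complex_of_real c)" .
  moreover have "1 \<le> k" using k by simp
  ultimately show ?thesis by blast
qed

lemma transfer_period_properties:
  assumes "\<not> uniquely_ergodic \<Phi>" and per: "p = transfer_period \<mu> \<theta> \<alpha> u"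
  shows "0 < p" "\<And>r w. 0 < r \<Longrightarrow> r < p \<Longrightarrow> \<not> transfer r w"
proof -
  have ex: "\<exists>n. 1 \<le> n \<and> (\<exists>w. transfer n w)" using transfer_exists[OF assms(1)] by blast
  from LeastI_ex[OF ex] show "0 < p" unfolding per transfer_period_def by simp
  show "\<not> transfer r w" if "0 < r" "r < p" for r w
    using not_less_Least[of r "\<lambda>n. 1 \<le> n \<and> (\<exists>w. transfer n w)"] that
    unfolding per transfer_period_def by auto
qed

context
  fixes p :: nat and w :: "'x \<Rightarrow> complex"
  assumes p: "0 < p" and minimal: "\<forall>r w. 0 < r \<longrightarrow> r < p \<longrightarrow> \<not> transfer r w"
    and w: "transfer p w"
begin

abbreviation "wu \<equiv> w1 w"

lemmas w1_period = w1[OF transferD(1,2)[OF w] p]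

lemma wu: "wu \<in> borel_measurable \<mu>" "cmod (wu x) = 1"
  "AE x in \<mu>. wu (hg g x) * apply_bcontfun (cp g p) x = wu x" "AE x in \<mu>. w x = wu x"
proof -
  show "wu \<in> borel_measurable \<mu>" "cmod (wu x) = 1" by (rule w1_period)+
  show ae: "AE x in \<mu>. w x = wu x" by (rule w1_period)
  have "AE x in \<mu>. w (hg g x) = wu (hg g x)"
  proof -
    have "AE x in distr \<mu> \<mu> (hg g). w x = wu x" using ae by (simp only: hg_distr)
    then show ?thesis by (rule AE_distrD[OF hg_measurable])
  qed
  then show "AE x in \<mu>. wu (hg g x) * apply_bcontfun (cp g p) x = wu x"
    using ae transferD(3)[OF w, of g] by eventually_elim simp
qed

abbreviation "W k \<equiv> trf p wu k"

lemmas W_norm = trf_norm[OF wu(1,2), where n = p]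
lemmas W_measurable = trf_measurable[OF wu(1), where n = p]
lemmas W_add = trf_add[OF wu(1,2), where n = p]

lemma W_cnj: "W k x * cnj (W k x) = 1" "cnj (W k x) * W k x = 1"
  using complex_norm_square[of "W k x"] by (simp_all add: W_norm mult.commute)

text \<open>\<open>W\<close> and the powers of the cocycle are both cocycles over the powers of
  \<open>hz\<close>. The step multiplies the equation for \<open>k\<close> by the equation for
  \<open>wu\<close>, translated by \<open>hz (k p)\<close>.\<close>

lemma W_transfer: "AE x in \<mu>. W (int k) (hg g x) * apply_bcontfun (cp g (k * p)) x = W (int k) x"
proof (induction k)
  case 0
  then show ?case by (simp add: cocycle_power_def one_bcontfun.rep_eq)
next
  case (Suc k)
  have e: "W (int (Suc k)) y = W (int k) y * wu (hz (int (k * p)) y)" for y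
    using trf_Suc[OF wu(1,2), where n = p and k = "int k"] by (simp add: add.commute)
  have c: "apply_bcontfun (cp g (Suc k * p)) x = apply_bcontfun (cp g (k * p)) x * apply_bcontfun (cp g
      p) (hz (int (k * p)) x)" for x
    using cp_add[of g "k * p" p x] by (simp add: add.commute)
  have "AE x in \<mu>. wu (hg g (hz (int (k * p)) x)) * apply_bcontfun (cp g p) (hz (int (k * p)) x) =
      wu (hz (int (k * p)) x)"
    by (rule AE_hz[OF wu(3)])
  then show ?case using Suc
  proof eventually_elim
    case (elim x)
    have "W (int (Suc k)) (hg g x) * apply_bcontfun (cp g (Suc k * p)) x =
      (W (int k) (hg g x) * apply_bcontfun (cp g (k * p)) x) *
      (wu (hg g (hz (int (k * p)) x)) * apply_bcontfun (cp g p) (hz (int (k * p)) x))"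
      unfolding e c hz_hg by (simp only: mult_ac)
    then show ?case using elim by (simp only: e)
  qed
qed

lemma W_transfer_cnj: "AE x in \<mu>. apply_bcontfun (cp g (k * p)) x * cnj (W (int k) x) =
    cnj (W (int k) (hg g x))"
  using W_transfer[of k g]
proof eventually_elim
  case (elim x)
  have c: "cnj (apply_bcontfun (cp g (k * p)) x) * apply_bcontfun (cp g (k * p)) x = 1"
    using complex_norm_square[of "apply_bcontfun (cp g (k * p)) x"] by (simp add: cp_norm mult.commute)
  have "apply_bcontfun (cp g (k * p)) x * cnj (W (int k) x) =
    cnj (W (int k) (hg g x)) * (cnj (apply_bcontfun (cp g (k * p)) x) * apply_bcontfun (cp g (k * p)) x)"
    unfolding elim[symmetric] by (simp add: ac_simps)
  then show ?case by (simp add: c)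
qed

text \<open>The periods of transfer functions form a subgroup of the integers.\<close>

lemma invariant_state_other:
  assumes \<phi>: "\<phi> \<in> S" and m: "\<not> p dvd m"
  shows "\<phi> (\<iota> a * V ^ m) = 0"
proof -
  obtain h c where h: "integrable \<mu> h" "\<And>a. \<phi> (\<iota> a * V ^ m) = (LINT x|\<mu>. apply_bcontfun a x * h x)"
    "\<And>g. AE x in \<mu>. h (hg g x) = apply_bcontfun (cp g m) x * h x" "AE x in \<mu>. cmod (h x) = c"
    using invariant_state_density[OF \<phi>, of m] by blast
  have "c = 0"
  proof (rule ccontr)
    assume c: "c \<noteq> 0"
    define v where "v x = cnj (h x) / complex_of_real c" for x
    have v: "transfer m v"
      unfolding v_def by (rule density_transfer[OF borel_measurable_integrable[OF h(1)] h(3,4) c])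
    define q r where "q = m div p" and "r = m mod p"
    have mqr: "m = q * p + r" by (simp add: q_def r_def)
    have r: "0 < r" "r < p" using m p by (auto simp: r_def mod_greater_zero_iff_not_dvd)
    \<comment> \<open>Periods behave like exponents: with \<open>m = q p + r\<close>, dividing a
      function of period \<open>m\<close> by one of period \<open>q p\<close> should leave the
      period \<open>r\<close>.\<close>
    define y where "y x = v x * cnj (W (int q) x)" for x
    have ym: "y \<in> borel_measurable \<mu>"
      unfolding y_def[abs_def]
      by (intro borel_measurable_times transferD(1)[OF v] borel_measurable_continuous_on[OF _
          W_measurable, of cnj])
        (auto intro: continuous_intros)
    have y1: "AE x in \<mu>. cmod (y x) = 1"
      using transferD(2)[OF v] by eventually_elim (simp add: y_def norm_mult W_norm)
    have y2: "AE x in \<mu>. y (hg g x) * apply_bcontfun (cp g r) (hz (int (q * p)) x) = y x" for g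
      using W_transfer_cnj[of g q] transferD(3)[OF v, of g]
    proof eventually_elim
      case (elim x)
      have "y (hg g x) * apply_bcontfun (cp g r) (hz (int (q * p)) x) =
        (v (hg g x) * (apply_bcontfun (cp g (q * p)) x * apply_bcontfun (cp g r) (hz (int (q * p)) x)))
            * cnj (W (int q) x)"
        unfolding y_def elim(1)[symmetric] by (simp only: ac_simps)
      then show ?case unfolding cp_add[symmetric] mqr[symmetric] elim(2) y_def .
    qed
    \<comment> \<open>The remaining cocycle power of order \<open>r\<close> sits at the translate by
      \<open>q p\<close>. Undoing this translation produces a transfer function of period
      \<open>r < p\<close>, against minimality.\<close>
    have "transfer r (\<lambda>x. y (hz (- int (q * p)) x))"
    proof (rule transferI)
      show "(\<lambda>x. y (hz (- int (q * p)) x)) \<in> borel_measurable \<mu>"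
        by (rule measurable_compose[OF hz_measurable ym])
      show "AE x in \<mu>. cmod (y (hz (- int (q * p)) x)) = 1" by (rule AE_hz[OF y1])
      show "AE x in \<mu>. y (hz (- int (q * p)) (hg g x)) * apply_bcontfun (cp g r) x =
          y (hz (- int (q * p)) x)" for g
        using AE_hz[OF y2[of g], of "- int (q * p)"]
        by eventually_elim (simp add: hz_hg hz_add[symmetric])
    qed
    then show False using minimal r by blast
  qed
  then have z: "AE x in \<mu>. h x = 0" using h(4) by simp
  have "(LINT x|\<mu>. apply_bcontfun a x * h x) = 0"
    by (rule integral_eq_zero_AE) (use z in \<open>eventually_elim, simp\<close>)
  then show ?thesis by (simp add: h(2))
qed

text \<open>In \<open>h * W k\<close> the cocycles of the two factors cancel, so the product is an
  invariant function and constant by ergodicity.\<close>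

lemma invariant_state_multiple:
  assumes \<phi>: "\<phi> \<in> S"
  shows "\<exists>c. \<forall>a. \<phi> (\<iota> a * V ^ (k * p)) = c * (LINT x|\<mu>. apply_bcontfun a x * cnj (W (int k) x))"
proof -
  obtain h c where h: "integrable \<mu> h" "\<And>a. \<phi> (\<iota> a * V ^ (k * p)) = (LINT x|\<mu>. apply_bcontfun a x * h x)"
    "\<And>g. AE x in \<mu>. h (hg g x) = apply_bcontfun (cp g (k * p)) x * h x" "AE x in \<mu>. cmod (h x) = c"
    using invariant_state_density[OF \<phi>, of "k * p"] by blast
  define f where "f x = h x * W (int k) x" for x
  have fm: "f \<in> borel_measurable \<mu>" unfolding f_def[abs_def]
    by (intro borel_measurable_times borel_measurable_integrable[OF h(1)] W_measurable)
  have f1: "AE x in \<mu>. cmod (f x) \<le> c"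
    using h(4) by eventually_elim (simp add: f_def norm_mult W_norm)
  have "\<exists>d. AE x in \<mu>. f x = d"
  proof (rule invariant_function_constant[OF _ f1])
    show "integrable \<mu> f" by (rule integrable_const_bound[OF f1 fm])
    show "AE x in \<mu>. f (hg g x) = f x" for g
      using h(3)[of g] W_transfer[of k g]
      by eventually_elim (simp add: f_def ac_simps)
  qed
  then obtain d where d: "AE x in \<mu>. f x = d" by blast
  have "(LINT x|\<mu>. apply_bcontfun a x * h x) = (LINT x|\<mu>. d * (apply_bcontfun a x * cnj (W (int k) x)))"
      for a
  proof (rule integral_cong_AE)
    show "AE x in \<mu>. apply_bcontfun a x * h x = d * (apply_bcontfun a x * cnj (W (int k) x))"
      using d
    proof eventually_elim
      case (elim x)
      have "h x = h x * (W (int k) x * cnj (W (int k) x))" by (simp add: W_cnj)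
      also have "\<dots> = d * cnj (W (int k) x)" using elim by (simp add: f_def mult.assoc[symmetric])
      finally show ?case by (simp add: ac_simps)
    qed
  qed (intro borel_measurable_times bcontfun_measurable borel_measurable_integrable[OF h(1)]
      borel_measurable_const
      cnj_trf_measurable wu(1))+
  then show ?thesis by (intro exI[of _ d]) (simp add: h(2))
qed

section \<open>Injectivity and surjectivity of \<open>\<Psi>\<close>\<close>

abbreviation "Psi \<equiv> skew_Psi \<mu> \<alpha> \<iota> V p w"
abbreviation "Mom a k \<equiv> (LINT x|\<mu>. apply_bcontfun a x * cnj (W k x))"

lemmas wp = wu(1,2)

lemma Psi_values:
  assumes \<nu>: "\<nu> \<in> prob_measures circle"
  shows "state_on UNIV (Psi \<nu>)" "Psi \<nu> (\<iota> a * upow V (k * int p)) = Mom a k * (LINT z|\<nu>. z powi k)"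
    "\<not> int p dvd m \<Longrightarrow> Psi \<nu> (\<iota> a * upow V m) = 0"
  using skew_Psi_properties[OF transferD(1,2)[OF w] p \<nu>] integral_trf_w1[OF transferD(1,2)[OF w] p]
  by simp_all

lemma Psi_nat:
  assumes \<nu>: "\<nu> \<in> prob_measures circle"
  shows "Psi \<nu> (\<iota> a * V ^ (k * p)) = Mom a (int k) * (LINT z|\<nu>. z ^ k)"
    "\<not> p dvd m \<Longrightarrow> Psi \<nu> (\<iota> a * V ^ m) = 0"
  using Psi_values(2)[OF \<nu>, of a "int k"] Psi_values(3)[OF \<nu>, of "int m" a]
  by (simp_all add: upow_of_nat flip: of_nat_mult)

text \<open>The cocycle power that \<open>\<Phi> g\<close> produces turns \<open>cnj (W k)\<close>
  into its translate, so the whole integrand is translated and the measure absorbs it. At powers not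
  divisible by \<open>p\<close> both sides vanish.\<close>

lemma Psi_invariant:
  assumes \<nu>: "\<nu> \<in> prob_measures circle"
  shows "Psi \<nu> \<in> S"
proof (rule invariant_stateI[OF Psi_values(1)[OF \<nu>]])
  fix g a m
  show "Psi \<nu> (\<iota> (\<theta> g a * cp g m) * V ^ m) = Psi \<nu> (\<iota> a * V ^ m)"
  proof (cases "p dvd m")
    case True
    then obtain k where k: "m = k * p" by (metis dvdE mult.commute)
    have c: "(\<lambda>x. cnj (W (int k) x)) \<in> borel_measurable \<mu>" by (rule cnj_trf_measurable[OF wp(1)])
    have "Mom (\<theta> g a * cp g m) (int k) = (LINT x|\<mu>. apply_bcontfun a (hg g x) * cnj (W (int k) (hg g x)))"
    proof (rule integral_cong_AE)
      show "AE x in \<mu>. apply_bcontfun (\<theta> g a * cp g m) x * cnj (W (int k) x) =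
        apply_bcontfun a (hg g x) * cnj (W (int k) (hg g x))"
        using W_transfer_cnj[of g k]
        by eventually_elim (simp add: times_bcontfun.rep_eq hg_eval k mult.assoc)
      show "(\<lambda>x. apply_bcontfun a (hg g x) * cnj (W (int k) (hg g x))) \<in> borel_measurable \<mu>"
        by (intro borel_measurable_times measurable_compose[OF hg_measurable] bcontfun_measurable c)
    qed (intro borel_measurable_times bcontfun_measurable c)
    also have "\<dots> = Mom a (int k)"
      by (rule integral_hg[where f = "\<lambda>x. apply_bcontfun a x * cnj (W (int k) x)"])
        (intro borel_measurable_times bcontfun_measurable c)
    finally show ?thesis by (simp add: k Psi_nat[OF \<nu>])
  qed (simp add: Psi_nat[OF \<nu>])
qed

text \<open>A unimodular function is not almost everywhere zero. Division by such a
  \<open>Mom a k\<close> recovers the moments of a measure from its state, for injectivity and again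
  for continuity of the inverse.\<close>

lemma Mom_nonzero: "\<exists>a. Mom a k \<noteq> 0"
proof (rule ccontr)
  assume "\<nexists>a. Mom a k \<noteq> 0"
  then have "AE x in \<mu>. cnj (W k x) = 0"
    by (intro AE_zero integrable_cnj_trf[OF wp]) auto
  then have "AE x in \<mu>. False" by eventually_elim (use W_norm in \<open>simp, metis norm_zero zero_neq_one\<close>)
  then show False using AE_not_False by simp
qed

lemma Psi_inj: "inj_on Psi (prob_measures circle)"
proof (rule inj_onI)
  fix \<nu> \<nu>' assume m: "\<nu> \<in> prob_measures circle" "\<nu>' \<in> prob_measures circle" and eq: "Psi \<nu> = Psi \<nu>'"
  show "\<nu> = \<nu>'"
  proof (rule circle_measure_eqI[OF m])
    fix k
    obtain a where "Mom a (int k) \<noteq> 0" using Mom_nonzero by blast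
    then show "(LINT z|\<nu>. z ^ k) = (LINT z|\<nu>'. z ^ k)"
      using Psi_nat(1)[OF m(1), of a k] Psi_nat(1)[OF m(2), of a k] eq by simp
  qed
qed

text \<open>Negative powers are adjoints of positive ones, so the coefficients are continued by
  conjugation. One sequence over all integers is what Herglotz's theorem expects.\<close>

lemma invariant_state_coefficients:
  assumes \<phi>: "\<phi> \<in> S"
  shows "\<exists>c. \<forall>k a. \<phi> (\<iota> a * upow V (k * int p)) = c k * Mom a k"
proof -
  note s = invariant_stateD(1)[OF \<phi>]
  obtain d where d: "\<And>k a. \<phi> (\<iota> a * V ^ (k * p)) = d k * Mom a (int k)"
    using invariant_state_multiple[OF \<phi>] by metis
  define c where "c k = (if 0 \<le> k then d (nat k) else cnj (d (nat (- k))))" for k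
  have "\<phi> (\<iota> a * upow V (k * int p)) = c k * Mom a k" for k a
  proof (cases "0 \<le> k")
    case True
    then obtain j where "k = int j" by (metis nonneg_int_cases)
    then show ?thesis using d[of a j] by (simp add: c_def upow_of_nat flip: of_nat_mult)
  next
    case False
    then obtain j where j: "k = - int j" by (metis int_cases2 of_nat_0_le_iff)
    let ?b = "zpow \<alpha> (int (j * p)) (star a)"
    have e: "\<iota> a * upow V (k * int p) = star (\<iota> ?b * V ^ (j * p))"
      unfolding upow_of_nat[symmetric] upow_commute[symmetric]
      by (simp add: j star_mult upow_star[OF uV] I(5) star_star)
    have "\<phi> (\<iota> a * upow V (k * int p)) = cnj (d j) * cnj (Mom ?b (int j))"
      unfolding e state_on_star[OF cstar_subalgebra_UNIV s UNIV_I] d by simp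
    \<comment> \<open>Moving the coefficient past \<open>V^(j p)\<close> left a translate.
      \<open>trf_inverse\<close> rewrites \<open>W j\<close> at the original point as the conjugate
      of \<open>W (- j)\<close> at the translated one, and invariance of the measure removes the
      translation.\<close>
    also have "cnj (Mom ?b (int j)) = (LINT x|\<mu>. apply_bcontfun a (hz (int (j * p)) x) * W (int j) x)"
      unfolding Bochner_Integration.integral_cnj[symmetric]
      by (simp add: zpow_eval star_bcontfun.rep_eq star_complex_def del: Bochner_Integration.integral_cnj)
    also have "\<dots> = (LINT x|\<mu>. apply_bcontfun a (hz (int (j * p)) x) * cnj (W k (hz (int (j * p)) x)))"
      using trf_inverse[OF wp, where n = p and k = "int j"] by (simp add: j)
    also have "\<dots> = Mom a k"
      by (rule integral_hz[where g = "\<lambda>x. apply_bcontfun a x * cnj (W k x)"])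
        (intro borel_measurable_times bcontfun_measurable cnj_trf_measurable wp)
    finally show ?thesis using False by (simp add: c_def j)
  qed
  then show ?thesis by blast
qed

text \<open>A telescoping estimate: one factor is exchanged at a time while the others have modulus
  at most 1, and the shift \<open>hz m\<close> does not change the integral of the error.\<close>

lemma integral_product_limit:
  fixes b b' :: "nat \<Rightarrow> ('x \<Rightarrow>\<^sub>C complex)" and f f' e :: "'x \<Rightarrow> complex"
  assumes f: "f \<in> borel_measurable \<mu>" "\<And>x. cmod (f x) =
      1" and f': "f' \<in> borel_measurable \<mu>" "\<And>x. cmod (f' x) = 1"
    and e: "e \<in> borel_measurable \<mu>" "\<And>x. cmod (e x) = 1"
    and b: "(\<lambda>i. LINT x|\<mu>. cmod (f x - apply_bcontfun (b i) x)) \<longlonglongrightarrow> 0" "\<And>i. norm (b i) \<le> 1"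
    and b': "(\<lambda>i. LINT x|\<mu>. cmod (f' x - apply_bcontfun (b' i) x)) \<longlonglongrightarrow> 0" "\<And>i. norm (b' i) \<le> 1"
  shows "(\<lambda>i. LINT x|\<mu>. apply_bcontfun (b i) x * cnj (apply_bcontfun (b' i) (hz m x)) * e x) \<longlonglongrightarrow>
    (LINT x|\<mu>. f x * cnj (f' (hz m x)) * e x)"
proof -
  let ?F = "\<lambda>i x. apply_bcontfun (b i) x * cnj (apply_bcontfun (b' i) (hz m x)) * e x"
  let ?G = "\<lambda>x. f x * cnj (f' (hz m x)) * e x"
  let ?d = "\<lambda>i x. cmod (f x - apply_bcontfun (b i) x)"
  let ?d' = "\<lambda>i x. cmod (f' x - apply_bcontfun (b' i) x)"
  have b1: "cmod (apply_bcontfun (b i) x) \<le> 1" and b1': "cmod (apply_bcontfun (b' i) x) \<le> 1" for i x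
    using norm_bounded[of "b i" x] b(2)[of i] norm_bounded[of "b' i" x] b'(2)[of i] by linarith+
  have cm: "(\<lambda>x. cnj (g (hz m x))) \<in> borel_measurable \<mu>" if "g \<in> borel_measurable \<mu>" for g :: "'x \<Rightarrow> complex"
    by (rule borel_measurable_continuous_on[OF _ measurable_compose[OF hz_measurable that], of cnj])
      (auto intro: continuous_intros)
  have int1: "integrable \<mu> (\<lambda>x. ?F i x)" for i
  proof (rule integrable_const_bound[where B = 1])
    show "AE x in \<mu>. cmod (?F i x) \<le> 1"
      by (simp add: norm_mult e b1 b1' mult_le_one)
  qed (intro borel_measurable_times bcontfun_measurable cm e)
  have int2: "integrable \<mu> (\<lambda>x. ?G x)"
  proof (rule integrable_const_bound[where B = 1])
    show "AE x in \<mu>. cmod (?G x) \<le> 1" by (simp add: norm_mult f f' e)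
  qed (intro borel_measurable_times cm f f' e)
  have intf: "integrable \<mu> f" "integrable \<mu> f'"
    using f f' by (auto intro!: integrable_const_bound[where B = 1])
  have intd: "integrable \<mu> (\<lambda>x. ?d i x)" "integrable \<mu> (\<lambda>x. ?d' i x)" for i
    by (intro integrable_norm Bochner_Integration.integrable_diff intf integrable_bcontfun)+
  have inth: "integrable \<mu> (\<lambda>x. cmod (f' (hz m x) - apply_bcontfun (b' i) (hz m x)))" for i
    using integrable_distr_eq[OF hz_measurable borel_measurable_integrable[OF intd(2)[of i]], of m]
        intd(2)[of i]
    by (simp add: hz_distr)
  show ?thesis
  proof (rule LIM_zero_cancel, rule Lim_null_comparison)
    show "(\<lambda>i. (LINT x|\<mu>. ?d i x) + (LINT x|\<mu>. ?d' i x)) \<longlonglongrightarrow> 0"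
      using tendsto_add[OF b(1) b'(1)] by simp
    have "cmod ((LINT x|\<mu>. ?F i x) - (LINT x|\<mu>. ?G x))
      \<le> (LINT x|\<mu>. ?d i x) + (LINT x|\<mu>. ?d' i x)" for i
    proof -
      have "cmod ((LINT x|\<mu>. ?F i x) - (LINT x|\<mu>. ?G x))
        = cmod (LINT x|\<mu>. ?F i x - ?G x)"
        by (simp only: Bochner_Integration.integral_diff[OF int1 int2])
      also have "\<dots> \<le> (LINT x|\<mu>. cmod (?F i x - ?G x))"
        by (rule integral_norm_bound)
      also have "\<dots> \<le> (LINT x|\<mu>. ?d i x + cmod (f' (hz m x) - apply_bcontfun (b' i) (hz m x)))"
      proof (rule integral_mono)
        fix x
        define A B C D where "A = apply_bcontfun (b i) x" and "B =
            cnj (apply_bcontfun (b' i) (hz m x))" and "C = f x" and "D = cnj (f' (hz m x))"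
        have "cmod (A * B * e x - C * D * e x) = cmod ((A - C) * B + C * (B - D))"
          unfolding left_diff_distrib[symmetric] norm_mult by (simp add: e algebra_simps)
        also have "\<dots> \<le> cmod (A - C) * cmod B + cmod C * cmod (B - D)"
          by (rule order_trans[OF norm_triangle_ineq]) (simp add: norm_mult)
        also have "\<dots> \<le> cmod (A - C) * 1 + 1 * cmod (B - D)"
          by (intro add_mono mult_mono) (auto simp: B_def C_def b1' f)
        also have "cmod (B - D) = cmod (f' (hz m x) - apply_bcontfun (b' i) (hz m x))"
          unfolding B_def D_def complex_cnj_diff[symmetric] complex_mod_cnj by (rule norm_minus_commute)
        finally show "cmod (?F i x - ?G x)
          \<le> ?d i x + cmod (f' (hz m x) - apply_bcontfun (b' i) (hz m x))"
          by (simp add: A_def B_def C_def D_def norm_minus_commute)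
      qed (use int1 int2 intd inth in auto)
      also have "\<dots> = (LINT x|\<mu>. ?d i x) + (LINT x|\<mu>. ?d' i x)"
        using integral_hz[of "\<lambda>x. ?d' i x" m] intd inth
        by (simp add: borel_measurable_integrable)
      finally show ?thesis .
    qed
    then show "\<forall>\<^sub>F i in sequentially. norm ((LINT x|\<mu>. ?F i x) - (LINT x|\<mu>. ?G x))
      \<le> (LINT x|\<mu>. ?d i x) + (LINT x|\<mu>. ?d' i x)"
      by (intro always_eventually allI)
  qed
qed

text \<open>It remains to recognise the coefficients \<open>c\<close> of an invariant state as
  moments. Positive definiteness comes from positivity of the state at sums of
  \<open>W_k V^(k p)\<close>, with the measurable \<open>W_k\<close> replaced by bounded continuous
  approximants.\<close>

lemma Psi_surj: "Psi ` prob_measures circle = S"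
proof
  show "Psi ` prob_measures circle \<subseteq> S" using Psi_invariant by blast
  show "S \<subseteq> Psi ` prob_measures circle"
  proof
    fix \<phi> assume \<phi>: "\<phi> \<in> S"
    note s = invariant_stateD(1)[OF \<phi>]
    note L = clinearD[OF state_clinear[OF s]]
    obtain c where c: "\<And>k a. \<phi> (\<iota> a * upow V (k * int p)) = c k * Mom a k"
      using invariant_state_coefficients[OF \<phi>] by blast
    have c0: "c 0 = 1" using c[of 1 0] state_onD(4)[OF s] prob_space by (simp add: I(3) one_bcontfun.rep_eq)
    have "\<exists>b. (\<lambda>i. LINT x|\<mu>. cmod (W k x - apply_bcontfun (b i) x)) \<longlonglongrightarrow> 0 \<and> (\<forall>i. norm (b i) \<le> 1)" for k
      using bcontfun_dense_L1_bounded[OF W_measurable W_norm, of k] by metis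
    then obtain b where b: "\<And>k. (\<lambda>i. LINT x|\<mu>. cmod (W k x - apply_bcontfun (b k i) x)) \<longlonglongrightarrow>
        0" "\<And>k i. norm (b k i) \<le> 1"
      by metis
    \<comment> \<open>For a contraction \<open>b\<close> the value \<open>\<phi> (b V^(k p))\<close>
      has modulus at most 1 and equals \<open>c k\<close> times the integral of
      \<open>b * cnj W_k\<close>, which tends to 1 as \<open>b\<close> approaches \<open>W_k\<close>
      in mean.\<close>
    have c1: "cmod (c k) \<le> 1" for k
    proof -
      have "(\<lambda>i. c k * Mom (b k i) k) \<longlonglongrightarrow> c k * (LINT x|\<mu>. W k x * cnj (W k x))"
      proof (intro tendsto_mult tendsto_const)
        \<comment> \<open>The two-factor limit is used with the constant 1 as second factor and with
          shift 0.\<close>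
        have one: "(\<lambda>i. LINT x|\<mu>. cmod (1 - apply_bcontfun (1 :: 'x \<Rightarrow>\<^sub>C complex) x)) \<longlonglongrightarrow> 0"
          by (simp add: one_bcontfun.rep_eq)
        have cW: "(\<lambda>x. cnj (W k x)) \<in> borel_measurable \<mu>" by (rule cnj_trf_measurable[OF wp(1)])
        have "(\<lambda>i. LINT x|\<mu>. apply_bcontfun (b k i) x * cnj (apply_bcontfun (1 :: 'x \<Rightarrow>\<^sub>C complex) (hz 0
            x)) * cnj (W k x)) \<longlonglongrightarrow>
          (LINT x|\<mu>. W k x * cnj 1 * cnj (W k x))"
          by (rule integral_product_limit[where f' =
              "\<lambda>_. 1", OF W_measurable W_norm _ _ cW _ b one]) (simp_all add: W_norm)
        then show "(\<lambda>i. Mom (b k i) k) \<longlonglongrightarrow> (LINT x|\<mu>. W k x * cnj (W k x))"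
          by (simp add: one_bcontfun.rep_eq)
      qed
      then have "(\<lambda>i. cmod (c k * Mom (b k i) k)) \<longlonglongrightarrow> cmod (c k)"
        using tendsto_norm prob_space by (fastforce simp: W_cnj)
      moreover have "cmod (c k * Mom (b k i) k) \<le> 1" for i
      proof -
        have "cmod (\<phi> (\<iota> (b k i) * upow V (k * int p))) \<le> norm (\<iota> (b k i) * upow V (k * int p))"
          by (rule state_on_norm_le[OF cstar_subalgebra_UNIV s UNIV_I])
        also have "\<dots> \<le> norm (\<iota> (b k i)) * norm (upow V (k * int p))" by (rule norm_mult_ineq)
        also have "\<dots> \<le> norm (b k i)" using unital_star_hom_contractive[OF hom] by (simp add: uV)
        finally show ?thesis using b(2)[of k i] by (simp add: c)
      qed
      ultimately show ?thesis by (intro LIMSEQ_le_const2) auto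
    qed
    have "\<exists>\<nu>\<in>prob_measures circle. \<forall>k. (LINT z|\<nu>. z ^ k) = c (int k)"
    proof (rule Herglotz[where c = c, OF _ c0 c1])
      fix n and l :: "nat \<Rightarrow> complex"
      \<comment> \<open>With \<open>W_k\<close> itself as coefficient,
        \<open>\<phi> (X * star X)\<close> would be the quadratic form of \<open>c\<close>. The
        approximants multiply its terms by \<open>E i j k\<close>. The order
        \<open>X * star X\<close> leaves a single power of \<open>V\<close> to be moved past a
        coefficient.\<close>
      define X where "X i = (\<Sum>k<n. l k *\<^sub>C (\<iota> (b (int k) i) * upow V (int k * int p)))" for i
      define E where "E i j k = (LINT x|\<mu>. apply_bcontfun (b (int k) i) x * cnj (apply_bcontfun (b (int
          j) i) (hz ((int k - int j) * int p) x)) * cnj (W (int k - int j) x))" for i j k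
      have XX: "\<phi> (X i * star (X i)) = (\<Sum>j<n. \<Sum>k<n. l k * cnj (l j) * (c (int k - int j) * E i j k))" for i
      proof -
        have t: "\<phi> ((l k *\<^sub>C (\<iota> (b (int k) i) * upow V (int k * int p))) * star (l j *\<^sub>C (\<iota> (b (int j)
            i) * upow V (int j * int p)))) =
          l k * cnj (l j) * (c (int k - int j) * E i j k)" for j k
        proof -
          let ?m = "(int k - int j) * int p"
          have m: "upow V (int k * int p) * upow V (- (int j * int p)) = upow V ?m"
            by (simp add: upow_add[OF uV, symmetric] algebra_simps)
          have "(\<iota> (b (int k) i) * upow V (int k * int p)) * star (\<iota> (b (int j) i) * upow V (int j * int
              p)) =
            \<iota> (b (int k) i) * (upow V ?m * \<iota> (star (b (int j) i)))"
            unfolding m[symmetric] by (simp add: star_mult upow_star[OF uV] I(5) mult.assoc)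
          also have "\<dots> = \<iota> (b (int k) i * zpow \<alpha> ?m (star (b (int j) i))) * upow V ?m"
            unfolding upow_commute by (simp add: I(4) mult.assoc)
          finally have "\<phi> ((\<iota> (b (int k) i) * upow V (int k * int p)) * star (\<iota> (b (int j) i) * upow V
              (int j * int p))) =
            c (int k - int j) * Mom (b (int k) i * zpow \<alpha> ?m (star (b (int j) i))) (int k - int j)"
            by (simp only: c)
          also have "Mom (b (int k) i * zpow \<alpha> ?m (star (b (int j) i))) (int k - int j) = E i j k"
            unfolding E_def by (simp add: times_bcontfun.rep_eq zpow_eval star_bcontfun.rep_eq
                star_complex_def)
          finally show ?thesis
            by (simp add: star_scaleC mult_scaleC_left mult_scaleC_right L scaleC_complex_def mult.assoc)
        qed
        have sum: "\<phi> (\<Sum>i\<in>F. f i) = (\<Sum>i\<in>F. \<phi> (f i))" for F :: "nat set" and f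
          by (rule state_on_sum[OF cstar_subalgebra_UNIV s]) simp
        have "X i * star (X i) = (\<Sum>j<n. \<Sum>k<n. (l k *\<^sub>C (\<iota> (b (int k) i) * upow V (int k * int p))) *
            star (l j *\<^sub>C (\<iota> (b (int j) i) * upow V (int j * int p))))"
          unfolding X_def star_sum sum_distrib_left sum_distrib_right by (rule refl)
        then show ?thesis by (simp only: sum t)
      qed
      have pos: "\<phi> (X i * star (X i)) \<in> \<real>\<^sub>\<ge>\<^sub>0" for i
        using state_onD(3)[OF s UNIV_I, of "star (X i)"] by (simp add: star_star)
      \<comment> \<open>The cocycle identity \<open>W_k = W_(k - j) * (W_j o hz ((k - j) p))\<close>
        makes the limiting integrand constantly 1.\<close>
      have E: "(\<lambda>i. E i j k) \<longlonglongrightarrow> 1" for j k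
      proof -
        have "(\<lambda>i. E i j k) \<longlonglongrightarrow> (LINT x|\<mu>. W (int k) x * cnj (W (int j) (hz ((int k - int j) * int p) x))
            * cnj (W (int k - int j) x))"
          unfolding E_def
          by (rule integral_product_limit[OF W_measurable W_norm W_measurable W_norm
              cnj_trf_measurable[OF wp(1)] _ b b])
            (simp add: W_norm)
        also have "(LINT x|\<mu>. W (int k) x * cnj (W (int j) (hz ((int k - int j) * int p) x)) * cnj (W
            (int k - int j) x)) = (LINT x|\<mu>. 1)"
        proof (rule Bochner_Integration.integral_cong[OF refl])
          fix x
          have "W (int k) x = W (int k - int j) x * W (int j) (hz ((int k - int j) * int p) x)"
            using W_add[of "int k - int j" "int j" x] by simp
          then have "W (int k) x * cnj (W (int j) (hz ((int k - int j) * int p) x)) * cnj (W (int k -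
              int j) x) =
            (W (int k - int j) x * cnj (W (int k - int j) x)) * (W (int j) (hz ((int k - int j) * int p)
                x) * cnj (W (int j) (hz ((int k - int j) * int p) x)))"
            by (simp only: mult_ac)
          then show "W (int k) x * cnj (W (int j) (hz ((int k - int j) * int p) x)) * cnj (W (int k -
              int j) x) = 1"
            by (simp only: W_cnj mult_1)
        qed
        finally show ?thesis using prob_space by simp
      qed
      have "(\<lambda>i. \<Sum>j<n. \<Sum>k<n. l k * cnj (l j) * (c (int k - int j) * E i j k)) \<longlonglongrightarrow>
        (\<Sum>j<n. \<Sum>k<n. l k * cnj (l j) * (c (int k - int j) * 1))"
        by (intro tendsto_sum tendsto_mult tendsto_const E)
      then have "(\<Sum>j<n. \<Sum>k<n. l k * cnj (l j) * (c (int k - int j) * 1)) \<in> \<real>\<^sub>\<ge>\<^sub>0"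
        by (rule closed_sequentially[OF closed_nonneg_Reals_complex pos[unfolded XX]])
      then show "(\<Sum>j<n. \<Sum>k<n. l k * cnj (l j) * c (int k - int j)) \<in> \<real>\<^sub>\<ge>\<^sub>0" by simp
    qed
    then obtain \<nu> where \<nu>: "\<nu> \<in> prob_measures circle" "\<And>k. (LINT z|\<nu>. z ^ k) = c (int k)" by blast
    have "Psi \<nu> = \<phi>"
    proof (rule state_eqI[OF Psi_values(1)[OF \<nu>(1)] s])
      fix a m
      show "Psi \<nu> (\<iota> a * V ^ m) = \<phi> (\<iota> a * V ^ m)"
      proof (cases "p dvd m")
        case True
        then obtain k where k: "m = k * p" by (metis dvdE mult.commute)
        show ?thesis using c[of a "int k"] by (simp add: k Psi_nat[OF \<nu>(1)] \<nu>(2) upow_of_nat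
            mult.commute flip: of_nat_mult)
      next
        case False
        then show ?thesis by (simp add: Psi_nat[OF \<nu>(1)] invariant_state_other[OF \<phi>])
      qed
    qed
    then show "\<phi> \<in> Psi ` prob_measures circle" using \<nu>(1) by blast
  qed
qed

section \<open>Continuity of the inverse and compactness\<close>

abbreviation "\<Theta> \<equiv> inv_into (prob_measures circle) Psi"


lemma Theta: "\<phi> \<in> S \<Longrightarrow> \<Theta> \<phi> \<in> prob_measures circle" "\<phi> \<in> S \<Longrightarrow> Psi (\<Theta> \<phi>) = \<phi>" "\<nu> \<in> prob_measures circle \<Longrightarrow>
    \<Theta> (Psi \<nu>) = \<nu>"
  using Psi_surj Psi_inj by (auto intro: inv_into_into f_inv_into_f inv_into_f_f)

lemma Psi_continuous: "continuous_map (weak_star_prob circle) (weak_star S) Psi"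
  unfolding weak_star_def
proof (rule continuous_map_into_subtopology)
  show "Psi \<in> topspace (weak_star_prob circle) \<rightarrow> S"
    unfolding topspace_weak_star_prob using Psi_surj by blast
  show "continuous_map (weak_star_prob circle) (product_topology (\<lambda>_. euclidean) UNIV) Psi"
    unfolding continuous_map_componentwise_UNIV
  proof
    fix x
    obtain f where f: "continuous_on circle f" "\<And>\<nu>. \<nu> \<in> prob_measures circle \<Longrightarrow> Psi \<nu> x = (LINT z|\<nu>. f z)"
      using skew_Psi_integral[OF transferD(1,2)[OF w] p, of x] by blast
    have "continuous_map (weak_star_prob circle) euclidean
      ((\<lambda>F. F f) \<circ> (\<lambda>\<nu>. \<lambda>f\<in>{f. continuous_on circle f}. (LINT z|\<nu>. f z :: complex)))"
      unfolding weak_star_prob_def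
      by (intro continuous_map_pullback continuous_map_product_projection) (use f in simp)
    then show "continuous_map (weak_star_prob circle) euclidean (\<lambda>\<nu>. Psi \<nu> x)"
      by (rule continuous_map_eq) (simp add: topspace_weak_star_prob f)
  qed
qed

text \<open>A moment of the measure is evaluation of the state at a fixed element divided by a
  nonzero constant, and evaluations are weak-* continuous.\<close>

lemma Theta_moment_continuous: "continuous_on S (\<lambda>\<phi>. LINT z|\<Theta> \<phi>. z powi k)"
proof -
  obtain a where a: "(LINT x|\<mu>. apply_bcontfun a x * cnj (W k x)) \<noteq> 0"
    using Mom_nonzero[of k] by blast
  have "continuous_on S (\<lambda>\<phi>. \<phi> (\<iota> a * upow V (k * int p)) / (LINT x|\<mu>. apply_bcontfun a x * cnj (W k x)))"
    by (intro continuous_on_divide continuous_on_const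
        continuous_on_subset[OF continuous_on_product_coordinates]) (use a in auto)
  then show ?thesis
  proof (rule continuous_on_eq)
    fix \<phi> assume "\<phi> \<in> S"
    then show "\<phi> (\<iota> a * upow V (k * int p)) / (LINT x|\<mu>. apply_bcontfun a x * cnj (W k x)) =
        (LINT z|\<Theta> \<phi>. z powi k)"
      using Psi_values(2)[OF Theta(1), of \<phi> a k] a by (simp add: Theta)
  qed
qed

text \<open>Trigonometric polynomials approximate \<open>f\<close> uniformly on the circle. All
  measures have mass 1, so the integrals converge uniformly over the states.\<close>

lemma Theta_integral_continuous:
  assumes f: "continuous_on circle f"
  shows "continuous_on S (\<lambda>\<phi>. LINT z|\<Theta> \<phi>. f z :: complex)"
proof -
  have "\<exists>c. \<forall>i. alg_elem (c i) \<and> (\<forall>z. cmod z = 1 \<longrightarrow> cmod (f z - trig_poly (c i) z) < 1 / real (Suc i))"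
    by (intro choice allI trig_poly_dense f) simp
  then obtain c where c: "\<And>i. alg_elem (c i)" "\<And>i z. cmod z = 1 \<Longrightarrow>
      cmod (f z - trig_poly (c i) z) < 1 / real (Suc i)"
    by blast
  show ?thesis
  proof (rule uniform_limit_theorem[where F = sequentially])
    show "\<forall>\<^sub>F i in sequentially. continuous_on S (\<lambda>\<phi>. LINT z|\<Theta> \<phi>. trig_poly (c i) z)"
    proof (intro always_eventually allI)
      fix i
      have "continuous_on S (\<lambda>\<phi>. \<Sum>n | c i n \<noteq> 0. c i n * (LINT z|\<Theta> \<phi>. z powi n))"
        by (intro continuous_on_sum continuous_on_mult continuous_on_const Theta_moment_continuous)
      then show "continuous_on S (\<lambda>\<phi>. LINT z|\<Theta> \<phi>. trig_poly (c i) z)"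
      proof (rule continuous_on_eq)
        fix \<phi> assume "\<phi> \<in> S"
        then interpret nu: circle_measure "\<Theta> \<phi>" by unfold_locales (rule Theta)
        show "(\<Sum>n | c i n \<noteq> 0. c i n * (LINT z|\<Theta> \<phi>. z powi n)) = (LINT z|\<Theta> \<phi>. trig_poly (c i) z)"
          by (rule nu.integral_trig_poly[symmetric])
      qed
    qed
    show "uniform_limit S (\<lambda>i \<phi>. LINT z|\<Theta> \<phi>. trig_poly (c i) z) (\<lambda>\<phi>. LINT z|\<Theta> \<phi>. f z) sequentially"
    proof (rule uniform_limitI)
      fix e :: real assume "0 < e"
      then obtain N where N: "1 / real (Suc N) < e" using nat_approx_posE by blast
      have "dist (LINT z|\<Theta> \<phi>. trig_poly (c i) z) (LINT z|\<Theta> \<phi>. f z) < e" if i: "N \<le> i" and \<phi>: "\<phi> \<in> S" for i \<phi>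
      proof -
        interpret nu: circle_measure "\<Theta> \<phi>" by unfold_locales (rule Theta(1)[OF \<phi>])
        have "dist (LINT z|\<Theta> \<phi>. trig_poly (c i) z) (LINT z|\<Theta> \<phi>. f z) \<le> 1 / real (Suc i)"
          unfolding dist_norm norm_minus_commute[of "LINT z|\<Theta> \<phi>. trig_poly (c i) z"]
          by (rule nu.integral_trig_poly_approx[OF f]) (rule less_imp_le[OF c(2)])
        also have "\<dots> \<le> 1 / real (Suc N)" using i by (intro divide_left_mono) auto
        finally show ?thesis using N by simp
      qed
      then show "\<forall>\<^sub>F i in sequentially. \<forall>\<phi>\<in>S. dist (LINT z|\<Theta> \<phi>. trig_poly (c i) z) (LINT z|\<Theta> \<phi>. f z) < e"
        by (intro eventually_sequentiallyI[of N]) blast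
    qed
  qed simp
qed

lemma Theta_continuous: "continuous_map (weak_star S) (weak_star_prob circle) \<Theta>"
  unfolding weak_star_prob_def
proof (rule continuous_map_pullback')
  show "topspace (weak_star S) \<subseteq> \<Theta> -` (prob_measures circle)" using Theta(1) by (auto simp: weak_star_eq)
  show "continuous_map (weak_star S) (product_topology (\<lambda>_. euclidean) {f. continuous_on circle f})
    ((\<lambda>\<nu>. \<lambda>f\<in>{f. continuous_on circle f}. (LINT z|\<nu>. f z :: complex)) \<circ> \<Theta>)"
    unfolding continuous_map_componentwise
    by (auto simp: weak_star_eq Theta_integral_continuous)
qed

lemma Psi_homeomorphic: "homeomorphic_map (weak_star_prob circle) (weak_star S) Psi"
proof -
  have "homeomorphic_maps (weak_star_prob circle) (weak_star S) Psi \<Theta>"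
    unfolding homeomorphic_maps_def
    using Psi_continuous Theta_continuous Theta by (auto simp: topspace_weak_star_prob weak_star_eq)
  then show ?thesis using homeomorphic_maps_map by blast
qed

lemma compact_weak_star_S: "compact_space (weak_star S)"
proof -
  have "compact S" by (rule compact_states[OF closed_invariant_states]) (rule invariant_stateD(1))
  then show ?thesis by (simp add: weak_star_eq compact_space_subtopology)
qed

text \<open>Compactness is carried back from the invariant states along the homeomorphism, whose
  inverse was shown to be continuous without it.\<close>

lemma compact_weak_star_prob: "compact_space (weak_star_prob circle)"
  using compact_weak_star_S Psi_homeomorphic homeomorphic_compact_space homeomorphic_space by blast

lemma Psi_affine:
  assumes "\<nu> \<in> prob_measures circle" "\<nu>' \<in> prob_measures circle" "t \<in> {0..1}"
  shows "Psi (mix_measure t \<nu> \<nu>') = (\<lambda>x. complex_of_real t * Psi \<nu> x + complex_of_real (1 - t) * Psi \<nu>' x)"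
proof
  fix x
  obtain f where f: "continuous_on circle f" "\<And>\<nu>. \<nu> \<in> prob_measures circle \<Longrightarrow> Psi \<nu> x = (LINT z|\<nu>. f z)"
    using skew_Psi_integral[OF transferD(1,2)[OF w] p, of x] by blast
  show "Psi (mix_measure t \<nu> \<nu>') x = complex_of_real t * Psi \<nu> x + complex_of_real (1 - t) * Psi \<nu>' x"
    using integral_mix_measure[OF assms f(1)] assms mix_measure_circle[OF assms] by (simp add: f(2))
qed

end

end

theorem theorem3p13:
  fixes \<theta> :: "'g::{topological_group_add, t2_space, second_countable_topology} \<Rightarrow>
      ('x::metric_space \<Rightarrow>\<^sub>C complex) \<Rightarrow> ('x \<Rightarrow>\<^sub>C complex)"
    and \<omega>\<^sub>0 :: "('x \<Rightarrow>\<^sub>C complex) \<Rightarrow> complex"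
    and \<mu>\<^sub>0 :: "'x measure"
    and \<alpha> :: "('x \<Rightarrow>\<^sub>C complex) \<Rightarrow> ('x \<Rightarrow>\<^sub>C complex)"
    and u :: "'g \<times> 'x \<Rightarrow> complex"
    and \<iota> :: "('x \<Rightarrow>\<^sub>C complex) \<Rightarrow> 'c::cstar_algebra"
    and V :: 'c
  assumes "compact (UNIV :: 'x set)"
    and "locally_compact_space (euclidean :: 'g topology)"
    and "unimodular TYPE('g)"
    and "amenable TYPE('g)"
    and "cstar_dynamical_system \<theta>"
    and "invariant_states \<theta> = {\<omega>\<^sub>0}"
    and "\<mu>\<^sub>0 \<in> prob_measures UNIV"
    and "\<And>f. \<omega>\<^sub>0 f = (LINT x|\<mu>\<^sub>0. apply_bcontfun f x)"
    and "star_automorphism \<alpha>"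
    and "\<And>g. \<alpha> \<circ> \<theta> g = \<theta> g \<circ> \<alpha>"
    and "continuous_cocycle \<theta> u"
    and "is_crossed_product \<alpha> \<iota> V"
    and "\<not> uniquely_ergodic (skew_action \<theta> \<iota> V u)"
  shows "(\<exists>n\<ge>1. \<exists>w. is_transfer \<mu>\<^sub>0 \<theta> \<alpha> u n w) \<and>
    (\<forall>n\<^sub>0 w. n\<^sub>0 = transfer_period \<mu>\<^sub>0 \<theta> \<alpha> u \<longrightarrow> is_transfer \<mu>\<^sub>0 \<theta> \<alpha> u n\<^sub>0 w \<longrightarrow>
      (let P = prob_measures (sphere (0::complex) 1);
           S = invariant_states (skew_action \<theta> \<iota> V u);
           \<Psi> = skew_Psi \<mu>\<^sub>0 \<alpha> \<iota> V n\<^sub>0 w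
       in compact_space (weak_star_prob (sphere (0::complex) 1)) \<and>
          (\<forall>\<mu>\<in>P. \<forall>\<nu>\<in>P. \<forall>t\<in>{0..1}. mix_measure t \<mu> \<nu> \<in> P) \<and>
          compact_space (weak_star S) \<and>
          (\<forall>\<phi>\<in>S. \<forall>\<psi>\<in>S. \<forall>t\<in>{0..1}.
            (\<lambda>x. complex_of_real t * \<phi> x + complex_of_real (1 - t) * \<psi> x) \<in> S) \<and>
          homeomorphic_map (weak_star_prob (sphere 0 1)) (weak_star S) \<Psi> \<and>
          (\<forall>\<mu>\<in>P. \<forall>\<nu>\<in>P. \<forall>t\<in>{0..1}. \<Psi> (mix_measure t \<mu> \<nu>) =
            (\<lambda>x. complex_of_real t * \<Psi> \<mu> x + complex_of_real (1 - t) * \<Psi> \<nu> x))))"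
proof -
  have \<omega>: "\<omega>\<^sub>0 = (\<lambda>f. LINT x|\<mu>\<^sub>0. apply_bcontfun f x)" using assms(8) by (rule ext)
  interpret prob_space \<mu>\<^sub>0 using assms(7) by (simp add: prob_measures_def)
  interpret skew_system \<alpha> \<iota> V \<mu>\<^sub>0 \<theta> u
  proof unfold_locales
    \<comment> \<open>Invariance of the measure under \<open>\<alpha>\<close> follows from unique
      ergodicity, as \<open>\<alpha>\<close> commutes with the action.\<close>
    show "(LINT x|\<mu>\<^sub>0. apply_bcontfun (\<alpha> a) x) = (LINT x|\<mu>\<^sub>0. apply_bcontfun a x)" for a
      using uniquely_ergodic_commuting_invariant[OF assms(6,9,10), of a] by (simp add: assms(8))
  qed (use assms in \<open>simp_all add: prob_measures_def \<omega>\<close>)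
  note ex = transfer_exists[OF assms(13)]
  show ?thesis
  proof (intro conjI allI impI)
    fix p w assume per: "p = transfer_period \<mu>\<^sub>0 \<theta> \<alpha> u" and w: "is_transfer \<mu>\<^sub>0 \<theta> \<alpha> u p w"
    have p: "0 < p" "\<forall>r w. 0 < r \<longrightarrow> r < p \<longrightarrow> \<not> is_transfer \<mu>\<^sub>0 \<theta> \<alpha> u r w"
      using transfer_period_properties[OF assms(13) per] by blast+
    show "let P = prob_measures (sphere (0::complex) 1);
           S = invariant_states (skew_action \<theta> \<iota> V u);
           \<Psi> = skew_Psi \<mu>\<^sub>0 \<alpha> \<iota> V p w
       in compact_space (weak_star_prob (sphere (0::complex) 1)) \<and>
          (\<forall>\<mu>\<in>P. \<forall>\<nu>\<in>P. \<forall>t\<in>{0..1}. mix_measure t \<mu> \<nu> \<in> P) \<and>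
          compact_space (weak_star S) \<and>
          (\<forall>\<phi>\<in>S. \<forall>\<psi>\<in>S. \<forall>t\<in>{0..1}.
            (\<lambda>x. complex_of_real t * \<phi> x + complex_of_real (1 - t) * \<psi> x) \<in> S) \<and>
          homeomorphic_map (weak_star_prob (sphere 0 1)) (weak_star S) \<Psi> \<and>
          (\<forall>\<mu>\<in>P. \<forall>\<nu>\<in>P. \<forall>t\<in>{0..1}. \<Psi> (mix_measure t \<mu> \<nu>) =
            (\<lambda>x. complex_of_real t * \<Psi> \<mu> x + complex_of_real (1 - t) * \<Psi> \<nu> x))"
      unfolding Let_def
      using compact_weak_star_prob[OF p w] mix_measure_circle compact_weak_star_S[OF p w]
        convex_invariant_states Psi_homeomorphic[OF p w] Psi_affine[OF p w] by blast
  qed (rule ex)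
qed

end
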